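(* Consider the planar double drone-bar system with generalized coordinates $q=[y,z,\theta_1,\theta_2,\theta_3]^T$ whose (outer loop) dynamics are the Euler–Lagrange equations given in the context, with physical parameters $m_1,m_2,m_3,g,a>0$ and $l_1=l_2=l>0$. Let the desired positions $(y_{1d},z_{1d}),(y_{2d},z_{2d})$ be constants with $y_{2d}-y_{1d}=a$, $z_{1d}=z_{2d}$, and let $\theta_{1d}=\theta_{2d}=0$. Let the control inputs be $$f_1\sin\phi_1=-k_{p_1}e_{y_1}-k_{d_1}\dot y_1-k_{a_1}(\dot\theta_1^2+\dot\theta_2^2+\dot\theta_3^2)\dot y_1-\tfrac12 m_3g\tan\theta_{2d}-\frac{\sigma\rho e_y}{(\rho-e_y^2)^2},$$ $$f_2\sin\phi_2=-k_{p_2}e_{y_2}-k_{d_2}\dot y_2-k_{a_2}(\dot\theta_1^2+\dot\theta_2^2+\dot\theta_3^2)\dot y_2+\tfrac12 m_3g\tan\theta_{2d}+\frac{\sigma\rho e_y}{(\rho-e_y^2)^2},$$ $$f_1\cos\phi_1=-k_{p_3}e_{z_1}-k_{d_3}\dot z_1+\tfrac12(2m_1+m_3)g,$$ $$f_2\cos\phi_2=-k_{p_4}e_{z_2}-k_{d_4}\dot z_2+\tfrac12(2m_2+m_3)g,$$ where $e_{y_i}=y_i-y_{id}$, $e_{z_i}=z_i-z_{id}$, $e_y=e_{y_1}-e_{y_2}$, the gains $k_{p_1},\dots,k_{p_4},k_{d_1},\dots,k_{d_4},k_{a_1},k_{a_2},\sigma$ are positive, and $\rho>0$ is a constant with $\rho>|e_{y_1}(0)-e_{y_2}(0)|^2$.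 Assume that Assumption 1 (stated in the context) holds along the motion for all $t\ge 0$. Then the desired equilibrium point $y_1=y_{1d}$, $y_2=y_{2d}$, $z_1=z_{1d}$, $z_2=z_{2d}$, $\theta_1=\theta_{1d}$, $\theta_2=\theta_{2d}$ (with zero velocities) of the closed-loop system is asymptotically stable, in the sense that $$\lim_{t\to\infty}[e_{y_1},e_{z_1}]^T=0,\qquad \lim_{t\to\infty}[e_{y_2},e_{z_2}]^T=0,\qquad \lim_{t\to\infty}[\theta_1,\theta_2,\theta_3]^T=0.$$
   Context: Notation: $S_i=\sin\theta_i$, $C_i=\cos\theta_i$, $S_{i\pm j}=\sin(\theta_i\pm\theta_j)$, $C_{i\pm j}=\cos(\theta_i\pm\theta_j)$. System. In a vertical $(y,z)$-plane, two drones (masses $m_1,m_2$) carry a bar (mass $m_3$, length $a$) by two cables of equal length $l_1=l_2=l$, the first attached to the left end and the second to the right end of the bar. Positions of drone 1, drone 2 and the bar centre are $(y_1,z_1)=(y,z)$, $(y_2,z_2)=(y+l_1S_1+l_2S_2+aC_3,\ z-l_1C_1+l_2C_2+aS_3)$, $(y_3,z_3)=(y+l_1S_1+\frac a2C_3,\ z-l_1C_1+\frac a2S_3)$. Here $\theta_1,\theta_2$ are the cable swing angles and $\theta_3$ the bar inclination. Dynamics. With $q=[y,z,\theta_1,\theta_2,\theta_3]^T$, the kinetic energy is $\frac12\dot q^TM(q)\dot q=\frac12\sum_{i=1}^3 m_i(\dot y_i^2+\dot z_i^2)$. That is, $M$ is the symmetric matrix with $M_{11}=M_{22}=m_1+m_2+m_3$,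 $M_{12}=0$, $M_{13}=(m_2+m_3)l_1C_1$, $M_{14}=m_2l_2C_2$, $M_{15}=-(m_2+\frac{m_3}2)aS_3$, $M_{23}=(m_2+m_3)l_1S_1$, $M_{24}=-m_2l_2S_2$, $M_{25}=(m_2+\frac{m_3}2)aC_3$, $M_{33}=(m_2+m_3)l_1^2$, $M_{34}=m_2l_1l_2C_{1+2}$, $M_{35}=(m_2+\frac{m_3}2)l_1aS_{1-3}$, $M_{44}=m_2l_2^2$, $M_{45}=-m_2l_2aS_{2+3}$, $M_{55}=m_2a^2+m_3(\frac a2)^2$. The potential energy is $P(q)=g(m_1z_1+m_2z_2+m_3z_3)$. The dynamics are $\frac{d}{dt}\frac{\partial L}{\partial\dot q_i}-\frac{\partial L}{\partial q_i}=Q_i$, $i=1,\dots,5$, with $L=\frac12\dot q^TM(q)\dot q-P(q)$ and generalized forces $Q_1=f_1\sin\phi_1+f_2\sin\phi_2$, $Q_2=f_1\cos\phi_1+f_2\cos\phi_2$, $Q_3=f_2\sin\phi_2\,l_1C_1+f_2\cos\phi_2\,l_1S_1$, $Q_4=f_2\sin\phi_2\,l_2C_2-f_2\cos\phi_2\,l_2S_2$, $Q_5=-f_2\sin\phi_2\,aS_3+f_2\cos\phi_2\,aC_3$. Here $f_i$ is the thrust and $\phi_i$ the rotation angle of drone $i$. In the outer loop the four quantities $f_i\sin\phi_i$, $f_i\cos\phi_i$ ($i=1,2$) are treated as the control inputs, assumed to be realized exactly. Assumption 1. (i) The two cables are always in tension. That is, the cable tensions $T_1,T_2$, defined by $m_1(\ddot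 y_1,\ddot z_1)=(f_1\sin\phi_1,\,f_1\cos\phi_1-m_1g)+T_1(S_1,-C_1)$ and $m_2(\ddot y_2,\ddot z_2)=(f_2\sin\phi_2,\,f_2\cos\phi_2-m_2g)-T_2(S_2,C_2)$, are positive. (ii) The bar is always under the two drones in the vertical direction, and $-\frac\pi2<\phi_1,\phi_2,\theta_1(t),\theta_2(t),\theta_3(t)<\frac\pi2$ for all $t\ge0$. (iii) The bar is never in a straight line with either cable, understood as $|\theta_2+\theta_3|<\frac\pi2$ and $|\theta_1-\theta_3|<\frac\pi2$ for all $t\ge 0$. *)

theory Defs
  imports "HOL-Analysis.Analysis"
begin

text \<open>
  The generalized coordinates are \<open>q = (y, z, \<theta>\<^sub>1, \<theta>\<^sub>2, \<theta>\<^sub>3)\<close>, a vector of type \<open>real^5\<close>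
  with components \<open>q $ 1\<close> to \<open>q $ 5\<close>.  Points of the vertical plane are pairs
  \<open>(horizontal, vertical)\<close>.
\<close>

lemma exhaust_5:
  fixes x :: 5
  shows "x = 1 \<or> x = 2 \<or> x = 3 \<or> x = 4 \<or> x = 5"
proof (induct x)
  case (of_int z)
  then have "z = 0 \<or> z = 1 \<or> z = 2 \<or> z = 3 \<or> z = 4" by fastforce
  then show ?case by auto
qed

lemma forall_5: "(\<forall>i::5. P i) \<longleftrightarrow> P 1 \<and> P 2 \<and> P 3 \<and> P 4 \<and> P 5"
  by (metis exhaust_5)

lemma UNIV_5: "UNIV = {1, 2, 3, 4, 5::5}"
  using exhaust_5 by auto

lemma sum_5: "sum f (UNIV::5 set) = f 1 + f 2 + f 3 + f 4 + f 5"
  unfolding UNIV_5 by (simp add: ac_simps)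

lemma vector_5 [simp]:
  "(vector [x,y,z,u,v] :: 'a::zero^5) $ 1 = x"
  "(vector [x,y,z,u,v] :: 'a::zero^5) $ 2 = y"
  "(vector [x,y,z,u,v] :: 'a::zero^5) $ 3 = z"
  "(vector [x,y,z,u,v] :: 'a::zero^5) $ 4 = u"
  "(vector [x,y,z,u,v] :: 'a::zero^5) $ 5 = v"
  unfolding vector_def by simp_all


text \<open>Motions live on the time interval \<open>{0..}\<close>, so the derivative at time 0 is one-sided.\<close>

definition time_deriv :: "(real \<Rightarrow> 'a::real_normed_vector) \<Rightarrow> real \<Rightarrow> 'a" where
  "time_deriv x t = vector_derivative x (at t within {0..})"

definition twice_differentiable :: "(real \<Rightarrow> 'a::real_normed_vector) \<Rightarrow> bool" where
  "twice_differentiable x \<longleftrightarrow>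
     x differentiable_on {0..} \<and> time_deriv x differentiable_on {0..}"

definition partial_deriv :: "'n \<Rightarrow> (real^'n \<Rightarrow> real) \<Rightarrow> real^'n \<Rightarrow> real" where
  "partial_deriv i F x = deriv (\<lambda>s. F (x + s *\<^sub>R axis i 1)) 0"


definition drone1_pos :: "real^5 \<Rightarrow> real \<times> real" where
  "drone1_pos q = (q $ 1, q $ 2)"

definition drone2_pos :: "real \<Rightarrow> real \<Rightarrow> real \<Rightarrow> real^5 \<Rightarrow> real \<times> real" where
  "drone2_pos l1 l2 a q =
     (q $ 1 + l1 * sin (q $ 3) + l2 * sin (q $ 4) + a * cos (q $ 5),
      q $ 2 - l1 * cos (q $ 3) + l2 * cos (q $ 4) + a * sin (q $ 5))"

definition bar_pos :: "real \<Rightarrow> real \<Rightarrow> real^5 \<Rightarrow> real \<times> real" where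
  "bar_pos l1 a q =
     (q $ 1 + l1 * sin (q $ 3) + a / 2 * cos (q $ 5),
      q $ 2 - l1 * cos (q $ 3) + a / 2 * sin (q $ 5))"

definition mass_matrix ::
    "real \<Rightarrow> real \<Rightarrow> real \<Rightarrow> real \<Rightarrow> real \<Rightarrow> real \<Rightarrow> real^5 \<Rightarrow> real^5^5" where
  "mass_matrix m1 m2 m3 l1 l2 a q =
    (let \<theta>1 = q $ 3; \<theta>2 = q $ 4; \<theta>3 = q $ 5;
         M11 = m1 + m2 + m3;
         M13 = (m2 + m3) * l1 * cos \<theta>1;
         M14 = m2 * l2 * cos \<theta>2;
         M15 = - (m2 + m3 / 2) * a * sin \<theta>3;
         M23 = (m2 + m3) * l1 * sin \<theta>1;
         M24 = - m2 * l2 * sin \<theta>2;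
         M25 = (m2 + m3 / 2) * a * cos \<theta>3;
         M33 = (m2 + m3) * l1\<^sup>2;
         M34 = m2 * l1 * l2 * cos (\<theta>1 + \<theta>2);
         M35 = (m2 + m3 / 2) * l1 * a * sin (\<theta>1 - \<theta>3);
         M44 = m2 * l2\<^sup>2;
         M45 = - m2 * l2 * a * sin (\<theta>2 + \<theta>3);
         M55 = m2 * a\<^sup>2 + m3 * (a / 2)\<^sup>2
     in vector
      [vector [M11, 0,   M13, M14, M15],
       vector [0,   M11, M23, M24, M25],
       vector [M13, M23, M33, M34, M35],
       vector [M14, M24, M34, M44, M45],
       vector [M15, M25, M35, M45, M55]])"

definition kinetic_energy ::
    "real \<Rightarrow> real \<Rightarrow> real \<Rightarrow> real \<Rightarrow> real \<Rightarrow> real \<Rightarrow> real^5 \<Rightarrow> real^5 \<Rightarrow> real" where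
  "kinetic_energy m1 m2 m3 l1 l2 a q v =
     1 / 2 * (v \<bullet> (mass_matrix m1 m2 m3 l1 l2 a q *v v))"

definition potential_energy ::
    "real \<Rightarrow> real \<Rightarrow> real \<Rightarrow> real \<Rightarrow> real \<Rightarrow> real \<Rightarrow> real \<Rightarrow> real^5 \<Rightarrow> real" where
  "potential_energy m1 m2 m3 l1 l2 a g q =
     g * (m1 * snd (drone1_pos q) + m2 * snd (drone2_pos l1 l2 a q)
          + m3 * snd (bar_pos l1 a q))"

definition lagrangian ::
    "real \<Rightarrow> real \<Rightarrow> real \<Rightarrow> real \<Rightarrow> real \<Rightarrow> real \<Rightarrow> real \<Rightarrow> real^5 \<Rightarrow> real^5 \<Rightarrow> real" where
  "lagrangian m1 m2 m3 l1 l2 a g q v =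
     kinetic_energy m1 m2 m3 l1 l2 a q v - potential_energy m1 m2 m3 l1 l2 a g q"

definition generalized_force ::
    "real \<Rightarrow> real \<Rightarrow> real \<Rightarrow> real^5 \<Rightarrow> real \<Rightarrow> real \<Rightarrow> real \<Rightarrow> real \<Rightarrow> real^5" where
  "generalized_force l1 l2 a q f1 \<phi>1 f2 \<phi>2 =
    (let \<theta>1 = q $ 3; \<theta>2 = q $ 4; \<theta>3 = q $ 5
     in vector
      [f1 * sin \<phi>1 + f2 * sin \<phi>2,
       f1 * cos \<phi>1 + f2 * cos \<phi>2,
       f2 * sin \<phi>2 * l1 * cos \<theta>1 + f2 * cos \<phi>2 * l1 * sin \<theta>1,
       f2 * sin \<phi>2 * l2 * cos \<theta>2 - f2 * cos \<phi>2 * l2 * sin \<theta>2,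
       - f2 * sin \<phi>2 * a * sin \<theta>3 + f2 * cos \<phi>2 * a * cos \<theta>3])"

definition euler_lagrange ::
    "real \<Rightarrow> real \<Rightarrow> real \<Rightarrow> real \<Rightarrow> real \<Rightarrow> real \<Rightarrow> real \<Rightarrow>
     (real \<Rightarrow> real^5) \<Rightarrow> (real \<Rightarrow> real) \<Rightarrow> (real \<Rightarrow> real) \<Rightarrow> (real \<Rightarrow> real) \<Rightarrow> (real \<Rightarrow> real) \<Rightarrow> bool" where
  "euler_lagrange m1 m2 m3 l1 l2 a g q f1 \<phi>1 f2 \<phi>2 \<longleftrightarrow>
    (\<forall>t\<ge>0. \<forall>i.
       time_deriv
         (\<lambda>s. partial_deriv i (\<lambda>v. lagrangian m1 m2 m3 l1 l2 a g (q s) v) (time_deriv q s)) t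
       - partial_deriv i (\<lambda>x. lagrangian m1 m2 m3 l1 l2 a g x (time_deriv q t)) (q t)
       = generalized_force l1 l2 a (q t) (f1 t) (\<phi>1 t) (f2 t) (\<phi>2 t) $ i)"


text \<open>
  \<open>T1\<close> and \<open>T2\<close> are the cable tensions; the two force balances determine them uniquely.
\<close>

definition cables_in_tension ::
    "real \<Rightarrow> real \<Rightarrow> real \<Rightarrow> real \<Rightarrow> real \<Rightarrow> real \<Rightarrow>
     (real \<Rightarrow> real^5) \<Rightarrow> (real \<Rightarrow> real) \<Rightarrow> (real \<Rightarrow> real) \<Rightarrow> (real \<Rightarrow> real) \<Rightarrow> (real \<Rightarrow> real) \<Rightarrow> bool" where
  "cables_in_tension m1 m2 l1 l2 a g q f1 \<phi>1 f2 \<phi>2 \<longleftrightarrow>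
    (\<forall>t\<ge>0. \<exists>T1 T2.
       T1 > 0 \<and> T2 > 0 \<and>
       m1 *\<^sub>R time_deriv (time_deriv (\<lambda>s. drone1_pos (q s))) t =
         (f1 t * sin (\<phi>1 t), f1 t * cos (\<phi>1 t) - m1 * g)
         + T1 *\<^sub>R (sin (q t $ 3), - cos (q t $ 3)) \<and>
       m2 *\<^sub>R time_deriv (time_deriv (\<lambda>s. drone2_pos l1 l2 a (q s))) t =
         (f2 t * sin (\<phi>2 t), f2 t * cos (\<phi>2 t) - m2 * g)
         - T2 *\<^sub>R (sin (q t $ 4), cos (q t $ 4)))"

text \<open>
  The bar being under the two drones is stated for its centre, the point \<open>bar_pos\<close> that
  represents the bar; this is implied by the same requirement on every point of the bar.
\<close>

definition assumption1 ::
    "real \<Rightarrow> real \<Rightarrow> real \<Rightarrow> real \<Rightarrow> real \<Rightarrow> real \<Rightarrow>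
     (real \<Rightarrow> real^5) \<Rightarrow> (real \<Rightarrow> real) \<Rightarrow> (real \<Rightarrow> real) \<Rightarrow> (real \<Rightarrow> real) \<Rightarrow> (real \<Rightarrow> real) \<Rightarrow> bool" where
  "assumption1 m1 m2 l1 l2 a g q f1 \<phi>1 f2 \<phi>2 \<longleftrightarrow>
    cables_in_tension m1 m2 l1 l2 a g q f1 \<phi>1 f2 \<phi>2 \<and>
    (\<forall>t\<ge>0. snd (bar_pos l1 a (q t)) < snd (drone1_pos (q t)) \<and>
            snd (bar_pos l1 a (q t)) < snd (drone2_pos l1 l2 a (q t))) \<and>
    (\<forall>t\<ge>0. \<forall>\<alpha> \<in> {\<phi>1 t, \<phi>2 t, q t $ 3, q t $ 4, q t $ 5}. - (pi / 2) < \<alpha> \<and> \<alpha> < pi / 2) \<and>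
    (\<forall>t\<ge>0. \<bar>q t $ 4 + q t $ 5\<bar> < pi / 2 \<and> \<bar>q t $ 3 - q t $ 5\<bar> < pi / 2)"

end

theory Submission
  imports Defs
begin

text \<open>
  The energy \<open>V\<close> of the closed loop, with the barrier term \<open>\<sigma> / 2 * ey\<^sup>2 / (\<rho> - ey\<^sup>2)\<close> as part of the
  potential, decreases at the rate \<open>dis\<close>, a positive definite form in the drones' velocities. This
  keeps the drones bounded and \<open>ey\<^sup>2\<close> away from \<open>\<rho>\<close>. LaSalle's principle does not apply directly:
  the mass matrix degenerates where the cables and the bar are aligned, and the strict angle
  constraints do not pass to the limit, so that tensions and angular velocities could a priori be
  unbounded. Instead, the drones' positions move arbitrarily little over long time windows because
  \<open>V\<close> converges, and the degenerate positions are excluded one by one: both cables horizontal (the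
  bar's weight could not be carried), and the bar aligned with both cables (an inclined bar would
  accelerate sideways; a hanging bar's fast rotation would decelerate too strongly to keep the
  angles in range). Then tensions and rotation are eventually bounded, all drone and bar centre
  velocities tend to 0, and averaging Newton's equations over short intervals shows that every
  cluster point of the configuration satisfies the equations of static equilibrium. These have only
  the desired solution.
\<close>

subsection \<open>Slowly varying functions\<close>

text \<open>The bar enters as a point mass at its centre, so its moment balance
  \<open>T1 * c1 = T2 * c2\<close> is algebraic, and its rotation is felt only through the
  velocities \<open>a / 2 * \<omega>3 * c1\<close> and \<open>a / 2 * \<omega>3 * c2\<close> along
  the cables. The energy therefore bounds these products but not \<open>\<omega>3\<close>, which is
  the origin of the degenerate positions. Two facts make up for the missing compactness. Vertically,
  the tensions always pull the drones down and the bar up, so relative accelerations are bounded on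
  one side even if the tensions are not; this suffices for the vertical velocities to vanish. And
  once the rotation is bounded, the two equations for \<open>\<alpha>3\<close>, multiplied crosswise
  by \<open>c2\<close> and \<open>c1\<close>, bound the tensions however small these cosines are.
  Even then the tensions need not converge, so the static equations are obtained at times chosen
  separately for each linear combination of Newton's equations. Impulses and dissipated energies are
  compared through antiderivatives, never as integrals.\<close>

lemma deriv_le_imp_diff_le:
  fixes f g :: "real \<Rightarrow> real"
  assumes "s \<le> t"
    and "\<And>r. s \<le> r \<Longrightarrow> r \<le> t \<Longrightarrow> (f has_real_derivative f' r) (at r)"
    and "\<And>r. s \<le> r \<Longrightarrow> r \<le> t \<Longrightarrow> (g has_real_derivative g' r) (at r)"
    and "\<And>r. s \<le> r \<Longrightarrow> r \<le> t \<Longrightarrow> f' r \<le> g' r"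
  shows "f t - f s \<le> g t - g s"
proof -
  have "(\<lambda>r. g r - f r) s \<le> (\<lambda>r. g r - f r) t"
  proof (rule DERIV_nonneg_imp_nondecreasing[OF assms(1)])
    fix r assume "s \<le> r" "r \<le> t"
    then show "\<exists>y. ((\<lambda>r. g r - f r) has_real_derivative y) (at r) \<and> 0 \<le> y"
      using assms(2-4) by (intro exI[of _ "g' r - f' r"]) (auto intro!: derivative_eq_intros)
  qed
  then show ?thesis by simp
qed

lemma deriv_bound_imp_diff_bound:
  fixes f :: "real \<Rightarrow> real"
  assumes "s \<le> t"
    and "\<And>r. s \<le> r \<Longrightarrow> r \<le> t \<Longrightarrow> (f has_real_derivative f' r) (at r)"
  shows "(\<And>r. s \<le> r \<Longrightarrow> r \<le> t \<Longrightarrow> f' r \<le> c) \<Longrightarrow> f t - f s \<le> c * (t - s)"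
    and "(\<And>r. s \<le> r \<Longrightarrow> r \<le> t \<Longrightarrow> c \<le> f' r) \<Longrightarrow> c * (t - s) \<le> f t - f s"
    and "(\<And>r. s \<le> r \<Longrightarrow> r \<le> t \<Longrightarrow> \<bar>f' r\<bar> \<le> c) \<Longrightarrow> \<bar>f t - f s\<bar> \<le> c * (t - s)"
proof -
  have lin: "((\<lambda>r. c * r) has_real_derivative c) (at r)" for c r :: real
    by (auto intro!: derivative_eq_intros)
  show up: "f t - f s \<le> c * (t - s)" if "\<And>r. s \<le> r \<Longrightarrow> r \<le> t \<Longrightarrow> f' r \<le> c" for c
    using deriv_le_imp_diff_le[OF assms lin that] by (simp add: algebra_simps)
  show lo: "c * (t - s) \<le> f t - f s" if "\<And>r. s \<le> r \<Longrightarrow> r \<le> t \<Longrightarrow> c \<le> f' r" for c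
    using deriv_le_imp_diff_le[OF assms(1) lin assms(2) that] by (simp add: algebra_simps)
  show "\<bar>f t - f s\<bar> \<le> c * (t - s)" if *: "\<And>r. s \<le> r \<Longrightarrow> r \<le> t \<Longrightarrow> \<bar>f' r\<bar> \<le> c"
  proof -
    have "f' r \<le> c" "- c \<le> f' r" if "s \<le> r" "r \<le> t" for r
      using *[OF that] by auto
    then show ?thesis using up[of c] lo[of "-c"] by (simp add: abs_le_iff)
  qed
qed

text \<open>Weaker than convergence: \<open>sin (sqrt t)\<close> qualifies. The energy yields no
  more for the positions, since square integrable velocities produce small increments over bounded
  windows but need not be integrable.\<close>

definition slow :: "(real \<Rightarrow> real) \<Rightarrow> bool" where
  "slow f \<longleftrightarrow> (\<forall>L>0. \<forall>\<eta>>0. \<forall>\<^sub>F t in at_top. \<forall>s\<in>{t..t + L}. \<bar>f s - f t\<bar> < \<eta>)"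

lemma slowD:
  assumes "slow f" "L > 0" "\<eta> > 0"
  shows "\<forall>\<^sub>F t in at_top. \<forall>s\<in>{t..t + L}. \<bar>f s - f t\<bar> < \<eta>"
  using assms unfolding slow_def by blast

lemma slow_add:
  assumes "slow f" "slow g"
  shows "slow (\<lambda>t. f t + g t)"
  unfolding slow_def
proof (intro allI impI)
  fix L \<eta> :: real assume "L > 0" "\<eta> > 0"
  then have "\<eta> / 2 > 0" by simp
  show "\<forall>\<^sub>F t in at_top. \<forall>s\<in>{t..t + L}. \<bar>f s + g s - (f t + g t)\<bar> < \<eta>"
    using slowD[OF assms(1) \<open>L > 0\<close> \<open>\<eta> / 2 > 0\<close>] slowD[OF assms(2) \<open>L > 0\<close> \<open>\<eta> / 2 > 0\<close>]
  proof eventually_elim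
    case (elim t)
    show ?case
    proof
      fix s assume "s \<in> {t..t + L}"
      then have "\<bar>f s - f t\<bar> < \<eta> / 2" "\<bar>g s - g t\<bar> < \<eta> / 2" using elim by auto
      then show "\<bar>f s + g s - (f t + g t)\<bar> < \<eta>" by linarith
    qed
  qed
qed

lemma slow_cmult:
  assumes "slow f"
  shows "slow (\<lambda>t. c * f t)"
proof (cases "c = 0")
  case False
  show ?thesis
    unfolding slow_def
  proof (intro allI impI)
    fix L \<eta> :: real assume "L > 0" "\<eta> > 0"
    then have "\<eta> / \<bar>c\<bar> > 0" using False by simp
    show "\<forall>\<^sub>F t in at_top. \<forall>s\<in>{t..t + L}. \<bar>c * f s - c * f t\<bar> < \<eta>"
      using slowD[OF assms \<open>L > 0\<close> \<open>\<eta> / \<bar>c\<bar> > 0\<close>]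
    proof eventually_elim
      case (elim t)
      then show ?case using False
        by (auto simp: abs_mult pos_less_divide_eq mult.commute simp flip: right_diff_distrib)
    qed
  qed
qed (simp add: slow_def)

lemma slow_diff:
  assumes "slow f" "slow g"
  shows "slow (\<lambda>t. f t - g t)"
  using slow_add[OF assms(1) slow_cmult[OF assms(2), of "-1"]] by simp

lemma slow_const: "slow (\<lambda>_. c)"
  by (simp add: slow_def)

lemma tendsto_imp_slow:
  assumes "(f \<longlongrightarrow> c) at_top"
  shows "slow f"
  unfolding slow_def
proof (intro allI impI)
  fix L \<eta> :: real assume "L > 0" "\<eta> > 0"
  then have "\<forall>\<^sub>F t in at_top. dist (f t) c < \<eta> / 2"
    by (intro tendstoD[OF assms]) simp
  then obtain N where N: "\<And>t. t \<ge> N \<Longrightarrow> \<bar>f t - c\<bar> < \<eta> / 2"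
    by (auto simp: eventually_at_top_linorder dist_real_def)
  show "\<forall>\<^sub>F t in at_top. \<forall>s\<in>{t..t + L}. \<bar>f s - f t\<bar> < \<eta>"
    unfolding eventually_at_top_linorder
  proof (intro exI[of _ N] allI impI ballI)
    fix t s assume "N \<le> t" "s \<in> {t..t + L}"
    then have "\<bar>f t - c\<bar> < \<eta> / 2" "\<bar>f s - c\<bar> < \<eta> / 2" using N by auto
    then show "\<bar>f s - f t\<bar> < \<eta>" by linarith
  qed
qed

text \<open>The weighted inequality between arithmetic and geometric mean, up to a factor 2. It
  turns a term linear in a velocity into a small constant plus dissipated energy, with a weight that
  can be tuned.\<close>

lemma abs_le_young:
  fixes x :: real assumes "\<eta> > 0" shows "\<bar>x\<bar> \<le> \<eta> + x\<^sup>2 / \<eta>"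
proof -
  have "0 \<le> (\<bar>x\<bar> - \<eta>)\<^sup>2" by simp
  also have "\<dots> = x\<^sup>2 - 2 * (\<bar>x\<bar> * \<eta>) + \<eta> * \<eta>" by (simp add: power2_eq_square algebra_simps)
  finally have "0 \<le> x\<^sup>2 - 2 * (\<bar>x\<bar> * \<eta>) + \<eta> * \<eta>" .
  moreover have "0 \<le> \<bar>x\<bar> * \<eta>" using assms by simp
  ultimately have "\<bar>x\<bar> * \<eta> \<le> \<eta> * \<eta> + x\<^sup>2" by linarith
  then show ?thesis using assms by (simp add: field_simps)
qed

text \<open>Cauchy-Schwarz without integrals: Young's inequality gives
  \<open>\<bar>f' r\<bar> \<le> e - C / e * V' r\<close>, and the right side has the antiderivative
  \<open>e * r - C / e * V r\<close>, whose increment is small once \<open>V\<close> hardly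
  changes.\<close>

lemma slow_if_dissipated:
  fixes f V :: "real \<Rightarrow> real"
  assumes V: "slow V" and C: "C \<ge> 0"
    and dV: "\<And>t. t \<ge> N \<Longrightarrow> (V has_real_derivative V' t) (at t)"
    and df: "\<And>t. t \<ge> N \<Longrightarrow> (f has_real_derivative f' t) (at t)"
    and le: "\<And>t. t \<ge> N \<Longrightarrow> (f' t)\<^sup>2 \<le> C * (- V' t)"
  shows "slow f"
  unfolding slow_def
proof (intro allI impI)
  fix L \<eta> :: real assume L: "L > 0" and "\<eta> > 0"
  \<comment> \<open>Half of \<eta> is spent on the constant rate \<open>e\<close> over the length
    \<open>L\<close>, the other half on the drop of \<open>V\<close>; the \<open>C + 1\<close> in
    \<open>d\<close> covers \<open>C = 0\<close>.\<close>
  define e where "e = \<eta> / (2 * L)"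
  have e: "e > 0" "e * L = \<eta> / 2" using L \<open>\<eta> > 0\<close> by (auto simp: e_def)
  define d where "d = \<eta> * e / (2 * (C + 1))"
  have d: "d > 0" using e \<open>\<eta> > 0\<close> C by (auto simp: d_def)
  have Cd: "C / e * d < \<eta> / 2 + 0"
    using e \<open>\<eta> > 0\<close> C by (simp add: d_def field_simps)
  show "\<forall>\<^sub>F t in at_top. \<forall>s\<in>{t..t + L}. \<bar>f s - f t\<bar> < \<eta>"
    using slowD[OF V L d] eventually_ge_at_top[of N]
  proof eventually_elim
    case (elim t)
    show ?case
    proof
      fix s assume s: "s \<in> {t..t + L}"
      have dg: "((\<lambda>r. e * r - C / e * V r) has_real_derivative e - C / e * V' r) (at r)"
        if "t \<le> r" "r \<le> s" for r
        using that elim e by (auto intro!: derivative_eq_intros dV)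
      have dng: "((\<lambda>r. - (e * r - C / e * V r)) has_real_derivative - (e - C / e * V' r)) (at r)"
        if "t \<le> r" "r \<le> s" for r
        using dg[OF that] by (rule DERIV_minus)
      have le': "\<bar>f' r\<bar> \<le> e - C / e * V' r" if "t \<le> r" "r \<le> s" for r
      proof -
        have "\<bar>f' r\<bar> \<le> e + (f' r)\<^sup>2 / e" by (rule abs_le_young[OF e(1)])
        also have "\<dots> \<le> e + C * (- V' r) / e"
          using divide_right_mono[OF le[of r], of e] that elim e by simp
        finally show ?thesis by simp
      qed
      have df': "(f has_real_derivative f' r) (at r)" if "t \<le> r" for r
        using df that elim by simp
      have le1: "f' r \<le> e - C / e * V' r" and le2: "- (e - C / e * V' r) \<le> f' r"
        if "t \<le> r" "r \<le> s" for r
        using le'[OF that] by linarith+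
      have ts: "t \<le> s" using s by simp
      have 1: "f s - f t \<le> (e * s - C / e * V s) - (e * t - C / e * V t)"
        by (rule deriv_le_imp_diff_le[OF ts df' dg le1])
      have 2: "- (e * s - C / e * V s) - - (e * t - C / e * V t) \<le> f s - f t"
        by (rule deriv_le_imp_diff_le[OF ts dng df' le2])
      have 3: "(e * s - C / e * V s) - (e * t - C / e * V t) < \<eta>"
      proof -
        have "e * (s - t) \<le> e * L" using s e by (intro mult_left_mono) auto
        moreover have "C / e * (V t - V s) \<le> C / e * d"
          using bspec[OF elim(1) s] C e by (intro mult_left_mono) (simp_all add: abs_less_iff)
        moreover have "(e * s - C / e * V s) - (e * t - C / e * V t) = e * (s - t) + C / e * (V t - V s)"
          by (simp add: right_diff_distrib)
        ultimately show ?thesis using e Cd by linarith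
      qed
      show "\<bar>f s - f t\<bar> < \<eta>" using 1 2 3 by linarith
    qed
  qed
qed

lemma deriv_tendsto_0_imp_slow:
  fixes f :: "real \<Rightarrow> real"
  assumes df: "\<And>t. t \<ge> N \<Longrightarrow> (f has_real_derivative f' t) (at t)"
    and "(f' \<longlongrightarrow> 0) at_top"
  shows "slow f"
  unfolding slow_def
proof (intro allI impI)
  fix L \<eta> :: real assume L: "L > 0" and "\<eta> > 0"
  then have "\<forall>\<^sub>F t in at_top. dist (f' t) 0 < \<eta> / (2 * L)"
    by (intro tendstoD[OF assms(2)]) simp
  then obtain M where M: "\<And>t. t \<ge> M \<Longrightarrow> \<bar>f' t\<bar> < \<eta> / (2 * L)"
    by (auto simp: eventually_at_top_linorder dist_real_def)
  show "\<forall>\<^sub>F t in at_top. \<forall>s\<in>{t..t + L}. \<bar>f s - f t\<bar> < \<eta>"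
    unfolding eventually_at_top_linorder
  proof (intro exI[of _ "max M N"] allI impI ballI)
    fix t s assume t: "max M N \<le> t" and s: "s \<in> {t..t + L}"
    have "\<bar>f s - f t\<bar> \<le> \<eta> / (2 * L) * (s - t)"
      by (rule deriv_bound_imp_diff_bound(3)[of _ _ _ f']) (use t s df less_imp_le[OF M] in auto)
    also have "\<dots> \<le> \<eta> / (2 * L) * L"
      using s L \<open>\<eta> > 0\<close> by (intro mult_left_mono) auto
    also have "\<dots> < \<eta>" using L \<open>\<eta> > 0\<close> by simp
    finally show "\<bar>f s - f t\<bar> < \<eta>" .
  qed
qed

text \<open>A one-sided bound on the second derivative is enough for Barbalat's conclusion.\<close>

lemma slow_deriv_tendsto_0:
  fixes f :: "real \<Rightarrow> real"
  assumes slow: "slow f"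
    and df: "\<And>t. t \<ge> N \<Longrightarrow> (f has_real_derivative f' t) (at t)"
    and df': "\<And>t. t \<ge> N \<Longrightarrow> (f' has_real_derivative f'' t) (at t)"
    and le: "\<And>t. t \<ge> N \<Longrightarrow> f'' t \<le> C"
  shows "(f' \<longlongrightarrow> 0) at_top"
proof (rule tendstoI)
  fix \<eta> :: real assume "\<eta> > 0"
  define C' where "C' = \<bar>C\<bar> + 1"
  have C': "C' > 0" "\<And>t. t \<ge> N \<Longrightarrow> f'' t \<le> C'" using le by (fastforce simp: C'_def)+
  define d where "d = \<eta> / (2 * C')"
  have d: "d > 0" "C' * d = \<eta> / 2" using C' \<open>\<eta> > 0\<close> by (auto simp: d_def)
  have "\<eta> / 2 * d > 0" using \<open>\<eta> > 0\<close> d by simp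
  then obtain M where M: "\<And>t s. t \<ge> M \<Longrightarrow> s \<in> {t..t + d} \<Longrightarrow> \<bar>f s - f t\<bar> < \<eta> / 2 * d"
    using slowD[OF slow d(1) \<open>\<eta> / 2 * d > 0\<close>] unfolding eventually_at_top_linorder by blast
  show "\<forall>\<^sub>F t in at_top. dist (f' t) 0 < \<eta>"
    unfolding eventually_at_top_linorder
  proof (intro exI[of _ "max M N + d"] allI impI)
    fix t assume t: "max M N + d \<le> t"
    have grow: "f' r' - f' r \<le> C' * (r' - r)" if "N \<le> r" "r \<le> r'" for r r'
      by (rule deriv_bound_imp_diff_bound(1)[of _ _ _ f'']) (use that df' C' in auto)
    \<comment> \<open>An upper bound on \<open>f''\<close> carries a negative value of
      \<open>f'\<close> forward in the estimate of the next window only from below zero, and a large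
      positive value backward. The two windows lie on opposite sides of \<open>t\<close>, hence the
      \<open>+ d\<close> in the threshold.\<close>
    have "\<not> f' t \<le> - \<eta>"
    proof
      assume neg: "f' t \<le> - \<eta>"
      have "f' r \<le> - (\<eta> / 2)" if "t \<le> r" "r \<le> t + d" for r
      proof -
        have "f' r - f' t \<le> C' * (r - t)" using that t d by (intro grow) auto
        also have "\<dots> \<le> C' * d" using that C' by (intro mult_left_mono) auto
        finally show ?thesis using neg d by linarith
      qed
      then have "f (t + d) - f t \<le> - (\<eta> / 2) * (t + d - t)"
        by (intro deriv_bound_imp_diff_bound(1)[of _ _ _ f']) (use d t df in auto)
      moreover have "\<bar>f (t + d) - f t\<bar> < \<eta> / 2 * d" using t d by (intro M) auto
      ultimately show False using \<open>\<eta> / 2 * d > 0\<close> by (simp add: abs_less_iff)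
    qed
    moreover have "\<not> f' t \<ge> \<eta>"
    proof
      assume pos: "f' t \<ge> \<eta>"
      have "\<eta> / 2 \<le> f' r" if "t - d \<le> r" "r \<le> t" for r
      proof -
        have "f' t - f' r \<le> C' * (t - r)" using that t d by (intro grow) auto
        also have "\<dots> \<le> C' * d" using that C' by (intro mult_left_mono) auto
        finally show ?thesis using pos d by linarith
      qed
      then have "\<eta> / 2 * (t - (t - d)) \<le> f t - f (t - d)"
        by (intro deriv_bound_imp_diff_bound(2)[of _ _ _ f']) (use d t df in auto)
      moreover have "\<bar>f t - f (t - d)\<bar> < \<eta> / 2 * d" using t d by (intro M) auto
      ultimately show False using \<open>\<eta> / 2 * d > 0\<close> by (simp add: abs_less_iff)
    qed
    ultimately show "dist (f' t) 0 < \<eta>" by (simp add: dist_real_def abs_less_iff)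
  qed
qed

text \<open>On a long window \<open>F\<close> is nearly a parabola with initial slope
  \<open>f t\<close> and second derivative \<open>\<kappa> t\<close>. Boundedness forces these
  coefficients to be of order \<open>1 / L\<close> and \<open>1 / L\<^sup>2\<close>. The summand
  \<open>\<sigma>\<close> accommodates damping forces, which are derivatives of slow position
  terms.\<close>

lemma bounded_slow_acceleration:
  fixes F f \<sigma> \<kappa> :: "real \<Rightarrow> real"
  assumes slow: "slow \<sigma>" "slow \<kappa>"
    and bound: "\<And>t. t \<ge> N \<Longrightarrow> \<bar>F t\<bar> \<le> K"
    and dF: "\<And>t. t \<ge> N \<Longrightarrow> (F has_real_derivative f t) (at t)"
    and df: "\<And>t. t \<ge> N \<Longrightarrow> ((\<lambda>t. f t + \<sigma> t) has_real_derivative \<kappa> t) (at t)"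
  shows "(f \<longlongrightarrow> 0) at_top" "(\<kappa> \<longlongrightarrow> 0) at_top"
proof -
  have K: "K \<ge> 0" using bound[of N] by simp
  have main: "\<forall>\<^sub>F t in at_top. \<bar>\<kappa> t\<bar> * L\<^sup>2 \<le> 24 * (K + 1) \<and> \<bar>f t\<bar> * L \<le> 14 * (K + 1)"
    if L: "L \<ge> 1" for L
  proof -
    \<comment> \<open>So chosen that the errors of \<open>\<sigma>\<close> and
      \<open>\<kappa>\<close>, accumulated in \<open>F\<close> over the window, are at most
      2.\<close>
    define e where "e = 1 / L\<^sup>2"
    have e: "e > 0" "e * L * L = 1" using L by (auto simp: e_def power2_eq_square)
    have L0: "L > 0" using L by simp
    show ?thesis
      using slowD[OF slow(1) L0 e(1)] slowD[OF slow(2) L0 e(1)] eventually_ge_at_top[of N]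
    proof eventually_elim
      case (elim t)
      have f: "\<bar>f s - f t - \<kappa> t * (s - t)\<bar> \<le> 2 * e * L" if s: "t \<le> s" "s \<le> t + L" for s
      proof -
        have "\<bar>(f s + \<sigma> s - \<kappa> t * s) - (f t + \<sigma> t - \<kappa> t * t)\<bar> \<le> e * (s - t)"
        proof (rule deriv_bound_imp_diff_bound(3)[of _ _ "\<lambda>s. f s + \<sigma> s - \<kappa> t * s" "\<lambda>r. \<kappa> r - \<kappa> t"])
          fix r assume r: "t \<le> r" "r \<le> s"
          then show "((\<lambda>s. f s + \<sigma> s - \<kappa> t * s) has_real_derivative \<kappa> r - \<kappa> t) (at r)"
            using DERIV_diff[OF df[of r] DERIV_cmult_Id[of "\<kappa> t"]] elim by (simp add: algebra_simps)
          show "\<bar>\<kappa> r - \<kappa> t\<bar> \<le> e" using elim(2) r s by (auto intro: less_imp_le)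
        qed (use s in simp)
        also have "\<dots> \<le> e * L" using s e by (intro mult_left_mono) auto
        finally have 1: "\<bar>(f s + \<sigma> s - \<kappa> t * s) - (f t + \<sigma> t - \<kappa> t * t)\<bar> \<le> e * L" .
        have 2: "\<bar>\<sigma> s - \<sigma> t\<bar> < e" using elim(1) s by auto
        have 3: "e \<le> e * L" using e L by simp
        have 4: "f s - f t - \<kappa> t * (s - t) = (f s + \<sigma> s - \<kappa> t * s) - (f t + \<sigma> t - \<kappa> t * t) - (\<sigma> s - \<sigma> t)"
          by (simp add: algebra_simps)
        show ?thesis using 1 2 3 unfolding 4 by linarith
      qed
      have F: "\<bar>F s - F t - f t * (s - t) - \<kappa> t * (s - t)\<^sup>2 / 2\<bar> \<le> 2" if s: "t \<le> s" "s \<le> t + L" for s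
      proof -
        have "\<bar>(F s - f t * (s - t) - \<kappa> t * (s - t)\<^sup>2 / 2) - (F t - f t * (t - t) - \<kappa> t * (t - t)\<^sup>2 / 2)\<bar> \<le> 2 * e * L * (s - t)"
          by (rule deriv_bound_imp_diff_bound(3)[of _ _ "\<lambda>s. F s - f t * (s - t) - \<kappa> t * (s - t)\<^sup>2 / 2"
                "\<lambda>s. f s - f t - \<kappa> t * (s - t)"])
            (use s elim f in \<open>auto intro!: derivative_eq_intros dF\<close>)
        also have "\<dots> \<le> 2 * e * L * L" using s e L by (intro mult_left_mono) auto
        finally show ?thesis using e by simp
      qed
      have B: "\<bar>F s - F t\<bar> \<le> 2 * K" if "t \<le> s" for s
        using bound[of s] bound[of t] that elim by linarith
      \<comment> \<open>The parabola at the end and at the middle of the window gives two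
        independent relations, which separate the linear from the quadratic coefficient.\<close>
      have 1: "\<bar>f t * L + \<kappa> t * L\<^sup>2 / 2\<bar> \<le> 2 * K + 2"
        using F[of "t + L"] B[of "t + L"] L by (simp add: abs_if split: if_splits)
      have "\<bar>f t * (L / 2) + \<kappa> t * (L / 2)\<^sup>2 / 2\<bar> \<le> 2 * K + 2"
        using F[of "t + L / 2"] B[of "t + L / 2"] L by (simp add: abs_if split: if_splits)
      then have 2: "\<bar>f t * L / 2 + \<kappa> t * L\<^sup>2 / 8\<bar> \<le> 2 * K + 2"
        by (simp add: power_divide)
      have 3: "\<bar>\<kappa> t * L\<^sup>2\<bar> \<le> 24 * (K + 1)" using 1 2 by argo
      have 4: "\<bar>f t * L\<bar> \<le> 14 * (K + 1)" using 1 3 by argo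
      show ?case using 3 4 L by (simp add: abs_mult)
    qed
  qed
  have lim: "(q \<longlongrightarrow> 0) at_top" if q: "\<And>L. L \<ge> 1 \<Longrightarrow> \<forall>\<^sub>F t in at_top. \<bar>q t\<bar> * L \<le> 24 * (K + 1)" for q :: "real \<Rightarrow> real"
  proof (rule tendstoI)
    fix \<eta> :: real assume "\<eta> > 0"
    define L where "L = 1 + 24 * (K + 1) / \<eta>"
    have L: "L \<ge> 1" "24 * (K + 1) < \<eta> * L" using K \<open>\<eta> > 0\<close> by (auto simp: L_def field_simps)
    show "\<forall>\<^sub>F t in at_top. dist (q t) 0 < \<eta>"
      using q[OF L(1)]
    proof eventually_elim
      case (elim t)
      then have "\<bar>q t\<bar> * L < \<eta> * L" using L by linarith
      then show ?case using L by (simp add: dist_real_def)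
    qed
  qed
  show "(f \<longlongrightarrow> 0) at_top"
  proof (rule lim)
    fix L :: real assume "L \<ge> 1"
    from main[OF this] show "\<forall>\<^sub>F t in at_top. \<bar>f t\<bar> * L \<le> 24 * (K + 1)"
      by eventually_elim (use K in auto)
  qed
  show "(\<kappa> \<longlongrightarrow> 0) at_top"
  proof (rule lim)
    fix L :: real assume L: "L \<ge> 1"
    from main[OF L] show "\<forall>\<^sub>F t in at_top. \<bar>\<kappa> t\<bar> * L \<le> 24 * (K + 1)"
    proof eventually_elim
      case (elim t)
      have "L \<le> L\<^sup>2" using L by (simp add: power2_eq_square)
      then have "\<bar>\<kappa> t\<bar> * L \<le> \<bar>\<kappa> t\<bar> * L\<^sup>2" by (intro mult_left_mono) auto
      then show ?case using elim by linarith
    qed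
  qed
qed

text \<open>Bolzano-Weierstrass along times at which \<open>f\<close> keeps the distance
  \<open>e\<close> from 0. It reduces convergence to the identification of limits along arbitrary
  sequences of times.\<close>

lemma tendsto_0_if_cluster_points_0:
  fixes f :: "real \<Rightarrow> 'a::{heine_borel, real_normed_vector}"
  assumes bdd: "bounded (f ` {N..})"
    and cluster: "\<And>t y. filterlim t at_top sequentially \<Longrightarrow> (\<lambda>n. f (t n)) \<longlonglongrightarrow> y \<Longrightarrow> y = 0"
  shows "(f \<longlongrightarrow> 0) at_top"
proof (rule ccontr)
  assume "\<not> (f \<longlongrightarrow> 0) at_top"
  then obtain e where e: "e > 0" "\<not> (\<forall>\<^sub>F t in at_top. dist (f t) 0 < e)"
    unfolding tendsto_iff by blast
  have "\<exists>t\<ge>max N (real n). dist (f t) 0 \<ge> e" for n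
    using e(2) unfolding eventually_at_top_linorder by (meson not_le)
  then obtain t where t: "\<And>n. t n \<ge> max N (real n)" "\<And>n. dist (f (t n)) 0 \<ge> e" by metis
  have "bounded (range (\<lambda>n. f (t n)))"
    by (rule bounded_subset[OF bdd]) (use t(1) in auto)
  then obtain y r where r: "strict_mono r" "((\<lambda>n. f (t n)) \<circ> r) \<longlonglongrightarrow> y"
    using bounded_imp_convergent_subsequence by blast
  have "filterlim t at_top sequentially"
    by (rule filterlim_at_top_mono[OF filterlim_real_sequentially]) (use t in auto)
  then have "filterlim (\<lambda>n. t (r n)) at_top sequentially"
    by (rule filterlim_compose) (rule filterlim_subseq[OF r(1)])
  then have "y = 0" using cluster[of "\<lambda>n. t (r n)" y] r(2) by (simp add: o_def)
  then have "(\<lambda>n. dist (f (t (r n))) 0) \<longlonglongrightarrow> 0"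
    using tendsto_dist[OF r(2) tendsto_const[of 0]] by (simp add: o_def)
  moreover have "\<And>n. e \<le> dist (f (t (r n))) 0" using t(2) by simp
  ultimately have "e \<le> 0" by (meson LIMSEQ_le_const)
  then show False using e by simp
qed

subsection \<open>Euler--Lagrange equations of the linkage\<close>

text \<open>
  Velocity and acceleration of \<open>drone2_pos l1 l2 a\<close>. The first drone is the instance with
  \<open>l1 = l2 = a = 0\<close>, and the bar centre the one with \<open>l2 = 0\<close> and \<open>a / 2\<close> in place of \<open>a\<close>.
\<close>

definition "vel_y l1 l2 a q v = v $ 1 + l1 * (cos (q $ 3) * v $ 3) + l2 * (cos (q $ 4) * v $ 4) - a * (sin (q $ 5) * v $ 5)"
  for l1 l2 a :: real and q v :: "real^5"
definition "vel_z l1 l2 a q v = v $ 2 + l1 * (sin (q $ 3) * v $ 3) - l2 * (sin (q $ 4) * v $ 4) + a * (cos (q $ 5) * v $ 5)"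
  for l1 l2 a :: real and q v :: "real^5"
definition "acc_y l1 l2 a q v c = c $ 1 + l1 * (cos (q $ 3) * c $ 3 - sin (q $ 3) * (v $ 3)\<^sup>2)
    + l2 * (cos (q $ 4) * c $ 4 - sin (q $ 4) * (v $ 4)\<^sup>2) - a * (sin (q $ 5) * c $ 5 + cos (q $ 5) * (v $ 5)\<^sup>2)"
  for l1 l2 a :: real and q v c :: "real^5"
definition "acc_z l1 l2 a q v c = c $ 2 + l1 * (sin (q $ 3) * c $ 3 + cos (q $ 3) * (v $ 3)\<^sup>2)
    - l2 * (sin (q $ 4) * c $ 4 + cos (q $ 4) * (v $ 4)\<^sup>2) + a * (cos (q $ 5) * c $ 5 - sin (q $ 5) * (v $ 5)\<^sup>2)"
  for l1 l2 a :: real and q v c :: "real^5"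

text \<open>Expanded so that the coefficients of the products of velocities can be matched with the
  entries of \<open>mass_matrix\<close>.\<close>

lemma speed_squared:
  "(vel_y l1 l2 a q v)\<^sup>2 + (vel_z l1 l2 a q v)\<^sup>2 =
    (v $ 1)\<^sup>2 + (v $ 2)\<^sup>2 + (l1 * v $ 3)\<^sup>2 + (l2 * v $ 4)\<^sup>2 + (a * v $ 5)\<^sup>2
    + 2 * (l1 * v $ 3 * (cos (q $ 3) * v $ 1 + sin (q $ 3) * v $ 2) + l2 * v $ 4 * (cos (q $ 4) * v $ 1 - sin (q $ 4) * v $ 2)
      + a * v $ 5 * (cos (q $ 5) * v $ 2 - sin (q $ 5) * v $ 1) + l1 * l2 * v $ 3 * v $ 4 * cos (q $ 3 + q $ 4)
      + l1 * a * v $ 3 * v $ 5 * sin (q $ 3 - q $ 5) - l2 * a * v $ 4 * v $ 5 * sin (q $ 4 + q $ 5))"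
proof -
  have "(vel_y l1 l2 a q v)\<^sup>2 + (vel_z l1 l2 a q v)\<^sup>2 =
    (v $ 1)\<^sup>2 + (v $ 2)\<^sup>2 + (l1 * v $ 3)\<^sup>2 * ((sin (q $ 3))\<^sup>2 + (cos (q $ 3))\<^sup>2) + (l2 * v $ 4)\<^sup>2 * ((sin (q $ 4))\<^sup>2 + (cos (q $ 4))\<^sup>2)
    + (a * v $ 5)\<^sup>2 * ((sin (q $ 5))\<^sup>2 + (cos (q $ 5))\<^sup>2)
    + 2 * (l1 * v $ 3 * (cos (q $ 3) * v $ 1 + sin (q $ 3) * v $ 2) + l2 * v $ 4 * (cos (q $ 4) * v $ 1 - sin (q $ 4) * v $ 2)
      + a * v $ 5 * (cos (q $ 5) * v $ 2 - sin (q $ 5) * v $ 1) + l1 * l2 * v $ 3 * v $ 4 * cos (q $ 3 + q $ 4)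
      + l1 * a * v $ 3 * v $ 5 * sin (q $ 3 - q $ 5) - l2 * a * v $ 4 * v $ 5 * sin (q $ 4 + q $ 5))"
    unfolding vel_y_def vel_z_def sin_add sin_diff cos_add power2_eq_square
    by (simp add: algebra_simps del: sin_cos_squared_add sin_cos_squared_add2 sin_cos_squared_add3)
  then show ?thesis by simp
qed

text \<open>\<open>mass_matrix\<close> is that of three point masses: its entry
  \<open>m2 * a\<^sup>2 + m3 * (a / 2)\<^sup>2\<close> contains no moment of inertia of the bar
  about its centre.\<close>

lemma kinetic_energy_eq:
  "kinetic_energy m1 m2 m3 l1 l2 a q v =
    1 / 2 * (m1 * ((vel_y 0 0 0 q v)\<^sup>2 + (vel_z 0 0 0 q v)\<^sup>2)
      + m2 * ((vel_y l1 l2 a q v)\<^sup>2 + (vel_z l1 l2 a q v)\<^sup>2)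
      + m3 * ((vel_y l1 0 (a / 2) q v)\<^sup>2 + (vel_z l1 0 (a / 2) q v)\<^sup>2))"
proof -
  define b where "b = a / 2"
  have a: "a = 2 * b" by (simp add: b_def)
  have "kinetic_energy m1 m2 m3 l1 l2 (2 * b) q v = 1 / 2 * (m1 * ((vel_y 0 0 0 q v)\<^sup>2 + (vel_z 0 0 0 q v)\<^sup>2)
      + m2 * ((vel_y l1 l2 (2 * b) q v)\<^sup>2 + (vel_z l1 l2 (2 * b) q v)\<^sup>2)
      + m3 * ((vel_y l1 0 b q v)\<^sup>2 + (vel_z l1 0 b q v)\<^sup>2))"
    unfolding speed_squared kinetic_energy_def mass_matrix_def Let_def inner_vec_def matrix_vector_mult_def
    by (simp add: sum_5) (simp add: power2_eq_square algebra_simps)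
  then show ?thesis by (simp add: a)
qed

lemma potential_energy_eq:
  "potential_energy m1 m2 m3 l1 l2 a g q =
    g * ((m1 + m2 + m3) * q $ 2 + (m2 + m3) * (- l1 * cos (q $ 3)) + m2 * l2 * cos (q $ 4) + (m2 + m3 / 2) * a * sin (q $ 5))"
  unfolding potential_energy_def drone1_pos_def drone2_pos_def bar_pos_def by (simp add: algebra_simps)

lemma partial_deriv_eqI:
  "((\<lambda>s. F (x + s *\<^sub>R axis i 1)) has_real_derivative d) (at 0) \<Longrightarrow> partial_deriv i F x = d"
  unfolding partial_deriv_def by (rule DERIV_imp_deriv)

lemma axis_component_derivative:
  fixes x :: "real^'n"
  shows "((\<lambda>s. (x + s *\<^sub>R axis i 1) $ j) has_real_derivative axis i 1 $ j) (at 0)"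
  by (auto intro!: derivative_eq_intros)

lemma square_sum_derivative:
  assumes "(f has_real_derivative f') (at s)" "(h has_real_derivative h') (at s)"
  shows "((\<lambda>s. (f s)\<^sup>2 + (h s)\<^sup>2) has_real_derivative 2 * (f s * f' + h s * h')) (at s)"
  by (rule DERIV_cong[OF DERIV_add[OF DERIV_power[OF assms(1)] DERIV_power[OF assms(2)]]]) simp

text \<open>Differentiation along an arbitrary path \<open>(Q, V)\<close> serves both kinds of
  partial derivative, one of the two components being constant. The velocity derivatives are assumed
  for all lengths because the three masses share one formula with different lengths.\<close>

lemma partial_deriv_lagrangian:
  fixes Q V :: "real \<Rightarrow> real^5"
  assumes "\<And>l1 l2 a. ((\<lambda>s. vel_y l1 l2 a (Q s) (V s)) has_real_derivative dy l1 l2 a) (at 0)"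
    and "\<And>l1 l2 a. ((\<lambda>s. vel_z l1 l2 a (Q s) (V s)) has_real_derivative dz l1 l2 a) (at 0)"
    and "((\<lambda>s. potential_energy m1 m2 m3 l1 l2 a g (Q s)) has_real_derivative dP) (at 0)"
  shows "((\<lambda>s. lagrangian m1 m2 m3 l1 l2 a g (Q s) (V s)) has_real_derivative
      m1 * (vel_y 0 0 0 (Q 0) (V 0) * dy 0 0 0 + vel_z 0 0 0 (Q 0) (V 0) * dz 0 0 0)
    + m2 * (vel_y l1 l2 a (Q 0) (V 0) * dy l1 l2 a + vel_z l1 l2 a (Q 0) (V 0) * dz l1 l2 a)
    + m3 * (vel_y l1 0 (a / 2) (Q 0) (V 0) * dy l1 0 (a / 2) + vel_z l1 0 (a / 2) (Q 0) (V 0) * dz l1 0 (a / 2)) - dP) (at 0)"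
  unfolding lagrangian_def kinetic_energy_eq
  by (rule DERIV_cong[OF DERIV_diff[OF DERIV_cmult[OF DERIV_add[OF DERIV_add[OF
          DERIV_cmult[OF square_sum_derivative[OF assms(1,2)]] DERIV_cmult[OF square_sum_derivative[OF assms(1,2)]]]
          DERIV_cmult[OF square_sum_derivative[OF assms(1,2)]]]] assms(3)]]) (simp add: algebra_simps)

lemma partial_deriv_lagrangian_velocity:
  "partial_deriv i (lagrangian m1 m2 m3 l1 l2 a g q) v =
      m1 * (vel_y 0 0 0 q v * vel_y 0 0 0 q (axis i 1) + vel_z 0 0 0 q v * vel_z 0 0 0 q (axis i 1))
    + m2 * (vel_y l1 l2 a q v * vel_y l1 l2 a q (axis i 1) + vel_z l1 l2 a q v * vel_z l1 l2 a q (axis i 1))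
    + m3 * (vel_y l1 0 (a / 2) q v * vel_y l1 0 (a / 2) q (axis i 1) + vel_z l1 0 (a / 2) q v * vel_z l1 0 (a / 2) q (axis i 1))"
proof -
  have y: "vel_y l1 l2 a q (v + s *\<^sub>R e) = vel_y l1 l2 a q v + vel_y l1 l2 a q e * s" for l1 l2 a s and e
    by (simp add: vel_y_def algebra_simps)
  have z: "vel_z l1 l2 a q (v + s *\<^sub>R e) = vel_z l1 l2 a q v + vel_z l1 l2 a q e * s" for l1 l2 a s and e
    by (simp add: vel_z_def algebra_simps)
  have lin: "((\<lambda>s. c + d * s) has_real_derivative d) (at 0)" for c d :: real
    by (auto intro!: derivative_eq_intros)
  note * = partial_deriv_lagrangian[of "\<lambda>s. q" "\<lambda>s. v + s *\<^sub>R axis i 1" "\<lambda>l1 l2 a. vel_y l1 l2 a q (axis i 1)"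
      "\<lambda>l1 l2 a. vel_z l1 l2 a q (axis i 1)", unfolded y z, OF lin lin DERIV_const]
  show ?thesis
    by (rule partial_deriv_eqI, rule DERIV_cong[OF *[folded y z]]) simp
qed

text \<open>Translation of the whole system and rotation of the bar: combined with the two force
  balances that define the tensions, their equations yield Newton's equations of the bar centre and
  the moment balance.\<close>

lemma momenta:
  "partial_deriv 1 (lagrangian m1 m2 m3 l1 l2 a g q) v =
    m1 * vel_y 0 0 0 q v + m2 * vel_y l1 l2 a q v + m3 * vel_y l1 0 (a / 2) q v"
  "partial_deriv 2 (lagrangian m1 m2 m3 l1 l2 a g q) v =
    m1 * vel_z 0 0 0 q v + m2 * vel_z l1 l2 a q v + m3 * vel_z l1 0 (a / 2) q v"
  "partial_deriv 5 (lagrangian m1 m2 m3 l1 l2 a g q) v =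
    m2 * a * (cos (q $ 5) * vel_z l1 l2 a q v - sin (q $ 5) * vel_y l1 l2 a q v)
    + m3 * (a / 2) * (cos (q $ 5) * vel_z l1 0 (a / 2) q v - sin (q $ 5) * vel_y l1 0 (a / 2) q v)"
proof -
  have e: "vel_y l1 l2 a q (axis 1 1) = 1" "vel_z l1 l2 a q (axis 1 1) = 0"
    "vel_y l1 l2 a q (axis 2 1) = 0" "vel_z l1 l2 a q (axis 2 1) = 1"
    "vel_y l1 l2 a q (axis 5 1) = - a * sin (q $ 5)" "vel_z l1 l2 a q (axis 5 1) = a * cos (q $ 5)" for l1 l2 a
    by (simp_all add: vel_y_def vel_z_def axis_def)
  show "partial_deriv 1 (lagrangian m1 m2 m3 l1 l2 a g q) v =
    m1 * vel_y 0 0 0 q v + m2 * vel_y l1 l2 a q v + m3 * vel_y l1 0 (a / 2) q v"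
  "partial_deriv 2 (lagrangian m1 m2 m3 l1 l2 a g q) v =
    m1 * vel_z 0 0 0 q v + m2 * vel_z l1 l2 a q v + m3 * vel_z l1 0 (a / 2) q v"
  "partial_deriv 5 (lagrangian m1 m2 m3 l1 l2 a g q) v =
    m2 * a * (cos (q $ 5) * vel_z l1 l2 a q v - sin (q $ 5) * vel_y l1 l2 a q v)
    + m3 * (a / 2) * (cos (q $ 5) * vel_z l1 0 (a / 2) q v - sin (q $ 5) * vel_y l1 0 (a / 2) q v)"
    unfolding partial_deriv_lagrangian_velocity e by (simp_all add: algebra_simps)
qed

lemma partial_deriv_lagrangian_position:
  fixes q v :: "real^5"
  defines "e i \<equiv> axis i 1"
  defines "dy l1 l2 a i \<equiv> - l1 * (sin (q $ 3) * e i $ 3 * v $ 3) - l2 * (sin (q $ 4) * e i $ 4 * v $ 4) - a * (cos (q $ 5) * e i $ 5 * v $ 5)"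
    and "dz l1 l2 a i \<equiv> l1 * (cos (q $ 3) * e i $ 3 * v $ 3) - l2 * (cos (q $ 4) * e i $ 4 * v $ 4) - a * (sin (q $ 5) * e i $ 5 * v $ 5)"
  shows "partial_deriv i (\<lambda>x. lagrangian m1 m2 m3 l1 l2 a g x v) q =
      m1 * (vel_y 0 0 0 q v * dy 0 0 0 i + vel_z 0 0 0 q v * dz 0 0 0 i)
    + m2 * (vel_y l1 l2 a q v * dy l1 l2 a i + vel_z l1 l2 a q v * dz l1 l2 a i)
    + m3 * (vel_y l1 0 (a / 2) q v * dy l1 0 (a / 2) i + vel_z l1 0 (a / 2) q v * dz l1 0 (a / 2) i)
    - g * ((m1 + m2 + m3) * e i $ 2 + (m2 + m3) * (l1 * (sin (q $ 3) * e i $ 3)) - m2 * l2 * (sin (q $ 4) * e i $ 4)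
        + (m2 + m3 / 2) * a * (cos (q $ 5) * e i $ 5))"
proof -
  define Q where "Q s = q + s *\<^sub>R e i" for s
  have d: "((\<lambda>s. Q s $ j) has_real_derivative e i $ j) (at 0)" for j
    unfolding Q_def e_def by (rule axis_component_derivative)
  have Q0: "Q 0 = q" by (simp add: Q_def)
  have y: "((\<lambda>s. vel_y l1 l2 a (Q s) v) has_real_derivative dy l1 l2 a i) (at 0)" for l1 l2 a
    unfolding vel_y_def dy_def by (rule d derivative_eq_intros refl)+ (simp add: Q0)
  have z: "((\<lambda>s. vel_z l1 l2 a (Q s) v) has_real_derivative dz l1 l2 a i) (at 0)" for l1 l2 a
    unfolding vel_z_def dz_def by (rule d derivative_eq_intros refl)+ (simp add: Q0)
  have P: "((\<lambda>s. potential_energy m1 m2 m3 l1 l2 a g (Q s)) has_real_derivative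
      g * ((m1 + m2 + m3) * e i $ 2 + (m2 + m3) * (l1 * (sin (q $ 3) * e i $ 3)) - m2 * l2 * (sin (q $ 4) * e i $ 4)
        + (m2 + m3 / 2) * a * (cos (q $ 5) * e i $ 5))) (at 0)"
    unfolding potential_energy_eq by (rule d derivative_eq_intros refl)+ (simp add: Q0)
  from partial_deriv_lagrangian[of Q "\<lambda>s. v", OF y z P] show ?thesis
    unfolding Q0 unfolding Q_def e_def by (rule partial_deriv_eqI)
qed

lemma position_forces:
  "partial_deriv 1 (\<lambda>x. lagrangian m1 m2 m3 l1 l2 a g x v) q = 0"
  "partial_deriv 2 (\<lambda>x. lagrangian m1 m2 m3 l1 l2 a g x v) q = - g * (m1 + m2 + m3)"
  "partial_deriv 5 (\<lambda>x. lagrangian m1 m2 m3 l1 l2 a g x v) q =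
    - m2 * a * v $ 5 * (sin (q $ 5) * vel_z l1 l2 a q v + cos (q $ 5) * vel_y l1 l2 a q v)
    - m3 * (a / 2) * v $ 5 * (sin (q $ 5) * vel_z l1 0 (a / 2) q v + cos (q $ 5) * vel_y l1 0 (a / 2) q v)
    - g * (m2 + m3 / 2) * a * cos (q $ 5)"
proof -
  have e: "axis (1::5) (1::real) $ 2 = 0" "axis (1::5) (1::real) $ 3 = 0" "axis (1::5) (1::real) $ 4 = 0" "axis (1::5) (1::real) $ 5 = 0"
    "axis (2::5) (1::real) $ 2 = 1" "axis (2::5) (1::real) $ 3 = 0" "axis (2::5) (1::real) $ 4 = 0" "axis (2::5) (1::real) $ 5 = 0"
    "axis (5::5) (1::real) $ 2 = 0" "axis (5::5) (1::real) $ 3 = 0" "axis (5::5) (1::real) $ 4 = 0" "axis (5::5) (1::real) $ 5 = 1"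
    by (simp_all add: axis_def)
  show "partial_deriv 1 (\<lambda>x. lagrangian m1 m2 m3 l1 l2 a g x v) q = 0"
    "partial_deriv 2 (\<lambda>x. lagrangian m1 m2 m3 l1 l2 a g x v) q = - g * (m1 + m2 + m3)"
    unfolding partial_deriv_lagrangian_position e by simp_all
  show "partial_deriv 5 (\<lambda>x. lagrangian m1 m2 m3 l1 l2 a g x v) q =
    - m2 * a * v $ 5 * (sin (q $ 5) * vel_z l1 l2 a q v + cos (q $ 5) * vel_y l1 l2 a q v)
    - m3 * (a / 2) * v $ 5 * (sin (q $ 5) * vel_z l1 0 (a / 2) q v + cos (q $ 5) * vel_y l1 0 (a / 2) q v)
    - g * (m2 + m3 / 2) * a * cos (q $ 5)"
    unfolding partial_deriv_lagrangian_position e by (simp add: algebra_simps)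
qed

section \<open>Two-sided time derivatives of the motion\<close>

lemma time_deriv_eqI:
  assumes "t > 0" "(x has_vector_derivative d) (at t)"
  shows "time_deriv x t = d"
proof -
  have "at t within {0..} = at t" using assms(1) by (intro at_within_interior) simp
  then show ?thesis unfolding time_deriv_def using vector_derivative_at[OF assms(2)] by simp
qed

lemma time_deriv_eqI2:
  assumes t: "t > 0" and x: "\<And>s. s > 0 \<Longrightarrow> (x has_vector_derivative v s) (at s)" and v: "(v has_vector_derivative c) (at t)"
  shows "time_deriv (time_deriv x) t = c"
proof (rule time_deriv_eqI[OF t])
  show "(time_deriv x has_vector_derivative c) (at t)"
    by (rule has_vector_derivative_transform_within_open[OF v, of "{0<..}"]) (use t time_deriv_eqI[OF _ x] in auto)
qed

lemma twice_differentiableD: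
  assumes "twice_differentiable x" "t > 0"
  shows "(x has_vector_derivative time_deriv x t) (at t)"
    "(time_deriv x has_vector_derivative time_deriv (time_deriv x) t) (at t)"
proof -
  have w: "at t within {0..} = at t" using assms(2) by (intro at_within_interior) simp
  have *: "(f has_vector_derivative time_deriv f t) (at t)" if "f differentiable_on {0..}" for f :: "real \<Rightarrow> 'a"
    using that assms(2) unfolding time_deriv_def differentiable_on_def w
    by (metis w atLeast_iff less_imp_le vector_derivative_works)
  show "(x has_vector_derivative time_deriv x t) (at t)"
    "(time_deriv x has_vector_derivative time_deriv (time_deriv x) t) (at t)"
    using assms(1) * unfolding twice_differentiable_def by blast+
qed

lemma component_derivative:
  fixes x :: "real \<Rightarrow> real^'n"
  assumes "(x has_vector_derivative d) (at t)"
  shows "((\<lambda>s. x s $ i) has_real_derivative d $ i) (at t)"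
  using bounded_linear.has_vector_derivative[OF bounded_linear_vec_nth assms]
  by (simp add: has_real_derivative_iff_has_vector_derivative)

lemma drone2_pos_derivatives:
  assumes q: "\<And>i. ((\<lambda>s. q s $ i) has_real_derivative v $ i) (at t)"
  shows "((\<lambda>s. fst (drone2_pos l1 l2 a (q s))) has_real_derivative vel_y l1 l2 a (q t) v) (at t)"
    "((\<lambda>s. snd (drone2_pos l1 l2 a (q s))) has_real_derivative vel_z l1 l2 a (q t) v) (at t)"
  unfolding drone2_pos_def fst_conv snd_conv
  subgoal by (rule q derivative_eq_intros refl)+ (simp add: vel_y_def)
  subgoal by (rule q derivative_eq_intros refl)+ (simp add: vel_z_def)
  done

lemma velocity_derivatives:
  assumes q: "\<And>i. ((\<lambda>s. q s $ i) has_real_derivative v t $ i) (at t)"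
    and v: "\<And>i. ((\<lambda>s. v s $ i) has_real_derivative c $ i) (at t)"
  shows "((\<lambda>s. vel_y l1 l2 a (q s) (v s)) has_real_derivative acc_y l1 l2 a (q t) (v t) c) (at t)"
    "((\<lambda>s. vel_z l1 l2 a (q s) (v s)) has_real_derivative acc_z l1 l2 a (q t) (v t) c) (at t)"
  unfolding vel_y_def vel_z_def
  subgoal by (rule q v derivative_eq_intros refl)+ (simp add: acc_y_def power2_eq_square algebra_simps)
  subgoal by (rule q v derivative_eq_intros refl)+ (simp add: acc_z_def power2_eq_square algebra_simps)
  done

subsection \<open>The closed loop\<close>

text \<open>
  \<open>x\<^sub>i\<close>, \<open>h\<^sub>i\<close> are horizontal and vertical deviations from the desired positions, where index 3 is the bar
  centre with desired position half way between the drones but at their height \<open>z1d\<close>.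
  Time starts at \<open>t0 > 0\<close> so that all derivatives are two-sided.
\<close>

locale drone_bar_motion =
  fixes m1 m2 m3 g a l kp1 kp2 kp3 kp4 kd1 kd2 kd3 kd4 ka1 ka2 \<sigma> \<rho> t0 :: real
    and x1 h1 x2 h2 x3 h3 u1 w1 u2 w2 u3 w3 :: "real \<Rightarrow> real"
    and \<theta>1 \<theta>2 \<theta>3 \<omega>1 \<omega>2 \<omega>3 \<alpha>3 T1 T2 :: "real \<Rightarrow> real"
  assumes pos: "m1 > 0" "m2 > 0" "m3 > 0" "g > 0" "a > 0" "l > 0"
      "kp1 > 0" "kp2 > 0" "kp3 > 0" "kp4 > 0" "kd1 > 0" "kd2 > 0" "kd3 > 0" "kd4 > 0"
      "ka1 > 0" "ka2 > 0" "\<sigma> > 0" "\<rho> > 0"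
    and geometry:
      "\<And>t. t \<ge> t0 \<Longrightarrow> x3 t - x1 t = l * sin (\<theta>1 t) + a / 2 * (cos (\<theta>3 t) - 1)"
      "\<And>t. t \<ge> t0 \<Longrightarrow> h3 t - h1 t = - l * cos (\<theta>1 t) + a / 2 * sin (\<theta>3 t)"
      "\<And>t. t \<ge> t0 \<Longrightarrow> x2 t - x3 t = l * sin (\<theta>2 t) + a / 2 * (cos (\<theta>3 t) - 1)"
      "\<And>t. t \<ge> t0 \<Longrightarrow> h2 t - h3 t = l * cos (\<theta>2 t) + a / 2 * sin (\<theta>3 t)"
    and velocity:
      "\<And>t. t \<ge> t0 \<Longrightarrow> u3 t - u1 t = l * cos (\<theta>1 t) * \<omega>1 t - a / 2 * sin (\<theta>3 t) * \<omega>3 t"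
      "\<And>t. t \<ge> t0 \<Longrightarrow> w3 t - w1 t = l * sin (\<theta>1 t) * \<omega>1 t + a / 2 * cos (\<theta>3 t) * \<omega>3 t"
      "\<And>t. t \<ge> t0 \<Longrightarrow> u2 t - u3 t = l * cos (\<theta>2 t) * \<omega>2 t - a / 2 * sin (\<theta>3 t) * \<omega>3 t"
      "\<And>t. t \<ge> t0 \<Longrightarrow> w2 t - w3 t = - l * sin (\<theta>2 t) * \<omega>2 t + a / 2 * cos (\<theta>3 t) * \<omega>3 t"
    and deriv_pos:
      "\<And>t. t \<ge> t0 \<Longrightarrow> (x1 has_real_derivative u1 t) (at t)"
      "\<And>t. t \<ge> t0 \<Longrightarrow> (h1 has_real_derivative w1 t) (at t)"
      "\<And>t. t \<ge> t0 \<Longrightarrow> (x2 has_real_derivative u2 t) (at t)"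
      "\<And>t. t \<ge> t0 \<Longrightarrow> (h2 has_real_derivative w2 t) (at t)"
      "\<And>t. t \<ge> t0 \<Longrightarrow> (x3 has_real_derivative u3 t) (at t)"
      "\<And>t. t \<ge> t0 \<Longrightarrow> (h3 has_real_derivative w3 t) (at t)"
    and deriv_angle:
      "\<And>t. t \<ge> t0 \<Longrightarrow> (\<theta>1 has_real_derivative \<omega>1 t) (at t)"
      "\<And>t. t \<ge> t0 \<Longrightarrow> (\<theta>2 has_real_derivative \<omega>2 t) (at t)"
      "\<And>t. t \<ge> t0 \<Longrightarrow> (\<theta>3 has_real_derivative \<omega>3 t) (at t)"
      "\<And>t. t \<ge> t0 \<Longrightarrow> (\<omega>3 has_real_derivative \<alpha>3 t) (at t)"
    and newton1:
      "\<And>t. t \<ge> t0 \<Longrightarrow> (u1 has_real_derivative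
         (T1 t * sin (\<theta>1 t) - kp1 * x1 t - \<sigma> * \<rho> * (x1 t - x2 t) / (\<rho> - (x1 t - x2 t)\<^sup>2)\<^sup>2
          - (kd1 + ka1 * ((\<omega>1 t)\<^sup>2 + (\<omega>2 t)\<^sup>2 + (\<omega>3 t)\<^sup>2)) * u1 t) / m1) (at t)"
      "\<And>t. t \<ge> t0 \<Longrightarrow> (w1 has_real_derivative
         (m3 * g / 2 - kp3 * h1 t - kd3 * w1 t - T1 t * cos (\<theta>1 t)) / m1) (at t)"
    and newton2:
      "\<And>t. t \<ge> t0 \<Longrightarrow> (u2 has_real_derivative
         (- T2 t * sin (\<theta>2 t) - kp2 * x2 t + \<sigma> * \<rho> * (x1 t - x2 t) / (\<rho> - (x1 t - x2 t)\<^sup>2)\<^sup>2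
          - (kd2 + ka2 * ((\<omega>1 t)\<^sup>2 + (\<omega>2 t)\<^sup>2 + (\<omega>3 t)\<^sup>2)) * u2 t) / m2) (at t)"
      "\<And>t. t \<ge> t0 \<Longrightarrow> (w2 has_real_derivative
         (m3 * g / 2 - kp4 * h2 t - kd4 * w2 t - T2 t * cos (\<theta>2 t)) / m2) (at t)"
    and newton3:
      "\<And>t. t \<ge> t0 \<Longrightarrow> (u3 has_real_derivative
         (T2 t * sin (\<theta>2 t) - T1 t * sin (\<theta>1 t)) / m3) (at t)"
      "\<And>t. t \<ge> t0 \<Longrightarrow> (w3 has_real_derivative
         (T1 t * cos (\<theta>1 t) + T2 t * cos (\<theta>2 t)) / m3 - g) (at t)"
    and moment: "\<And>t. t \<ge> t0 \<Longrightarrow> T1 t * cos (\<theta>1 t - \<theta>3 t) = T2 t * cos (\<theta>2 t + \<theta>3 t)"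
    and tension: "\<And>t. t \<ge> t0 \<Longrightarrow> T1 t > 0" "\<And>t. t \<ge> t0 \<Longrightarrow> T2 t > 0"
    and under: "\<And>t. t \<ge> t0 \<Longrightarrow> h3 t < h1 t" "\<And>t. t \<ge> t0 \<Longrightarrow> h3 t < h2 t"
    and angle_range:
      "\<And>t. t \<ge> t0 \<Longrightarrow> \<bar>\<theta>1 t\<bar> < pi / 2" "\<And>t. t \<ge> t0 \<Longrightarrow> \<bar>\<theta>2 t\<bar> < pi / 2"
      "\<And>t. t \<ge> t0 \<Longrightarrow> \<bar>\<theta>3 t\<bar> < pi / 2"
      "\<And>t. t \<ge> t0 \<Longrightarrow> \<bar>\<theta>1 t - \<theta>3 t\<bar> < pi / 2" "\<And>t. t \<ge> t0 \<Longrightarrow> \<bar>\<theta>2 t + \<theta>3 t\<bar> < pi / 2"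
    and initial: "(x1 t0 - x2 t0)\<^sup>2 < \<rho>"
begin

abbreviation "S1 t \<equiv> sin (\<theta>1 t)"
abbreviation "C1 t \<equiv> cos (\<theta>1 t)"
abbreviation "S2 t \<equiv> sin (\<theta>2 t)"
abbreviation "C2 t \<equiv> cos (\<theta>2 t)"
abbreviation "S3 t \<equiv> sin (\<theta>3 t)"
abbreviation "C3 t \<equiv> cos (\<theta>3 t)"
abbreviation "c1 t \<equiv> cos (\<theta>1 t - \<theta>3 t)"
abbreviation "s1 t \<equiv> sin (\<theta>1 t - \<theta>3 t)"
abbreviation "c2 t \<equiv> cos (\<theta>2 t + \<theta>3 t)"
abbreviation "s2 t \<equiv> sin (\<theta>2 t + \<theta>3 t)"
abbreviation "ey t \<equiv> x1 t - x2 t"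
abbreviation "\<Theta> t \<equiv> (\<omega>1 t)\<^sup>2 + (\<omega>2 t)\<^sup>2 + (\<omega>3 t)\<^sup>2"

text \<open>\<open>b1\<close> and \<open>b2\<close> are the partial derivatives of the control
  potential \<open>pot_c\<close> in \<open>x1\<close> and \<open>x2\<close>; \<open>A1\<close> and
  \<open>A2\<close> are the vertical thrusts without damping, less the drone's own weight.\<close>

definition "b1 t = kp1 * x1 t + \<sigma> * \<rho> * ey t / (\<rho> - (ey t)\<^sup>2)\<^sup>2"
definition "b2 t = kp2 * x2 t - \<sigma> * \<rho> * ey t / (\<rho> - (ey t)\<^sup>2)\<^sup>2"
definition "A1 t = m3 * g / 2 - kp3 * h1 t"
definition "A2 t = m3 * g / 2 - kp4 * h2 t"

lemma du1: "t \<ge> t0 \<Longrightarrow> (u1 has_real_derivative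
    (T1 t * S1 t - b1 t - (kd1 + ka1 * \<Theta> t) * u1 t) / m1) (at t)"
  and dw1: "t \<ge> t0 \<Longrightarrow> (w1 has_real_derivative (A1 t - kd3 * w1 t - T1 t * C1 t) / m1) (at t)"
  and du2: "t \<ge> t0 \<Longrightarrow> (u2 has_real_derivative
    (- T2 t * S2 t - b2 t - (kd2 + ka2 * \<Theta> t) * u2 t) / m2) (at t)"
  and dw2: "t \<ge> t0 \<Longrightarrow> (w2 has_real_derivative (A2 t - kd4 * w2 t - T2 t * C2 t) / m2) (at t)"
  using newton1[of t] newton2[of t] by (simp_all add: b1_def b2_def A1_def A2_def algebra_simps)

lemmas du3 = newton3(1) and dw3 = newton3(2)

lemma trig_pos:
  assumes "t \<ge> t0"
  shows "C1 t > 0" "C2 t > 0" "C3 t > 0" "c1 t > 0" "c2 t > 0"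
  using angle_range[OF assms] by (intro cos_gt_zero_pi; linarith)+

text \<open>The mirror image of a motion exchanges the roles of the two drones.\<close>

lemma swap:
  "drone_bar_motion m2 m1 m3 g a l kp2 kp1 kp4 kp3 kd2 kd1 kd4 kd3 ka2 ka1 \<sigma> \<rho> t0
     (\<lambda>t. - x2 t) h2 (\<lambda>t. - x1 t) h1 (\<lambda>t. - x3 t) h3
     (\<lambda>t. - u2 t) w2 (\<lambda>t. - u1 t) w1 (\<lambda>t. - u3 t) w3
     \<theta>2 \<theta>1 (\<lambda>t. - \<theta>3 t) \<omega>2 \<omega>1 (\<lambda>t. - \<omega>3 t) (\<lambda>t. - \<alpha>3 t) T2 T1"
proof (unfold_locales, goal_cases)
  case (37 t)
  show ?case
    by (rule DERIV_cong[OF DERIV_minus[OF newton2(1)[OF 37]]])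
      (simp add: minus_divide_left power2_commute algebra_simps)
next
  case (39 t)
  show ?case
    by (rule DERIV_cong[OF DERIV_minus[OF newton1(1)[OF 39]]])
      (simp add: minus_divide_left power2_commute algebra_simps)
next
  case (41 t)
  show ?case
    by (rule DERIV_cong[OF DERIV_minus[OF newton3(1)[OF 41]]])
      (simp add: minus_divide_left)
next
  case (42 t)
  show ?case using newton3(2)[OF 42] by (simp add: add.commute)
next
  case (19 t) then show ?case using geometry(3)[of t] by simp
next
  case (20 t) then show ?case using geometry(4)[of t] by simp
next
  case (21 t) then show ?case using geometry(1)[of t] by simp
next
  case (22 t) then show ?case using geometry(2)[of t] by simp
next
  case (23 t) then show ?case using velocity(3)[of t] by simp
next
  case (24 t) then show ?case using velocity(4)[of t] by simp
next
  case (25 t) then show ?case using velocity(1)[of t] by simp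
next
  case (26 t) then show ?case using velocity(2)[of t] by simp
next
  case (27 t) then show ?case by (rule DERIV_minus[OF deriv_pos(3)])
next
  case (28 t) then show ?case by (rule deriv_pos)
next
  case (29 t) then show ?case by (rule DERIV_minus[OF deriv_pos(1)])
next
  case (30 t) then show ?case by (rule deriv_pos)
next
  case (31 t) then show ?case by (rule DERIV_minus[OF deriv_pos(5)])
next
  case (32 t) then show ?case by (rule deriv_pos)
next
  case (33 t) then show ?case by (rule deriv_angle)
next
  case (34 t) then show ?case by (rule deriv_angle)
next
  case (35 t) then show ?case by (rule DERIV_minus[OF deriv_angle(3)])
next
  case (36 t) then show ?case by (rule DERIV_minus[OF deriv_angle(4)])
next
  case (38 t) then show ?case by (rule newton2(2))
next
  case (40 t) then show ?case by (rule newton1(2))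
next
  case (43 t) then show ?case using moment[of t] by simp
next
  case 53 then show ?case using initial by simp
qed (use pos tension under angle_range in simp_all)

text \<open>A taut cable acts as a rigid link: along it only the rotation of the half bar
  contributes to the relative velocity, across it also the swing of the cable. The cable directions
  are \<open>(S1, - C1)\<close> and \<open>(S2, C2)\<close>.\<close>

lemma kinematics:
  assumes "t \<ge> t0"
  shows kin1: "S1 t * (u1 t - u3 t) - C1 t * (w1 t - w3 t) = a / 2 * \<omega>3 t * c1 t"
    and kin2: "S2 t * (u2 t - u3 t) + C2 t * (w2 t - w3 t) = a / 2 * \<omega>3 t * c2 t"
    and kin3: "C1 t * (u1 t - u3 t) + S1 t * (w1 t - w3 t) = - (l * \<omega>1 t + a / 2 * s1 t * \<omega>3 t)"
    and kin4: "C2 t * (u2 t - u3 t) - S2 t * (w2 t - w3 t) = l * \<omega>2 t - a / 2 * s2 t * \<omega>3 t"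
proof -
  have sq: "C1 t * C1 t = 1 - S1 t * S1 t" "C2 t * C2 t = 1 - S2 t * S2 t"
    using sin_cos_squared_add3[of "\<theta>1 t"] sin_cos_squared_add3[of "\<theta>2 t"] by linarith+
  have v: "u1 t - u3 t = - (l * C1 t * \<omega>1 t - a / 2 * S3 t * \<omega>3 t)"
    "w1 t - w3 t = - (l * S1 t * \<omega>1 t + a / 2 * C3 t * \<omega>3 t)"
    using velocity(1,2)[OF assms] by linarith+
  show "S1 t * (u1 t - u3 t) - C1 t * (w1 t - w3 t) = a / 2 * \<omega>3 t * c1 t"
    unfolding v cos_diff by (simp add: algebra_simps)
  show "S2 t * (u2 t - u3 t) + C2 t * (w2 t - w3 t) = a / 2 * \<omega>3 t * c2 t"
    unfolding velocity(3,4)[OF assms] cos_add by (simp add: algebra_simps)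
  have "C1 t * (u1 t - u3 t) + S1 t * (w1 t - w3 t)
      = - (l * \<omega>1 t * (C1 t * C1 t) + l * \<omega>1 t * (S1 t * S1 t) + a / 2 * s1 t * \<omega>3 t)"
    unfolding v sin_diff by (simp add: algebra_simps)
  then show "C1 t * (u1 t - u3 t) + S1 t * (w1 t - w3 t) = - (l * \<omega>1 t + a / 2 * s1 t * \<omega>3 t)"
    unfolding sq by (simp add: algebra_simps)
  have "C2 t * (u2 t - u3 t) - S2 t * (w2 t - w3 t)
      = l * \<omega>2 t * (C2 t * C2 t) + l * \<omega>2 t * (S2 t * S2 t) - a / 2 * s2 t * \<omega>3 t"
    unfolding velocity(3,4)[OF assms] sin_add by (simp add: algebra_simps)
  then show "C2 t * (u2 t - u3 t) - S2 t * (w2 t - w3 t) = l * \<omega>2 t - a / 2 * s2 t * \<omega>3 t"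
    unfolding sq by (simp add: algebra_simps)
qed

text \<open>
  The vertical thrusts contain \<open>m3 * g / 2\<close> per drone beyond the drones' own weights, hence the
  form of the gravitational part \<open>pot_g\<close> of the energy.
\<close>

definition "kin_h t = (m1 * (u1 t)\<^sup>2 + m2 * (u2 t)\<^sup>2 + m3 * (u3 t)\<^sup>2) / 2"
definition "kin_v t = (m1 * (w1 t)\<^sup>2 + m2 * (w2 t)\<^sup>2 + m3 * (w3 t)\<^sup>2) / 2"
definition "pot_c t = (kp1 * (x1 t)\<^sup>2 + kp2 * (x2 t)\<^sup>2 + kp3 * (h1 t)\<^sup>2 + kp4 * (h2 t)\<^sup>2) / 2
    + \<sigma> / 2 * ((ey t)\<^sup>2 / (\<rho> - (ey t)\<^sup>2))"
definition "pot_g t = m3 * g * (h3 t - (h1 t + h2 t) / 2 + l)"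
definition "V t = kin_h t + kin_v t + pot_c t + pot_g t"
definition "dis t = (kd1 + ka1 * \<Theta> t) * (u1 t)\<^sup>2 + (kd2 + ka2 * \<Theta> t) * (u2 t)\<^sup>2
    + kd3 * (w1 t)\<^sup>2 + kd4 * (w2 t)\<^sup>2"

text \<open>The inclination of the bar cancels when the heights of the two drones are averaged, so
  only the swing of the cables stores gravitational energy, and this energy is nonnegative.\<close>

lemma pot_g_eq: "t \<ge> t0 \<Longrightarrow> pot_g t = m3 * g * l * (2 - C1 t - C2 t) / 2"
proof -
  assume "t \<ge> t0"
  then have "h3 t - (h1 t + h2 t) / 2 + l = l * (2 - C1 t - C2 t) / 2"
    using geometry(2,4)[of t] by (simp add: field_simps)
  then show ?thesis by (simp add: pot_g_def)
qed

section \<open>Energy balance\<close>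

lemma dis_nonneg: "dis t \<ge> 0"
  using pos by (auto simp: dis_def intro!: add_nonneg_nonneg mult_nonneg_nonneg)

lemma deriv_pot_c:
  assumes t: "t \<ge> t0" and r: "(ey t)\<^sup>2 < \<rho>"
  shows "(pot_c has_real_derivative
    b1 t * u1 t + b2 t * u2 t + kp3 * h1 t * w1 t + kp4 * h2 t * w2 t) (at t)"
proof -
  have bar: "((\<lambda>y. \<sigma> / 2 * (y\<^sup>2 / (\<rho> - y\<^sup>2))) has_real_derivative \<sigma> * \<rho> * y / (\<rho> - y\<^sup>2)\<^sup>2) (at y)"
    if "y\<^sup>2 < \<rho>" for y
  proof -
    have nz: "\<rho> - y\<^sup>2 \<noteq> 0" using that by simp
    show ?thesis
      by (rule derivative_eq_intros refl nz)+
        (simp add: power2_eq_square field_simps)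
  qed
  have dey: "(ey has_real_derivative u1 t - u2 t) (at t)"
    by (rule DERIV_diff[OF deriv_pos(1)[OF t] deriv_pos(3)[OF t]])
  have 1: "((\<lambda>t. \<sigma> / 2 * ((ey t)\<^sup>2 / (\<rho> - (ey t)\<^sup>2))) has_real_derivative
      \<sigma> * \<rho> * ey t / (\<rho> - (ey t)\<^sup>2)\<^sup>2 * (u1 t - u2 t)) (at t)"
    using DERIV_chain2[OF bar[OF r] dey] by simp
  have 2: "((\<lambda>t. (kp1 * (x1 t)\<^sup>2 + kp2 * (x2 t)\<^sup>2 + kp3 * (h1 t)\<^sup>2 + kp4 * (h2 t)\<^sup>2) / 2)
      has_real_derivative kp1 * x1 t * u1 t + kp2 * x2 t * u2 t + kp3 * h1 t * w1 t + kp4 * h2 t * w2 t) (at t)"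
    by (rule derivative_eq_intros deriv_pos[OF t] refl)+ (auto simp: field_simps)
  define q where "q = \<sigma> * \<rho> * ey t / (\<rho> - (ey t)\<^sup>2)\<^sup>2"
  show ?thesis
    unfolding pot_c_def b1_def b2_def q_def[symmetric]
    by (rule DERIV_cong[OF DERIV_add[OF 2 1[folded q_def]]]) (simp add: algebra_simps)
qed

lemma deriv_V:
  assumes t: "t \<ge> t0" and r: "(ey t)\<^sup>2 < \<rho>"
  shows "(V has_real_derivative - dis t) (at t)"
proof -
  have m: "m1 \<noteq> 0" "m2 \<noteq> 0" "m3 \<noteq> 0" using pos by auto
  have h: "(kin_h has_real_derivative
      u1 t * (T1 t * S1 t - b1 t - (kd1 + ka1 * \<Theta> t) * u1 t)
    + u2 t * (- T2 t * S2 t - b2 t - (kd2 + ka2 * \<Theta> t) * u2 t)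
    + u3 t * (T2 t * S2 t - T1 t * S1 t)) (at t)"
    unfolding kin_h_def
    by (rule derivative_eq_intros du1[OF t] du2[OF t] du3[OF t] refl)+ (use m in \<open>auto simp: field_simps\<close>)
  have v: "(kin_v has_real_derivative
      w1 t * (A1 t - kd3 * w1 t - T1 t * C1 t) + w2 t * (A2 t - kd4 * w2 t - T2 t * C2 t)
    + w3 t * (T1 t * C1 t + T2 t * C2 t - m3 * g)) (at t)"
    unfolding kin_v_def
    by (rule derivative_eq_intros dw1[OF t] dw2[OF t] dw3[OF t] refl)+ (use m in \<open>auto simp: field_simps\<close>)
  have p: "(pot_g has_real_derivative m3 * g * (w3 t - (w1 t + w2 t) / 2)) (at t)"
    unfolding pot_g_def
    by (rule DERIV_cong[OF DERIV_cmult[OF DERIV_add[OF DERIV_diff[OF deriv_pos(6)[OF t]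
      DERIV_cdivide[OF DERIV_add[OF deriv_pos(2,4)[OF t]]]] DERIV_const]]]) simp
  \<comment> \<open>The tensions do no net work: their power is \<open>a / 2 * \<omega>3 t\<close>
    times \<open>T1 t * c1 t - T2 t * c2 t\<close>, which vanishes by the moment balance.\<close>
  have work: "T1 t * (S1 t * (u1 t - u3 t) - C1 t * (w1 t - w3 t))
      = T2 t * (S2 t * (u2 t - u3 t) + C2 t * (w2 t - w3 t))"
    unfolding kin1[OF t] kin2[OF t] using moment[OF t] by (simp add: algebra_simps)
  show ?thesis
    unfolding V_def
    by (rule DERIV_cong[OF DERIV_add[OF DERIV_add[OF DERIV_add[OF h v] deriv_pot_c[OF t r]] p]])
      (use work in \<open>simp add: dis_def A1_def A2_def power2_eq_square algebra_simps add_divide_distrib\<close>)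
qed

section \<open>Confinement by the barrier and a priori bounds\<close>

lemma V_ge:
  assumes t: "t \<ge> t0" and r: "(ey t)\<^sup>2 < \<rho>"
  shows "kin_h t \<ge> 0" "kin_v t \<ge> 0" "pot_g t \<ge> 0"
    "\<sigma> / 2 * ((ey t)\<^sup>2 / (\<rho> - (ey t)\<^sup>2)) \<le> pot_c t" "0 \<le> \<sigma> / 2 * ((ey t)\<^sup>2 / (\<rho> - (ey t)\<^sup>2))"
proof -
  show "kin_h t \<ge> 0" "kin_v t \<ge> 0" using pos by (auto simp: kin_h_def kin_v_def)
  have "2 - C1 t - C2 t \<ge> 0" using cos_le_one[of "\<theta>1 t"] cos_le_one[of "\<theta>2 t"] by linarith
  then show "pot_g t \<ge> 0" unfolding pot_g_eq[OF t] using pos by auto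
  show "\<sigma> / 2 * ((ey t)\<^sup>2 / (\<rho> - (ey t)\<^sup>2)) \<le> pot_c t" using pos by (simp add: pot_c_def)
  show "0 \<le> \<sigma> / 2 * ((ey t)\<^sup>2 / (\<rho> - (ey t)\<^sup>2))" using pos r by simp
qed

text \<open>The bound \<open>V t0\<close> on the barrier term
  \<open>\<sigma> / 2 * (e / (\<rho> - e))\<close>, solved for the gap \<open>\<rho> - e\<close>,
  where \<open>e\<close> stands for the square of \<open>ey\<close>.\<close>

definition "\<delta> = \<rho> * \<sigma> / (\<sigma> + 2 * V t0)"

lemma V0_nonneg: "V t0 \<ge> 0"
  using V_ge[OF order_refl initial] by (simp add: V_def)

lemma \<delta>_pos: "\<delta> > 0"
  using V0_nonneg pos by (auto simp: \<delta>_def intro!: divide_pos_pos add_pos_nonneg)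

lemma barrier_gap:
  assumes t: "t \<ge> t0" and r: "(ey t)\<^sup>2 < \<rho>" and V: "V t \<le> V t0"
  shows "\<rho> - (ey t)\<^sup>2 \<ge> \<delta>"
proof -
  have "\<sigma> / 2 * ((ey t)\<^sup>2 / (\<rho> - (ey t)\<^sup>2)) \<le> V t0"
    using V_ge[OF t r] V by (simp add: V_def)
  then have "\<sigma> * (ey t)\<^sup>2 \<le> 2 * V t0 * (\<rho> - (ey t)\<^sup>2)"
    using r by (simp add: field_simps)
  then have "\<rho> * \<sigma> \<le> (\<rho> - (ey t)\<^sup>2) * (\<sigma> + 2 * V t0)"
    by (simp add: algebra_simps)
  then show ?thesis
    using V0_nonneg pos by (simp add: \<delta>_def pos_divide_le_eq add_pos_nonneg)
qed

lemma V_antimono_if: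
  assumes "t0 \<le> s" "s \<le> t" "\<And>r. s \<le> r \<Longrightarrow> r \<le> t \<Longrightarrow> (ey r)\<^sup>2 < \<rho>"
  shows "V t \<le> V s"
proof (rule DERIV_nonpos_imp_nonincreasing[OF assms(2)])
  fix r assume "s \<le> r" "r \<le> t"
  then show "\<exists>y. (V has_real_derivative y) (at r) \<and> y \<le> 0"
    using deriv_V[of r] assms dis_nonneg[of r] by force
qed

text \<open>Monotonicity of \<open>V\<close> is available only as long as the barrier has not been
  reached. At a first time \<open>s\<close> of reaching it, the gap \<delta> holds on the whole
  interval before \<open>s\<close>, hence by continuity also at \<open>s\<close>.\<close>

lemma barrier:
  assumes t: "t \<ge> t0"
  shows "(ey t)\<^sup>2 < \<rho>"
proof (rule ccontr)
  assume "\<not> (ey t)\<^sup>2 < \<rho>"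
  define B where "B = {s \<in> {t0..t}. \<rho> \<le> (ey s)\<^sup>2}"
  have cont: "continuous_on {t0..t} (\<lambda>s. (ey s)\<^sup>2)"
  proof (rule continuous_at_imp_continuous_on, rule ballI)
    fix s assume "s \<in> {t0..t}"
    then have "isCont x1 s" "isCont x2 s" using deriv_pos(1,3)[of s] DERIV_isCont by auto
    then show "isCont (\<lambda>s. (ey s)\<^sup>2) s" by (intro continuous_intros)
  qed
  have "closed ({t0..t} \<inter> (\<lambda>s. (ey s)\<^sup>2) -` {\<rho>..})"
    by (rule continuous_closed_preimage[OF cont]) auto
  moreover have "B = {t0..t} \<inter> (\<lambda>s. (ey s)\<^sup>2) -` {\<rho>..}" by (auto simp: B_def)
  ultimately have "compact B"
    unfolding compact_eq_bounded_closed by (auto intro: bounded_subset[OF bounded_closed_interval])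
  moreover have "t \<in> B" using \<open>\<not> (ey t)\<^sup>2 < \<rho>\<close> t by (auto simp: B_def)
  ultimately obtain s where s: "s \<in> B" "\<And>r. r \<in> B \<Longrightarrow> s \<le> r"
    using compact_attains_inf[of B] by blast
  have less: "(ey r)\<^sup>2 < \<rho>" if "t0 \<le> r" "r < s" for r
    using s(2)[of r] s(1) that by (force simp: B_def not_le)
  have "s \<noteq> t0" using s(1) initial by (auto simp: B_def)
  then have "t0 < s" using s(1) by (auto simp: B_def)
  have gap: "(ey r)\<^sup>2 \<le> \<rho> - \<delta>" if "t0 \<le> r" "r < s" for r
    using barrier_gap[OF that(1) less[OF that]] V_antimono_if[of t0 r] less that by force
  have "isCont (\<lambda>s. (ey s)\<^sup>2) s"
  proof -
    have "isCont x1 s" "isCont x2 s" using deriv_pos(1,3)[of s] DERIV_isCont \<open>t0 < s\<close> by auto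
    then show ?thesis by (intro continuous_intros)
  qed
  then have "((\<lambda>s. (ey s)\<^sup>2) \<longlongrightarrow> (ey s)\<^sup>2) (at_left s)"
    using isCont_def filterlim_at_split by blast
  moreover have "\<forall>\<^sub>F r in at_left s. (ey r)\<^sup>2 \<le> \<rho> - \<delta>"
    using eventually_at_left_real[OF \<open>t0 < s\<close>] by eventually_elim (auto intro: gap)
  ultimately have "(ey s)\<^sup>2 \<le> \<rho> - \<delta>"
    by (rule tendsto_upperbound) simp
  then show False using s(1) \<delta>_pos by (auto simp: B_def)
qed

lemmas dV = deriv_V[OF _ barrier] and dpot_c = deriv_pot_c[OF _ barrier]

lemma V_antimono: "t0 \<le> s \<Longrightarrow> s \<le> t \<Longrightarrow> V t \<le> V s"
  by (rule V_antimono_if) (auto intro: barrier)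

lemma V_nonneg: "t \<ge> t0 \<Longrightarrow> V t \<ge> 0"
  using V_ge[OF _ barrier, of t] by (simp add: V_def)

lemma \<delta>_le: "t \<ge> t0 \<Longrightarrow> \<delta> \<le> \<rho> - (ey t)\<^sup>2"
  using barrier_gap[OF _ barrier] V_antimono by blast

text \<open>Sublevels of \<open>V\<close> are bounded in all velocities and in the drones'
  positions. The bar centre follows through the geometry of the linkage, the barrier force through
  the gap \<delta>.\<close>

lemma bounds:
  obtains K where "K \<ge> 1"
    "\<And>t. t \<ge> t0 \<Longrightarrow> \<bar>x1 t\<bar> \<le> K" "\<And>t. t \<ge> t0 \<Longrightarrow> \<bar>x2 t\<bar> \<le> K" "\<And>t. t \<ge> t0 \<Longrightarrow> \<bar>x3 t\<bar> \<le> K"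
    "\<And>t. t \<ge> t0 \<Longrightarrow> \<bar>h1 t\<bar> \<le> K" "\<And>t. t \<ge> t0 \<Longrightarrow> \<bar>h2 t\<bar> \<le> K" "\<And>t. t \<ge> t0 \<Longrightarrow> \<bar>h3 t\<bar> \<le> K"
    "\<And>t. t \<ge> t0 \<Longrightarrow> \<bar>u1 t\<bar> \<le> K" "\<And>t. t \<ge> t0 \<Longrightarrow> \<bar>u2 t\<bar> \<le> K" "\<And>t. t \<ge> t0 \<Longrightarrow> \<bar>u3 t\<bar> \<le> K"
    "\<And>t. t \<ge> t0 \<Longrightarrow> \<bar>w1 t\<bar> \<le> K" "\<And>t. t \<ge> t0 \<Longrightarrow> \<bar>w2 t\<bar> \<le> K" "\<And>t. t \<ge> t0 \<Longrightarrow> \<bar>w3 t\<bar> \<le> K"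
    "\<And>t. t \<ge> t0 \<Longrightarrow> \<bar>b1 t\<bar> \<le> K" "\<And>t. t \<ge> t0 \<Longrightarrow> \<bar>b2 t\<bar> \<le> K"
    "\<And>t. t \<ge> t0 \<Longrightarrow> \<bar>A1 t\<bar> \<le> K" "\<And>t. t \<ge> t0 \<Longrightarrow> \<bar>A2 t\<bar> \<le> K"
proof -
  define bdd :: "(real \<Rightarrow> real) \<Rightarrow> bool" where "bdd f \<longleftrightarrow> (\<exists>K. \<forall>t\<ge>t0. \<bar>f t\<bar> \<le> K)" for f
  have sq: "bdd f" if c: "c > 0" and le: "\<And>t. t \<ge> t0 \<Longrightarrow> c * (f t)\<^sup>2 / 2 \<le> V t" for c f
    unfolding bdd_def
  proof (intro exI allI impI)
    fix t assume t: "t \<ge> t0"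
    have "c * (f t)\<^sup>2 \<le> 2 * V t0" using le[OF t] V_antimono[OF order_refl t] by simp
    then have "(f t)\<^sup>2 \<le> 2 * V t0 / c" using c by (simp add: field_simps)
    then show "\<bar>f t\<bar> \<le> 1 + 2 * V t0 / c" using abs_le_young[of 1 "f t"] by simp
  qed
  define Q where "Q t = \<sigma> / 2 * ((ey t)\<^sup>2 / (\<rho> - (ey t)\<^sup>2))" for t
  have V: "0 \<le> Q t" "0 \<le> pot_g t" if "t \<ge> t0" for t
    using V_ge[OF that barrier[OF that]] by (auto simp: Q_def)
  have nn: "0 \<le> m1 * (u1 t)\<^sup>2" "0 \<le> m2 * (u2 t)\<^sup>2" "0 \<le> m3 * (u3 t)\<^sup>2"
    "0 \<le> m1 * (w1 t)\<^sup>2" "0 \<le> m2 * (w2 t)\<^sup>2" "0 \<le> m3 * (w3 t)\<^sup>2"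
    "0 \<le> kp1 * (x1 t)\<^sup>2" "0 \<le> kp2 * (x2 t)\<^sup>2" "0 \<le> kp3 * (h1 t)\<^sup>2" "0 \<le> kp4 * (h2 t)\<^sup>2" for t
    using pos by auto
  have le: "m1 * (u1 t)\<^sup>2 / 2 \<le> V t" "m2 * (u2 t)\<^sup>2 / 2 \<le> V t" "m3 * (u3 t)\<^sup>2 / 2 \<le> V t"
    "m1 * (w1 t)\<^sup>2 / 2 \<le> V t" "m2 * (w2 t)\<^sup>2 / 2 \<le> V t" "m3 * (w3 t)\<^sup>2 / 2 \<le> V t"
    "kp1 * (x1 t)\<^sup>2 / 2 \<le> V t" "kp2 * (x2 t)\<^sup>2 / 2 \<le> V t" "kp3 * (h1 t)\<^sup>2 / 2 \<le> V t" "kp4 * (h2 t)\<^sup>2 / 2 \<le> V t"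
    if "t \<ge> t0" for t
    using V[OF that] nn[of t] unfolding V_def kin_h_def kin_v_def pot_c_def Q_def[symmetric]
    by - (simp_all add: add_divide_distrib)
  have 1: "bdd u1" "bdd u2" "bdd u3" "bdd w1" "bdd w2" "bdd w3" "bdd x1" "bdd x2" "bdd h1" "bdd h2"
    by (rule sq[OF _ le(1)] sq[OF _ le(2)] sq[OF _ le(3)] sq[OF _ le(4)] sq[OF _ le(5)] sq[OF _ le(6)]
        sq[OF _ le(7)] sq[OF _ le(8)] sq[OF _ le(9)] sq[OF _ le(10)]; use pos in simp)+
  have add: "bdd (\<lambda>t. f t + h t)" if f: "bdd f" and h: "bdd h" for f h
  proof -
    obtain K K' where "\<forall>t\<ge>t0. \<bar>f t\<bar> \<le> K" "\<forall>t\<ge>t0. \<bar>h t\<bar> \<le> K'" using f h unfolding bdd_def by blast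
    then have "\<forall>t\<ge>t0. \<bar>f t + h t\<bar> \<le> K + K'" by (meson abs_triangle_ineq add_mono order_trans)
    then show ?thesis unfolding bdd_def by blast
  qed
  have cmult: "bdd (\<lambda>t. c * f t)" if f: "bdd f" for c f
  proof -
    obtain K where "\<forall>t\<ge>t0. \<bar>f t\<bar> \<le> K" using f unfolding bdd_def by blast
    then have "\<forall>t\<ge>t0. \<bar>c * f t\<bar> \<le> \<bar>c\<bar> * K" by (simp add: abs_mult mult_left_mono)
    then show ?thesis unfolding bdd_def by blast
  qed
  have const: "bdd (\<lambda>_. c)" for c unfolding bdd_def by auto
  have mono: "bdd f" if "bdd h" "\<And>t. t \<ge> t0 \<Longrightarrow> \<bar>f t\<bar> \<le> \<bar>h t\<bar>" for f h
    using that unfolding bdd_def by (meson order_trans)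
  have cong: "bdd f" if "bdd h" "\<And>t. t \<ge> t0 \<Longrightarrow> f t = h t" for f h
    using mono[of h f] that by simp
  have trig: "bdd (\<lambda>t. sin (f t))" "bdd (\<lambda>t. cos (f t))" for f
    unfolding bdd_def by (rule exI[of _ 1], simp)+
  have x3: "bdd x3"
    by (rule cong[OF add[OF 1(7) add[OF cmult[OF trig(1)[of \<theta>1], of l] cmult[OF add[OF trig(2)[of \<theta>3] const[of "-1"]], of "a / 2"]]]])
      (drule geometry(1), simp add: algebra_simps)
  have h3: "bdd h3"
    by (rule cong[OF add[OF 1(9) add[OF cmult[OF trig(2)[of \<theta>1], of "- l"] cmult[OF trig(1)[of \<theta>3], of "a / 2"]]]])
      (drule geometry(2), simp)
  define B where "B t = \<sigma> * \<rho> * ey t / (\<rho> - (ey t)\<^sup>2)\<^sup>2" for t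
  have "bdd ey" using add[OF 1(7) cmult[OF 1(8), of "-1"]] by simp
  then have B: "bdd B"
  proof (rule mono[OF cmult[of _ "\<sigma> * \<rho> / \<delta>\<^sup>2"]])
    fix t assume t: "t \<ge> t0"
    have d: "\<delta>\<^sup>2 \<le> (\<rho> - (ey t)\<^sup>2)\<^sup>2" using \<delta>_le[OF t] \<delta>_pos by (intro power_mono) auto
    have "\<bar>B t\<bar> = (\<sigma> * \<rho> * \<bar>ey t\<bar>) / (\<rho> - (ey t)\<^sup>2)\<^sup>2"
      using pos by (simp add: B_def abs_mult)
    also have "\<dots> \<le> (\<sigma> * \<rho> * \<bar>ey t\<bar>) / \<delta>\<^sup>2"
      using d pos \<delta>_pos by (intro divide_left_mono mult_pos_pos) (auto intro: less_le_trans[OF _ d])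
    also have "\<dots> = \<bar>\<sigma> * \<rho> / \<delta>\<^sup>2 * ey t\<bar>" using pos by (simp add: abs_mult)
    finally show "\<bar>B t\<bar> \<le> \<bar>\<sigma> * \<rho> / \<delta>\<^sup>2 * ey t\<bar>" .
  qed
  have b1: "bdd b1" by (rule cong[OF add[OF cmult[OF 1(7), of kp1] B]]) (simp add: b1_def B_def)
  have b2: "bdd b2" by (rule cong[OF add[OF cmult[OF 1(8), of kp2] cmult[OF B, of "-1"]]]) (simp add: b2_def B_def)
  have A1: "bdd A1" by (rule cong[OF add[OF const[of "m3 * g / 2"] cmult[OF 1(9), of "- kp3"]]]) (simp add: A1_def)
  have A2: "bdd A2" by (rule cong[OF add[OF const[of "m3 * g / 2"] cmult[OF 1(10), of "- kp4"]]]) (simp add: A2_def)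
  \<comment> \<open>Merges the finitely many separate bounds into a single constant.\<close>
  have ex: "\<exists>K\<ge>1. \<forall>f\<in>set fs. \<forall>t\<ge>t0. \<bar>f t\<bar> \<le> K" if "\<forall>f\<in>set fs. bdd f" for fs
    using that
  proof (induction fs)
    case Nil then show ?case by auto
  next
    case (Cons f fs)
    then obtain K where K: "K \<ge> 1" "\<forall>f\<in>set fs. \<forall>t\<ge>t0. \<bar>f t\<bar> \<le> K" by auto
    obtain K' where K': "\<forall>t\<ge>t0. \<bar>f t\<bar> \<le> K'" using Cons.prems unfolding bdd_def by auto
    have "\<forall>h\<in>set (f # fs). \<forall>t\<ge>t0. \<bar>h t\<bar> \<le> max K K'"
      using K(2) K' by (simp add: le_max_iff_disj)
    moreover have "1 \<le> max K K'" using K(1) by simp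
    ultimately show ?case by blast
  qed
  have "\<forall>f\<in>set [x1, x2, x3, h1, h2, h3, u1, u2, u3, w1, w2, w3, b1, b2, A1, A2]. bdd f"
    by (simp add: 1 x3 h3 b1 b2 A1 A2)
  from ex[OF this] obtain K where K: "K \<ge> 1"
    "\<forall>f\<in>set [x1, x2, x3, h1, h2, h3, u1, u2, u3, w1, w2, w3, b1, b2, A1, A2]. \<forall>t\<ge>t0. \<bar>f t\<bar> \<le> K"
    by blast
  have "\<bar>f t\<bar> \<le> K" if "f \<in> set [x1, x2, x3, h1, h2, h3, u1, u2, u3, w1, w2, w3, b1, b2, A1, A2]" "t \<ge> t0" for f t
    using K(2) that by blast
  then show ?thesis by (intro that[OF K(1)]) simp_all
qed

subsection \<open>Slow drones and vanishing vertical velocities\<close>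

lemma V_slow: "slow V"
proof -
  have bb: "bdd_below (V ` {t0..})" using V_nonneg by (intro bdd_belowI[of _ 0]) auto
  have "(V \<longlongrightarrow> Inf (V ` {t0..})) at_top"
  proof (rule tendstoI)
    fix e :: real assume "e > 0"
    then obtain N where N: "N \<ge> t0" "V N < Inf (V ` {t0..}) + e"
      using cInf_lessD[of "V ` {t0..}" "Inf (V ` {t0..}) + e"] by auto
    show "\<forall>\<^sub>F t in at_top. dist (V t) (Inf (V ` {t0..})) < e"
      unfolding eventually_at_top_linorder
    proof (intro exI allI impI)
      fix t assume "N \<le> t"
      then have "V t \<le> V N" using V_antimono N by simp
      moreover have "Inf (V ` {t0..}) \<le> V t" using bb \<open>N \<le> t\<close> N by (intro cInf_lower) auto
      ultimately show "dist (V t) (Inf (V ` {t0..})) < e" using N by (simp add: dist_real_def)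
    qed
  qed
  then show ?thesis by (rule tendsto_imp_slow)
qed

lemma le_dis:
  shows "kd1 * (u1 t)\<^sup>2 \<le> dis t" "kd2 * (u2 t)\<^sup>2 \<le> dis t" "kd3 * (w1 t)\<^sup>2 \<le> dis t" "kd4 * (w2 t)\<^sup>2 \<le> dis t"
    "ka1 * (\<Theta> t * (u1 t)\<^sup>2) \<le> dis t" "ka2 * (\<Theta> t * (u2 t)\<^sup>2) \<le> dis t"
    "kd1 * (u1 t)\<^sup>2 + kd2 * (u2 t)\<^sup>2 \<le> dis t"
proof -
  have nn: "0 \<le> kd1 * (u1 t)\<^sup>2" "0 \<le> kd2 * (u2 t)\<^sup>2" "0 \<le> kd3 * (w1 t)\<^sup>2" "0 \<le> kd4 * (w2 t)\<^sup>2"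
    "0 \<le> ka1 * (\<Theta> t * (u1 t)\<^sup>2)" "0 \<le> ka2 * (\<Theta> t * (u2 t)\<^sup>2)"
    using pos by auto
  have eq: "dis t = kd1 * (u1 t)\<^sup>2 + ka1 * (\<Theta> t * (u1 t)\<^sup>2) + kd2 * (u2 t)\<^sup>2 + ka2 * (\<Theta> t * (u2 t)\<^sup>2)
    + kd3 * (w1 t)\<^sup>2 + kd4 * (w2 t)\<^sup>2"
    unfolding dis_def by (simp add: algebra_simps)
  show "kd1 * (u1 t)\<^sup>2 \<le> dis t" "kd2 * (u2 t)\<^sup>2 \<le> dis t" "kd3 * (w1 t)\<^sup>2 \<le> dis t" "kd4 * (w2 t)\<^sup>2 \<le> dis t"
    "ka1 * (\<Theta> t * (u1 t)\<^sup>2) \<le> dis t" "ka2 * (\<Theta> t * (u2 t)\<^sup>2) \<le> dis t"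
    "kd1 * (u1 t)\<^sup>2 + kd2 * (u2 t)\<^sup>2 \<le> dis t"
    using nn unfolding eq by linarith+
qed

lemma square_le_dis:
  "(u1 t)\<^sup>2 \<le> 1 / kd1 * dis t" "(u2 t)\<^sup>2 \<le> 1 / kd2 * dis t"
  "(w1 t)\<^sup>2 \<le> 1 / kd3 * dis t" "(w2 t)\<^sup>2 \<le> 1 / kd4 * dis t"
  using le_dis(1-4)[of t] pos by (simp_all add: field_simps)

lemma slow_if_le_dis:
  assumes "\<And>t. t \<ge> t0 \<Longrightarrow> (f has_real_derivative f' t) (at t)"
    and "\<And>t. t \<ge> t0 \<Longrightarrow> (f' t)\<^sup>2 \<le> C * dis t" "C \<ge> 0"
  shows "slow f"
  by (rule slow_if_dissipated[OF V_slow assms(3) dV assms(1)]) (use assms(2) in simp_all)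

lemma position_slow: "slow x1" "slow x2" "slow h1" "slow h2"
proof -
  show "slow x1" by (rule slow_if_le_dis[OF deriv_pos(1) square_le_dis(1)]) (use pos in auto)
  show "slow x2" by (rule slow_if_le_dis[OF deriv_pos(3) square_le_dis(2)]) (use pos in auto)
  show "slow h1" by (rule slow_if_le_dis[OF deriv_pos(2) square_le_dis(3)]) (use pos in auto)
  show "slow h2" by (rule slow_if_le_dis[OF deriv_pos(4) square_le_dis(4)]) (use pos in auto)
qed

text \<open>The rate of the control potential is linear in the drones' velocities with bounded
  coefficients, so its square is dominated by \<open>dis\<close>.\<close>

lemma pot_c_slow: "slow pot_c"
proof -
  obtain K where K: "K \<ge> 1" "\<And>t. t \<ge> t0 \<Longrightarrow> \<bar>b1 t\<bar> \<le> K" "\<And>t. t \<ge> t0 \<Longrightarrow> \<bar>b2 t\<bar> \<le> K"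
    "\<And>t. t \<ge> t0 \<Longrightarrow> \<bar>h1 t\<bar> \<le> K" "\<And>t. t \<ge> t0 \<Longrightarrow> \<bar>h2 t\<bar> \<le> K"
    using bounds by metis
  have four: "(p + q + r + s)\<^sup>2 \<le> 4 * (p\<^sup>2 + q\<^sup>2 + r\<^sup>2 + s\<^sup>2)" for p q r s :: real
  proof -
    have "0 \<le> (p - q)\<^sup>2 + (p - r)\<^sup>2 + (p - s)\<^sup>2 + (q - r)\<^sup>2 + (q - s)\<^sup>2 + (r - s)\<^sup>2" by simp
    then show ?thesis by (simp add: power2_eq_square algebra_simps)
  qed
  have prod: "(c * f)\<^sup>2 \<le> K'\<^sup>2 / k * d" if "\<bar>c\<bar> \<le> K'" "f\<^sup>2 \<le> 1 / k * d" for c f K' k d :: real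
  proof -
    have "(c * f)\<^sup>2 = c\<^sup>2 * f\<^sup>2" by (simp add: power_mult_distrib)
    also have "\<dots> \<le> K'\<^sup>2 * (1 / k * d)"
      using that by (intro mult_mono) (auto simp: abs_le_square_iff[symmetric] abs_le_iff intro: order_trans)
    finally show ?thesis by simp
  qed
  define C where "C = 4 * (K\<^sup>2 / kd1 + K\<^sup>2 / kd2 + (kp3 * K)\<^sup>2 / kd3 + (kp4 * K)\<^sup>2 / kd4)"
  show ?thesis
  proof (rule slow_if_le_dis[OF dpot_c, where C = C])
    fix t assume t: "t \<ge> t0"
    have "(b1 t * u1 t + b2 t * u2 t + kp3 * h1 t * w1 t + kp4 * h2 t * w2 t)\<^sup>2
      \<le> 4 * ((b1 t * u1 t)\<^sup>2 + (b2 t * u2 t)\<^sup>2 + (kp3 * h1 t * w1 t)\<^sup>2 + (kp4 * h2 t * w2 t)\<^sup>2)"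
      by (rule four)
    also have "\<dots> \<le> 4 * (K\<^sup>2 / kd1 * dis t + K\<^sup>2 / kd2 * dis t + (kp3 * K)\<^sup>2 / kd3 * dis t + (kp4 * K)\<^sup>2 / kd4 * dis t)"
      using K t pos
      by (intro mult_left_mono add_mono prod square_le_dis) (auto simp: abs_mult)
    also have "\<dots> = C * dis t" by (simp add: C_def algebra_simps)
    finally show "(b1 t * u1 t + b2 t * u2 t + kp3 * h1 t * w1 t + kp4 * h2 t * w2 t)\<^sup>2 \<le> C * dis t" .
  qed (use pos in \<open>auto simp: C_def\<close>)
qed

text \<open>The tensions cancel in the sum over the three masses. What remains is the slow force
  \<open>A1 + A2 - m3 * g\<close> and the damping, which is the negative derivative of
  \<open>kd3 * h1 + kd4 * h2\<close>. As the height of the centre of mass is bounded, momentum and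
  force must both vanish in the limit.\<close>

lemma vertical_momentum:
  shows momentum_tendsto_0: "((\<lambda>t. m1 * w1 t + m2 * w2 t + m3 * w3 t) \<longlongrightarrow> 0) at_top"
    and weight_tendsto: "((\<lambda>t. A1 t + A2 t - m3 * g) \<longlongrightarrow> 0) at_top"
proof -
  obtain K where K: "K \<ge> 1" "\<And>t. t \<ge> t0 \<Longrightarrow> \<bar>h1 t\<bar> \<le> K" "\<And>t. t \<ge> t0 \<Longrightarrow> \<bar>h2 t\<bar> \<le> K" "\<And>t. t \<ge> t0 \<Longrightarrow> \<bar>h3 t\<bar> \<le> K"
    using bounds by metis
  have slow: "slow (\<lambda>t. kd3 * h1 t + kd4 * h2 t)" "slow (\<lambda>t. A1 t + A2 t - m3 * g)"
    unfolding A1_def A2_def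
    by (intro slow_add slow_diff slow_cmult slow_const position_slow)+
  have bound: "\<bar>m1 * h1 t + m2 * h2 t + m3 * h3 t\<bar> \<le> (m1 + m2 + m3) * K" if t: "t \<ge> t0" for t
  proof -
    have "\<bar>m1 * h1 t\<bar> \<le> m1 * K" "\<bar>m2 * h2 t\<bar> \<le> m2 * K" "\<bar>m3 * h3 t\<bar> \<le> m3 * K"
      using K t pos by (simp_all add: abs_mult)
    then show ?thesis by (simp add: distrib_right)
  qed
  have dF: "((\<lambda>t. m1 * h1 t + m2 * h2 t + m3 * h3 t) has_real_derivative m1 * w1 t + m2 * w2 t + m3 * w3 t) (at t)"
    if t: "t \<ge> t0" for t
    by (intro DERIV_add DERIV_cmult deriv_pos t)
  have df: "((\<lambda>t. m1 * w1 t + m2 * w2 t + m3 * w3 t + (kd3 * h1 t + kd4 * h2 t)) has_real_derivative A1 t + A2 t - m3 * g) (at t)"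
    if t: "t \<ge> t0" for t
  proof -
    have m: "m1 \<noteq> 0" "m2 \<noteq> 0" "m3 \<noteq> 0" using pos by auto
    show ?thesis
      by (rule DERIV_cong[OF DERIV_add[OF DERIV_add[OF DERIV_add[OF DERIV_cmult[OF dw1[OF t]] DERIV_cmult[OF dw2[OF t]]]
          DERIV_cmult[OF dw3[OF t]]] DERIV_add[OF DERIV_cmult[OF deriv_pos(2)[OF t]] DERIV_cmult[OF deriv_pos(4)[OF t]]]]])
        (use m in \<open>simp add: right_diff_distrib[of m3]\<close>)
  qed
  show "((\<lambda>t. m1 * w1 t + m2 * w2 t + m3 * w3 t) \<longlongrightarrow> 0) at_top"
    "((\<lambda>t. A1 t + A2 t - m3 * g) \<longlongrightarrow> 0) at_top"
    using bounded_slow_acceleration[OF slow bound dF df] by blast+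
qed

text \<open>The bar has no damping of its own; its height inherits slowness from the centre of mass
  and the drones.\<close>

lemma h3_slow: "slow h3"
proof -
  have *: "slow (\<lambda>t. m1 * h1 t + m2 * h2 t + m3 * h3 t)"
    by (rule deriv_tendsto_0_imp_slow[OF _ momentum_tendsto_0, of t0]) (intro DERIV_add DERIV_cmult deriv_pos)
  have "slow (\<lambda>t. 1 / m3 * ((m1 * h1 t + m2 * h2 t + m3 * h3 t) - (m1 * h1 t + m2 * h2 t)))"
    by (intro slow_cmult slow_diff[OF *] slow_add position_slow)
  moreover have "1 / m3 * ((m1 * h1 t + m2 * h2 t + m3 * h3 t) - (m1 * h1 t + m2 * h2 t)) = h3 t" for t
    using pos by simp
  ultimately show ?thesis by (simp only:)
qed

text \<open>Since \<open>C1\<close> and \<open>C2\<close> are positive, the tensions pull the drones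
  down and the bar up. The relative acceleration is thus bounded above however large the tensions
  are, which is all that the one-sided criterion requires.\<close>

lemma relative_vertical_tendsto_0:
  shows "((\<lambda>t. w1 t - w3 t) \<longlongrightarrow> 0) at_top" "((\<lambda>t. w2 t - w3 t) \<longlongrightarrow> 0) at_top"
proof -
  obtain K where K: "K \<ge> 1" "\<And>t. t \<ge> t0 \<Longrightarrow> \<bar>w1 t\<bar> \<le> K" "\<And>t. t \<ge> t0 \<Longrightarrow> \<bar>w2 t\<bar> \<le> K"
    "\<And>t. t \<ge> t0 \<Longrightarrow> \<bar>A1 t\<bar> \<le> K" "\<And>t. t \<ge> t0 \<Longrightarrow> \<bar>A2 t\<bar> \<le> K"
    using bounds by metis
  have bar: "- ((T1 t * C1 t + T2 t * C2 t) / m3 - g) \<le> g" if t: "t \<ge> t0" for t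
    using trig_pos[OF t] tension(1,2)[OF t] pos by simp
  have *: "(A - kd * w - T * C) / m \<le> (K + kd * K) / m"
    if "\<bar>A\<bar> \<le> K" "\<bar>w\<bar> \<le> K" "0 < m" "0 < kd" "0 < T" "0 < C" for A kd w T C m
  proof -
    have "- (kd * w) \<le> kd * K" using that by (simp add: abs_le_iff) (metis mult_le_cancel_left_pos mult_minus_right minus_le_iff)
    moreover have "0 < T * C" using that by simp
    ultimately have "A - kd * w - T * C \<le> K + kd * K" using that(1) by linarith
    then show ?thesis using that by (simp add: divide_right_mono)
  qed
  show "((\<lambda>t. w1 t - w3 t) \<longlongrightarrow> 0) at_top"
  proof (rule slow_deriv_tendsto_0[where N = t0 and C = "(K + kd3 * K) / m1 + g"])
    show "slow (\<lambda>t. h1 t - h3 t)" by (intro slow_diff position_slow h3_slow)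
    show "((\<lambda>t. h1 t - h3 t) has_real_derivative w1 t - w3 t) (at t)" if "t0 \<le> t" for t
      by (intro DERIV_diff deriv_pos that)
    show "((\<lambda>t. w1 t - w3 t) has_real_derivative
        (A1 t - kd3 * w1 t - T1 t * C1 t) / m1 - ((T1 t * C1 t + T2 t * C2 t) / m3 - g)) (at t)" if "t0 \<le> t" for t
      by (rule DERIV_diff[OF dw1[OF that] dw3[OF that]])
    show "(A1 t - kd3 * w1 t - T1 t * C1 t) / m1 - ((T1 t * C1 t + T2 t * C2 t) / m3 - g) \<le> (K + kd3 * K) / m1 + g"
      if t: "t0 \<le> t" for t
      using bar[OF t] *[OF K(4)[OF t] K(2)[OF t] pos(1) pos(13) tension(1)[OF t] trig_pos(1)[OF t]] by linarith
  qed
  show "((\<lambda>t. w2 t - w3 t) \<longlongrightarrow> 0) at_top"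
  proof (rule slow_deriv_tendsto_0[where N = t0 and C = "(K + kd4 * K) / m2 + g"])
    show "slow (\<lambda>t. h2 t - h3 t)" by (intro slow_diff position_slow h3_slow)
    show "((\<lambda>t. h2 t - h3 t) has_real_derivative w2 t - w3 t) (at t)" if "t0 \<le> t" for t
      by (intro DERIV_diff deriv_pos that)
    show "((\<lambda>t. w2 t - w3 t) has_real_derivative
        (A2 t - kd4 * w2 t - T2 t * C2 t) / m2 - ((T1 t * C1 t + T2 t * C2 t) / m3 - g)) (at t)" if "t0 \<le> t" for t
      by (rule DERIV_diff[OF dw2[OF that] dw3[OF that]])
    show "(A2 t - kd4 * w2 t - T2 t * C2 t) / m2 - ((T1 t * C1 t + T2 t * C2 t) / m3 - g) \<le> (K + kd4 * K) / m2 + g"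
      if t: "t0 \<le> t" for t
      using bar[OF t] *[OF K(5)[OF t] K(3)[OF t] pos(2) pos(14) tension(2)[OF t] trig_pos(2)[OF t]] by linarith
  qed
qed

lemma vertical_tendsto_0:
  shows w1_tendsto_0: "(w1 \<longlongrightarrow> 0) at_top"
    and w2_tendsto_0: "(w2 \<longlongrightarrow> 0) at_top"
    and w3_tendsto_0: "(w3 \<longlongrightarrow> 0) at_top"
proof -
  have m: "m1 + m2 + m3 \<noteq> 0" using pos by linarith
  have "((\<lambda>t. ((m1 * w1 t + m2 * w2 t + m3 * w3 t) - m1 * (w1 t - w3 t) - m2 * (w2 t - w3 t)) / (m1 + m2 + m3))
      \<longlongrightarrow> (0 - m1 * 0 - m2 * 0) / (m1 + m2 + m3)) at_top"
    by (intro tendsto_intros momentum_tendsto_0 relative_vertical_tendsto_0 m)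
  moreover have "((m1 * w1 t + m2 * w2 t + m3 * w3 t) - m1 * (w1 t - w3 t) - m2 * (w2 t - w3 t)) / (m1 + m2 + m3) = w3 t" for t
    using m by (simp add: field_simps)
  ultimately show w3: "(w3 \<longlongrightarrow> 0) at_top" by simp
  show "(w1 \<longlongrightarrow> 0) at_top" "(w2 \<longlongrightarrow> 0) at_top"
    using tendsto_add[OF relative_vertical_tendsto_0(1) w3] tendsto_add[OF relative_vertical_tendsto_0(2) w3] by simp_all
qed

text \<open>The horizontal tension components have no fixed sign, so the vertical argument does not
  carry over. Instead, the horizontal kinetic energy is what remains of \<open>V\<close> when the
  slow parts are removed.\<close>

lemma kin_h_slow: "slow kin_h"
proof -
  have "(kin_v \<longlongrightarrow> (m1 * 0\<^sup>2 + m2 * 0\<^sup>2 + m3 * 0\<^sup>2) / 2) at_top"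
    unfolding kin_v_def by (intro tendsto_intros vertical_tendsto_0) simp
  then have "slow kin_v" by (rule tendsto_imp_slow)
  moreover have "slow (\<lambda>t. m3 * g * (h3 t - 1 / 2 * (h1 t + h2 t) + l))"
    by (intro slow_cmult slow_add slow_diff slow_const position_slow h3_slow)
  then have "slow pot_g" unfolding pot_g_def by simp
  ultimately have "slow (\<lambda>t. V t - kin_v t - pot_c t - pot_g t)"
    by (intro slow_diff V_slow pot_c_slow)
  then show ?thesis by (simp add: V_def)
qed

text \<open>If at every time of the window one of the drones were faster, \<open>V\<close> would
  drop by at least \<open>k * \<eta> * \<tau>\<close>. The time found serves both drones at
  once.\<close>

lemma drones_momentarily_slow:
  assumes "\<tau> > 0" "\<eta> > 0"
  shows "\<forall>\<^sub>F t in at_top. \<exists>r\<in>{t..t + \<tau>}. (u1 r)\<^sup>2 < \<eta> \<and> (u2 r)\<^sup>2 < \<eta>"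
proof -
  define k where "k = min kd1 kd2"
  have k: "k > 0" "k \<le> kd1" "k \<le> kd2" using pos by (auto simp: k_def)
  have "k * \<eta> * \<tau> > 0" using k assms by simp
  show ?thesis
    using slowD[OF V_slow \<open>\<tau> > 0\<close> \<open>k * \<eta> * \<tau> > 0\<close>] eventually_ge_at_top[of t0]
  proof eventually_elim
    case (elim t)
    show ?case
    proof (rule ccontr)
      assume neg: "\<not> (\<exists>r\<in>{t..t + \<tau>}. (u1 r)\<^sup>2 < \<eta> \<and> (u2 r)\<^sup>2 < \<eta>)"
      have "- dis r \<le> - (k * \<eta>)" if r: "t \<le> r" "r \<le> t + \<tau>" for r
      proof -
        have "\<eta> \<le> (u1 r)\<^sup>2 \<or> \<eta> \<le> (u2 r)\<^sup>2" using neg r by (meson atLeastAtMost_iff not_less)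
        then have "k * \<eta> \<le> kd1 * (u1 r)\<^sup>2 \<or> k * \<eta> \<le> kd2 * (u2 r)\<^sup>2"
          using k assms(2) by (meson less_imp_le mult_mono order_trans zero_le_power2)
        then show ?thesis using le_dis(1,2)[of r] by linarith
      qed
      then have "V (t + \<tau>) - V t \<le> - (k * \<eta>) * (t + \<tau> - t)"
        by (intro deriv_bound_imp_diff_bound(1)[of _ _ _ "\<lambda>r. - dis r"]) (use assms elim dV in auto)
      moreover have "\<bar>V (t + \<tau>) - V t\<bar> < k * \<eta> * \<tau>" using elim(1) assms by auto
      ultimately show False by simp
    qed
  qed
qed

end

subsection \<open>Motion of the bar relative to the drones\<close>

lemma abs_mult_le:
  fixes x y A B :: real
  assumes "\<bar>x\<bar> \<le> A" "\<bar>y\<bar> \<le> B"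
  shows "\<bar>x * y\<bar> \<le> A * B"
  unfolding abs_mult using assms by (intro mult_mono) auto

lemma abs_mult_le_right:
  fixes x y A :: real
  assumes "\<bar>x\<bar> \<le> 1" "\<bar>y\<bar> \<le> A"
  shows "\<bar>x * y\<bar> \<le> A"
  using abs_mult_le[OF assms] by simp

context drone_bar_motion
begin

text \<open>
  \<open>N\<^sub>i\<close> and \<open>p\<^sub>i\<close> are the components along and across cable \<open>i\<close> of the relative velocity of drone \<open>i\<close> and
  the bar centre. In the derivative \<open>R\<^sub>i + \<omega>\<^sub>i * p\<^sub>i\<close> of \<open>N\<^sub>i\<close> the tensions enter through \<open>R\<^sub>i\<close>, and \<open>G\<^sub>i\<close> is the
  contribution of thrust and gravity.
\<close>

definition "N1 t = S1 t * (u1 t - u3 t) - C1 t * (w1 t - w3 t)"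
definition "N2 t = S2 t * (u2 t - u3 t) + C2 t * (w2 t - w3 t)"
definition "p1 t = C1 t * (u1 t - u3 t) + S1 t * (w1 t - w3 t)"
definition "p2 t = C2 t * (u2 t - u3 t) - S2 t * (w2 t - w3 t)"
definition "G1 t = (- S1 t * (b1 t + (kd1 + ka1 * \<Theta> t) * u1 t) - C1 t * (A1 t - kd3 * w1 t)) / m1 - C1 t * g"
definition "G2 t = (- S2 t * (b2 t + (kd2 + ka2 * \<Theta> t) * u2 t) + C2 t * (A2 t - kd4 * w2 t)) / m2 + C2 t * g"

text \<open>The inner product of the cable directions \<open>(S1, - C1)\<close> and
  \<open>(S2, C2)\<close>, equal to \<open>- cos (\<theta>1 + \<theta>2)\<close>.\<close>

abbreviation "e12 t \<equiv> S1 t * S2 t - C1 t * C2 t"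

definition "R1 t = T1 t / m1 + (T1 t - T2 t * e12 t) / m3 + G1 t"
definition "R2 t = - T2 t / m2 - (T2 t - T1 t * e12 t) / m3 + G2 t"

lemma dtrig:
  assumes t: "t \<ge> t0"
  shows "(S1 has_real_derivative C1 t * \<omega>1 t) (at t)" "(C1 has_real_derivative - S1 t * \<omega>1 t) (at t)"
    "(S2 has_real_derivative C2 t * \<omega>2 t) (at t)" "(C2 has_real_derivative - S2 t * \<omega>2 t) (at t)"
    "(S3 has_real_derivative C3 t * \<omega>3 t) (at t)" "(C3 has_real_derivative - S3 t * \<omega>3 t) (at t)"
  using deriv_angle[OF t] by (auto intro!: derivative_eq_intros)

lemma dN1:
  assumes t: "t \<ge> t0"
  shows "(N1 has_real_derivative R1 t + \<omega>1 t * p1 t) (at t)"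
proof -
  have sq: "S1 t * S1 t = 1 - C1 t * C1 t"
    using sin_cos_squared_add3[of "\<theta>1 t"] by linarith
  define F where "F = b1 t + (kd1 + ka1 * \<Theta> t) * u1 t"
  define H where "H = A1 t - kd3 * w1 t"
  have 1: "(u1 has_real_derivative (T1 t * S1 t - F) / m1) (at t)"
    using du1[OF t] by (simp add: F_def diff_diff_eq)
  have 2: "(w1 has_real_derivative (H - T1 t * C1 t) / m1) (at t)"
    using dw1[OF t] by (simp add: H_def)
  have e: "((T1 t * S1 t - F) / m1) * S1 t - ((H - T1 t * C1 t) / m1) * C1 t
     = (T1 t * (S1 t * S1 t) + T1 t * (C1 t * C1 t) - F * S1 t - H * C1 t) / m1"
    by (simp add: diff_divide_distrib add_divide_distrib algebra_simps)
  have e': "(T2 t * S2 t - T1 t * S1 t) / m3 * S1 t - ((T1 t * C1 t + T2 t * C2 t) / m3 - g) * C1 t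
     = - (T1 t * (S1 t * S1 t) + T1 t * (C1 t * C1 t) - T2 t * e12 t) / m3 + g * C1 t"
    by (simp add: diff_divide_distrib add_divide_distrib algebra_simps)
  show ?thesis
    unfolding N1_def
  proof (rule DERIV_cong[OF DERIV_diff[OF DERIV_mult[OF dtrig(1)[OF t] DERIV_diff[OF 1 du3[OF t]]]
      DERIV_mult[OF dtrig(2)[OF t] DERIV_diff[OF 2 dw3[OF t]]]]])
    have "C1 t * \<omega>1 t * (u1 t - u3 t) + ((T1 t * S1 t - F) / m1 - (T2 t * S2 t - T1 t * S1 t) / m3) * S1 t -
        (- S1 t * \<omega>1 t * (w1 t - w3 t) + ((H - T1 t * C1 t) / m1 - ((T1 t * C1 t + T2 t * C2 t) / m3 - g)) * C1 t)
      = \<omega>1 t * p1 t + (((T1 t * S1 t - F) / m1) * S1 t - ((H - T1 t * C1 t) / m1) * C1 t)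
        - ((T2 t * S2 t - T1 t * S1 t) / m3 * S1 t - ((T1 t * C1 t + T2 t * C2 t) / m3 - g) * C1 t)"
      by (simp add: p1_def algebra_simps)
    also have "\<dots> = R1 t + \<omega>1 t * p1 t"
      unfolding e e' sq R1_def G1_def F_def[symmetric] H_def[symmetric]
      by (simp add: diff_divide_distrib add_divide_distrib algebra_simps)
    finally show "C1 t * \<omega>1 t * (u1 t - u3 t) + ((T1 t * S1 t - F) / m1 - (T2 t * S2 t - T1 t * S1 t) / m3) * S1 t -
        (- S1 t * \<omega>1 t * (w1 t - w3 t) + ((H - T1 t * C1 t) / m1 - ((T1 t * C1 t + T2 t * C2 t) / m3 - g)) * C1 t)
      = R1 t + \<omega>1 t * p1 t" .
  qed
qed

lemma dN2:
  assumes t: "t \<ge> t0"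
  shows "(N2 has_real_derivative R2 t + \<omega>2 t * p2 t) (at t)"
proof -
  have sq: "S2 t * S2 t = 1 - C2 t * C2 t"
    using sin_cos_squared_add3[of "\<theta>2 t"] by linarith
  define F where "F = b2 t + (kd2 + ka2 * \<Theta> t) * u2 t"
  define H where "H = A2 t - kd4 * w2 t"
  have 1: "(u2 has_real_derivative (- T2 t * S2 t - F) / m2) (at t)"
    using du2[OF t] by (simp add: F_def diff_diff_eq)
  have 2: "(w2 has_real_derivative (H - T2 t * C2 t) / m2) (at t)"
    using dw2[OF t] by (simp add: H_def)
  have e: "((- T2 t * S2 t - F) / m2) * S2 t + ((H - T2 t * C2 t) / m2) * C2 t
     = (- (T2 t * (S2 t * S2 t)) - T2 t * (C2 t * C2 t) - F * S2 t + H * C2 t) / m2"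
    by (simp add: diff_divide_distrib add_divide_distrib algebra_simps)
  have e': "(T2 t * S2 t - T1 t * S1 t) / m3 * S2 t + ((T1 t * C1 t + T2 t * C2 t) / m3 - g) * C2 t
     = (T2 t * (S2 t * S2 t) + T2 t * (C2 t * C2 t) - T1 t * e12 t) / m3 - g * C2 t"
    by (simp add: diff_divide_distrib add_divide_distrib algebra_simps)
  show ?thesis
    unfolding N2_def
  proof (rule DERIV_cong[OF DERIV_add[OF DERIV_mult[OF dtrig(3)[OF t] DERIV_diff[OF 1 du3[OF t]]]
      DERIV_mult[OF dtrig(4)[OF t] DERIV_diff[OF 2 dw3[OF t]]]]])
    have "C2 t * \<omega>2 t * (u2 t - u3 t) + ((- T2 t * S2 t - F) / m2 - (T2 t * S2 t - T1 t * S1 t) / m3) * S2 t +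
        (- S2 t * \<omega>2 t * (w2 t - w3 t) + ((H - T2 t * C2 t) / m2 - ((T1 t * C1 t + T2 t * C2 t) / m3 - g)) * C2 t)
      = \<omega>2 t * p2 t + (((- T2 t * S2 t - F) / m2) * S2 t + ((H - T2 t * C2 t) / m2) * C2 t)
        - ((T2 t * S2 t - T1 t * S1 t) / m3 * S2 t + ((T1 t * C1 t + T2 t * C2 t) / m3 - g) * C2 t)"
      by (simp add: p2_def algebra_simps)
    also have "\<dots> = R2 t + \<omega>2 t * p2 t"
      unfolding e e' sq R2_def G2_def F_def[symmetric] H_def[symmetric]
      by (simp add: diff_divide_distrib add_divide_distrib algebra_simps)
    finally show "C2 t * \<omega>2 t * (u2 t - u3 t) + ((- T2 t * S2 t - F) / m2 - (T2 t * S2 t - T1 t * S1 t) / m3) * S2 t +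
        (- S2 t * \<omega>2 t * (w2 t - w3 t) + ((H - T2 t * C2 t) / m2 - ((T1 t * C1 t + T2 t * C2 t) / m3 - g)) * C2 t)
      = R2 t + \<omega>2 t * p2 t" .
  qed
qed

lemma N_eq:
  assumes "t \<ge> t0"
  shows "N1 t = a / 2 * \<omega>3 t * c1 t" "N2 t = a / 2 * \<omega>3 t * c2 t"
  using kin1[OF assms] kin2[OF assms] by (simp_all add: N1_def N2_def)

text \<open>The derivatives of \<open>N1 = a / 2 * \<omega>3 * c1\<close> and of its analogue for
  \<open>N2\<close> are compared with Newton's equations. Each cable yields an equation for the same
  \<open>\<alpha>3\<close>, with a weight \<open>c1\<close> or \<open>c2\<close> that may
  degenerate.\<close>

lemma angular_acceleration:
  assumes t: "t > t0"
  shows acc1: "a / 2 * (\<alpha>3 t * c1 t - \<omega>3 t * (s1 t * (\<omega>1 t - \<omega>3 t))) = R1 t + \<omega>1 t * p1 t"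
    and acc2: "a / 2 * (\<alpha>3 t * c2 t - \<omega>3 t * (s2 t * (\<omega>2 t + \<omega>3 t))) = R2 t + \<omega>2 t * p2 t"
proof -
  have t': "t \<ge> t0" using t by simp
  have dc1: "(c1 has_real_derivative - (s1 t * (\<omega>1 t - \<omega>3 t))) (at t)"
    using deriv_angle(1,3)[OF t'] by (auto intro!: derivative_eq_intros)
  have dc2: "(c2 has_real_derivative - (s2 t * (\<omega>2 t + \<omega>3 t))) (at t)"
    using deriv_angle(2,3)[OF t'] by (auto intro!: derivative_eq_intros)
  have "((\<lambda>t. a / 2 * \<omega>3 t * c1 t) has_real_derivative a / 2 * (\<alpha>3 t * c1 t - \<omega>3 t * (s1 t * (\<omega>1 t - \<omega>3 t)))) (at t)"
    by (rule DERIV_cong[OF DERIV_mult[OF DERIV_cmult[OF deriv_angle(4)[OF t']] dc1]]) (simp add: field_simps)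
  then have "(N1 has_real_derivative a / 2 * (\<alpha>3 t * c1 t - \<omega>3 t * (s1 t * (\<omega>1 t - \<omega>3 t)))) (at t)"
    by (rule has_field_derivative_transform_within_open[where S = "{t0<..}"]) (use t N_eq in auto)
  then show "a / 2 * (\<alpha>3 t * c1 t - \<omega>3 t * (s1 t * (\<omega>1 t - \<omega>3 t))) = R1 t + \<omega>1 t * p1 t"
    by (rule DERIV_unique[OF _ dN1[OF t']])
  have "((\<lambda>t. a / 2 * \<omega>3 t * c2 t) has_real_derivative a / 2 * (\<alpha>3 t * c2 t - \<omega>3 t * (s2 t * (\<omega>2 t + \<omega>3 t)))) (at t)"
    by (rule DERIV_cong[OF DERIV_mult[OF DERIV_cmult[OF deriv_angle(4)[OF t']] dc2]]) (simp add: field_simps)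
  then have "(N2 has_real_derivative a / 2 * (\<alpha>3 t * c2 t - \<omega>3 t * (s2 t * (\<omega>2 t + \<omega>3 t)))) (at t)"
    by (rule has_field_derivative_transform_within_open[where S = "{t0<..}"]) (use t N_eq in auto)
  then show "a / 2 * (\<alpha>3 t * c2 t - \<omega>3 t * (s2 t * (\<omega>2 t + \<omega>3 t))) = R2 t + \<omega>2 t * p2 t"
    by (rule DERIV_unique[OF _ dN2[OF t']])
qed

text \<open>Everything is controlled by \<open>\<omega>3\<close>: inextensible cables tie
  \<open>\<omega>1\<close> and \<open>\<omega>2\<close> to it, while \<open>\<omega>3 * c1\<close>
  and \<open>\<omega>3 * c2\<close> are proportional to velocities along the cables and hence
  bounded. The rotation-dependent damping keeps its factors \<open>\<bar>S1 t\<bar>\<close> and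
  \<open>\<bar>S2 t\<bar>\<close> because they are small near the hanging bar.\<close>

lemma force_bounds:
  obtains P where "P \<ge> 1"
    "\<And>t. t \<ge> t0 \<Longrightarrow> \<bar>G1 t\<bar> \<le> P + P * (\<bar>S1 t\<bar> * (\<Theta> t * \<bar>u1 t\<bar>))"
    "\<And>t. t \<ge> t0 \<Longrightarrow> \<bar>G2 t\<bar> \<le> P + P * (\<bar>S2 t\<bar> * (\<Theta> t * \<bar>u2 t\<bar>))"
    "\<And>t. t \<ge> t0 \<Longrightarrow> \<bar>p1 t\<bar> \<le> P" "\<And>t. t \<ge> t0 \<Longrightarrow> \<bar>p2 t\<bar> \<le> P"
    "\<And>t. t \<ge> t0 \<Longrightarrow> \<bar>\<omega>1 t\<bar> \<le> P * (1 + \<bar>\<omega>3 t\<bar>)" "\<And>t. t \<ge> t0 \<Longrightarrow> \<bar>\<omega>2 t\<bar> \<le> P * (1 + \<bar>\<omega>3 t\<bar>)"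
    "\<And>t. t \<ge> t0 \<Longrightarrow> \<Theta> t \<le> P * (1 + (\<omega>3 t)\<^sup>2)"
    "\<And>t. t \<ge> t0 \<Longrightarrow> \<bar>\<omega>3 t * c1 t\<bar> \<le> P" "\<And>t. t \<ge> t0 \<Longrightarrow> \<bar>\<omega>3 t * c2 t\<bar> \<le> P"
    "\<And>t. t \<ge> t0 \<Longrightarrow> \<bar>N1 t\<bar> \<le> P" "\<And>t. t \<ge> t0 \<Longrightarrow> \<bar>N2 t\<bar> \<le> P"
    "\<And>t. t \<ge> t0 \<Longrightarrow> \<bar>u1 t\<bar> \<le> P" "\<And>t. t \<ge> t0 \<Longrightarrow> \<bar>u2 t\<bar> \<le> P" "\<And>t. t \<ge> t0 \<Longrightarrow> \<bar>u3 t\<bar> \<le> P"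
    "\<And>t. t \<ge> t0 \<Longrightarrow> \<bar>b1 t\<bar> \<le> P" "\<And>t. t \<ge> t0 \<Longrightarrow> \<bar>b2 t\<bar> \<le> P"
proof -
  obtain K where K: "K \<ge> 1"
    "\<And>t. t \<ge> t0 \<Longrightarrow> \<bar>x1 t\<bar> \<le> K" "\<And>t. t \<ge> t0 \<Longrightarrow> \<bar>x2 t\<bar> \<le> K" "\<And>t. t \<ge> t0 \<Longrightarrow> \<bar>x3 t\<bar> \<le> K"
    "\<And>t. t \<ge> t0 \<Longrightarrow> \<bar>h1 t\<bar> \<le> K" "\<And>t. t \<ge> t0 \<Longrightarrow> \<bar>h2 t\<bar> \<le> K" "\<And>t. t \<ge> t0 \<Longrightarrow> \<bar>h3 t\<bar> \<le> K"
    "\<And>t. t \<ge> t0 \<Longrightarrow> \<bar>u1 t\<bar> \<le> K" "\<And>t. t \<ge> t0 \<Longrightarrow> \<bar>u2 t\<bar> \<le> K" "\<And>t. t \<ge> t0 \<Longrightarrow> \<bar>u3 t\<bar> \<le> K"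
    "\<And>t. t \<ge> t0 \<Longrightarrow> \<bar>w1 t\<bar> \<le> K" "\<And>t. t \<ge> t0 \<Longrightarrow> \<bar>w2 t\<bar> \<le> K" "\<And>t. t \<ge> t0 \<Longrightarrow> \<bar>w3 t\<bar> \<le> K"
    "\<And>t. t \<ge> t0 \<Longrightarrow> \<bar>b1 t\<bar> \<le> K" "\<And>t. t \<ge> t0 \<Longrightarrow> \<bar>b2 t\<bar> \<le> K"
    "\<And>t. t \<ge> t0 \<Longrightarrow> \<bar>A1 t\<bar> \<le> K" "\<And>t. t \<ge> t0 \<Longrightarrow> \<bar>A2 t\<bar> \<le> K"
    by (rule bounds) blast
  have tri4: "\<bar>x + y + z + w\<bar> \<le> A + B + C + D" if "\<bar>x\<bar> \<le> A" "\<bar>y\<bar> \<le> B" "\<bar>z\<bar> \<le> C" "\<bar>w\<bar> \<le> D"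
    for x y z w A B C D :: real
    using that by linarith
  have tri: "\<bar>x - y\<bar> \<le> 2 * K" if "\<bar>x\<bar> \<le> K" "\<bar>y\<bar> \<le> K" for x y :: real
    using that by linarith
  have pN: "\<bar>p1 t\<bar> \<le> 4 * K" "\<bar>p2 t\<bar> \<le> 4 * K" "\<bar>N1 t\<bar> \<le> 4 * K" "\<bar>N2 t\<bar> \<le> 4 * K" if t: "t \<ge> t0" for t
  proof -
    have sum: "\<bar>x + y\<bar> \<le> 4 * K" "\<bar>x - y\<bar> \<le> 4 * K" if "\<bar>x\<bar> \<le> 2 * K" "\<bar>y\<bar> \<le> 2 * K" for x y
      using that by linarith+
    note b = tri[OF K(8)[OF t] K(10)[OF t]] tri[OF K(9)[OF t] K(10)[OF t]] tri[OF K(11)[OF t] K(13)[OF t]] tri[OF K(12)[OF t] K(13)[OF t]]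
    show "\<bar>p1 t\<bar> \<le> 4 * K" "\<bar>p2 t\<bar> \<le> 4 * K" "\<bar>N1 t\<bar> \<le> 4 * K" "\<bar>N2 t\<bar> \<le> 4 * K"
      unfolding p1_def p2_def N1_def N2_def
      by (intro sum abs_mult_le_right b abs_sin_le_one abs_cos_le_one)+
  qed
  have G: "\<bar>(x * (b + (kd + ka * \<Theta> t) * u) + y * (A - kd' * w)) / m + z * g\<bar>
      \<le> (2 * K + kd * K + kd' * K) / m + g + ka / m * (\<bar>x\<bar> * (\<Theta> t * \<bar>u\<bar>))"
    if "\<bar>x\<bar> \<le> 1" "\<bar>y\<bar> \<le> 1" "\<bar>z\<bar> \<le> 1" "\<bar>b\<bar> \<le> K" "\<bar>u\<bar> \<le> K" "\<bar>A\<bar> \<le> K" "\<bar>w\<bar> \<le> K"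
      "kd > 0" "kd' > 0" "ka > 0" "m > 0" for x y z b kd ka u A kd' w m t
  proof -
    have 1: "\<bar>x * b\<bar> \<le> K" "\<bar>x * (kd * u)\<bar> \<le> kd * K" "\<bar>y * (A - kd' * w)\<bar> \<le> K + kd' * K" "\<bar>z * g\<bar> \<le> g"
    proof -
      show "\<bar>x * b\<bar> \<le> K" by (rule abs_mult_le_right[OF that(1,4)])
      have "\<bar>kd * u\<bar> \<le> kd * K" using that(5,8) by (simp add: abs_mult)
      then show "\<bar>x * (kd * u)\<bar> \<le> kd * K" by (rule abs_mult_le_right[OF that(1)])
      have "\<bar>kd' * w\<bar> \<le> kd' * K" using that(7,9) by (simp add: abs_mult)
      then have "\<bar>A - kd' * w\<bar> \<le> K + kd' * K" using that(6) by linarith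
      then show "\<bar>y * (A - kd' * w)\<bar> \<le> K + kd' * K" by (rule abs_mult_le_right[OF that(2)])
      show "\<bar>z * g\<bar> \<le> g" by (rule abs_mult_le_right[OF that(3)]) (use pos(4) in simp)
    qed
    have 2: "\<bar>x * (ka * \<Theta> t * u)\<bar> = ka * (\<bar>x\<bar> * (\<Theta> t * \<bar>u\<bar>))"
      using that(10) by (simp add: abs_mult)
    have eq: "x * (b + (kd + ka * \<Theta> t) * u) + y * (A - kd' * w) = x * b + x * (kd * u) + x * (ka * \<Theta> t * u) + y * (A - kd' * w)"
      by (simp add: algebra_simps)
    have "\<bar>x * (b + (kd + ka * \<Theta> t) * u) + y * (A - kd' * w)\<bar> \<le> K + kd * K + ka * (\<bar>x\<bar> * (\<Theta> t * \<bar>u\<bar>)) + (K + kd' * K)"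
      unfolding eq by (rule tri4[OF 1(1,2) eq_refl[OF 2] 1(3)])
    also have "\<dots> = (2 * K + kd * K + kd' * K) + ka * (\<bar>x\<bar> * (\<Theta> t * \<bar>u\<bar>))"
      by simp
    finally have "\<bar>(x * (b + (kd + ka * \<Theta> t) * u) + y * (A - kd' * w)) / m\<bar> \<le> ((2 * K + kd * K + kd' * K) + ka * (\<bar>x\<bar> * (\<Theta> t * \<bar>u\<bar>))) / m"
      using that(11) by (simp add: divide_right_mono)
    then have "\<bar>(x * (b + (kd + ka * \<Theta> t) * u) + y * (A - kd' * w)) / m\<bar> \<le> (2 * K + kd * K + kd' * K) / m + ka / m * (\<bar>x\<bar> * (\<Theta> t * \<bar>u\<bar>))"
      by (simp only: add_divide_distrib times_divide_eq_left)
    from add_mono[OF this 1(4)] show ?thesis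
      by (intro order_trans[OF abs_triangle_ineq]) simp
  qed
  define P1 where "P1 = (2 * K + kd1 * K + kd3 * K) / m1 + g"
  define P2 where "P2 = (2 * K + kd2 * K + kd4 * K) / m2 + g"
  have G1: "\<bar>G1 t\<bar> \<le> P1 + ka1 / m1 * (\<bar>S1 t\<bar> * (\<Theta> t * \<bar>u1 t\<bar>))" if t: "t \<ge> t0" for t
    using G[of "- S1 t" "- C1 t" "- C1 t" "b1 t" "u1 t" "A1 t" "w1 t" kd1 kd3 ka1 m1 t]
      K(8,11,14,16)[OF t] pos(1,11,13,15)
    by (simp add: G1_def P1_def)
  have G2: "\<bar>G2 t\<bar> \<le> P2 + ka2 / m2 * (\<bar>S2 t\<bar> * (\<Theta> t * \<bar>u2 t\<bar>))" if t: "t \<ge> t0" for t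
    using G[of "- S2 t" "C2 t" "C2 t" "b2 t" "u2 t" "A2 t" "w2 t" kd2 kd4 ka2 m2 t]
      K(9,12,15,17)[OF t] pos(2,12,14,16)
    by (simp add: G2_def P2_def)
  define W where "W = (4 * K + a) / l"
  have W: "W > 0" using K pos by (simp add: W_def)
  have om: "\<bar>\<omega>1 t\<bar> \<le> W * (1 + \<bar>\<omega>3 t\<bar>)" "\<bar>\<omega>2 t\<bar> \<le> W * (1 + \<bar>\<omega>3 t\<bar>)" if t: "t \<ge> t0" for t
  proof -
    have *: "\<bar>\<omega>\<bar> \<le> W * (1 + \<bar>\<omega>3 t\<bar>)" if "l * \<omega> = p + a / 2 * s * \<omega>3 t" "\<bar>p\<bar> \<le> 4 * K" "\<bar>s\<bar> \<le> 1" for \<omega> p s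
    proof -
      have "\<bar>s * \<omega>3 t\<bar> \<le> \<bar>\<omega>3 t\<bar>" by (rule abs_mult_le_right[OF that(3)]) simp
      then have "\<bar>a / 2 * s * \<omega>3 t\<bar> \<le> a / 2 * \<bar>\<omega>3 t\<bar>" using pos(5) by (simp add: abs_mult)
      moreover have "l * \<bar>\<omega>\<bar> = \<bar>p + a / 2 * s * \<omega>3 t\<bar>"
        unfolding that(1)[symmetric] using pos(6) by (simp add: abs_mult)
      ultimately have "l * \<bar>\<omega>\<bar> \<le> 4 * K + a / 2 * \<bar>\<omega>3 t\<bar>"
        using that(2) by linarith
      also have "\<dots> \<le> (4 * K + a) * (1 + \<bar>\<omega>3 t\<bar>)"
      proof -
        have "0 \<le> a * \<bar>\<omega>3 t\<bar>" "0 \<le> K * \<bar>\<omega>3 t\<bar>" using pos K by auto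
        then show ?thesis using pos by (simp add: algebra_simps)
      qed
      finally show ?thesis using pos by (simp add: W_def field_simps)
    qed
    have 1: "l * \<omega>1 t = - p1 t + a / 2 * (- s1 t) * \<omega>3 t" using kin3[OF t] by (simp add: p1_def)
    have 2: "l * \<omega>2 t = p2 t + a / 2 * s2 t * \<omega>3 t" using kin4[OF t] by (simp add: p2_def)
    show "\<bar>\<omega>1 t\<bar> \<le> W * (1 + \<bar>\<omega>3 t\<bar>)" by (rule *[OF 1]) (use pN[OF t] in auto)
    show "\<bar>\<omega>2 t\<bar> \<le> W * (1 + \<bar>\<omega>3 t\<bar>)" by (rule *[OF 2]) (use pN[OF t] in auto)
  qed
  have Th: "\<Theta> t \<le> (4 * W\<^sup>2 + 1) * (1 + (\<omega>3 t)\<^sup>2)" if t: "t \<ge> t0" for t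
  proof -
    have sq: "\<omega>\<^sup>2 \<le> 2 * W\<^sup>2 * (1 + (\<omega>3 t)\<^sup>2)" if "\<bar>\<omega>\<bar> \<le> W * (1 + \<bar>\<omega>3 t\<bar>)" for \<omega>
    proof -
      have "\<omega>\<^sup>2 \<le> (W * (1 + \<bar>\<omega>3 t\<bar>))\<^sup>2" using that power_mono[OF that abs_ge_zero, of 2] by simp
      also have "\<dots> = W\<^sup>2 * (1 + \<bar>\<omega>3 t\<bar>)\<^sup>2" by (simp add: power_mult_distrib)
      also have "\<dots> \<le> W\<^sup>2 * (2 * (1 + (\<omega>3 t)\<^sup>2))"
      proof (rule mult_left_mono)
        have "0 \<le> (1 - \<bar>\<omega>3 t\<bar>)\<^sup>2" by simp
        then show "(1 + \<bar>\<omega>3 t\<bar>)\<^sup>2 \<le> 2 * (1 + (\<omega>3 t)\<^sup>2)" by (simp add: power2_sum power2_diff)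
      qed simp
      finally show ?thesis by (simp only: mult.assoc mult.left_commute)
    qed
    show ?thesis using sq[OF om(1)[OF t]] sq[OF om(2)[OF t]] by (simp add: algebra_simps)
  qed
  have oc: "\<bar>\<omega>3 t * c1 t\<bar> \<le> 8 * K / a" "\<bar>\<omega>3 t * c2 t\<bar> \<le> 8 * K / a" if t: "t \<ge> t0" for t
    using pN(3,4)[OF t] pos unfolding N_eq[OF t] by (simp_all add: abs_mult field_simps)
  define P where "P = 4 * K + P1 + P2 + ka1 / m1 + ka2 / m2 + W + (4 * W\<^sup>2 + 1) + 8 * K / a"
  have parts: "0 \<le> K" "0 \<le> P1" "0 \<le> P2" "0 \<le> ka1 / m1" "0 \<le> ka2 / m2" "0 \<le> W" "0 \<le> W\<^sup>2" "0 \<le> 8 * K / a"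
    using K pos W by (auto simp: P1_def P2_def)
  have le: "1 \<le> P" "4 * K \<le> P" "K \<le> P" "P1 \<le> P" "P2 \<le> P" "ka1 / m1 \<le> P" "ka2 / m2 \<le> P" "W \<le> P" "4 * W\<^sup>2 + 1 \<le> P" "8 * K / a \<le> P"
    using parts unfolding P_def by linarith+
  show ?thesis
  proof (rule that[of P])
    fix t assume t: "t \<ge> t0"
    have "P1 + ka1 / m1 * (\<bar>S1 t\<bar> * (\<Theta> t * \<bar>u1 t\<bar>)) \<le> P + P * (\<bar>S1 t\<bar> * (\<Theta> t * \<bar>u1 t\<bar>))"
      by (intro add_mono mult_right_mono le) auto
    then show "\<bar>G1 t\<bar> \<le> P + P * (\<bar>S1 t\<bar> * (\<Theta> t * \<bar>u1 t\<bar>))" using G1[OF t] by linarith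
    have "P2 + ka2 / m2 * (\<bar>S2 t\<bar> * (\<Theta> t * \<bar>u2 t\<bar>)) \<le> P + P * (\<bar>S2 t\<bar> * (\<Theta> t * \<bar>u2 t\<bar>))"
      by (intro add_mono mult_right_mono le) auto
    then show "\<bar>G2 t\<bar> \<le> P + P * (\<bar>S2 t\<bar> * (\<Theta> t * \<bar>u2 t\<bar>))" using G2[OF t] by linarith
    have "W * (1 + \<bar>\<omega>3 t\<bar>) \<le> P * (1 + \<bar>\<omega>3 t\<bar>)" by (intro mult_right_mono le) auto
    then show "\<bar>\<omega>1 t\<bar> \<le> P * (1 + \<bar>\<omega>3 t\<bar>)" "\<bar>\<omega>2 t\<bar> \<le> P * (1 + \<bar>\<omega>3 t\<bar>)" using om[OF t] by linarith+
    have "(4 * W\<^sup>2 + 1) * (1 + (\<omega>3 t)\<^sup>2) \<le> P * (1 + (\<omega>3 t)\<^sup>2)" by (intro mult_right_mono le) auto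
    then show "\<Theta> t \<le> P * (1 + (\<omega>3 t)\<^sup>2)" using Th[OF t] by linarith
    show "\<bar>p1 t\<bar> \<le> P" "\<bar>p2 t\<bar> \<le> P" "\<bar>N1 t\<bar> \<le> P" "\<bar>N2 t\<bar> \<le> P" using pN[OF t] le(2) by linarith+
    show "\<bar>\<omega>3 t * c1 t\<bar> \<le> P" "\<bar>\<omega>3 t * c2 t\<bar> \<le> P" using oc[OF t] le by linarith+
    show "\<bar>u1 t\<bar> \<le> P" "\<bar>u2 t\<bar> \<le> P" "\<bar>u3 t\<bar> \<le> P" "\<bar>b1 t\<bar> \<le> P" "\<bar>b2 t\<bar> \<le> P"
      using K(8,9,10,14,15)[OF t] le(3) by linarith+
  qed (rule le)
qed

text \<open>Collects what the energy does not bound pointwise: the rotation and the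
  rotation-dependent damping.\<close>

definition "Lam t = 1 + \<bar>\<omega>3 t\<bar> + \<Theta> t * (\<bar>u1 t\<bar> + \<bar>u2 t\<bar>)"

lemma Lam_ge: "1 \<le> Lam t" "1 + \<bar>\<omega>3 t\<bar> \<le> Lam t" "\<Theta> t * \<bar>u1 t\<bar> \<le> Lam t" "\<Theta> t * \<bar>u2 t\<bar> \<le> Lam t"
  "\<Theta> t * \<bar>u1 t\<bar> + \<Theta> t * \<bar>u2 t\<bar> \<le> Lam t"
proof -
  have "0 \<le> \<Theta> t * \<bar>u1 t\<bar>" "0 \<le> \<Theta> t * \<bar>u2 t\<bar>" by simp_all
  then show "1 \<le> Lam t" "1 + \<bar>\<omega>3 t\<bar> \<le> Lam t" "\<Theta> t * \<bar>u1 t\<bar> \<le> Lam t" "\<Theta> t * \<bar>u2 t\<bar> \<le> Lam t"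
    "\<Theta> t * \<bar>u1 t\<bar> + \<Theta> t * \<bar>u2 t\<bar> \<le> Lam t"
    unfolding Lam_def distrib_left by linarith+
qed

text \<open>The gains \<open>ka1\<close> and \<open>ka2\<close> dissipate multiples of
  \<open>\<Theta> * u1\<^sup>2\<close> and \<open>\<Theta> * u2\<^sup>2\<close>. By Young's
  inequality \<open>\<Theta> * \<bar>u1\<bar>\<close> therefore costs a small multiple of
  \<open>\<Theta>\<close>, itself of order \<open>1 + \<omega>3\<^sup>2\<close>, plus dissipated
  energy.\<close>

lemma Lam_young:
  assumes "\<eta> > 0"
  obtains C where "C \<ge> 1" "\<And>t. t \<ge> t0 \<Longrightarrow> Lam t \<le> \<eta> * (\<omega>3 t)\<^sup>2 + C * (1 + dis t)"
proof -
  obtain P where P: "P \<ge> 1" "\<And>t. t \<ge> t0 \<Longrightarrow> \<Theta> t \<le> P * (1 + (\<omega>3 t)\<^sup>2)"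
    by (rule force_bounds) blast
  \<comment> \<open>Splits the allowance \<open>\<eta> * (\<omega>3 t)\<^sup>2\<close> evenly
    between \<open>\<bar>\<omega>3 t\<bar>\<close> and the damping part.\<close>
  define e where "e = \<eta> / (4 * P)"
  have e: "e > 0" "2 * e * P = \<eta> / 2" using assms P by (auto simp: e_def)
  define C where "C = 1 + 2 / \<eta> + \<eta> / 2 + (1 / ka1 + 1 / ka2) / e"
  have parts: "0 < 2 / \<eta>" "0 < \<eta> / 2" "0 < (1 / ka1 + 1 / ka2) / e"
    using assms e pos by (auto intro!: divide_pos_pos add_pos_pos)
  show ?thesis
  proof (rule that[of C])
    show "C \<ge> 1" using parts by (simp add: C_def)
    fix t assume t: "t \<ge> t0"
    have 1: "\<bar>\<omega>3 t\<bar> \<le> 2 / \<eta> + \<eta> / 2 * (\<omega>3 t)\<^sup>2"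
      using abs_le_young[of "2 / \<eta>" "\<omega>3 t"] assms by (simp add: mult.commute)
    have 2: "\<Theta> t * (\<bar>u1 t\<bar> + \<bar>u2 t\<bar>) \<le> 2 * e * \<Theta> t + (\<Theta> t * (u1 t)\<^sup>2 + \<Theta> t * (u2 t)\<^sup>2) / e"
    proof -
      have "\<bar>u1 t\<bar> + \<bar>u2 t\<bar> \<le> 2 * e + ((u1 t)\<^sup>2 + (u2 t)\<^sup>2) / e"
        using abs_le_young[OF e(1), of "u1 t"] abs_le_young[OF e(1), of "u2 t"] by (simp add: add_divide_distrib)
      then have "\<Theta> t * (\<bar>u1 t\<bar> + \<bar>u2 t\<bar>) \<le> \<Theta> t * (2 * e + ((u1 t)\<^sup>2 + (u2 t)\<^sup>2) / e)"
        by (rule mult_left_mono) simp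
      also have "\<dots> = 2 * e * \<Theta> t + (\<Theta> t * (u1 t)\<^sup>2 + \<Theta> t * (u2 t)\<^sup>2) / e"
        by (simp only: distrib_left times_divide_eq_right mult.commute mult.left_commute add_divide_distrib)
      finally show ?thesis .
    qed
    have 3: "\<Theta> t * (u1 t)\<^sup>2 + \<Theta> t * (u2 t)\<^sup>2 \<le> (1 / ka1 + 1 / ka2) * dis t"
    proof -
      have "\<Theta> t * (u1 t)\<^sup>2 \<le> 1 / ka1 * dis t"
        using le_dis(5)[of t] pos(15) by (simp add: pos_le_divide_eq mult.commute)
      moreover have "\<Theta> t * (u2 t)\<^sup>2 \<le> 1 / ka2 * dis t"
        using le_dis(6)[of t] pos(16) by (simp add: pos_le_divide_eq mult.commute)
      ultimately show ?thesis by (simp add: distrib_right)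
    qed
    have 4: "2 * e * \<Theta> t \<le> \<eta> / 2 * (1 + (\<omega>3 t)\<^sup>2)"
    proof -
      have "2 * e * \<Theta> t \<le> 2 * e * (P * (1 + (\<omega>3 t)\<^sup>2))" by (rule mult_left_mono[OF P(2)[OF t]]) (use e in simp)
      also have "\<dots> = \<eta> / 2 * (1 + (\<omega>3 t)\<^sup>2)" unfolding e(2)[symmetric] by (simp only: mult.assoc)
      finally show ?thesis .
    qed
    have 5: "(\<Theta> t * (u1 t)\<^sup>2 + \<Theta> t * (u2 t)\<^sup>2) / e \<le> (1 / ka1 + 1 / ka2) / e * dis t"
      using divide_right_mono[OF 3, of e] e(1) by simp
    define Q where "Q = (1 / ka1 + 1 / ka2) / e"
    have 6: "(1 + 2 / \<eta> + \<eta> / 2) * 1 \<le> (1 + 2 / \<eta> + \<eta> / 2) * (1 + dis t)"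
      by (rule mult_left_mono) (use parts dis_nonneg[of t] in auto)
    have 7: "Q * dis t \<le> Q * (1 + dis t)" using parts by (intro mult_left_mono) (auto simp: Q_def)
    have "Lam t \<le> 1 + (2 / \<eta> + \<eta> / 2 * (\<omega>3 t)\<^sup>2) + (\<eta> / 2 * (1 + (\<omega>3 t)\<^sup>2) + Q * dis t)"
      using 1 2 4 5 unfolding Lam_def Q_def by linarith
    also have "\<dots> = \<eta> * (\<omega>3 t)\<^sup>2 + ((1 + 2 / \<eta> + \<eta> / 2) * 1 + Q * dis t)" by (simp add: algebra_simps)
    also have "\<dots> \<le> \<eta> * (\<omega>3 t)\<^sup>2 + ((1 + 2 / \<eta> + \<eta> / 2) * (1 + dis t) + Q * (1 + dis t))" using 6 7 by linarith
    also have "\<dots> = \<eta> * (\<omega>3 t)\<^sup>2 + C * (1 + dis t)"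
      unfolding C_def Q_def[symmetric] by (simp only: distrib_right)
    finally show "Lam t \<le> \<eta> * (\<omega>3 t)\<^sup>2 + C * (1 + dis t)" .
  qed
qed

lemma e12_bound: "\<bar>e12 t\<bar> \<le> 1"
proof -
  have "e12 t = - cos (\<theta>1 t + \<theta>2 t)" by (simp add: cos_add)
  then show ?thesis by simp
qed

lemma N_deriv_bound:
  obtains B where "B > 0"
    "\<And>t. t \<ge> t0 \<Longrightarrow> \<bar>R1 t + \<omega>1 t * p1 t\<bar> \<le> B * (T1 t + T2 t) + B * Lam t"
    "\<And>t. t \<ge> t0 \<Longrightarrow> \<bar>R2 t + \<omega>2 t * p2 t\<bar> \<le> B * (T1 t + T2 t) + B * Lam t"
proof -
  obtain P where P: "P \<ge> 1"
    "\<And>t. t \<ge> t0 \<Longrightarrow> \<bar>G1 t\<bar> \<le> P + P * (\<bar>S1 t\<bar> * (\<Theta> t * \<bar>u1 t\<bar>))"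
    "\<And>t. t \<ge> t0 \<Longrightarrow> \<bar>G2 t\<bar> \<le> P + P * (\<bar>S2 t\<bar> * (\<Theta> t * \<bar>u2 t\<bar>))"
    "\<And>t. t \<ge> t0 \<Longrightarrow> \<bar>p1 t\<bar> \<le> P" "\<And>t. t \<ge> t0 \<Longrightarrow> \<bar>p2 t\<bar> \<le> P"
    "\<And>t. t \<ge> t0 \<Longrightarrow> \<bar>\<omega>1 t\<bar> \<le> P * (1 + \<bar>\<omega>3 t\<bar>)" "\<And>t. t \<ge> t0 \<Longrightarrow> \<bar>\<omega>2 t\<bar> \<le> P * (1 + \<bar>\<omega>3 t\<bar>)"
    by (rule force_bounds) blast
  define M where "M = 1 / m1 + 1 / m2 + 1 / m3"
  have M: "M > 0" "1 / m1 + 1 / m3 \<le> M" "1 / m2 + 1 / m3 \<le> M" using pos by (auto simp: M_def intro!: add_pos_pos)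
  have G: "\<bar>G\<bar> \<le> 2 * P * Lam t" if "\<bar>G\<bar> \<le> P + P * (\<bar>S\<bar> * X)" "\<bar>S\<bar> \<le> 1" "0 \<le> X" "X \<le> Lam t" for G S X t
  proof -
    have "\<bar>S\<bar> * X \<le> 1 * X" using that by (intro mult_right_mono) auto
    then have "P * (\<bar>S\<bar> * X) \<le> P * Lam t" using that P(1) by (intro mult_left_mono) auto
    moreover have "P * 1 \<le> P * Lam t" using P(1) Lam_ge(1) by (intro mult_left_mono) auto
    ultimately show ?thesis using that(1) by linarith
  qed
  have W: "\<bar>\<omega> * p\<bar> \<le> P * P * Lam t" if "\<bar>\<omega>\<bar> \<le> P * (1 + \<bar>\<omega>3 t\<bar>)" "\<bar>p\<bar> \<le> P" for \<omega> p t
  proof -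
    have "\<bar>\<omega> * p\<bar> \<le> (P * (1 + \<bar>\<omega>3 t\<bar>)) * P" by (rule abs_mult_le[OF that])
    also have "\<dots> = P * P * (1 + \<bar>\<omega>3 t\<bar>)" by simp
    also have "\<dots> \<le> P * P * Lam t" using P(1) Lam_ge(2) by (intro mult_left_mono) auto
    finally show ?thesis .
  qed
  have T: "\<bar>T / m + (T - T' * e) / m'\<bar> \<le> (1 / m + 1 / m') * (T + T')"
    if "T > 0" "T' > 0" "\<bar>e\<bar> \<le> 1" "m > 0" "m' > 0" for T T' e m m' :: real
  proof -
    have "\<bar>T' * e\<bar> \<le> T'" using abs_mult_le[of T' T' e 1] that by simp
    then have "\<bar>T - T' * e\<bar> \<le> T + T'" using that by linarith
    then have 1: "\<bar>(T - T' * e) / m'\<bar> \<le> (T + T') / m'" using that by (simp add: divide_right_mono)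
    have 2: "\<bar>T / m\<bar> \<le> (T + T') / m" using that by (simp add: divide_right_mono)
    have "(1 / m + 1 / m') * (T + T') = (T + T') / m + (T + T') / m'" by (simp add: distrib_right)
    then show ?thesis using 1 2 by linarith
  qed
  define B where "B = M + 2 * P + P * P"
  have PP: "0 < P * P" using P(1) by simp
  have B: "B > 0" "M \<le> B" "2 * P + P * P \<le> B" using M PP P(1) unfolding B_def by linarith+
  have fin: "\<bar>R + w\<bar> \<le> B * S + B * Lam t"
    if R: "R = X + G" "\<bar>X\<bar> \<le> c * S" "c \<le> M" "S > 0" and G: "\<bar>G\<bar> \<le> 2 * P * Lam t" "\<bar>w\<bar> \<le> P * P * Lam t"
    for R w S X G c t
  proof -
    have "c * S \<le> B * S" using R(3,4) B(2) by (intro mult_right_mono) auto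
    moreover have "(2 * P + P * P) * Lam t \<le> B * Lam t" using B(3) Lam_ge(1)[of t] by (intro mult_right_mono) auto
    ultimately show ?thesis using R(1,2) G by (simp add: distrib_right)
  qed
  show ?thesis
  proof (rule that[OF B(1)])
    fix t assume t: "t \<ge> t0"
    note T0 = tension[OF t]
    show "\<bar>R1 t + \<omega>1 t * p1 t\<bar> \<le> B * (T1 t + T2 t) + B * Lam t"
      by (rule fin[OF R1_def T[OF T0(1,2) e12_bound pos(1,3)] M(2) _ G[OF P(2)[OF t]] W[OF P(6)[OF t] P(4)[OF t]]])
        (use T0 Lam_ge in simp_all)
    have "R2 t = - (T2 t / m2 + (T2 t - T1 t * e12 t) / m3) + G2 t" by (simp add: R2_def)
    moreover have "\<bar>- (T2 t / m2 + (T2 t - T1 t * e12 t) / m3)\<bar> \<le> (1 / m2 + 1 / m3) * (T1 t + T2 t)"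
      using T[OF T0(2,1) e12_bound pos(2,3), of t] by (simp add: add.commute)
    ultimately show "\<bar>R2 t + \<omega>2 t * p2 t\<bar> \<le> B * (T1 t + T2 t) + B * Lam t"
      by (rule fin[OF _ _ M(3) _ G[OF P(3)[OF t]] W[OF P(7)[OF t] P(5)[OF t]]])
        (use T0 Lam_ge in simp_all)
  qed
qed

text \<open>The bar centre lies below both drones, so the half bar cannot rise or sink by more than
  the vertical extent of a cable: flat cables force a flat bar.\<close>

lemma cable_height:
  assumes "t \<ge> t0"
  shows "\<bar>S3 t\<bar> \<le> 2 * l / a * (C1 t + C2 t)"
proof -
  have "a / 2 * S3 t < l * C1 t" "- (l * C2 t) < a / 2 * S3 t"
    using under[OF assms] geometry(2,4)[OF assms] by linarith+
  moreover have "0 < l * C1 t" "0 < l * C2 t" using trig_pos[OF assms] pos by auto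
  ultimately have "\<bar>a / 2 * S3 t\<bar> \<le> l * (C1 t + C2 t)" by (simp only: distrib_left abs_le_iff) linarith
  then show ?thesis using pos by (simp add: abs_mult field_simps)
qed

text \<open>The derivative of the identity \<open>l * (C1 + C2) = h1 + h2 - 2 * h3\<close>, from
  which the bar angle has dropped out.\<close>

lemma cos_sum_rate:
  assumes "t \<ge> t0"
  shows "- (S1 t * \<omega>1 t + S2 t * \<omega>2 t) = (w1 t + w2 t - 2 * w3 t) / l"
proof -
  have "w1 t + w2 t - 2 * w3 t = l * (- (S1 t * \<omega>1 t + S2 t * \<omega>2 t))"
    using velocity(2,4)[OF assms] by (simp add: algebra_simps)
  then show ?thesis using pos by simp
qed

text \<open>For sines of equal sign, \<open>(S1 - S2) * (S1 + S2) = C2\<^sup>2 - C1\<^sup>2\<close>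
  makes \<open>S1 - S2\<close> of second order in the cosines. Hence in
  \<open>c1 + c2 = (C1 + C2) * C3 + (S1 - S2) * S3\<close> the first summand dominates.\<close>

lemma corner_geometry:
  assumes t: "t \<ge> t0" and small: "C1 t + C2 t \<le> 1 / 4" "2 * l / a * (C1 t + C2 t) \<le> 1 / 2"
  shows "(S1 t)\<^sup>2 \<ge> 15 / 16" "(S2 t)\<^sup>2 \<ge> 15 / 16" "\<bar>S1 t\<bar> \<ge> 15 / 16" "\<bar>S2 t\<bar> \<ge> 15 / 16" "C3 t \<ge> 3 / 4"
    "S1 t * S2 t > 0 \<Longrightarrow> (C1 t + C2 t) / 2 \<le> c1 t + c2 t"
    "S1 t * S2 t > 0 \<Longrightarrow> c1 t + c2 t \<le> 2 * (C1 t + C2 t)"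
proof -
  note C = trig_pos[OF t]
  have sq: "(C1 t)\<^sup>2 \<le> 1 / 16" "(C2 t)\<^sup>2 \<le> 1 / 16"
    using power_mono[of "C1 t" "1 / 4" 2] power_mono[of "C2 t" "1 / 4" 2] C small by (auto simp: power_divide)
  show S: "(S1 t)\<^sup>2 \<ge> 15 / 16" "(S2 t)\<^sup>2 \<ge> 15 / 16"
    using sq sin_cos_squared_add[of "\<theta>1 t"] sin_cos_squared_add[of "\<theta>2 t"] by linarith+
  have le1: "x\<^sup>2 \<le> \<bar>x\<bar>" if "\<bar>x\<bar> \<le> 1" for x :: real
    using mult_right_mono[OF that abs_ge_zero[of x]] by (simp add: power2_eq_square)
  show A: "\<bar>S1 t\<bar> \<ge> 15 / 16" "\<bar>S2 t\<bar> \<ge> 15 / 16"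
    using S le1[of "S1 t"] le1[of "S2 t"] by simp_all
  have S3: "\<bar>S3 t\<bar> \<le> 1 / 2" using cable_height[OF t] small by linarith
  then have "(S3 t)\<^sup>2 \<le> 1 / 4" using power_mono[of "\<bar>S3 t\<bar>" "1 / 2" 2] by (auto simp: power_divide)
  then have "(C3 t)\<^sup>2 \<ge> 3 / 4" using sin_cos_squared_add[of "\<theta>3 t"] by linarith
  then show C3: "C3 t \<ge> 3 / 4" using le1[of "C3 t"] C by simp
  assume ss: "S1 t * S2 t > 0"
  have sum: "1 \<le> \<bar>S1 t + S2 t\<bar>"
    using ss A by (auto simp: zero_less_mult_iff abs_if)
  have "\<bar>S1 t - S2 t\<bar> * 1 \<le> \<bar>S1 t - S2 t\<bar> * \<bar>S1 t + S2 t\<bar>"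
    using sum by (intro mult_left_mono) auto
  also have "\<dots> = \<bar>(S1 t)\<^sup>2 - (S2 t)\<^sup>2\<bar>" by (simp add: abs_mult[symmetric] power2_eq_square algebra_simps)
  also have "\<dots> = \<bar>C1 t - C2 t\<bar> * \<bar>C1 t + C2 t\<bar>"
    unfolding abs_mult[symmetric] sin_squared_eq
    by (subst abs_minus_cancel[symmetric]) (simp add: power2_eq_square algebra_simps)
  also have "\<dots> \<le> 1 / 4 * (C1 t + C2 t)"
  proof (intro mult_mono)
    show "\<bar>C1 t - C2 t\<bar> \<le> 1 / 4" using C(1,2) small(1) by linarith
  qed (use C(1,2) in simp_all)
  finally have "\<bar>S1 t - S2 t\<bar> \<le> 1 / 4 * (C1 t + C2 t)" by simp
  from abs_mult_le[OF this S3] have d: "\<bar>(S1 t - S2 t) * S3 t\<bar> \<le> (C1 t + C2 t) / 8" by simp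
  have eq: "c1 t + c2 t = (C1 t + C2 t) * C3 t + (S1 t - S2 t) * S3 t"
    by (simp add: cos_diff cos_add algebra_simps)
  have "(C1 t + C2 t) * (3 / 4) \<le> (C1 t + C2 t) * C3 t" "(C1 t + C2 t) * C3 t \<le> (C1 t + C2 t) * 1"
    using C C3 by (intro mult_left_mono; simp)+
  then show "(C1 t + C2 t) / 2 \<le> c1 t + c2 t" "c1 t + c2 t \<le> 2 * (C1 t + C2 t)"
    using d C unfolding eq by linarith+
qed

end

subsection \<open>The cables are not both nearly horizontal\<close>

lemma constant_sign:
  fixes f :: "real \<Rightarrow> real"
  assumes "continuous_on {s..t} f" "\<And>r. r \<in> {s..t} \<Longrightarrow> f r \<noteq> 0"
  shows "(\<forall>r\<in>{s..t}. f r > 0) \<or> (\<forall>r\<in>{s..t}. f r < 0)"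
proof (rule ccontr)
  assume "\<not> ((\<forall>r\<in>{s..t}. f r > 0) \<or> (\<forall>r\<in>{s..t}. f r < 0))"
  then obtain p q where pq: "p \<in> {s..t}" "q \<in> {s..t}" "f p \<le> 0" "0 \<le> f q" by (auto simp: not_less)
  have "connected (f ` {s..t})" by (rule connected_continuous_image[OF assms(1)]) simp
  then have "0 \<in> f ` {s..t}" by (rule connectedD_interval) (use pq in auto)
  then show False using assms(2) by force
qed

context drone_bar_motion
begin

text \<open>
  While \<open>Q\<close> holds, the integral of the tensions over a time window is bounded in terms of its length
  and the energy dissipated.
\<close>

definition tension_budget :: "(real \<Rightarrow> bool) \<Rightarrow> bool" where
  "tension_budget Q \<longleftrightarrow> (\<exists>E E' C. C \<ge> 0 \<and> (\<forall>t\<ge>t0. Q t \<longrightarrow> (E has_real_derivative E' t) (at t) \<and>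
     \<bar>E t\<bar> \<le> C \<and> T1 t + T2 t \<le> E' t + C * (1 + dis t)))"

text \<open>The second inequality is calibrated to \<open>cable_height\<close>: it gives
  \<open>\<bar>S3 t\<bar> \<le> 1 / 2\<close>.\<close>

definition "corner t \<longleftrightarrow> C1 t + C2 t \<le> 1 / 4 \<and> 2 * l / a * (C1 t + C2 t) \<le> 1 / 2"

text \<open>Weighting the drones' horizontal momenta with \<open>S1\<close> and \<open>- S2\<close>
  makes both tensions appear with nonnegative coefficients, which are close to 1 when the cables are
  nearly horizontal.\<close>

lemma momentum_S_deriv:
  assumes t: "t \<ge> t0"
  defines "r \<equiv> S1 t * (b1 t + (kd1 + ka1 * \<Theta> t) * u1 t) - m1 * u1 t * C1 t * \<omega>1 t
    - S2 t * (b2 t + (kd2 + ka2 * \<Theta> t) * u2 t) + m2 * u2 t * C2 t * \<omega>2 t"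
  shows "((\<lambda>t. m1 * (u1 t * S1 t) - m2 * (u2 t * S2 t)) has_real_derivative
    T1 t * (S1 t)\<^sup>2 + T2 t * (S2 t)\<^sup>2 - r) (at t)"
proof -
  have m: "m1 \<noteq> 0" "m2 \<noteq> 0" using pos by auto
  define F1 where "F1 = b1 t + (kd1 + ka1 * \<Theta> t) * u1 t"
  define F2 where "F2 = b2 t + (kd2 + ka2 * \<Theta> t) * u2 t"
  have 1: "(u1 has_real_derivative (T1 t * S1 t - F1) / m1) (at t)"
    using du1[OF t] by (simp add: F1_def diff_diff_eq)
  have 2: "(u2 has_real_derivative (- T2 t * S2 t - F2) / m2) (at t)"
    using du2[OF t] by (simp add: F2_def diff_diff_eq)
  have r: "r = S1 t * F1 - m1 * u1 t * C1 t * \<omega>1 t - S2 t * F2 + m2 * u2 t * C2 t * \<omega>2 t"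
    unfolding r_def F1_def F2_def ..
  have e: "m1 * ((T1 t * S1 t - F1) / m1 * S1 t) = (T1 t * S1 t - F1) * S1 t"
    "m2 * ((- T2 t * S2 t - F2) / m2 * S2 t) = (- T2 t * S2 t - F2) * S2 t"
    using m by simp_all
  show ?thesis
    by (rule DERIV_cong[OF DERIV_diff[OF DERIV_cmult[OF DERIV_mult[OF 1 dtrig(1)[OF t]]]
          DERIV_cmult[OF DERIV_mult[OF 2 dtrig(3)[OF t]]]]])
      (simp only: distrib_left e, simp add: r power2_eq_square algebra_simps)
qed

text \<open>Controls the remainder \<open>r\<close> in \<open>momentum_S_deriv\<close> and the
  weighted momentum itself, so that near the corner the tensions are bounded by a derivative of a
  bounded function plus a multiple of \<open>Lam\<close>.\<close>

lemma drone_force_bound: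
  obtains B where "B > 0"
    "\<And>t. t \<ge> t0 \<Longrightarrow> \<bar>S1 t * (b1 t + (kd1 + ka1 * \<Theta> t) * u1 t) - m1 * u1 t * C1 t * \<omega>1 t
      - S2 t * (b2 t + (kd2 + ka2 * \<Theta> t) * u2 t) + m2 * u2 t * C2 t * \<omega>2 t\<bar> \<le> B * Lam t"
    "\<And>t. t \<ge> t0 \<Longrightarrow> \<bar>m1 * (u1 t * S1 t) - m2 * (u2 t * S2 t)\<bar> \<le> B"
proof -
  obtain P where P: "P \<ge> 1"
    "\<And>t. t \<ge> t0 \<Longrightarrow> \<bar>\<omega>1 t\<bar> \<le> P * (1 + \<bar>\<omega>3 t\<bar>)" "\<And>t. t \<ge> t0 \<Longrightarrow> \<bar>\<omega>2 t\<bar> \<le> P * (1 + \<bar>\<omega>3 t\<bar>)"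
    "\<And>t. t \<ge> t0 \<Longrightarrow> \<bar>u1 t\<bar> \<le> P" "\<And>t. t \<ge> t0 \<Longrightarrow> \<bar>u2 t\<bar> \<le> P"
    "\<And>t. t \<ge> t0 \<Longrightarrow> \<bar>b1 t\<bar> \<le> P" "\<And>t. t \<ge> t0 \<Longrightarrow> \<bar>b2 t\<bar> \<le> P"
    by (rule force_bounds) blast
  have F: "\<bar>S * (b + (kd + ka * \<Theta> t) * u)\<bar> \<le> (P + kd * P + ka) * Lam t"
    if "\<bar>S\<bar> \<le> 1" "\<bar>b\<bar> \<le> P" "\<bar>u\<bar> \<le> P" "kd > 0" "ka > 0" "\<Theta> t * \<bar>u\<bar> \<le> Lam t" for S b kd ka u t
  proof -
    have 1: "\<bar>kd * u\<bar> \<le> kd * P" using that by (simp add: abs_mult)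
    have 2: "\<bar>ka * (\<Theta> t * u)\<bar> = ka * (\<Theta> t * \<bar>u\<bar>)" using that(5) by (simp add: abs_mult)
    have 3: "ka * (\<Theta> t * \<bar>u\<bar>) \<le> ka * Lam t" using that by (intro mult_left_mono) auto
    have 4: "(P + kd * P) * 1 \<le> (P + kd * P) * Lam t" using P(1) that Lam_ge(1) by (intro mult_left_mono) auto
    have "b + (kd + ka * \<Theta> t) * u = b + kd * u + ka * (\<Theta> t * u)" by (simp add: algebra_simps)
    then have "\<bar>b + (kd + ka * \<Theta> t) * u\<bar> \<le> \<bar>b\<bar> + \<bar>kd * u\<bar> + \<bar>ka * (\<Theta> t * u)\<bar>"
      by (simp only:)
    also have "\<dots> \<le> (P + kd * P) * 1 + ka * Lam t"
      using add_mono[OF add_mono[OF that(2) 1] 3] unfolding 2 by simp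
    also have "\<dots> \<le> (P + kd * P) * Lam t + ka * Lam t" using 4 by simp
    finally show ?thesis
      by (intro abs_mult_le_right[OF that(1)]) (simp only: distrib_right)
  qed
  have W: "\<bar>m * u * C * \<omega>\<bar> \<le> m * P * P * Lam t"
    if "m > 0" "\<bar>u\<bar> \<le> P" "\<bar>C\<bar> \<le> 1" "\<bar>\<omega>\<bar> \<le> P * (1 + \<bar>\<omega>3 t\<bar>)" for m u C \<omega> t
  proof -
    have "\<bar>m * u * C * \<omega>\<bar> = m * \<bar>u * (C * \<omega>)\<bar>" using that(1) by (simp add: abs_mult)
    also have "\<dots> \<le> m * (P * (P * (1 + \<bar>\<omega>3 t\<bar>)))"
      using that(1) by (intro mult_left_mono abs_mult_le that(2) abs_mult_le_right[OF that(3,4)]) auto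
    also have "\<dots> = m * P * P * (1 + \<bar>\<omega>3 t\<bar>)" by simp
    also have "\<dots> \<le> m * P * P * Lam t" using P(1) that(1) Lam_ge(2) by (intro mult_left_mono) auto
    finally show ?thesis .
  qed
  define B1 where "B1 = P + kd1 * P + ka1"
  define B2 where "B2 = P + kd2 * P + ka2"
  define B where "B = B1 + m1 * P * P + B2 + m2 * P * P + m1 * P + m2 * P"
  have nn: "0 < B1" "0 < B2" "0 < m1 * P * P" "0 < m2 * P * P" "0 < m1 * P" "0 < m2 * P"
    using P(1) pos by (auto simp: B1_def B2_def intro!: add_pos_pos)
  show ?thesis
  proof (rule that[of B])
    show "B > 0" using nn by (simp add: B_def)
    fix t assume t: "t \<ge> t0"
    have four: "\<bar>p - q - r + s\<bar> \<le> (A + A' + A'' + A''') * L" if "\<bar>p\<bar> \<le> A * L" "\<bar>q\<bar> \<le> A' * L" "\<bar>r\<bar> \<le> A'' * L" "\<bar>s\<bar> \<le> A''' * L"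
      for p q r s A A' A'' A''' L :: real
      using that unfolding distrib_right by linarith
    have "\<bar>S1 t * (b1 t + (kd1 + ka1 * \<Theta> t) * u1 t) - m1 * u1 t * C1 t * \<omega>1 t
      - S2 t * (b2 t + (kd2 + ka2 * \<Theta> t) * u2 t) + m2 * u2 t * C2 t * \<omega>2 t\<bar>
      \<le> (B1 + m1 * P * P + B2 + m2 * P * P) * Lam t"
      unfolding B1_def B2_def
      by (intro four F W P Lam_ge abs_sin_le_one abs_cos_le_one pos t)
    also have "\<dots> \<le> B * Lam t" using nn Lam_ge(1)[of t] by (intro mult_right_mono) (auto simp: B_def)
    finally show "\<bar>S1 t * (b1 t + (kd1 + ka1 * \<Theta> t) * u1 t) - m1 * u1 t * C1 t * \<omega>1 t
      - S2 t * (b2 t + (kd2 + ka2 * \<Theta> t) * u2 t) + m2 * u2 t * C2 t * \<omega>2 t\<bar> \<le> B * Lam t" .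
    have "\<bar>m1 * (u1 t * S1 t)\<bar> \<le> m1 * P" "\<bar>m2 * (u2 t * S2 t)\<bar> \<le> m2 * P"
      using abs_mult_le[OF P(4)[OF t] abs_sin_le_one[of "\<theta>1 t"]] abs_mult_le[OF P(5)[OF t] abs_sin_le_one[of "\<theta>2 t"]] pos
      by (simp_all add: abs_mult)
    then show "\<bar>m1 * (u1 t * S1 t) - m2 * (u2 t * S2 t)\<bar> \<le> B"
      using nn unfolding B_def by linarith
  qed
qed

text \<open>
  When the cables and the bar are nearly aligned horizontally with \<open>S1\<close> and \<open>S2\<close> of equal sign,
  the angular velocity is controlled by the virial function \<open>S3 * (N1 + N2) / (C1 + C2)\<close>, whose
  derivative dominates \<open>\<omega>3\<^sup>2\<close> although the inertia of the fast rotation degenerates.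
\<close>

lemma tension_budget_same_sign:
  "tension_budget (\<lambda>t. corner t \<and> S1 t * S2 t > 0 \<and> \<bar>w1 t + w2 t - 2 * w3 t\<bar> \<le> l)"
proof -
  obtain B where B: "B > 0"
    "\<And>t. t \<ge> t0 \<Longrightarrow> \<bar>R1 t + \<omega>1 t * p1 t\<bar> \<le> B * (T1 t + T2 t) + B * Lam t"
    "\<And>t. t \<ge> t0 \<Longrightarrow> \<bar>R2 t + \<omega>2 t * p2 t\<bar> \<le> B * (T1 t + T2 t) + B * Lam t"
    by (rule N_deriv_bound) blast
  obtain P where P: "P \<ge> 1" "\<And>t. t \<ge> t0 \<Longrightarrow> \<bar>N1 t\<bar> \<le> P" "\<And>t. t \<ge> t0 \<Longrightarrow> \<bar>N2 t\<bar> \<le> P"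
    by (rule force_bounds) blast
  define r where "r t = S1 t * (b1 t + (kd1 + ka1 * \<Theta> t) * u1 t) - m1 * u1 t * C1 t * \<omega>1 t
      - S2 t * (b2 t + (kd2 + ka2 * \<Theta> t) * u2 t) + m2 * u2 t * C2 t * \<omega>2 t" for t
  define \<Psi> where "\<Psi> t = m1 * (u1 t * S1 t) - m2 * (u2 t * S2 t)" for t
  obtain D where D: "D > 0" "\<And>t. t \<ge> t0 \<Longrightarrow> \<bar>r t\<bar> \<le> D * Lam t" "\<And>t. t \<ge> t0 \<Longrightarrow> \<bar>\<Psi> t\<bar> \<le> D"
    unfolding r_def \<Psi>_def by (rule drone_force_bound) blast
  define \<Psi>' where "\<Psi>' t = T1 t * (S1 t)\<^sup>2 + T2 t * (S2 t)\<^sup>2 - r t" for t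
  have d\<Psi>: "(\<Psi> has_real_derivative \<Psi>' t) (at t)" if "t \<ge> t0" for t
    using momentum_S_deriv[OF that] unfolding \<Psi>_def \<Psi>'_def r_def .
  define s where "s t = C1 t + C2 t" for t
  define sd where "sd t = - (S1 t * \<omega>1 t + S2 t * \<omega>2 t)" for t
  define Nd where "Nd t = R1 t + \<omega>1 t * p1 t + (R2 t + \<omega>2 t * p2 t)" for t
  \<comment> \<open>Near the corner \<open>N1 + N2\<close> is of order \<open>\<omega>3 * s\<close>
    and \<open>S3\<close> of order \<open>s\<close>, so division by \<open>s\<close> leaves a
    bounded function whose derivative contains a term of order
    \<open>\<omega>3\<^sup>2\<close>.\<close>
  define \<Phi> where "\<Phi> t = S3 t * (N1 t + N2 t) / s t" for t
  define \<Phi>' where "\<Phi>' t = ((C3 t * \<omega>3 t) * (N1 t + N2 t) + S3 t * Nd t) / s t - S3 t * (N1 t + N2 t) * sd t / (s t * s t)" for t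
  have s_pos: "s t > 0" if "t \<ge> t0" for t using trig_pos[OF that] by (simp add: s_def)
  have d\<Phi>: "(\<Phi> has_real_derivative \<Phi>' t) (at t)" if t: "t \<ge> t0" for t
  proof -
    have ds: "(s has_real_derivative sd t) (at t)"
      unfolding s_def sd_def by (rule DERIV_cong[OF DERIV_add[OF dtrig(2,4)[OF t]]]) simp
    have dn: "((\<lambda>t. N1 t + N2 t) has_real_derivative Nd t) (at t)"
      unfolding Nd_def by (rule DERIV_add[OF dN1[OF t] dN2[OF t]])
    have nz: "s t \<noteq> 0" using s_pos[OF t] by simp
    show ?thesis
      unfolding \<Phi>_def
      by (rule DERIV_cong[OF DERIV_divide[OF DERIV_mult[OF dtrig(5)[OF t] dn] ds nz]])
        (use nz in \<open>simp add: \<Phi>'_def field_simps\<close>)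
  qed
  define F where "F = 2 * l / a"
  have F: "F > 0" using pos by (simp add: F_def)
  define H where "H = F * a + 2 * F * B"
  have H: "H > 0" using F B pos by (auto simp: H_def intro!: add_pos_pos)
  have \<Phi>_lower: "a / 8 * (\<omega>3 t)\<^sup>2 \<le> \<Phi>' t + H * (T1 t + T2 t) + H * Lam t"
    and \<Phi>_bound: "\<bar>\<Phi> t\<bar> \<le> 2 * F * P"
    and T_le: "T1 t + T2 t \<le> 2 * \<Psi>' t + 2 * D * Lam t"
    if t: "t \<ge> t0" and Q: "corner t" "S1 t * S2 t > 0" "\<bar>w1 t + w2 t - 2 * w3 t\<bar> \<le> l" for t
  proof -
    note geo = corner_geometry[OF t conjunct1[OF Q(1)[unfolded corner_def]] conjunct2[OF Q(1)[unfolded corner_def]]]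
    have s0: "s t > 0" by (rule s_pos[OF t])
    \<comment> \<open>\<open>q\<close> and \<open>f\<close> stay bounded as \<open>s\<close> tends
      to 0, the former by the same-sign geometry, the latter by \<open>cable_height\<close>.\<close>
    define q where "q = (c1 t + c2 t) / s t"
    have q: "1 / 2 \<le> q" "q \<le> 2" using geo(6,7)[OF Q(2)] s0 by (simp_all add: q_def s_def field_simps)
    define f where "f = S3 t / s t"
    have f: "\<bar>f\<bar> \<le> F" using cable_height[OF t] s0 by (simp add: f_def F_def s_def pos_divide_le_eq)
    have N: "N1 t + N2 t = a / 2 * \<omega>3 t * (q * s t)"
      unfolding N_eq[OF t] using s0 by (simp add: q_def distrib_left)
    have S3: "S3 t = f * s t" using s0 by (simp add: f_def)
    \<comment> \<open>The first term comes from the derivative of \<open>S3\<close> and is the gain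
      in \<open>\<omega>3\<^sup>2\<close>. The second brings in the tensions, and the third is only
      linear in \<open>\<omega>3\<close>, because \<open>sd\<close> is at most 1 in absolute
      value.\<close>
    have eq: "\<Phi>' t = a / 2 * (C3 t * q * (\<omega>3 t)\<^sup>2) + f * Nd t - f * (sd t * (a / 2 * \<omega>3 t * q))"
      unfolding \<Phi>'_def N S3 using s0 by (simp add: field_simps power2_eq_square)
    have "3 / 4 * (1 / 2) \<le> C3 t * q" using geo(5) q by (intro mult_mono) auto
    then have "3 / 8 * (\<omega>3 t)\<^sup>2 \<le> C3 t * q * (\<omega>3 t)\<^sup>2" by (intro mult_right_mono) auto
    then have "a / 2 * (3 / 8 * (\<omega>3 t)\<^sup>2) \<le> a / 2 * (C3 t * q * (\<omega>3 t)\<^sup>2)"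
      using pos(5) by (intro mult_left_mono) auto
    moreover have "0 \<le> a * (\<omega>3 t)\<^sup>2" using pos(5) by simp
    ultimately have 1: "a / 8 * (\<omega>3 t)\<^sup>2 \<le> a / 2 * (C3 t * q * (\<omega>3 t)\<^sup>2)" by linarith
    have "\<bar>Nd t\<bar> \<le> 2 * B * (T1 t + T2 t) + 2 * B * Lam t"
      using B(2,3)[OF t] unfolding Nd_def by linarith
    from abs_mult_le[OF f this] have 2: "\<bar>f * Nd t\<bar> \<le> 2 * F * B * (T1 t + T2 t) + 2 * F * B * Lam t"
      by (simp add: algebra_simps)
    have sd: "\<bar>sd t\<bar> \<le> 1" unfolding sd_def cos_sum_rate[OF t] using Q(3) pos by simp
    have "\<bar>a / 2 * \<omega>3 t * q\<bar> \<le> a / 2 * \<bar>\<omega>3 t\<bar> * 2"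
      unfolding abs_mult using q pos(5) by (intro mult_mono) auto
    from abs_mult_le[OF f abs_mult_le_right[OF sd this]]
    have 3: "\<bar>f * (sd t * (a / 2 * \<omega>3 t * q))\<bar> \<le> F * a * \<bar>\<omega>3 t\<bar>" by simp
    have "\<bar>\<omega>3 t\<bar> \<le> Lam t" using Lam_ge(2)[of t] by simp
    then have "F * a * \<bar>\<omega>3 t\<bar> \<le> F * a * Lam t" using F pos by (intro mult_left_mono) auto
    moreover have "2 * F * B * (T1 t + T2 t) \<le> H * (T1 t + T2 t)"
      using tension[OF t] F pos by (intro mult_right_mono) (auto simp: H_def)
    moreover have "H * Lam t = F * a * Lam t + 2 * F * B * Lam t" by (simp add: H_def distrib_right)
    ultimately show "a / 8 * (\<omega>3 t)\<^sup>2 \<le> \<Phi>' t + H * (T1 t + T2 t) + H * Lam t"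
      using 1 2 3 unfolding eq by linarith
    have "\<Phi> t = f * (N1 t + N2 t)" by (simp add: \<Phi>_def f_def)
    moreover have "\<bar>N1 t + N2 t\<bar> \<le> 2 * P" using P(2,3)[OF t] by linarith
    ultimately show "\<bar>\<Phi> t\<bar> \<le> 2 * F * P" using abs_mult_le[OF f] by (metis mult.assoc mult.commute)
    have "T1 t * (15 / 16) \<le> T1 t * (S1 t)\<^sup>2" "T2 t * (15 / 16) \<le> T2 t * (S2 t)\<^sup>2"
      using geo(1,2) tension[OF t] by (intro mult_left_mono; simp)+
    then show "T1 t + T2 t \<le> 2 * \<Psi>' t + 2 * D * Lam t"
      using D(2)[OF t] tension[OF t] unfolding \<Psi>'_def mult.assoc[of 2 D] by argo
  qed
  \<comment> \<open>The coefficient of \<open>Lam\<close> once \<open>T_le\<close> is inserted into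
    \<open>\<Phi>_lower\<close>. With the weight \<open>a / (16 * J)\<close>, half of
    \<open>a / 8 * (\<omega>3 t)\<^sup>2\<close> absorbs the quadratic part of
    \<open>Lam\<close>.\<close>
  define J where "J = H * (2 * D) + H"
  have J: "J > 0" using H D(1) by (auto simp: J_def intro!: add_pos_pos)
  have "a / (16 * J) > 0" using pos J by simp
  then obtain X where X: "X \<ge> 1"
    "\<And>t. t \<ge> t0 \<Longrightarrow> Lam t \<le> a / (16 * J) * (\<omega>3 t)\<^sup>2 + X * (1 + dis t)"
    by (rule Lam_young) blast
  obtain Y where Y: "Y \<ge> 1" "\<And>t. t \<ge> t0 \<Longrightarrow> Lam t \<le> 1 * (\<omega>3 t)\<^sup>2 + Y * (1 + dis t)"
    by (rule Lam_young[OF zero_less_one]) blast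
  \<comment> \<open>The resulting bound on \<open>\<omega>3\<^sup>2\<close> by
    \<open>\<Phi>'\<close>, \<open>\<Psi>'\<close> and dissipation is fed back into
    \<open>T_le\<close>, where \<open>Lam\<close> is the only remainder.\<close>
  define E where "E t = 2 * \<Psi> t + 2 * D * (16 / a) * (\<Phi> t + H * (2 * \<Psi> t))" for t
  define E' where "E' t = 2 * \<Psi>' t + 2 * D * (16 / a) * (\<Phi>' t + H * (2 * \<Psi>' t))" for t
  define C where "C = 2 * D + 2 * D * (16 / a) * (2 * F * P + H * (2 * D)) + 2 * D * (16 / a) * (J * X) + 2 * D * Y"
  have parts: "0 \<le> 2 * D" "0 \<le> 2 * D * (16 / a) * (2 * F * P + H * (2 * D))" "0 \<le> 2 * D * (16 / a) * (J * X)" "0 \<le> 2 * D * Y"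
    using D(1) F P(1) H J X(1) Y(1) pos by auto
  show ?thesis
    unfolding tension_budget_def
  proof (rule exI[of _ E], rule exI[of _ E'], rule exI[of _ C], intro conjI allI impI)
    show "0 \<le> C" using parts unfolding C_def by linarith
    fix t assume t: "t \<ge> t0" and "corner t \<and> S1 t * S2 t > 0 \<and> \<bar>w1 t + w2 t - 2 * w3 t\<bar> \<le> l"
    then have Q: "corner t" "S1 t * S2 t > 0" "\<bar>w1 t + w2 t - 2 * w3 t\<bar> \<le> l" by auto
    show "(E has_real_derivative E' t) (at t)"
      unfolding E_def E'_def by (intro DERIV_add DERIV_cmult d\<Psi>[OF t] d\<Phi>[OF t])
    have "\<bar>2 * \<Psi> t\<bar> \<le> 2 * D" using D(3)[OF t] by simp
    then have "\<bar>H * (2 * \<Psi> t)\<bar> \<le> H * (2 * D)" using H abs_mult_le[of H H "2 * \<Psi> t"] by simp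
    then have "\<bar>\<Phi> t + H * (2 * \<Psi> t)\<bar> \<le> 2 * F * P + H * (2 * D)" using \<Phi>_bound[OF t Q] by linarith
    then have "\<bar>2 * D * (16 / a) * (\<Phi> t + H * (2 * \<Psi> t))\<bar> \<le> 2 * D * (16 / a) * (2 * F * P + H * (2 * D))"
      by (intro abs_mult_le) (use D(1) pos in simp_all)
    then show "\<bar>E t\<bar> \<le> C"
      using \<open>\<bar>2 * \<Psi> t\<bar> \<le> 2 * D\<close> parts unfolding E_def C_def by linarith
    define Z where "Z = \<Phi>' t + H * (2 * \<Psi>' t)"
    have "H * (T1 t + T2 t) \<le> H * (2 * \<Psi>' t + 2 * D * Lam t)"
      using T_le[OF t Q] H by (intro mult_left_mono) auto
    then have "a / 8 * (\<omega>3 t)\<^sup>2 \<le> Z + J * Lam t"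
      using \<Phi>_lower[OF t Q] unfolding Z_def J_def by (simp add: algebra_simps)
    also have "J * Lam t \<le> J * (a / (16 * J) * (\<omega>3 t)\<^sup>2 + X * (1 + dis t))"
      using X(2)[OF t] J by (intro mult_left_mono) auto
    also have "\<dots> = a / 16 * (\<omega>3 t)\<^sup>2 + J * X * (1 + dis t)" using J by (simp add: distrib_left)
    finally have "a / 16 * (\<omega>3 t)\<^sup>2 \<le> Z + J * X * (1 + dis t)" by (simp add: field_simps)
    then have w: "(\<omega>3 t)\<^sup>2 \<le> 16 / a * (Z + J * X * (1 + dis t))" using pos(5) by (simp add: field_simps)
    have "T1 t + T2 t \<le> 2 * \<Psi>' t + 2 * D * Lam t" by (rule T_le[OF t Q])
    also have "2 * D * Lam t \<le> 2 * D * (16 / a * (Z + J * X * (1 + dis t)) + Y * (1 + dis t))"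
      using Y(2)[OF t] w D(1) by (intro mult_left_mono) auto
    finally have "T1 t + T2 t \<le> 2 * \<Psi>' t + 2 * D * (16 / a * (Z + J * X * (1 + dis t)) + Y * (1 + dis t))" by simp
    also have "\<dots> = E' t + (2 * D * (16 / a) * (J * X) + 2 * D * Y) * (1 + dis t)"
      unfolding E'_def Z_def[symmetric] by (simp only: distrib_left distrib_right mult.assoc add.assoc)
    also have "\<dots> \<le> E' t + C * (1 + dis t)"
      using parts dis_nonneg[of t] unfolding C_def by (intro add_left_mono mult_right_mono) auto
    finally show "T1 t + T2 t \<le> E' t + C * (1 + dis t)" .
  qed
qed

text \<open>For sines of opposite sign both tensions push the bar in the same horizontal direction,
  so the bounded momentum of the bar is already a budget. The factor 2 suffices because the sines
  exceed \<open>1 / 2\<close> in absolute value.\<close>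

lemma tension_budget_opposite_sign:
  "tension_budget (\<lambda>t. corner t \<and> S1 t > 0 \<and> S2 t < 0)" (is ?A)
  "tension_budget (\<lambda>t. corner t \<and> S1 t < 0 \<and> S2 t > 0)" (is ?B)
proof -
  obtain P where P: "P \<ge> 1" "\<And>t. t \<ge> t0 \<Longrightarrow> \<bar>u3 t\<bar> \<le> P"
    by (rule force_bounds) blast
  have bound: "\<bar>2 * m3 * u3 t\<bar> \<le> 2 * m3 * P" if "t \<ge> t0" for t
    using P(2)[OF that] pos(3) by (simp add: abs_mult)
  have d: "((\<lambda>t. 2 * m3 * u3 t) has_real_derivative 2 * (T2 t * S2 t - T1 t * S1 t)) (at t)" if "t \<ge> t0" for t
    by (rule DERIV_cong[OF DERIV_cmult[OF du3[OF that]]]) (use pos(3) in simp)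
  have C: "0 \<le> 2 * m3 * P" using pos(3) P by simp
  then have dis: "0 \<le> 2 * m3 * P * (1 + dis t)" for t using dis_nonneg[of t] by simp
  have half: "T / 2 \<le> T * s" if "s \<ge> 15 / 16" "T > 0" for T s :: real
    using mult_left_mono[of "1 / 2" s T] that by simp
  have sum: "T1 t / 2 \<le> T1 t * \<bar>S1 t\<bar>" "T2 t / 2 \<le> T2 t * \<bar>S2 t\<bar>" if t: "t \<ge> t0" and "corner t" for t
    using corner_geometry(3,4)[OF t] that(2) tension[OF t] by (auto simp: corner_def intro!: half)
  show ?A
    unfolding tension_budget_def
  proof (rule exI[of _ "\<lambda>t. - (2 * m3 * u3 t)"], rule exI[of _ "\<lambda>t. - (2 * (T2 t * S2 t - T1 t * S1 t))"],
      rule exI[of _ "2 * m3 * P"], intro conjI allI impI C)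
    fix t assume t: "t \<ge> t0" and Q: "corner t \<and> S1 t > 0 \<and> S2 t < 0"
    show "((\<lambda>t. - (2 * m3 * u3 t)) has_real_derivative - (2 * (T2 t * S2 t - T1 t * S1 t))) (at t)"
      by (rule DERIV_minus[OF d[OF t]])
    show "\<bar>- (2 * m3 * u3 t)\<bar> \<le> 2 * m3 * P" using bound[OF t] by simp
    have "T1 t / 2 \<le> T1 t * S1 t" "T2 t / 2 \<le> - (T2 t * S2 t)" using sum[OF t] Q by simp_all
    then show "T1 t + T2 t \<le> - (2 * (T2 t * S2 t - T1 t * S1 t)) + 2 * m3 * P * (1 + dis t)"
      using dis[of t] by argo
  qed
  show ?B
    unfolding tension_budget_def
  proof (rule exI[of _ "\<lambda>t. 2 * m3 * u3 t"], rule exI[of _ "\<lambda>t. 2 * (T2 t * S2 t - T1 t * S1 t)"],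
      rule exI[of _ "2 * m3 * P"], intro conjI allI impI C)
    fix t assume t: "t \<ge> t0" and Q: "corner t \<and> S1 t < 0 \<and> S2 t > 0"
    show "((\<lambda>t. 2 * m3 * u3 t) has_real_derivative 2 * (T2 t * S2 t - T1 t * S1 t)) (at t)"
      by (rule d[OF t])
    show "\<bar>2 * m3 * u3 t\<bar> \<le> 2 * m3 * P" using bound[OF t] by simp
    have "T1 t / 2 \<le> - (T1 t * S1 t)" "T2 t / 2 \<le> T2 t * S2 t" using sum[OF t] Q by simp_all
    then show "T1 t + T2 t \<le> 2 * (T2 t * S2 t - T1 t * S1 t) + 2 * m3 * P * (1 + dis t)"
      using dis[of t] by argo
  qed
qed

text \<open>The cables must carry the weight of the bar, but only through the factors \<open>C1\<close> and \<open>C2\<close>.\<close>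

lemma corner_exclusion:
  assumes "tension_budget Q"
  obtains \<epsilon> where "\<epsilon> > 0" "\<forall>\<^sub>F t in at_top. \<not> (\<forall>s\<in>{t..t + 1}. Q s \<and> C1 s + C2 s \<le> \<epsilon>)"
proof -
  obtain E E' C where E: "C \<ge> 0" "\<And>t. t \<ge> t0 \<Longrightarrow> Q t \<Longrightarrow> (E has_real_derivative E' t) (at t)"
    "\<And>t. t \<ge> t0 \<Longrightarrow> Q t \<Longrightarrow> \<bar>E t\<bar> \<le> C" "\<And>t. t \<ge> t0 \<Longrightarrow> Q t \<Longrightarrow> T1 t + T2 t \<le> E' t + C * (1 + dis t)"
    using assms unfolding tension_budget_def by blast
  \<comment> \<open>Bounds the time integral of the tensions over a unit window:
    \<open>2 * C\<close> from \<open>E\<close>, \<open>C\<close> from the length,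
    \<open>C * V t0\<close> from dissipation. With cosines of at most \<epsilon> the vertical
    impulse is then at most \<open>m3 * g / 2\<close>, while the nearly vanishing \<open>w3\<close>
    requires more.\<close>
  define Y where "Y = 3 * C + C * V t0 + 1"
  have Y: "Y > 0" using E(1) V0_nonneg by (simp add: Y_def add_nonneg_pos)
  define \<epsilon> where "\<epsilon> = m3 * g / (2 * Y)"
  have \<epsilon>: "\<epsilon> > 0" "\<epsilon> * Y = m3 * g / 2" using Y pos by (auto simp: \<epsilon>_def)
  show ?thesis
  proof (rule that[OF \<epsilon>(1)])
    have "\<forall>\<^sub>F t in at_top. dist (w3 t) 0 < g / 4"
      by (rule tendstoD[OF w3_tendsto_0]) (use pos in simp)
    then obtain N where N: "\<And>t. t \<ge> N \<Longrightarrow> \<bar>w3 t\<bar> < g / 4"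
      by (auto simp: eventually_at_top_linorder dist_real_def)
    show "\<forall>\<^sub>F t in at_top. \<not> (\<forall>s\<in>{t..t + 1}. Q s \<and> C1 s + C2 s \<le> \<epsilon>)"
      unfolding eventually_at_top_linorder
    proof (rule exI[of _ "max N t0"], intro allI impI notI)
      fix t assume t: "max N t0 \<le> t" and Q: "\<forall>s\<in>{t..t + 1}. Q s \<and> C1 s + C2 s \<le> \<epsilon>"
      \<comment> \<open>The vertical impulse of the tensions, up to a constant.\<close>
      define f where "f r = m3 * w3 r + m3 * g * r" for r
      define h where "h r = \<epsilon> * (E r + C * r - C * V r)" for r
      have df: "(f has_real_derivative T1 r * C1 r + T2 r * C2 r) (at r)" if "t \<le> r" "r \<le> t + 1" for r
        unfolding f_def
        by (rule DERIV_cong[OF DERIV_add[OF DERIV_cmult[OF dw3] DERIV_cmult_Id]])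
          (use that t pos(3) in \<open>auto simp: right_diff_distrib\<close>)
      have dh: "(h has_real_derivative \<epsilon> * (E' r + C * (1 + dis r))) (at r)" if "t \<le> r" "r \<le> t + 1" for r
        unfolding h_def
        by (rule DERIV_cong[OF DERIV_cmult[OF DERIV_diff[OF DERIV_add[OF E(2) DERIV_cmult_Id] DERIV_cmult[OF dV]]]])
          (use that t Q in \<open>auto simp: algebra_simps\<close>)
      have le: "T1 r * C1 r + T2 r * C2 r \<le> \<epsilon> * (E' r + C * (1 + dis r))" if r: "t \<le> r" "r \<le> t + 1" for r
      proof -
        have r0: "t0 \<le> r" using r t by simp
        have Qr: "Q r" "C1 r + C2 r \<le> \<epsilon>" using Q r by auto
        then have "C1 r \<le> \<epsilon>" "C2 r \<le> \<epsilon>" using trig_pos(1,2)[OF r0] by linarith+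
        then have "T1 r * C1 r \<le> T1 r * \<epsilon>" "T2 r * C2 r \<le> T2 r * \<epsilon>"
          using tension[OF r0] by (intro mult_left_mono; simp)+
        then have "T1 r * C1 r + T2 r * C2 r \<le> \<epsilon> * (T1 r + T2 r)" by (simp add: algebra_simps)
        also have "\<dots> \<le> \<epsilon> * (E' r + C * (1 + dis r))"
          using E(4)[OF r0 Qr(1)] \<epsilon>(1) by (intro mult_left_mono) auto
        finally show ?thesis .
      qed
      have diff: "f (t + 1) - f t \<le> h (t + 1) - h t"
        by (rule deriv_le_imp_diff_le[OF _ df dh le]) auto
      have "f (t + 1) - f t = m3 * (w3 (t + 1) - w3 t + g)" by (simp add: f_def algebra_simps)
      moreover have "m3 * (g / 2) < m3 * (w3 (t + 1) - w3 t + g)"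
        using N[of t] N[of "t + 1"] t pos(3) by (intro mult_strict_left_mono) auto
      moreover have "h (t + 1) - h t = \<epsilon> * (E (t + 1) - E t + C + C * (V t - V (t + 1)))"
        by (simp add: h_def algebra_simps)
      moreover have "\<epsilon> * (E (t + 1) - E t + C + C * (V t - V (t + 1))) \<le> \<epsilon> * Y"
      proof (rule mult_left_mono)
        have "V t - V (t + 1) \<le> V t0"
          using V_antimono[of t0 t] V_nonneg[of "t + 1"] t by simp
        then have "C * (V t - V (t + 1)) \<le> C * V t0" using E(1) by (intro mult_left_mono) auto
        moreover have "\<bar>E (t + 1)\<bar> \<le> C" "\<bar>E t\<bar> \<le> C" using E(3) Q t by auto
        ultimately show "E (t + 1) - E t + C + C * (V t - V (t + 1)) \<le> Y"
          unfolding Y_def by linarith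
      qed (use \<epsilon> in simp)
      ultimately show False using diff \<epsilon>(2) by simp
    qed
  qed
qed

text \<open>\<open>C1 + C2\<close> equals the slow function \<open>(h1 + h2 - 2 * h3) / l\<close>.
  If it is small at a late time, it is small on a unit window, where neither sine can vanish; the
  signs are then constant and one of the three exclusions applies.\<close>

lemma cables_not_horizontal:
  obtains \<kappa> where "\<kappa> > 0" "\<forall>\<^sub>F t in at_top. \<kappa> \<le> C1 t + C2 t"
proof -
  obtain \<epsilon>1 where e1: "\<epsilon>1 > 0" "\<forall>\<^sub>F t in at_top. \<not> (\<forall>s\<in>{t..t + 1}.
      (corner s \<and> S1 s * S2 s > 0 \<and> \<bar>w1 s + w2 s - 2 * w3 s\<bar> \<le> l) \<and> C1 s + C2 s \<le> \<epsilon>1)"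
    by (rule corner_exclusion[OF tension_budget_same_sign])
  obtain \<epsilon>2 where e2: "\<epsilon>2 > 0" "\<forall>\<^sub>F t in at_top. \<not> (\<forall>s\<in>{t..t + 1}.
      (corner s \<and> S1 s > 0 \<and> S2 s < 0) \<and> C1 s + C2 s \<le> \<epsilon>2)"
    by (rule corner_exclusion[OF tension_budget_opposite_sign(1)])
  obtain \<epsilon>3 where e3: "\<epsilon>3 > 0" "\<forall>\<^sub>F t in at_top. \<not> (\<forall>s\<in>{t..t + 1}.
      (corner s \<and> S1 s < 0 \<and> S2 s > 0) \<and> C1 s + C2 s \<le> \<epsilon>3)"
    by (rule corner_exclusion[OF tension_budget_opposite_sign(2)])
  \<comment> \<open>The last two entries force \<open>corner\<close>.\<close>
  define \<epsilon> where "\<epsilon> = Min {\<epsilon>1, \<epsilon>2, \<epsilon>3, 1 / 4, a / (4 * l)}"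
  have \<epsilon>: "\<epsilon> > 0" "\<epsilon> \<le> \<epsilon>1" "\<epsilon> \<le> \<epsilon>2" "\<epsilon> \<le> \<epsilon>3" "\<epsilon> \<le> 1 / 4" "\<epsilon> \<le> a / (4 * l)"
    using e1(1) e2(1) e3(1) pos unfolding \<epsilon>_def by auto
  have "\<forall>\<^sub>F t in at_top. dist (w1 t + w2 t - 2 * w3 t) (0 + 0 - 2 * 0) < l"
    by (intro tendstoD tendsto_intros vertical_tendsto_0 pos)
  then obtain N where N: "\<And>t. t \<ge> N \<Longrightarrow> \<bar>w1 t + w2 t - 2 * w3 t\<bar> \<le> l"
    by (auto simp: eventually_at_top_linorder dist_real_def intro: less_imp_le)
  have slow: "slow (\<lambda>t. 1 / l * (h1 t + h2 t - 2 * h3 t))"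
    by (intro slow_cmult slow_diff slow_add position_slow h3_slow)
  have sum: "1 / l * (h1 t + h2 t - 2 * h3 t) = C1 t + C2 t" if "t \<ge> t0" for t
  proof -
    have "h1 t + h2 t - 2 * h3 t = l * (C1 t + C2 t)"
      using geometry(2,4)[OF that] by (simp add: distrib_left)
    then show ?thesis using pos by simp
  qed
  have "\<epsilon> / 2 > 0" using \<epsilon> by simp
  have "\<forall>\<^sub>F t in at_top. \<epsilon> / 2 \<le> C1 t + C2 t"
    using e1(2) e2(2) e3(2) slowD[OF slow zero_less_one \<open>\<epsilon> / 2 > 0\<close>] eventually_ge_at_top[of "max N t0"]
  proof eventually_elim
    case (elim t)
    show ?case
    proof (rule ccontr)
      assume "\<not> \<epsilon> / 2 \<le> C1 t + C2 t"
      then have small: "C1 s + C2 s \<le> \<epsilon>" if "s \<in> {t..t + 1}" for s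
      proof -
        have "\<bar>1 / l * (h1 s + h2 s - 2 * h3 s) - 1 / l * (h1 t + h2 t - 2 * h3 t)\<bar> < \<epsilon> / 2"
          using elim(4) that by blast
        then have "\<bar>(C1 s + C2 s) - (C1 t + C2 t)\<bar> < \<epsilon> / 2" using sum[of s] sum[of t] that elim(5) by simp
        then show ?thesis using \<open>\<not> \<epsilon> / 2 \<le> C1 t + C2 t\<close> by linarith
      qed
      have corner: "corner s" if "s \<in> {t..t + 1}" for s
      proof -
        have "C1 s + C2 s \<le> a / (4 * l)" using small[OF that] \<epsilon> by linarith
        then have "2 * l / a * (C1 s + C2 s) \<le> 2 * l / a * (a / (4 * l))" using pos by (intro mult_left_mono) auto
        then show ?thesis using small[OF that] \<epsilon> pos by (simp add: corner_def)
      qed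
      have nz: "S1 s \<noteq> 0" "S2 s \<noteq> 0" if "s \<in> {t..t + 1}" for s
        using corner_geometry(3,4)[of s] corner[OF that] that elim(5) by (auto simp: corner_def)
      have "isCont S1 s" "isCont S2 s" if "s \<in> {t..t + 1}" for s
        using DERIV_isCont[OF dtrig(1)[of s]] DERIV_isCont[OF dtrig(3)[of s]] that elim(5) by simp_all
      then have cont: "continuous_on {t..t + 1} S1" "continuous_on {t..t + 1} S2"
        by (auto intro!: continuous_at_imp_continuous_on)
      have rate: "\<bar>w1 s + w2 s - 2 * w3 s\<bar> \<le> l" if "s \<in> {t..t + 1}" for s using N elim(5) that by simp
      have le: "C1 s + C2 s \<le> \<epsilon>1" "C1 s + C2 s \<le> \<epsilon>2" "C1 s + C2 s \<le> \<epsilon>3" if "s \<in> {t..t + 1}" for s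
        using small[OF that] \<epsilon> by linarith+
      have "(\<forall>r\<in>{t..t + 1}. 0 < S1 r) \<or> (\<forall>r\<in>{t..t + 1}. S1 r < 0)"
        by (rule constant_sign[OF cont(1) nz(1)])
      moreover have "(\<forall>r\<in>{t..t + 1}. 0 < S2 r) \<or> (\<forall>r\<in>{t..t + 1}. S2 r < 0)"
        by (rule constant_sign[OF cont(2) nz(2)])
      ultimately show False
      proof (elim disjE)
        assume "\<forall>r\<in>{t..t + 1}. 0 < S1 r" "\<forall>r\<in>{t..t + 1}. 0 < S2 r"
        then show False using elim(1) corner rate le by (simp add: zero_less_mult_iff)
      next
        assume "\<forall>r\<in>{t..t + 1}. S1 r < 0" "\<forall>r\<in>{t..t + 1}. S2 r < 0"
        then show False using elim(1) corner rate le by (simp add: zero_less_mult_iff)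
      next
        assume "\<forall>r\<in>{t..t + 1}. 0 < S1 r" "\<forall>r\<in>{t..t + 1}. S2 r < 0"
        then show False using elim(2) corner le by simp
      next
        assume "\<forall>r\<in>{t..t + 1}. S1 r < 0" "\<forall>r\<in>{t..t + 1}. 0 < S2 r"
        then show False using elim(3) corner le by simp
      qed
    qed
  qed
  then show ?thesis using that[of "\<epsilon> / 2"] \<epsilon>(1) by simp
qed

end

subsection \<open>Bounded rotation\<close>

text \<open>At the last point \<open>p\<close> up to \<open>q\<close> with
  \<open>f p \<le> c\<close> the derivative is negative, so \<open>f\<close> would remain below
  \<open>c\<close> a little longer.\<close>

lemma stays_below:
  fixes f :: "real \<Rightarrow> real"
  assumes df: "\<And>r. s \<le> r \<Longrightarrow> r \<le> t \<Longrightarrow> (f has_real_derivative f' r) (at r)"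
    and neg: "\<And>r. s \<le> r \<Longrightarrow> r \<le> t \<Longrightarrow> f r \<le> c \<Longrightarrow> f' r < 0"
    and start: "f s \<le> c" and q: "s \<le> q" "q \<le> t"
  shows "f q \<le> c"
proof (rule ccontr)
  assume "\<not> f q \<le> c"
  define B where "B = {s..q} \<inter> f -` {..c}"
  have "isCont f r" if "r \<in> {s..q}" for r
    using DERIV_isCont[OF df[of r]] that q by simp
  then have "continuous_on {s..q} f" by (simp add: continuous_at_imp_continuous_on)
  then have "closed B" unfolding B_def by (rule continuous_closed_preimage) auto
  then have "compact B"
    unfolding compact_eq_bounded_closed B_def by (auto intro: bounded_subset[OF bounded_closed_interval])
  moreover have "s \<in> B" using start q by (simp add: B_def)
  ultimately obtain p where p: "p \<in> B" "\<And>r. r \<in> B \<Longrightarrow> r \<le> p"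
    using compact_attains_sup[of B] by blast
  have "p < q" using p(1) \<open>\<not> f q \<le> c\<close> by (cases "p = q") (auto simp: B_def)
  have "f' p < 0" using neg[of p] p(1) q by (simp add: B_def)
  then obtain d where d: "d > 0" "\<And>h. 0 < h \<Longrightarrow> h < d \<Longrightarrow> f (p + h) < f p"
    using DERIV_neg_dec_right[OF df[of p]] p(1) q by (auto simp: B_def)
  define h where "h = min (d / 2) (q - p)"
  have h: "0 < h" "h < d" "p + h \<le> q" using d(1) \<open>p < q\<close> by (auto simp: h_def)
  then have "p + h \<in> B" using d(2)[OF h(1,2)] p(1) by (simp add: B_def)
  then show False using p(2) h(1) by force
qed

context drone_bar_motion
begin

section \<open>Persistence of the alignment of cables and bar\<close>

lemma dsin_rel:
  assumes t: "t \<ge> t0"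
  shows "(s1 has_real_derivative c1 t * (\<omega>1 t - \<omega>3 t)) (at t)"
    "(s2 has_real_derivative c2 t * (\<omega>2 t + \<omega>3 t)) (at t)"
  using deriv_angle(1,2,3)[OF t] by (auto intro!: derivative_eq_intros)

text \<open>In the derivative \<open>c1 * (\<omega>1 - \<omega>3)\<close> of \<open>s1\<close> the
  factor \<open>c1\<close> tames both angular velocities, since \<open>\<omega>3 * c1\<close> is
  bounded and \<open>\<bar>\<omega>1\<bar>\<close> is of order
  \<open>1 + \<bar>\<omega>3\<bar>\<close>. Alignment thus changes at bounded speed even where the
  rotation is not yet bounded.\<close>

lemma sin_rel_lipschitz:
  obtains L where "L > 0" "\<And>s t. t0 \<le> s \<Longrightarrow> t0 \<le> t \<Longrightarrow> \<bar>s1 s - s1 t\<bar> \<le> L * \<bar>s - t\<bar>"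
    "\<And>s t. t0 \<le> s \<Longrightarrow> t0 \<le> t \<Longrightarrow> \<bar>s2 s - s2 t\<bar> \<le> L * \<bar>s - t\<bar>"
proof -
  obtain P where P: "P \<ge> 1"
    "\<And>t. t \<ge> t0 \<Longrightarrow> \<bar>\<omega>1 t\<bar> \<le> P * (1 + \<bar>\<omega>3 t\<bar>)" "\<And>t. t \<ge> t0 \<Longrightarrow> \<bar>\<omega>2 t\<bar> \<le> P * (1 + \<bar>\<omega>3 t\<bar>)"
    "\<And>t. t \<ge> t0 \<Longrightarrow> \<bar>\<omega>3 t * c1 t\<bar> \<le> P" "\<And>t. t \<ge> t0 \<Longrightarrow> \<bar>\<omega>3 t * c2 t\<bar> \<le> P"
    by (rule force_bounds) blast
  define L where "L = P * (1 + P) + P"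
  have L: "L > 0" using P(1) by (simp add: L_def add_pos_pos)
  have rate: "\<bar>c * (\<omega> + x)\<bar> \<le> L" if "0 < c" "c \<le> 1" "\<bar>\<omega>\<bar> \<le> P * (1 + \<bar>x\<bar>)" "\<bar>x * c\<bar> \<le> P" for c \<omega> x
  proof -
    have "\<bar>c * \<omega>\<bar> = c * \<bar>\<omega>\<bar>" using that by (simp add: abs_mult)
    also have "\<dots> \<le> c * (P * (1 + \<bar>x\<bar>))" using that by (intro mult_left_mono) auto
    also have "\<dots> = P * (c + \<bar>x * c\<bar>)" using that by (simp add: abs_mult algebra_simps)
    also have "\<dots> \<le> P * (1 + P)" using that P(1) by (intro mult_left_mono add_mono) auto
    finally have "\<bar>c * \<omega>\<bar> \<le> P * (1 + P)" .
    moreover have "c * (\<omega> + x) = c * \<omega> + x * c" by (simp add: algebra_simps)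
    ultimately show ?thesis using that(4) unfolding L_def by linarith
  qed
  have le: "\<bar>f s - f t\<bar> \<le> L * \<bar>s - t\<bar>"
    if "\<And>r. r \<ge> t0 \<Longrightarrow> (f has_real_derivative f' r) (at r)" "\<And>r. r \<ge> t0 \<Longrightarrow> \<bar>f' r\<bar> \<le> L" "t0 \<le> s" "t0 \<le> t"
    for f f' s t
    using deriv_bound_imp_diff_bound(3)[of s t f f' L] deriv_bound_imp_diff_bound(3)[of t s f f' L] that
    by (cases "s \<le> t") (auto simp: abs_minus_commute)
  show ?thesis
  proof (rule that[OF L])
    fix s t assume st: "t0 \<le> s" "t0 \<le> t"
    show "\<bar>s1 s - s1 t\<bar> \<le> L * \<bar>s - t\<bar>"
    proof (rule le[OF dsin_rel(1) _ st])
      fix r assume r: "t0 \<le> r"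
      show "\<bar>c1 r * (\<omega>1 r - \<omega>3 r)\<bar> \<le> L"
        using rate[of "c1 r" "\<omega>1 r" "- \<omega>3 r"] trig_pos[OF r] P(2,4)[OF r] by simp
    qed
    show "\<bar>s2 s - s2 t\<bar> \<le> L * \<bar>s - t\<bar>"
    proof (rule le[OF dsin_rel(2) _ st])
      fix r assume r: "t0 \<le> r"
      show "\<bar>c2 r * (\<omega>2 r + \<omega>3 r)\<bar> \<le> L"
        using rate[of "c2 r" "\<omega>2 r" "\<omega>3 r"] trig_pos[OF r] P(3,5)[OF r] by simp
    qed
  qed
qed

lemma cos_small_if_sin_near_1:
  fixes \<nu> \<psi> x :: real
  assumes "1 - \<nu> \<le> \<bar>sin x\<bar>" "2 * \<nu> \<le> \<psi>\<^sup>2" "\<psi> \<ge> 0"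
  shows "\<bar>cos x\<bar> \<le> \<psi>"
proof -
  have "0 \<le> \<nu>" using assms(1) abs_sin_le_one[of x] by linarith
  then have "(1 - \<bar>sin x\<bar>) * (1 + \<bar>sin x\<bar>) \<le> \<nu> * 2"
    using assms by (intro mult_mono) auto
  then have "(cos x)\<^sup>2 \<le> \<psi>\<^sup>2"
    using assms(2) unfolding cos_squared_eq by (simp add: algebra_simps power2_eq_square)
  then show ?thesis using assms(3) by (simp add: abs_le_square_iff[symmetric])
qed

text \<open>
  Both drones on the line through the bar, one beyond its left end and the other over it:
  this is an extremal position of the linkage, so it persists as long as the drones hardly move.
\<close>

lemma stays_aligned:
  assumes "\<psi> > 0"
  obtains \<epsilon> \<tau> where "\<epsilon> > 0" "\<tau> > 0" "\<forall>\<^sub>F t in at_top. s1 t \<ge> 1 - \<epsilon> \<longrightarrow> s2 t \<le> - 1 + \<epsilon> \<longrightarrow>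
    (\<forall>s. \<bar>s - t\<bar> \<le> \<tau> \<longrightarrow> s > t0 \<and> s1 s \<ge> 1 - \<psi> \<and> s2 s \<le> - 1 + \<psi> \<and> c1 s \<le> \<psi> \<and> c2 s \<le> \<psi> \<and> \<bar>S3 s - S3 t\<bar> \<le> \<psi>)"
proof -
  obtain L where L: "L > 0" "\<And>s t. t0 \<le> s \<Longrightarrow> t0 \<le> t \<Longrightarrow> \<bar>s1 s - s1 t\<bar> \<le> L * \<bar>s - t\<bar>"
    "\<And>s t. t0 \<le> s \<Longrightarrow> t0 \<le> t \<Longrightarrow> \<bar>s2 s - s2 t\<bar> \<le> L * \<bar>s - t\<bar>"
    by (rule sin_rel_lipschitz) blast
  define \<zeta> where "\<zeta> = min \<psi> 1 / 8"
  have \<zeta>: "\<zeta> > 0" "\<zeta> \<le> \<psi> / 8" "\<zeta> \<le> 1 / 8" using assms by (auto simp: \<zeta>_def)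
  define \<nu> where "\<nu> = \<zeta>\<^sup>2 / 2"
  have "\<zeta> * \<zeta> \<le> \<zeta> * 1" using \<zeta> by (intro mult_left_mono) auto
  then have \<nu>: "\<nu> > 0" "\<nu> \<le> \<zeta>" "2 * \<nu> \<le> \<zeta>\<^sup>2" using \<zeta> by (auto simp: \<nu>_def power2_eq_square)
  define \<tau> where "\<tau> = \<nu> / (2 * L)"
  have \<tau>: "\<tau> > 0" "L * \<tau> = \<nu> / 2" using \<nu> L by (auto simp: \<tau>_def)
  have slow: "slow (\<lambda>t. h3 t - h1 t)" by (intro slow_diff h3_slow position_slow)
  have "2 * \<tau> > 0" "l * \<psi> / 4 > 0" using \<tau> assms pos by auto
  then obtain N where N: "\<And>t s. t \<ge> N \<Longrightarrow> s \<in> {t..t + 2 * \<tau>} \<Longrightarrow> \<bar>(h3 s - h1 s) - (h3 t - h1 t)\<bar> < l * \<psi> / 4"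
    using slowD[OF slow, of "2 * \<tau>" "l * \<psi> / 4"] unfolding eventually_at_top_linorder by blast
  show ?thesis
  proof (rule that[of "\<nu> / 2" \<tau>])
    show "\<forall>\<^sub>F t in at_top. s1 t \<ge> 1 - \<nu> / 2 \<longrightarrow> s2 t \<le> - 1 + \<nu> / 2 \<longrightarrow>
      (\<forall>s. \<bar>s - t\<bar> \<le> \<tau> \<longrightarrow> s > t0 \<and> s1 s \<ge> 1 - \<psi> \<and> s2 s \<le> - 1 + \<psi> \<and> c1 s \<le> \<psi> \<and> c2 s \<le> \<psi> \<and> \<bar>S3 s - S3 t\<bar> \<le> \<psi>)"
      unfolding eventually_at_top_linorder
    proof (rule exI[of _ "max N t0 + \<tau> + 1"], intro allI impI)
      fix t s assume t: "max N t0 + \<tau> + 1 \<le> t" and near: "1 - \<nu> / 2 \<le> s1 t" "s2 t \<le> - 1 + \<nu> / 2" and s: "\<bar>s - t\<bar> \<le> \<tau>"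
      have st0: "t0 < s" "t0 \<le> s" "t0 \<le> t" using s t \<tau> by linarith+
      have "L * \<bar>s - t\<bar> \<le> L * \<tau>" using s L by (intro mult_left_mono) auto
      then have sn: "1 - \<nu> \<le> s1 s" "s2 s \<le> - 1 + \<nu>"
        using L(2,3)[OF st0(2,3)] near \<tau>(2) by linarith+
      have cs: "c1 r \<le> \<zeta>" "c2 r \<le> \<zeta>" if "1 - \<nu> \<le> s1 r" "s2 r \<le> - 1 + \<nu>" for r
      proof -
        have "\<bar>c1 r\<bar> \<le> \<zeta>" "\<bar>c2 r\<bar> \<le> \<zeta>"
          by (rule cos_small_if_sin_near_1[OF _ \<nu>(3)]; use that \<zeta> in linarith)+
        then show "c1 r \<le> \<zeta>" "c2 r \<le> \<zeta>" by linarith+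
      qed
      have near': "1 - \<nu> \<le> s1 t" "s2 t \<le> - 1 + \<nu>" using near \<nu> by linarith+
      \<comment> \<open>In the aligned position \<open>C1\<close> is nearly \<open>- S3\<close>, so
        \<open>h3 - h1\<close> is nearly \<open>(l + a / 2) * S3\<close>, and the slowness of the
        heights passes to \<open>S3\<close>.\<close>
      have S3: "\<bar>(l + a / 2) * S3 r - (h3 r - h1 r)\<bar> \<le> 2 * l * \<zeta>" if r: "t0 \<le> r" "1 - \<nu> \<le> s1 r" "s2 r \<le> - 1 + \<nu>" for r
      proof -
        have "C1 r = cos ((\<theta>1 r - \<theta>3 r) + \<theta>3 r)" by simp
        then have C1: "C1 r = c1 r * C3 r - s1 r * S3 r" unfolding cos_add .
        have eq: "(l + a / 2) * S3 r - (h3 r - h1 r) = l * (c1 r * C3 r + (1 - s1 r) * S3 r)"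
          unfolding geometry(2)[OF r(1)] C1 by (simp add: algebra_simps)
        have "\<bar>c1 r * C3 r\<bar> \<le> \<zeta> * 1"
          by (rule abs_mult_le) (use cs(1)[OF r(2,3)] trig_pos[OF r(1)] in auto)
        moreover have "\<bar>(1 - s1 r) * S3 r\<bar> \<le> \<zeta> * 1"
          by (rule abs_mult_le) (use r(2) \<nu> sin_le_one[of "\<theta>1 r - \<theta>3 r"] in auto)
        ultimately have "\<bar>c1 r * C3 r + (1 - s1 r) * S3 r\<bar> \<le> 2 * \<zeta>" by linarith
        then show ?thesis unfolding eq abs_mult using pos(6) by simp
      qed
      have "\<bar>(h3 s - h1 s) - (h3 t - h1 t)\<bar> < l * \<psi> / 2"
      proof -
        \<comment> \<open>\<open>slow\<close> looks forward only, so both times are compared with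
          the start of a window of length \<open>2 * \<tau>\<close>.\<close>
        have "t - \<tau> \<ge> N" "s \<in> {t - \<tau>..t - \<tau> + 2 * \<tau>}" "t \<in> {t - \<tau>..t - \<tau> + 2 * \<tau>}"
          using s t \<tau>(1) by auto
        then have "\<bar>(h3 s - h1 s) - (h3 (t - \<tau>) - h1 (t - \<tau>))\<bar> < l * \<psi> / 4"
          "\<bar>(h3 t - h1 t) - (h3 (t - \<tau>) - h1 (t - \<tau>))\<bar> < l * \<psi> / 4"
          using N by blast+
        then show ?thesis by argo
      qed
      then have "\<bar>(l + a / 2) * S3 s - (l + a / 2) * S3 t\<bar> \<le> l * \<psi> / 2 + 4 * l * \<zeta>"
        using S3[OF st0(2) sn] S3[OF st0(3) near'] by linarith
      also have "\<dots> \<le> l * \<psi> / 2 + 4 * l * (\<psi> / 8)" using \<zeta>(2) pos(6) by (intro add_left_mono mult_left_mono) auto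
      also have "\<dots> = l * \<psi>" by simp
      also have "\<dots> \<le> (l + a / 2) * \<psi>" using assms pos by (intro mult_right_mono) auto
      finally have "(l + a / 2) * \<bar>S3 s - S3 t\<bar> \<le> (l + a / 2) * \<psi>"
        using pos by (simp add: right_diff_distrib[symmetric] abs_mult)
      then have "\<bar>S3 s - S3 t\<bar> \<le> \<psi>" using pos by (simp add: add_pos_pos)
      moreover have "\<nu> \<le> \<psi>" "\<zeta> \<le> \<psi>" using \<nu> \<zeta> by linarith+
      ultimately show "t0 < s \<and> 1 - \<psi> \<le> s1 s \<and> s2 s \<le> - 1 + \<psi> \<and> c1 s \<le> \<psi> \<and> c2 s \<le> \<psi> \<and> \<bar>S3 s - S3 t\<bar> \<le> \<psi>"
        using sn cs[OF sn] st0(1) by (intro conjI; linarith)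
    qed
  qed (use \<nu> \<tau> in auto)
qed

lemma tension_part_bound:
  fixes T T' e m m' :: real
  assumes "T > 0" "T' > 0" "\<bar>e\<bar> \<le> 1" "m > 0" "m' > 0"
  shows "T / m + (T - T' * e) / m' \<le> (1 / m + 1 / m') * (T + T')"
proof -
  have "\<bar>T' * e\<bar> \<le> T'" using abs_mult_le[of T' T' e 1] assms by simp
  then have "(T - T' * e) / m' \<le> (T + T') / m'" using assms by (intro divide_right_mono) auto
  moreover have "T / m \<le> (T + T') / m" using assms by (simp add: divide_right_mono)
  moreover have "(1 / m + 1 / m') * (T + T') = (T + T') / m + (T + T') / m'" by (simp add: distrib_right)
  ultimately show ?thesis by linarith
qed

text \<open>
  Near the hanging bar (\<open>\<theta>3\<close> close to \<open>-pi/2\<close>) a fast rotation always decelerates: if it did not,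
  the second equation of motion would bound the tensions, and then the first one the rotation.
  Here \<open>a \<le> 2 * l\<close> is forced by the bar centre being below the second drone.
\<close>

lemma vertical_deceleration:
  obtains \<psi> M where "\<psi> > 0" "M > 0"
    "\<And>t. t > t0 \<Longrightarrow> s1 t \<ge> 1 - \<psi> \<Longrightarrow> s2 t \<le> - 1 + \<psi> \<Longrightarrow> S3 t \<le> - 1 + \<psi> \<Longrightarrow> \<bar>\<omega>3 t\<bar> \<ge> M \<Longrightarrow> \<alpha>3 t < 0"
proof (cases "a \<le> 2 * l")
  case False
  \<comment> \<open>The threshold at which even a vertical second cable cannot keep its drone above
    the bar centre.\<close>
  define \<psi> where "\<psi> = 1 - 2 * l / a"
  have "\<psi> > 0" using False pos by (simp add: \<psi>_def)
  moreover have "\<not> S3 t \<le> - 1 + \<psi>" if t: "t > t0" for t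
  proof
    assume "S3 t \<le> - 1 + \<psi>"
    then have "a / 2 * S3 t \<le> a / 2 * (- (2 * l / a))" using pos by (intro mult_left_mono) (auto simp: \<psi>_def)
    then have "a / 2 * S3 t \<le> - l" using pos by simp
    moreover have "l * C2 t \<le> l * 1" using pos by (intro mult_left_mono) auto
    ultimately show False using geometry(4)[of t] under(2)[of t] t by simp
  qed
  ultimately show ?thesis using that[of \<psi> 1] by simp
next
  case True
  obtain P where P: "P \<ge> 1"
    "\<And>t. t \<ge> t0 \<Longrightarrow> \<bar>G1 t\<bar> \<le> P + P * (\<bar>S1 t\<bar> * (\<Theta> t * \<bar>u1 t\<bar>))"
    "\<And>t. t \<ge> t0 \<Longrightarrow> \<bar>G2 t\<bar> \<le> P + P * (\<bar>S2 t\<bar> * (\<Theta> t * \<bar>u2 t\<bar>))"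
    "\<And>t. t \<ge> t0 \<Longrightarrow> \<bar>p1 t\<bar> \<le> P" "\<And>t. t \<ge> t0 \<Longrightarrow> \<bar>p2 t\<bar> \<le> P"
    "\<And>t. t \<ge> t0 \<Longrightarrow> \<bar>\<omega>1 t\<bar> \<le> P * (1 + \<bar>\<omega>3 t\<bar>)" "\<And>t. t \<ge> t0 \<Longrightarrow> \<bar>\<omega>2 t\<bar> \<le> P * (1 + \<bar>\<omega>3 t\<bar>)"
    "\<And>t. t \<ge> t0 \<Longrightarrow> \<Theta> t \<le> P * (1 + (\<omega>3 t)\<^sup>2)"
    "\<And>t. t \<ge> t0 \<Longrightarrow> \<bar>u1 t\<bar> \<le> P" "\<And>t. t \<ge> t0 \<Longrightarrow> \<bar>u2 t\<bar> \<le> P"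
    by (rule force_bounds) blast
  \<comment> \<open>Once the tensions are bounded by \<open>2 * m3 * W\<close>, the first equation
    of motion gives \<open>a / 4 * x\<^sup>2 \<le> M1 * W\<close>.\<close>
  define M1 where "M1 = (1 / m1 + 1 / m3) * (2 * m3) + 1"
  have M1: "M1 > 0" "M1 \<ge> 1" using pos by (auto simp: M1_def intro!: add_nonneg_pos mult_nonneg_nonneg)
  \<comment> \<open>The damping part of \<open>W\<close> is quadratic in the rotation, just like the
    gain \<open>a / 4 * x\<^sup>2\<close>. It has to be made small, not merely bounded, and this is
    done by its factor \<open>S1\<close> or \<open>S2\<close>, of absolute value at most
    \<open>\<sigma>'\<close>.\<close>
  define \<sigma>' where "\<sigma>' = min 1 (a / (16 * M1 * P ^ 3))"
  have \<sigma>': "\<sigma>' > 0" "\<sigma>' \<le> 1" "M1 * (\<sigma>' * P ^ 3) \<le> a / 16"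
  proof -
    have "0 < M1 * P ^ 3" using M1 P(1) by simp
    then show "\<sigma>' > 0" "\<sigma>' \<le> 1" using pos(5) by (auto simp: \<sigma>'_def mult.assoc)
    have "\<sigma>' * (M1 * P ^ 3) \<le> a / (16 * M1 * P ^ 3) * (M1 * P ^ 3)"
      using \<open>0 < M1 * P ^ 3\<close> by (intro mult_right_mono) (auto simp: \<sigma>'_def)
    also have "\<dots> = a / 16" using \<open>0 < M1 * P ^ 3\<close> M1 P(1) by (simp add: field_simps)
    finally show "M1 * (\<sigma>' * P ^ 3) \<le> a / 16" by (simp add: algebra_simps)
  qed
  define \<psi> where "\<psi> = \<sigma>'\<^sup>2 / 8"
  have \<psi>: "\<psi> > 0" "\<psi> \<le> 1 / 8" "2 * \<psi> \<le> (\<sigma>' / 2)\<^sup>2"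
    using \<sigma>' by (auto simp: \<psi>_def power_divide power2_eq_square mult_le_one)
  define Q where "Q = M1 * (P + P * P + a / (2 * l) * P)"
  have Q: "Q > 0" using M1 P(1) pos by (auto simp: Q_def intro!: mult_pos_pos add_pos_pos)
  define M where "M = 1 + (16 / a) * (2 * Q + a)"
  have M: "M \<ge> 1" "(16 / a) * (2 * Q + a) < M" using Q pos by (auto simp: M_def)
  show ?thesis
  proof (rule that[OF \<psi>(1)])
    show "M > 0" using M by simp
    fix t assume t: "t > t0" and near: "s1 t \<ge> 1 - \<psi>" "s2 t \<le> - 1 + \<psi>" "S3 t \<le> - 1 + \<psi>" and large: "\<bar>\<omega>3 t\<bar> \<ge> M"
    have t': "t \<ge> t0" using t by simp
    define x where "x = \<bar>\<omega>3 t\<bar>"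
    have x: "x \<ge> M" "x \<ge> 1" "x\<^sup>2 = (\<omega>3 t)\<^sup>2" using large M by (auto simp: x_def)
    note T = tension[OF t'] and C = trig_pos[OF t']
    have c: "\<bar>c1 t\<bar> \<le> \<sigma>' / 2" "\<bar>c2 t\<bar> \<le> \<sigma>' / 2" "\<bar>C3 t\<bar> \<le> \<sigma>' / 2"
      by (rule cos_small_if_sin_near_1[OF _ \<psi>(3)]; use near \<sigma>' in linarith)+
    have S1: "\<bar>S1 t\<bar> \<le> \<sigma>'"
    proof -
      have "S1 t = sin ((\<theta>1 t - \<theta>3 t) + \<theta>3 t)" by simp
      then have "S1 t = s1 t * C3 t + c1 t * S3 t" unfolding sin_add .
      moreover have "\<bar>s1 t * C3 t\<bar> \<le> \<sigma>' / 2" by (rule abs_mult_le_right[OF abs_sin_le_one c(3)])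
      moreover have "\<bar>S3 t * c1 t\<bar> \<le> \<sigma>' / 2" by (rule abs_mult_le_right[OF abs_sin_le_one c(1)])
      ultimately show ?thesis by (simp add: mult.commute)
    qed
    have S2: "\<bar>S2 t\<bar> \<le> \<sigma>'"
    proof -
      have "S2 t = sin ((\<theta>2 t + \<theta>3 t) - \<theta>3 t)" by simp
      then have "S2 t = s2 t * C3 t - c2 t * S3 t" unfolding sin_diff .
      moreover have "\<bar>s2 t * C3 t\<bar> \<le> \<sigma>' / 2" by (rule abs_mult_le_right[OF abs_sin_le_one c(3)])
      moreover have "\<bar>S3 t * c2 t\<bar> \<le> \<sigma>' / 2" by (rule abs_mult_le_right[OF abs_sin_le_one c(2)])
      ultimately show ?thesis by (simp add: mult.commute)
    qed
    have G: "P + P * (\<bar>S\<bar> * (\<Theta> t * \<bar>u\<bar>)) \<le> P + \<sigma>' * P ^ 3 * (1 + x\<^sup>2)" if "\<bar>S\<bar> \<le> \<sigma>'" "\<bar>u\<bar> \<le> P" for S u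
    proof -
      have "\<Theta> t * \<bar>u\<bar> \<le> (P * (1 + x\<^sup>2)) * P" 
      proof (rule mult_mono[OF _ that(2)])
        show "\<Theta> t \<le> P * (1 + x\<^sup>2)" using P(8)[OF t'] unfolding x(3) .
      qed (use P(1) in auto)
      then have "\<bar>S\<bar> * (\<Theta> t * \<bar>u\<bar>) \<le> \<sigma>' * ((P * (1 + x\<^sup>2)) * P)"
        by (rule mult_mono[OF that(1)]) (use \<sigma>' in auto)
      then have "P * (\<bar>S\<bar> * (\<Theta> t * \<bar>u\<bar>)) \<le> P * (\<sigma>' * ((P * (1 + x\<^sup>2)) * P))" using P(1) by (intro mult_left_mono) auto
      also have "\<dots> = \<sigma>' * P ^ 3 * (1 + x\<^sup>2)" by (simp add: power3_eq_cube)
      finally show ?thesis by simp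
    qed
    define W where "W = P + P * P * (1 + x) + a / (2 * l) * P * x + \<sigma>' * P ^ 3 * (1 + x\<^sup>2)"
    have W: "\<bar>g'\<bar> + \<bar>\<omega> * p\<bar> + \<bar>a / (2 * l) * s * (\<omega>3 t * p)\<bar> \<le> W"
      if "\<bar>g'\<bar> \<le> P + P * (\<bar>S\<bar> * (\<Theta> t * \<bar>u\<bar>))" "\<bar>S\<bar> \<le> \<sigma>'" "\<bar>u\<bar> \<le> P" "\<bar>\<omega>\<bar> \<le> P * (1 + \<bar>\<omega>3 t\<bar>)" "\<bar>p\<bar> \<le> P" "\<bar>s\<bar> \<le> 1"
      for g' S u \<omega> p s
    proof -
      have 1: "\<bar>\<omega> * p\<bar> \<le> P * P * (1 + x)" using abs_mult_le[OF that(4,5)] by (simp add: x_def algebra_simps)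
      have "\<bar>\<omega>3 t * p\<bar> \<le> x * P" by (rule abs_mult_le) (use that(5) in \<open>auto simp: x_def\<close>)
      then have "\<bar>s * (\<omega>3 t * p)\<bar> \<le> x * P" by (rule abs_mult_le_right[OF that(6)])
      then have "a / (2 * l) * \<bar>s * (\<omega>3 t * p)\<bar> \<le> a / (2 * l) * (x * P)" using pos by (intro mult_left_mono) auto
      then have 2: "\<bar>a / (2 * l) * s * (\<omega>3 t * p)\<bar> \<le> a / (2 * l) * P * x" using pos by (simp add: abs_mult algebra_simps)
      show ?thesis using order_trans[OF that(1) G[OF that(2,3)]] 1 2 unfolding W_def by linarith
    qed
    show "\<alpha>3 t < 0"
    proof (rule ccontr)
      assume "\<not> \<alpha>3 t < 0"
      then have \<alpha>: "0 \<le> a / 2 * (\<alpha>3 t * c1 t)" "0 \<le> a / 2 * (\<alpha>3 t * c2 t)" using C pos by auto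
      \<comment> \<open>Both cables lift the bar in nearly the same direction, so the tensions add
        up in \<open>R2\<close> instead of cancelling.\<close>
      have e12: "e12 t \<le> - 1 / 2"
      proof -
        have "e12 t = - cos ((\<theta>1 t - \<theta>3 t) + (\<theta>2 t + \<theta>3 t))" by (simp add: cos_add)
        also have "\<dots> = s1 t * s2 t - c1 t * c2 t" unfolding cos_add by simp
        finally have e: "e12 t = s1 t * s2 t - c1 t * c2 t" .
        have "(7 / 8) * (7 / 8) \<le> s1 t * (- s2 t)" using near \<psi> by (intro mult_mono) auto
        moreover have "0 \<le> c1 t * c2 t" using C by simp
        ultimately show ?thesis unfolding e by simp
      qed
      have om2: "\<omega>2 t = p2 t / l + a / (2 * l) * s2 t * \<omega>3 t"
        using kin4[OF t'] pos by (simp add: p2_def field_simps)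
      have om1: "\<omega>1 t = - p1 t / l - a / (2 * l) * s1 t * \<omega>3 t"
      proof -
        have "l * \<omega>1 t = - p1 t - a / 2 * s1 t * \<omega>3 t" using kin3[OF t'] by (simp add: p1_def)
        then show ?thesis using pos(6) by (simp add: field_simps)
      qed
      \<comment> \<open>Expressing \<open>\<omega>2\<close> through the kinematics turns the
        centrifugal term into a multiple of \<open>\<omega>3\<^sup>2\<close> up to linear terms. The
        multiple is nonpositive, since \<open>s2\<close> is negative and
        \<open>1 + a / (2 * l) * s2\<close> is nonnegative by \<open>a \<le> 2 * l\<close>.\<close>
      have "a / 2 * (\<omega>3 t * (s2 t * (\<omega>2 t + \<omega>3 t)))
          = a / (2 * l) * s2 t * (\<omega>3 t * p2 t) + a / 2 * (s2 t * (1 + a / (2 * l) * s2 t) * (\<omega>3 t)\<^sup>2)"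
        unfolding om2 by (simp add: field_simps power2_eq_square)
      moreover have "s2 t * (1 + a / (2 * l) * s2 t) \<le> 0"
      proof (rule mult_nonpos_nonneg)
        have "a / (2 * l) * (- s2 t) \<le> 1 * 1"
          using True pos sin_ge_minus_one[of "\<theta>2 t + \<theta>3 t"] near(2) \<psi>(2) by (intro mult_mono) auto
        then show "0 \<le> 1 + a / (2 * l) * s2 t" by simp
      qed (use near \<psi> in linarith)
      then have "a / 2 * (s2 t * (1 + a / (2 * l) * s2 t) * (\<omega>3 t)\<^sup>2) \<le> 0"
        using pos by (simp add: mult_nonneg_nonpos mult_nonpos_nonneg)
      ultimately have "- \<bar>a / (2 * l) * s2 t * (\<omega>3 t * p2 t)\<bar> \<le> R2 t + \<omega>2 t * p2 t"
        using acc2[OF t, unfolded right_diff_distrib[of "a / 2"]] \<alpha>(2) by linarith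
      moreover have "R2 t \<le> - (1 / (2 * m3) * (T1 t + T2 t)) + \<bar>G2 t\<bar>"
      proof -
        have "T1 t * e12 t \<le> T1 t * (- 1 / 2)" using T e12 by (intro mult_left_mono) auto
        then have "(1 / 2) * (T1 t + T2 t) \<le> T2 t - T1 t * e12 t" using T by simp
        then have "(1 / 2) * (T1 t + T2 t) / m3 \<le> (T2 t - T1 t * e12 t) / m3" using pos by (intro divide_right_mono) auto
        moreover have "0 \<le> T2 t / m2" using T pos by simp
        moreover have "(1 / 2) * (T1 t + T2 t) / m3 = 1 / (2 * m3) * (T1 t + T2 t)" by simp
        ultimately show ?thesis unfolding R2_def by linarith
      qed
      ultimately have "1 / (2 * m3) * (T1 t + T2 t) \<le> W"
        using W[OF P(3)[OF t'] S2 P(10)[OF t'] P(7)[OF t'] P(5)[OF t'] abs_sin_le_one[of "\<theta>2 t + \<theta>3 t"]] by linarith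
      then have TW: "T1 t + T2 t \<le> 2 * m3 * W" using pos by (simp add: field_simps)
      \<comment> \<open>As \<open>s1\<close> is near 1, the corresponding factor in the first
        equation is at least \<open>1 / 2\<close>; this gain in \<open>\<omega>3\<^sup>2\<close>
        outweighs a multiple of \<open>W\<close> when the rotation is fast.\<close>
      have "- (a / 2 * (\<omega>3 t * (s1 t * (\<omega>1 t - \<omega>3 t))))
          = a / (2 * l) * s1 t * (\<omega>3 t * p1 t) + a / 2 * (s1 t * (1 + a / (2 * l) * s1 t) * (\<omega>3 t)\<^sup>2)"
        unfolding om1 by (simp add: field_simps power2_eq_square)
      moreover have "a / 4 * x\<^sup>2 \<le> a / 2 * (s1 t * (1 + a / (2 * l) * s1 t) * (\<omega>3 t)\<^sup>2)"
      proof -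
        have "0 \<le> a / (2 * l) * s1 t" using near \<psi> pos by (intro mult_nonneg_nonneg) auto
        then have "(1 / 2) * 1 \<le> s1 t * (1 + a / (2 * l) * s1 t)" using near \<psi> by (intro mult_mono) auto
        then have "1 / 2 * (\<omega>3 t)\<^sup>2 \<le> s1 t * (1 + a / (2 * l) * s1 t) * (\<omega>3 t)\<^sup>2" by (intro mult_right_mono) auto
        then have "a / 2 * (1 / 2 * (\<omega>3 t)\<^sup>2) \<le> a / 2 * (s1 t * (1 + a / (2 * l) * s1 t) * (\<omega>3 t)\<^sup>2)" using pos by (intro mult_left_mono) auto
        then show ?thesis unfolding x(3) by simp
      qed
      ultimately have "a / 4 * x\<^sup>2 \<le> R1 t + \<omega>1 t * p1 t + \<bar>a / (2 * l) * s1 t * (\<omega>3 t * p1 t)\<bar>"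
        using acc1[OF t, unfolded right_diff_distrib[of "a / 2"]] \<alpha>(1) by linarith
      moreover have "R1 t \<le> (1 / m1 + 1 / m3) * (T1 t + T2 t) + \<bar>G1 t\<bar>"
        using tension_part_bound[OF T(1,2) e12_bound[of t] pos(1,3)] unfolding R1_def by linarith
      ultimately have "a / 4 * x\<^sup>2 \<le> (1 / m1 + 1 / m3) * (T1 t + T2 t) + W"
        using W[OF P(2)[OF t'] S1 P(9)[OF t'] P(6)[OF t'] P(4)[OF t'] abs_sin_le_one[of "\<theta>1 t - \<theta>3 t"]] by linarith
      also have "(1 / m1 + 1 / m3) * (T1 t + T2 t) \<le> (1 / m1 + 1 / m3) * (2 * m3 * W)"
        using TW pos by (intro mult_left_mono) auto
      finally have "a / 4 * x\<^sup>2 \<le> M1 * W" by (simp add: M1_def algebra_simps)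
      also have "M1 * W = M1 * (P + P * P * (1 + x) + a / (2 * l) * P * x) + M1 * (\<sigma>' * P ^ 3) * (1 + x\<^sup>2)"
        by (simp add: W_def algebra_simps)
      also have "\<dots> \<le> Q * (1 + x) + a / 16 * (1 + x\<^sup>2)"
      proof (rule add_mono)
        have "P * 1 \<le> P * (1 + x)" "a / (2 * l) * P * x \<le> a / (2 * l) * P * (1 + x)"
          using P(1) x pos by (intro mult_left_mono; simp)+
        then have "P + P * P * (1 + x) + a / (2 * l) * P * x \<le> (P + P * P + a / (2 * l) * P) * (1 + x)"
          unfolding distrib_right[of _ _ "1 + x"] by linarith
        then show "M1 * (P + P * P * (1 + x) + a / (2 * l) * P * x) \<le> Q * (1 + x)"
          unfolding Q_def mult.assoc[of M1] using M1 by (intro mult_left_mono) auto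
        show "M1 * (\<sigma>' * P ^ 3) * (1 + x\<^sup>2) \<le> a / 16 * (1 + x\<^sup>2)" using \<sigma>'(3) by (intro mult_right_mono) auto
      qed
      finally have le: "a / 4 * x\<^sup>2 \<le> Q * (1 + x) + a / 16 * (1 + x\<^sup>2)" .
      have "1 \<le> x\<^sup>2" "x \<le> x\<^sup>2" using x(2) by (simp_all add: self_le_power)
      then have "a / 16 * (1 + x\<^sup>2) \<le> a / 16 * (2 * x\<^sup>2)" using pos by (intro mult_left_mono) auto
      then have "a / 8 * x\<^sup>2 \<le> Q * (1 + x)" using le by simp
      also have "\<dots> \<le> Q * (2 * x)" using Q x by (intro mult_left_mono) auto
      finally have "a / 8 * x * x \<le> 2 * Q * x" by (simp add: power2_eq_square algebra_simps)
      then have "a / 8 * x \<le> 2 * Q" using x by (simp only: mult_le_cancel_right)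
      then have "x \<le> (16 / a) * Q" using pos by (simp add: field_simps)
      also have "\<dots> \<le> (16 / a) * (2 * Q + a)" using Q pos by (intro mult_left_mono) auto
      finally show False using x(1) M(2) by linarith
    qed
  qed
qed

text \<open>A fast negative rotation persists forward in time and a fast positive one backward,
  because \<open>\<alpha>3\<close> is negative wherever the rotation is fast. Either way
  \<open>\<theta>3\<close> would change by at least \<open>M * \<tau> \<ge> 4\<close>, more than its
  range of length \<open>pi\<close> permits.\<close>

lemma bounded_rotation_vertical:
  obtains \<psi> \<epsilon> M where "\<psi> > 0" "\<epsilon> > 0"
    "\<forall>\<^sub>F t in at_top. s1 t \<ge> 1 - \<epsilon> \<longrightarrow> s2 t \<le> - 1 + \<epsilon> \<longrightarrow> S3 t \<le> - 1 + \<psi> \<longrightarrow> \<bar>\<omega>3 t\<bar> \<le> M"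
proof -
  obtain \<psi>0 M0 where v: "\<psi>0 > 0" "M0 > 0"
    "\<And>t. t > t0 \<Longrightarrow> s1 t \<ge> 1 - \<psi>0 \<Longrightarrow> s2 t \<le> - 1 + \<psi>0 \<Longrightarrow> S3 t \<le> - 1 + \<psi>0 \<Longrightarrow> \<bar>\<omega>3 t\<bar> \<ge> M0 \<Longrightarrow> \<alpha>3 t < 0"
    by (rule vertical_deceleration) blast
  have "\<psi>0 / 2 > 0" using v(1) by simp
  then obtain \<epsilon> \<tau> where s: "\<epsilon> > 0" "\<tau> > 0" "\<forall>\<^sub>F t in at_top. s1 t \<ge> 1 - \<epsilon> \<longrightarrow> s2 t \<le> - 1 + \<epsilon> \<longrightarrow>
    (\<forall>s. \<bar>s - t\<bar> \<le> \<tau> \<longrightarrow> s > t0 \<and> s1 s \<ge> 1 - \<psi>0 / 2 \<and> s2 s \<le> - 1 + \<psi>0 / 2 \<and> c1 s \<le> \<psi>0 / 2 \<and> c2 s \<le> \<psi>0 / 2 \<and> \<bar>S3 s - S3 t\<bar> \<le> \<psi>0 / 2)"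
    by (rule stays_aligned)
  define M where "M = max M0 (4 / \<tau>)"
  have M: "M \<ge> M0" "M > 0" "4 \<le> M * \<tau>"
  proof -
    show "M \<ge> M0" "M > 0" using v(2) by (auto simp: M_def)
    have "4 / \<tau> * \<tau> \<le> M * \<tau>" using s(2) by (intro mult_right_mono) (auto simp: M_def)
    then show "4 \<le> M * \<tau>" using s(2) by simp
  qed
  have range: "\<bar>\<theta>3 t - \<theta>3 s\<bar> < 4" if "t \<ge> t0" "s \<ge> t0" for s t
    using angle_range(3)[OF that(1)] angle_range(3)[OF that(2)] pi_less_4 by linarith
  show ?thesis
  proof (rule that[OF \<open>\<psi>0 / 2 > 0\<close> s(1)])
    show "\<forall>\<^sub>F t in at_top. s1 t \<ge> 1 - \<epsilon> \<longrightarrow> s2 t \<le> - 1 + \<epsilon> \<longrightarrow> S3 t \<le> - 1 + \<psi>0 / 2 \<longrightarrow> \<bar>\<omega>3 t\<bar> \<le> M"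
      using s(3) eventually_ge_at_top[of "t0 + \<tau>"]
    proof eventually_elim
      case (elim t)
      show ?case
      proof (intro impI)
      assume al: "s1 t \<ge> 1 - \<epsilon>" "s2 t \<le> - 1 + \<epsilon>" "S3 t \<le> - 1 + \<psi>0 / 2"
      have near: "s > t0 \<and> s1 s \<ge> 1 - \<psi>0 / 2 \<and> s2 s \<le> - 1 + \<psi>0 / 2 \<and> \<bar>S3 s - S3 t\<bar> \<le> \<psi>0 / 2"
        if "\<bar>s - t\<bar> \<le> \<tau>" for s using elim(1) al that by blast
      have dec: "\<alpha>3 r < 0" if "\<bar>r - t\<bar> \<le> \<tau>" "\<bar>\<omega>3 r\<bar> \<ge> M" for r
        using near[OF that(1)] that(2) M(1) al(3) v(1) by (intro v(3)) linarith+
      show "\<bar>\<omega>3 t\<bar> \<le> M"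
      proof (rule ccontr)
        assume "\<not> \<bar>\<omega>3 t\<bar> \<le> M"
        then consider "\<omega>3 t \<le> - M" | "- \<omega>3 t \<le> - M" by linarith
        then show False
        proof cases
          case 1
          have "\<omega>3 q \<le> - M" if "t \<le> q" "q \<le> t + \<tau>" for q
            by (rule stays_below[of t "t + \<tau>" \<omega>3 \<alpha>3])
              (use that 1 elim s(2) M(2) deriv_angle(4) in \<open>auto intro!: dec\<close>)
          then have "\<theta>3 (t + \<tau>) - \<theta>3 t \<le> - M * (t + \<tau> - t)"
            by (intro deriv_bound_imp_diff_bound(1)[of _ _ _ \<omega>3]) (use elim s(2) deriv_angle(3) in auto)
          then show False using range[of "t + \<tau>" t] M(3) elim s(2) by simp
        next
          case 2
          \<comment> \<open>Reflecting time at \<open>t\<close> reduces the positive case to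
            \<open>stays_below\<close>.\<close>
          define f where "f r = - \<omega>3 (2 * t - r)" for r
          have df: "(f has_real_derivative \<alpha>3 (2 * t - r)) (at r)" if "t \<le> r" "r \<le> t + \<tau>" for r
          proof -
            have "((\<lambda>r. 2 * t - r) has_real_derivative - 1) (at r)" by (auto intro!: derivative_eq_intros)
            from DERIV_chain2[OF deriv_angle(4) this] have "((\<lambda>r. \<omega>3 (2 * t - r)) has_real_derivative \<alpha>3 (2 * t - r) * - 1) (at r)"
              using that elim by simp
            from DERIV_minus[OF this] show ?thesis unfolding f_def by simp
          qed
          have le: "f q \<le> - M" if "t \<le> q" "q \<le> t + \<tau>" for q
            by (rule stays_below[of t "t + \<tau>" f "\<lambda>r. \<alpha>3 (2 * t - r)"])
              (use that 2 M(2) df in \<open>auto intro!: dec simp: f_def\<close>)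
          have "M \<le> \<omega>3 q" if "t - \<tau> \<le> q" "q \<le> t" for q
            using le[of "2 * t - q"] that by (simp add: f_def)
          then have "M * (t - (t - \<tau>)) \<le> \<theta>3 t - \<theta>3 (t - \<tau>)"
            by (intro deriv_bound_imp_diff_bound(2)[of _ _ _ \<omega>3]) (use elim s(2) deriv_angle(3) in auto)
          then show False using range[of t "t - \<tau>"] M(3) elim s(2) by simp
        qed
      qed
      qed
    qed
  qed
qed

text \<open>
  In an inclined aligned position the bar would have to accelerate horizontally, contradicting
  that its horizontal speed is nearly constant whenever the drones are slow.
\<close>

lemma not_inclined:
  assumes "\<psi> > 0" "\<psi> \<le> 1"
  obtains \<epsilon> where "\<epsilon> > 0" "\<forall>\<^sub>F t in at_top. \<not> (s1 t \<ge> 1 - \<epsilon> \<and> s2 t \<le> - 1 + \<epsilon> \<and> S3 t \<ge> - 1 + \<psi>)"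
proof -
  have "\<psi> / 16 > 0" using assms by simp
  then obtain \<epsilon> \<tau> where st: "\<epsilon> > 0" "\<tau> > 0" "\<forall>\<^sub>F t in at_top. s1 t \<ge> 1 - \<epsilon> \<longrightarrow> s2 t \<le> - 1 + \<epsilon> \<longrightarrow>
    (\<forall>s. \<bar>s - t\<bar> \<le> \<tau> \<longrightarrow> s > t0 \<and> s1 s \<ge> 1 - \<psi> / 16 \<and> s2 s \<le> - 1 + \<psi> / 16 \<and> c1 s \<le> \<psi> / 16 \<and> c2 s \<le> \<psi> / 16 \<and> \<bar>S3 s - S3 t\<bar> \<le> \<psi> / 16)"
    by (rule stays_aligned)
  \<comment> \<open>\<open>\<gamma>\<close> is a lower bound for the absolute values of both cable
    sines and \<open>\<sigma>'\<close> for the drop of \<open>u3\<close> over a time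
    \<open>\<tau> / 5\<close>; \<eta> keeps \<open>\<kappa> * \<eta>\<close>, the uncertainty of
    \<open>u3\<^sup>2\<close>, below the square of \<open>\<sigma>'\<close>.\<close>
  define \<gamma> where "\<gamma> = \<psi> / 8"
  have \<gamma>: "\<gamma> > 0" using assms by (simp add: \<gamma>_def)
  define \<sigma>' where "\<sigma>' = \<gamma> * g * \<tau> / 10"
  have \<sigma>': "\<sigma>' > 0" using \<gamma> st pos by (simp add: \<sigma>'_def)
  define \<kappa> where "\<kappa> = (4 / m3) * (1 + (m1 + m2) / 2)"
  have \<kappa>: "\<kappa> > 0" using pos by (simp add: \<kappa>_def add_pos_pos)
  define \<eta> where "\<eta> = \<sigma>'\<^sup>2 / (2 * \<kappa>)"
  have \<eta>: "\<eta> > 0" "\<kappa> * \<eta> < \<sigma>'\<^sup>2" using \<kappa> \<sigma>' by (auto simp: \<eta>_def)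
  have "\<tau> / 5 > 0" "g * \<tau> / 20 > 0" using st(2) pos by auto
  have "\<forall>\<^sub>F t in at_top. \<bar>w3 t\<bar> < g * \<tau> / 20 \<and> (\<exists>r\<in>{t..t + \<tau> / 5}. (u1 r)\<^sup>2 < \<eta> \<and> (u2 r)\<^sup>2 < \<eta>)
      \<and> (\<forall>r\<in>{t..t + \<tau>}. \<bar>kin_h r - kin_h t\<bar> < \<eta>)"
    using tendstoD[OF w3_tendsto_0 \<open>g * \<tau> / 20 > 0\<close>] drones_momentarily_slow[OF \<open>\<tau> / 5 > 0\<close> \<eta>(1)]
      slowD[OF kin_h_slow st(2) \<eta>(1)]
    by eventually_elim (simp add: dist_real_def)
  then obtain N where N: "\<And>t. t \<ge> N \<Longrightarrow> \<bar>w3 t\<bar> < g * \<tau> / 20"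
      "\<And>t. t \<ge> N \<Longrightarrow> \<exists>r\<in>{t..t + \<tau> / 5}. (u1 r)\<^sup>2 < \<eta> \<and> (u2 r)\<^sup>2 < \<eta>"
      "\<And>t r. t \<ge> N \<Longrightarrow> r \<in> {t..t + \<tau>} \<Longrightarrow> \<bar>kin_h r - kin_h t\<bar> < \<eta>"
    unfolding eventually_at_top_linorder by blast
  show ?thesis
  proof (rule that[OF st(1)])
    show "\<forall>\<^sub>F t in at_top. \<not> (s1 t \<ge> 1 - \<epsilon> \<and> s2 t \<le> - 1 + \<epsilon> \<and> S3 t \<ge> - 1 + \<psi>)"
      using st(3) eventually_ge_at_top[of N]
    proof eventually_elim
      case (elim t)
      show ?case
      proof
      assume "s1 t \<ge> 1 - \<epsilon> \<and> s2 t \<le> - 1 + \<epsilon> \<and> S3 t \<ge> - 1 + \<psi>"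
      then have al: "s1 t \<ge> 1 - \<epsilon>" "s2 t \<le> - 1 + \<epsilon>" "S3 t \<ge> - 1 + \<psi>" by auto
      have near: "s > t0 \<and> s1 s \<ge> 1 - \<psi> / 16 \<and> s2 s \<le> - 1 + \<psi> / 16 \<and> c1 s \<le> \<psi> / 16 \<and> c2 s \<le> \<psi> / 16 \<and> \<bar>S3 s - S3 t\<bar> \<le> \<psi> / 16"
        if "t \<le> s" "s \<le> t + \<tau>" for s
        using elim(1) al that by simp
      have SS: "\<gamma> \<le> S1 s" "S2 s \<le> - \<gamma>" if s: "t \<le> s" "s \<le> t + \<tau>" for s
      proof -
        note n = near[OF s]
        have s0: "s \<ge> t0" using n by simp
        note C = trig_pos[OF s0]
        have lo: "- 1 + \<psi> / 2 \<le> S3 s" 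
        proof -
          have "\<bar>S3 s - S3 t\<bar> \<le> \<psi> / 16" using n by blast
          then show ?thesis using al(3) assms by argo
        qed
        have cc: "\<bar>c1 s * C3 s\<bar> \<le> \<psi> / 16" "\<bar>c1 s * S3 s\<bar> \<le> \<psi> / 16" "\<bar>c2 s * S3 s\<bar> \<le> \<psi> / 16"
          using abs_mult_le[of "c1 s" "\<psi> / 16" "C3 s" 1] abs_mult_le[of "c1 s" "\<psi> / 16" "S3 s" 1]
            abs_mult_le[of "c2 s" "\<psi> / 16" "S3 s" 1] n C by auto
        have "C1 s = cos ((\<theta>1 s - \<theta>3 s) + \<theta>3 s)" by simp
        then have "C1 s = c1 s * C3 s - s1 s * S3 s" unfolding cos_add .
        then have "s1 s * S3 s \<le> \<psi> / 16" using C cc(1) by linarith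
        \<comment> \<open>Positivity of \<open>C1\<close>, which is nearly \<open>- S3\<close>,
          keeps the bar from pointing upwards; together with \<open>lo\<close> this bounds
          \<open>C3\<close> away from 0.\<close>
        have hi: "S3 s \<le> 1 - \<psi> / 2"
        proof (rule ccontr)
          assume "\<not> S3 s \<le> 1 - \<psi> / 2"
          then have "1 / 2 \<le> S3 s" using assms by simp
          then have "(15 / 16) * (1 / 2) \<le> s1 s * S3 s" using n assms by (intro mult_mono) auto
          then show False using \<open>s1 s * S3 s \<le> \<psi> / 16\<close> assms by simp
        qed
        have "\<bar>S3 s\<bar> \<le> 1 - \<psi> / 2" using lo hi by linarith
        then have "\<bar>S3 s\<bar> * \<bar>S3 s\<bar> \<le> (1 - \<psi> / 2) * 1" by (intro mult_mono) auto
        then have "(C3 s)\<^sup>2 \<ge> \<psi> / 2" unfolding cos_squared_eq by (simp add: power2_eq_square)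
        moreover have "(C3 s)\<^sup>2 \<le> C3 s" using C mult_left_mono[of "C3 s" 1 "C3 s"] by (simp add: power2_eq_square)
        ultimately have C3: "\<psi> / 2 \<le> C3 s" by linarith
        have b1: "(1 - \<psi> / 16) * C3 s \<le> s1 s * C3 s" "s2 s * C3 s \<le> (- 1 + \<psi> / 16) * C3 s"
          using n C by (intro mult_right_mono; simp)+
        have "\<psi> / 16 * C3 s \<le> \<psi> / 16 * 1" using assms by (intro mult_left_mono) auto
        then have b2: "C3 s - \<psi> / 16 \<le> s1 s * C3 s" "s2 s * C3 s \<le> - C3 s + \<psi> / 16"
          using b1 by (auto simp: algebra_simps)
        have "S1 s = sin ((\<theta>1 s - \<theta>3 s) + \<theta>3 s)" "S2 s = sin ((\<theta>2 s + \<theta>3 s) - \<theta>3 s)" by simp_all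
        then have eq: "S1 s = s1 s * C3 s + c1 s * S3 s" "S2 s = s2 s * C3 s - c2 s * S3 s"
          unfolding sin_add sin_diff .
        show "\<gamma> \<le> S1 s" "S2 s \<le> - \<gamma>" unfolding eq \<gamma>_def using b2 C3 cc(2,3) assms(1) by linarith+
      qed
      have drop: "u3 r' - u3 r \<le> - \<sigma>'" if r: "t \<le> r" "r + \<tau> / 5 \<le> r'" "r' \<le> t + \<tau>" for r r'
      proof -
        have rr: "r \<le> r'" using r st(2) by linarith
        \<comment> \<open>The horizontal pull on the bar is at least \<gamma> times the lift. Since
          the lift balances the weight on average, \<open>u3\<close> must fall at an average rate of
          nearly \<open>\<gamma> * g\<close> or more.\<close>
        define f where "f s = u3 s + \<gamma> * w3 s" for s
        have df: "(f has_real_derivative (T2 s * S2 s - T1 s * S1 s) / m3 + \<gamma> * ((T1 s * C1 s + T2 s * C2 s) / m3 - g)) (at s)"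
          if "r \<le> s" "s \<le> r'" for s
          unfolding f_def by (intro DERIV_add DERIV_cmult du3 dw3) (use near[of s] that r in simp_all)
        have le: "(T2 s * S2 s - T1 s * S1 s) / m3 + \<gamma> * ((T1 s * C1 s + T2 s * C2 s) / m3 - g) \<le> - (\<gamma> * g)"
          if s: "r \<le> s" "s \<le> r'" for s
        proof -
          have ts: "t \<le> s" "s \<le> t + \<tau>" using s r by linarith+
          have s0: "s \<ge> t0" using near[OF ts] by simp
          note T = tension[OF s0]
          have "T1 s * \<gamma> \<le> T1 s * S1 s" "T2 s * S2 s \<le> T2 s * - \<gamma>"
            using SS[OF ts] T by (intro mult_left_mono; simp)+
          moreover have "\<gamma> * (T1 s * C1 s) \<le> \<gamma> * T1 s" "\<gamma> * (T2 s * C2 s) \<le> \<gamma> * T2 s"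
            using T \<gamma> by simp_all
          ultimately have "(T2 s * S2 s - T1 s * S1 s) + \<gamma> * (T1 s * C1 s + T2 s * C2 s) \<le> 0"
            by (simp add: algebra_simps)
          then have "((T2 s * S2 s - T1 s * S1 s) + \<gamma> * (T1 s * C1 s + T2 s * C2 s)) / m3 \<le> 0"
            using pos(3) by (simp add: divide_nonpos_pos)
          moreover have "(T2 s * S2 s - T1 s * S1 s) / m3 + \<gamma> * ((T1 s * C1 s + T2 s * C2 s) / m3 - g)
              = ((T2 s * S2 s - T1 s * S1 s) + \<gamma> * (T1 s * C1 s + T2 s * C2 s)) / m3 - \<gamma> * g"
            by (simp add: add_divide_distrib[of _ _ m3] right_diff_distrib[of \<gamma>] distrib_left[of \<gamma>])
          ultimately show ?thesis by linarith
        qed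
        have "f r' - f r \<le> - (\<gamma> * g) * (r' - r)"
          by (rule deriv_bound_imp_diff_bound(1)[OF rr df le])
        also have "\<dots> \<le> - (\<gamma> * g) * (\<tau> / 5)" using r \<gamma> pos by (intro mult_left_mono_neg) auto
        finally have 1: "f r' - f r \<le> - (2 * \<sigma>')" by (simp add: \<sigma>'_def mult.commute mult.left_commute)
        have "\<bar>w3 r' - w3 r\<bar> \<le> g * \<tau> / 10"
        proof -
          have "\<bar>w3 r\<bar> < g * \<tau> / 20" "\<bar>w3 r'\<bar> < g * \<tau> / 20" using r rr elim(2) by (intro N(1); linarith)+
          then show ?thesis by argo
        qed
        then have "\<bar>\<gamma> * (w3 r' - w3 r)\<bar> \<le> \<gamma> * (g * \<tau> / 10)" using \<gamma> by (simp add: abs_mult)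
        then have "\<bar>\<gamma> * (w3 r' - w3 r)\<bar> \<le> \<sigma>'" by (simp add: \<sigma>'_def mult.assoc)
        moreover have "u3 r' - u3 r = (f r' - f r) - \<gamma> * (w3 r' - w3 r)" by (simp add: f_def algebra_simps)
        ultimately show ?thesis using 1 by linarith
      qed
      \<comment> \<open>Three times at which the drones are slow, so that \<open>u3\<^sup>2\<close>
        is nearly the same at all of them. A drop of \<open>u3\<close> is then possible once, by
        reversal of its sign, but not twice.\<close>
      obtain r0 where r0: "t \<le> r0" "r0 \<le> t + \<tau> / 5" "(u1 r0)\<^sup>2 < \<eta>" "(u2 r0)\<^sup>2 < \<eta>"
        using N(2)[of t] elim(2) by auto
      obtain r1 where r1: "t + 2 * \<tau> / 5 \<le> r1" "r1 \<le> t + 2 * \<tau> / 5 + \<tau> / 5" "(u1 r1)\<^sup>2 < \<eta>" "(u2 r1)\<^sup>2 < \<eta>"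
        using N(2)[of "t + 2 * \<tau> / 5"] elim(2) st(2) by auto
      obtain r2 where r2: "t + 4 * \<tau> / 5 \<le> r2" "r2 \<le> t + 4 * \<tau> / 5 + \<tau> / 5" "(u1 r2)\<^sup>2 < \<eta>" "(u2 r2)\<^sup>2 < \<eta>"
        using N(2)[of "t + 4 * \<tau> / 5"] elim(2) st(2) by auto
      have en: "\<bar>m3 / 2 * (u3 r)\<^sup>2 - kin_h t\<bar> \<le> (1 + (m1 + m2) / 2) * \<eta>"
        if "t \<le> r" "r \<le> t + \<tau>" "(u1 r)\<^sup>2 < \<eta>" "(u2 r)\<^sup>2 < \<eta>" for r
      proof -
        have "\<bar>kin_h r - kin_h t\<bar> < \<eta>" using N(3)[of t r] that elim(2) by simp
        moreover have "m3 / 2 * (u3 r)\<^sup>2 = kin_h r - m1 / 2 * (u1 r)\<^sup>2 - m2 / 2 * (u2 r)\<^sup>2"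
          by (simp add: kin_h_def field_simps)
        moreover have "m1 / 2 * (u1 r)\<^sup>2 \<le> m1 / 2 * \<eta>" "m2 / 2 * (u2 r)\<^sup>2 \<le> m2 / 2 * \<eta>"
          "0 \<le> m1 / 2 * (u1 r)\<^sup>2" "0 \<le> m2 / 2 * (u2 r)\<^sup>2"
          using that pos by auto
        moreover have "(1 + (m1 + m2) / 2) * \<eta> = \<eta> + m1 / 2 * \<eta> + m2 / 2 * \<eta>" by (simp add: field_simps)
        ultimately show ?thesis by linarith
      qed
      have sq: "\<bar>(u3 r)\<^sup>2 - (u3 r')\<^sup>2\<bar> \<le> \<kappa> * \<eta>"
        if "\<bar>m3 / 2 * (u3 r)\<^sup>2 - kin_h t\<bar> \<le> (1 + (m1 + m2) / 2) * \<eta>" "\<bar>m3 / 2 * (u3 r')\<^sup>2 - kin_h t\<bar> \<le> (1 + (m1 + m2) / 2) * \<eta>" for r r'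
      proof -
        have "\<bar>m3 / 2 * (u3 r)\<^sup>2 - m3 / 2 * (u3 r')\<^sup>2\<bar> \<le> 2 * ((1 + (m1 + m2) / 2) * \<eta>)" using that by linarith
        moreover have "m3 / 2 * \<bar>(u3 r)\<^sup>2 - (u3 r')\<^sup>2\<bar> = \<bar>m3 / 2 * (u3 r)\<^sup>2 - m3 / 2 * (u3 r')\<^sup>2\<bar>"
          unfolding right_diff_distrib[symmetric] abs_mult using pos(3) by simp
        ultimately have "m3 / 2 * \<bar>(u3 r)\<^sup>2 - (u3 r')\<^sup>2\<bar> \<le> 2 * ((1 + (m1 + m2) / 2) * \<eta>)" by linarith
        then show ?thesis using pos(3) by (simp add: \<kappa>_def field_simps)
      qed
      have le: "t \<le> r0" "r0 + \<tau> / 5 \<le> r1" "r1 + \<tau> / 5 \<le> r2" "r2 \<le> t + \<tau>" "t \<le> r1" "r1 \<le> t + \<tau>" "t \<le> r2" "r0 \<le> t + \<tau>"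
        using r0 r1 r2 st(2) by simp_all
      have d: "\<sigma>' \<le> u3 r0 - u3 r1" "\<sigma>' \<le> u3 r1 - u3 r2" using drop[OF le(1,2,6)] drop[OF le(5,3,4)] by linarith+
      note en0 = en[OF le(1,8) r0(3,4)] and en1 = en[OF le(5,6) r1(3,4)] and en2 = en[OF le(7,4) r2(3,4)]
      have close: "\<bar>x + y\<bar> < \<sigma>'" if "\<sigma>' \<le> x - y" "\<bar>x\<^sup>2 - y\<^sup>2\<bar> \<le> \<kappa> * \<eta>" for x y
      proof (rule ccontr)
        assume "\<not> \<bar>x + y\<bar> < \<sigma>'"
        then have "\<sigma>' * \<sigma>' \<le> \<bar>x + y\<bar> * \<bar>x - y\<bar>" using that(1) \<sigma>' by (intro mult_mono) auto
        also have "\<dots> = \<bar>x\<^sup>2 - y\<^sup>2\<bar>" by (simp add: abs_mult[symmetric] power2_eq_square algebra_simps)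
        finally show False using that(2) \<eta>(2) by (simp add: power2_eq_square)
      qed
      show False
        using close[OF d(1) sq[OF en0 en1]] close[OF d(2) sq[OF en1 en2]] d by linarith
      qed
    qed
  qed
qed

lemma bounded_rotation_aligned:
  obtains \<epsilon> M where "\<epsilon> > 0" "\<forall>\<^sub>F t in at_top. s1 t \<ge> 1 - \<epsilon> \<longrightarrow> s2 t \<le> - 1 + \<epsilon> \<longrightarrow> \<bar>\<omega>3 t\<bar> \<le> M"
proof -
  obtain \<psi> \<epsilon> M where v: "\<psi> > 0" "\<epsilon> > 0"
    "\<forall>\<^sub>F t in at_top. s1 t \<ge> 1 - \<epsilon> \<longrightarrow> s2 t \<le> - 1 + \<epsilon> \<longrightarrow> S3 t \<le> - 1 + \<psi> \<longrightarrow> \<bar>\<omega>3 t\<bar> \<le> M"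
    by (rule bounded_rotation_vertical)
  have "min \<psi> 1 > 0" "min \<psi> 1 \<le> 1" using v(1) by auto
  then obtain \<epsilon>' where i: "\<epsilon>' > 0" "\<forall>\<^sub>F t in at_top. \<not> (s1 t \<ge> 1 - \<epsilon>' \<and> s2 t \<le> - 1 + \<epsilon>' \<and> S3 t \<ge> - 1 + min \<psi> 1)"
    by (rule not_inclined)
  show ?thesis
  proof (rule that[of "min \<epsilon> \<epsilon>'" M])
    show "\<forall>\<^sub>F t in at_top. s1 t \<ge> 1 - min \<epsilon> \<epsilon>' \<longrightarrow> s2 t \<le> - 1 + min \<epsilon> \<epsilon>' \<longrightarrow> \<bar>\<omega>3 t\<bar> \<le> M"
      using v(3) i(2)
    proof eventually_elim
      case (elim t)
      show ?case
      proof (intro impI)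
        assume "s1 t \<ge> 1 - min \<epsilon> \<epsilon>'" "s2 t \<le> - 1 + min \<epsilon> \<epsilon>'"
        then have "s1 t \<ge> 1 - \<epsilon>" "s2 t \<le> - 1 + \<epsilon>" "s1 t \<ge> 1 - \<epsilon>'" "s2 t \<le> - 1 + \<epsilon>'" by linarith+
        moreover from this have "S3 t \<le> - 1 + \<psi>" using elim(2) by linarith
        ultimately show "\<bar>\<omega>3 t\<bar> \<le> M" using elim(1) by blast
      qed
    qed
  qed (use v i in auto)
qed

text \<open>Since \<open>\<omega>3 * c1\<close> and \<open>\<omega>3 * c2\<close> are bounded, a
  fast rotation makes \<open>c1\<close> and \<open>c2\<close> small. Opposite signs of
  \<open>s1\<close> and \<open>s2\<close> give the aligned position or its mirror image; equal signs
  put \<open>cos (\<theta>1 + \<theta>2)\<close> near -1, so that both cables are nearly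
  horizontal.\<close>

lemma bounded_rotation:
  obtains M where "\<forall>\<^sub>F t in at_top. \<bar>\<omega>3 t\<bar> \<le> M"
proof -
  interpret sw: drone_bar_motion m2 m1 m3 g a l kp2 kp1 kp4 kp3 kd2 kd1 kd4 kd3 ka2 ka1 \<sigma> \<rho> t0
     "\<lambda>t. - x2 t" h2 "\<lambda>t. - x1 t" h1 "\<lambda>t. - x3 t" h3
     "\<lambda>t. - u2 t" w2 "\<lambda>t. - u1 t" w1 "\<lambda>t. - u3 t" w3
     \<theta>2 \<theta>1 "\<lambda>t. - \<theta>3 t" \<omega>2 \<omega>1 "\<lambda>t. - \<omega>3 t" "\<lambda>t. - \<alpha>3 t" T2 T1
    by (rule swap)
  obtain \<epsilon> M where 1: "\<epsilon> > 0" "\<forall>\<^sub>F t in at_top. s1 t \<ge> 1 - \<epsilon> \<longrightarrow> s2 t \<le> - 1 + \<epsilon> \<longrightarrow> \<bar>\<omega>3 t\<bar> \<le> M"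
    by (rule bounded_rotation_aligned)
  obtain \<epsilon>' M' where 2: "\<epsilon>' > 0" "\<forall>\<^sub>F t in at_top. s2 t \<ge> 1 - \<epsilon>' \<longrightarrow> s1 t \<le> - 1 + \<epsilon>' \<longrightarrow> \<bar>\<omega>3 t\<bar> \<le> M'"
    by (rule sw.bounded_rotation_aligned) simp
  obtain \<kappa> where 3: "\<kappa> > 0" "\<forall>\<^sub>F t in at_top. \<kappa> \<le> C1 t + C2 t"
    by (rule cables_not_horizontal)
  obtain P where P: "P \<ge> 1" "\<And>t. t \<ge> t0 \<Longrightarrow> \<bar>\<omega>3 t * c1 t\<bar> \<le> P" "\<And>t. t \<ge> t0 \<Longrightarrow> \<bar>\<omega>3 t * c2 t\<bar> \<le> P"
    by (rule force_bounds) blast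
  \<comment> \<open>With \<open>e \<le> \<kappa> / 8\<close> the estimate
    \<open>C1 t + C2 t \<le> 6 * e\<close> contradicts
    \<open>\<kappa> \<le> C1 t + C2 t\<close>.\<close>
  define e where "e = Min {\<epsilon>, \<epsilon>', \<kappa> / 8, 1 / 8}"
  have e: "e > 0" "e \<le> \<epsilon>" "e \<le> \<epsilon>'" "e \<le> \<kappa> / 8" "e \<le> 1 / 8" using 1(1) 2(1) 3(1) by (auto simp: e_def)
  have ee: "e * e \<le> e" "e * e \<le> 1 / 64" using e mult_left_mono[of e 1 e] mult_mono[of e "1 / 8" e "1 / 8"] by auto
  show ?thesis
  proof (rule that[of "max (max M M') (P / e)"])
    show "\<forall>\<^sub>F t in at_top. \<bar>\<omega>3 t\<bar> \<le> max (max M M') (P / e)"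
      using 1(2) 2(2) 3(2) eventually_ge_at_top[of t0]
    proof eventually_elim
      case (elim t)
      show ?case
      proof (rule ccontr)
        assume neg: "\<not> \<bar>\<omega>3 t\<bar> \<le> max (max M M') (P / e)"
        then have "P / e < \<bar>\<omega>3 t\<bar>" by simp
        then have big: "P < \<bar>\<omega>3 t\<bar> * e" "\<omega>3 t \<noteq> 0" using e P(1) by (auto simp: field_simps)
        have small: "c < e" if "\<bar>\<omega>3 t * c\<bar> \<le> P" "c > 0" for c
        proof -
          have "\<bar>\<omega>3 t\<bar> * c < \<bar>\<omega>3 t\<bar> * e" using that big(1) by (simp add: abs_mult)
          then show ?thesis using big(2) by simp
        qed
        have c: "c1 t < e" "c2 t < e" using small P(2,3)[OF elim(4)] trig_pos[OF elim(4)] by auto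
        have s: "1 - e * e \<le> \<bar>sin x\<bar>" if "\<bar>cos x\<bar> \<le> e" for x
        proof -
          have "\<bar>cos x\<bar> * \<bar>cos x\<bar> \<le> e * e" using that by (intro mult_mono) auto
          then have "1 - e * e \<le> (sin x)\<^sup>2" unfolding sin_squared_eq by (simp add: power2_eq_square)
          moreover have "(sin x)\<^sup>2 \<le> \<bar>sin x\<bar>"
            using mult_right_mono[OF abs_sin_le_one[of x] abs_ge_zero[of "sin x"]] by (simp add: power2_eq_square)
          ultimately show ?thesis by linarith
        qed
        have s12: "1 - e * e \<le> \<bar>s1 t\<bar>" "1 - e * e \<le> \<bar>s2 t\<bar>"
          using s[of "\<theta>1 t - \<theta>3 t"] s[of "\<theta>2 t + \<theta>3 t"] c trig_pos[OF elim(4)] by auto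
        consider "s1 t \<ge> 1 - e * e" "s2 t \<le> - 1 + e * e" | "s2 t \<ge> 1 - e * e" "s1 t \<le> - 1 + e * e"
          | "s1 t * s2 t \<ge> (1 - e * e) * (1 - e * e)"
        proof -
          have "s1 t * s2 t \<ge> (1 - e * e) * (1 - e * e)" if "s1 t * s2 t \<ge> 0"
          proof -
            have "(1 - e * e) * (1 - e * e) \<le> \<bar>s1 t\<bar> * \<bar>s2 t\<bar>" using s12 ee by (intro mult_mono) auto
            then show ?thesis using that by (simp add: abs_mult[symmetric])
          qed
          moreover have "s1 t * s2 t \<ge> 0 \<or> s1 t > 0 \<and> s2 t < 0 \<or> s1 t < 0 \<and> s2 t > 0"
            by (auto simp: not_le mult_less_0_iff zero_le_mult_iff)
          moreover have "s1 t \<ge> 1 - e * e \<and> s2 t \<le> - 1 + e * e" if "s1 t > 0 \<and> s2 t < 0"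
            using s12 that by simp
          moreover have "s2 t \<ge> 1 - e * e \<and> s1 t \<le> - 1 + e * e" if "s1 t < 0 \<and> s2 t > 0"
            using s12 that by simp
          ultimately show ?thesis using that by blast
        qed
        then show False
        proof cases
          case 1
          then have "s1 t \<ge> 1 - \<epsilon>" "s2 t \<le> - 1 + \<epsilon>" using ee e by linarith+
          then show False using elim(1) neg by simp
        next
          case 2
          then have "s2 t \<ge> 1 - \<epsilon>'" "s1 t \<le> - 1 + \<epsilon>'" using ee e by linarith+
          then show False using elim(2) neg by simp
        next
          case 3
          have "C1 t * C2 t - S1 t * S2 t = cos ((\<theta>1 t - \<theta>3 t) + (\<theta>2 t + \<theta>3 t))" by (simp add: cos_add)
          also have "\<dots> = c1 t * c2 t - s1 t * s2 t" by (rule cos_add)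
          also have "\<dots> \<le> e * e - (1 - e * e) * (1 - e * e)"
            using 3 c trig_pos[OF elim(4)] mult_mono[of "c1 t" e "c2 t" e] e by auto
          also have "\<dots> = - 1 + 3 * (e * e) - (e * e) * (e * e)" by (simp add: algebra_simps)
          finally have S: "1 - 3 * (e * e) \<le> S1 t * S2 t"
            using mult_pos_pos[OF trig_pos(1,2)[OF elim(4)]] zero_le_square[of "e * e"] by linarith
          have C: "C \<le> 3 * e" if "C > 0" "C\<^sup>2 = 1 - S\<^sup>2" "1 - 3 * (e * e) \<le> S * S'" "\<bar>S'\<bar> \<le> 1" for C S S' :: real
          proof -
            have "\<bar>S' * S\<bar> \<le> \<bar>S\<bar>" by (rule abs_mult_le_right[OF that(4)]) simp
            then have "1 - 3 * (e * e) \<le> \<bar>S\<bar>" using that(3) by (simp add: mult.commute)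
            moreover have "0 \<le> 1 - 3 * (e * e)" using ee by simp
            ultimately have "(1 - 3 * (e * e)) * (1 - 3 * (e * e)) \<le> \<bar>S\<bar> * \<bar>S\<bar>" by (intro mult_mono) auto
            then have "1 - 6 * (e * e) + 9 * ((e * e) * (e * e)) \<le> S\<^sup>2" by (simp add: algebra_simps power2_eq_square)
            then have "C\<^sup>2 \<le> 6 * (e * e)" using that(2) zero_le_square[of "e * e"] by linarith
            also have "\<dots> \<le> (3 * e)\<^sup>2" using e by (simp add: power2_eq_square)
            finally show ?thesis by (rule power2_le_imp_le) (use e(1) in simp)
          qed
          have "C1 t \<le> 3 * e" by (rule C[OF trig_pos(1)[OF elim(4)] cos_squared_eq S]) simp
          moreover have "C2 t \<le> 3 * e"
            by (rule C[OF trig_pos(2)[OF elim(4)] cos_squared_eq, of "S1 t"]) (use S in \<open>simp_all add: mult.commute\<close>)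
          ultimately show False using elim(3) e by linarith
        qed
      qed
    qed
  qed
qed

end

subsection \<open>Convergence\<close>

text \<open>
  \<open>H\<close> is the horizontal component of both cable tensions \<open>t1\<close>, \<open>t2\<close>, and \<open>v1\<close>, \<open>v2\<close> are their vertical
  components. Degenerate positions (zero tension, angles of absolute value \<open>pi/2\<close>) must be
  admitted because the assumed strict inequalities need not persist in the limit.
\<close>

lemma unique_equilibrium:
  fixes Q1 Q2 Q3 X1 X2 H1 H2 v1 v2 m3 g a l kp1 kp2 kp3 kp4 \<sigma> \<rho> :: real
  defines "H \<equiv> kp1 * X1 + \<sigma> * \<rho> * (X1 - X2) / (\<rho> - (X1 - X2)\<^sup>2)\<^sup>2"
  defines "t1 \<equiv> H * sin Q1 + v1 * cos Q1"
  defines "t2 \<equiv> H * sin Q2 + v2 * cos Q2"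
  assumes pos: "m3 > 0" "g > 0" "a > 0" "l > 0" "kp1 > 0" "kp2 > 0" "kp3 > 0" "kp4 > 0" "\<sigma> > 0" "\<rho> > 0"
    and angles: "\<bar>Q1\<bar> \<le> pi / 2" "\<bar>Q2\<bar> \<le> pi / 2" "\<bar>Q3\<bar> \<le> pi / 2" "\<bar>Q1 - Q3\<bar> \<le> pi / 2" "\<bar>Q2 + Q3\<bar> \<le> pi / 2"
    and barrier: "(X1 - X2)\<^sup>2 < \<rho>"
    and geom: "X2 - X1 = l * (sin Q1 + sin Q2) + a * (cos Q3 - 1)" "H2 - H1 = l * (cos Q2 - cos Q1) + a * sin Q3"
    and bal: "kp1 * X1 + kp2 * X2 = 0" "kp3 * H1 + kp4 * H2 = 0"
    and v: "v1 = m3 * g / 2 - kp3 * H1" "v2 = m3 * g / 2 - kp4 * H2"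
    and dir: "H * cos Q1 = v1 * sin Q1" "H * cos Q2 = v2 * sin Q2"
    and nonneg: "0 \<le> t1" "0 \<le> t2"
    and moment: "t1 * cos (Q1 - Q3) = t2 * cos (Q2 + Q3)"
  shows "X1 = 0" "X2 = 0" "H1 = 0" "H2 = 0" "Q1 = 0" "Q2 = 0" "Q3 = 0"
proof -
  \<comment> \<open>\<open>(h, v)\<close> is parallel to \<open>(sin Q, cos Q)\<close>, so it is
    recovered from its component along the cable.\<close>
  have comp: "(h * sin Q + v * cos Q) * sin Q = h" "(h * sin Q + v * cos Q) * cos Q = v"
    if "h * cos Q = v * sin Q" for h v Q :: real
  proof -
    have "(h * sin Q + v * cos Q) * sin Q = h * (sin Q)\<^sup>2 + (v * sin Q) * cos Q"
      by (simp add: power2_eq_square algebra_simps)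
    also have "\<dots> = h * (sin Q)\<^sup>2 + h * (cos Q)\<^sup>2"
      unfolding that[symmetric] by (simp add: power2_eq_square)
    finally show "(h * sin Q + v * cos Q) * sin Q = h" by (simp flip: distrib_left)
    have "(h * sin Q + v * cos Q) * cos Q = (h * cos Q) * sin Q + v * (cos Q)\<^sup>2"
      by (simp add: power2_eq_square algebra_simps)
    also have "\<dots> = v * (sin Q)\<^sup>2 + v * (cos Q)\<^sup>2"
      unfolding that by (simp add: power2_eq_square)
    finally show "(h * sin Q + v * cos Q) * cos Q = v" by (simp flip: distrib_left)
  qed
  have T: "t1 * sin Q1 = H" "t1 * cos Q1 = v1" "t2 * sin Q2 = H" "t2 * cos Q2 = v2"
    unfolding t1_def t2_def using comp[OF dir(1)] comp[OF dir(2)] by auto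
  have cnn: "0 \<le> cos x" if "\<bar>x\<bar> \<le> pi / 2" for x :: real
    using that by (intro cos_ge_zero) linarith+
  note C = cnn[OF angles(1)] cnn[OF angles(2)] cnn[OF angles(3)] cnn[OF angles(4)] cnn[OF angles(5)]
  have vsum: "v1 + v2 = m3 * g" and vdiff: "v1 - v2 = - 2 * kp3 * H1" "v1 - v2 = 2 * kp4 * H2"
    using bal(2) unfolding v by linarith+
  have mg: "m3 * g > 0" using pos by simp
  have mom: "(v1 - v2) * cos Q3 = - 2 * H * sin Q3"
  proof -
    have "t1 * cos (Q1 - Q3) = v1 * cos Q3 + H * sin Q3"
      unfolding cos_diff T(1,2)[symmetric] by (simp add: algebra_simps)
    moreover have "t2 * cos (Q2 + Q3) = v2 * cos Q3 - H * sin Q3"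
      unfolding cos_add T(3,4)[symmetric] by (simp add: algebra_simps)
    ultimately show ?thesis using moment by (simp add: algebra_simps)
  qed
  have X2: "X2 = - (kp1 / kp2 * X1)" using bal(1) pos by (simp add: field_simps)
  have e: "X1 - X2 = (1 + kp1 / kp2) * X1" unfolding X2 by (simp add: distrib_right)
  have k: "1 + kp1 / kp2 > 0" using pos by (simp add: add_pos_pos)
  have B: "\<sigma> * \<rho> / (\<rho> - (X1 - X2)\<^sup>2)\<^sup>2 > 0" using pos barrier by simp
  \<comment> \<open>The horizontal balance makes \<open>X1 - X2\<close> a positive multiple of
    \<open>X1\<close>; spring and barrier then act in the same direction, and \<open>H\<close> has
    the sign of \<open>X1\<close>.\<close>
  have H: "H = (kp1 + \<sigma> * \<rho> / (\<rho> - (X1 - X2)\<^sup>2)\<^sup>2 * (1 + kp1 / kp2)) * X1"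
  proof -
    have "\<sigma> * \<rho> * (X1 - X2) / (\<rho> - (X1 - X2)\<^sup>2)\<^sup>2 = \<sigma> * \<rho> / (\<rho> - (X1 - X2)\<^sup>2)\<^sup>2 * (X1 - X2)" by simp
    also have "\<dots> = \<sigma> * \<rho> / (\<rho> - (X1 - X2)\<^sup>2)\<^sup>2 * ((1 + kp1 / kp2) * X1)" by (subst (2) e) (rule refl)
    finally show ?thesis unfolding H_def by (simp only: distrib_right mult.assoc)
  qed
  have kH: "kp1 + \<sigma> * \<rho> / (\<rho> - (X1 - X2)\<^sup>2)\<^sup>2 * (1 + kp1 / kp2) > 0"
    using pos(5) mult_pos_pos[OF B k] by (rule add_pos_pos)
  have sq: "(sin x)\<^sup>2 + (cos x)\<^sup>2 = 1" for x :: real by simp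
  have C3: "cos Q3 = 1" if "sin Q3 = 0" using sq[of Q3] C(3) that by (simp add: power2_eq_1_iff)
  have "X1 = 0"
  proof (rule ccontr)
    assume "X1 \<noteq> 0"
    then consider "X1 > 0" | "X1 < 0" by linarith
    then show False
    proof cases
      case 1
      have Hp: "H > 0" unfolding H using kH 1 by (rule mult_pos_pos)
      have t: "t1 > 0" "t2 > 0" using T(1,3) Hp nonneg by (auto simp: less_le)
      have S: "sin Q1 > 0" "sin Q2 > 0" using T(1,3) Hp t by (metis zero_less_mult_pos)+
      have "X1 - X2 > 0" unfolding e using k 1 by (rule mult_pos_pos)
      then have "a * (cos Q3 - 1) < 0" using geom(1) mult_pos_pos[OF pos(4) add_pos_pos[OF S]] by linarith
      then have C3n: "cos Q3 < 1" using pos(3) by (simp add: mult_less_0_iff)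
      \<comment> \<open>Of two cables with the same horizontal tension, the flatter one carries less
        vertical load. Moment balance and geometry, however, assign the larger load to the flatter
        cable.\<close>
      have mono: False if "cos Q' < cos Q" "0 \<le> cos Q'" "sin Q > 0" "sin Q' > 0" "t * sin Q = H" "t' * sin Q' = H"
        "t > 0" "t' > 0" "t * cos Q \<le> t' * cos Q'" for Q Q' t t'
      proof -
        have "(cos Q')\<^sup>2 < (cos Q)\<^sup>2" using that(1,2) by (rule power_strict_mono) simp
        then have "(sin Q)\<^sup>2 < (sin Q')\<^sup>2" unfolding sin_squared_eq by simp
        then have "sin Q < sin Q'" using that(4) by (simp add: power2_less_imp_less)
        then have "t' * sin Q < t * sin Q" using that(5,6,8) by (metis mult_strict_left_mono)
        then have "t' < t" using that(3) by simp
        then have "t' * cos Q' \<le> t * cos Q'" "t * cos Q' < t * cos Q" using that by (simp_all add: mult_right_mono)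
        then show False using that(9) by linarith
      qed
      have "sin Q3 \<noteq> 0" using C3 C3n by auto
      then consider "sin Q3 > 0" | "sin Q3 < 0" by linarith
      then show False
      proof cases
        case 1
        then have "2 * H * sin Q3 > 0" using Hp by simp
        then have "(v1 - v2) * cos Q3 < 0" using mom by simp
        then have d: "v1 - v2 < 0" using C(3) by (simp add: mult_less_0_iff)
        then have "0 < kp3 * H1" "kp4 * H2 < 0" using vdiff by linarith+
        then have "H2 - H1 < 0" using pos by (simp add: zero_less_mult_iff mult_less_0_iff)
        then have "l * (cos Q2 - cos Q1) < 0" using geom(2) mult_pos_pos[OF pos(3) 1] by linarith
        then have "cos Q2 < cos Q1" using pos(4) by (simp add: mult_less_0_iff)
        then show False
          by (rule mono[OF _ C(2) S T(1,3) t]) (use T d in simp)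
      next
        case 2
        then have "2 * H * sin Q3 < 0" using Hp by (simp add: mult_pos_neg)
        then have "(v1 - v2) * cos Q3 > 0" using mom by simp
        then have d: "v1 - v2 > 0" using C(3) by (simp add: zero_less_mult_iff)
        then have "kp3 * H1 < 0" "0 < kp4 * H2" using vdiff by linarith+
        then have "0 < H2 - H1" using pos by (simp add: zero_less_mult_iff mult_less_0_iff)
        then have "0 < l * (cos Q2 - cos Q1)" using geom(2) mult_pos_neg[OF pos(3) 2] by linarith
        then have "cos Q1 < cos Q2" using pos(4) by (simp add: zero_less_mult_iff)
        then show False
          by (rule mono[OF _ C(1) S(2,1) T(3,1) t(2,1)]) (use T d in simp)
      qed
    next
      case 2
      have Hn: "H < 0" unfolding H using kH 2 by (rule mult_pos_neg)
      have S: "sin Q1 < 0" "sin Q2 < 0" using T(1,3) Hn nonneg by (metis mult_nonneg_nonneg not_le)+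
      have "X1 - X2 < 0" unfolding e using k 2 by (rule mult_pos_neg)
      moreover have "a * (cos Q3 - 1) \<le> 0" using pos(3) by (simp add: mult_nonneg_nonpos)
      moreover have "l * (sin Q1 + sin Q2) < 0" using pos(4) S by (simp add: mult_pos_neg)
      ultimately show False using geom(1) by linarith
    qed
  qed
  moreover from this have "X2 = 0" using X2 by simp
  moreover from calculation have H0: "H = 0" unfolding H_def by simp
  have geo0: "l * (sin Q1 + sin Q2) + a * (cos Q3 - 1) = 0" using geom(1) \<open>X1 = 0\<close> \<open>X2 = 0\<close> by simp
  have ts: "t1 = 0 \<or> sin Q1 = 0" "t2 = 0 \<or> sin Q2 = 0" using T(1,3) H0 by auto
  \<comment> \<open>With a vertical bar at least one cable would be slack. If the other carries the
    whole weight, the resulting height difference of the drones contradicts the closed angle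
    constraints.\<close>
  have "cos Q3 \<noteq> 0"
  proof
    assume c0: "cos Q3 = 0"
    have a: "l * (sin Q1 + sin Q2) = a" using geo0 c0 by simp
    have S3: "sin Q3 = 1 \<or> sin Q3 = - 1" using sq[of Q3] c0 by (simp add: power2_eq_1_iff)
    have c: "0 \<le> sin Q1 * sin Q3" "0 \<le> - (sin Q2 * sin Q3)"
      using C(4,5) c0 unfolding cos_diff cos_add by simp_all
    have "\<not> (sin Q1 = 0 \<and> sin Q2 = 0)" using a pos(3) by auto
    then consider "t1 = 0" "sin Q2 = 0" | "t2 = 0" "sin Q1 = 0" | "t1 = 0" "t2 = 0" using ts by auto
    then show False
    proof cases
      case 1
      have "v1 = 0" using T(2) 1 by simp
      then have "v1 - v2 < 0" using vsum mg by simp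
      then have "0 < kp3 * H1" "kp4 * H2 < 0" using vdiff by linarith+
      then have "H2 - H1 < 0" using pos by (simp add: zero_less_mult_iff mult_less_0_iff)
      moreover have "cos Q2 = 1" using sq[of Q2] C(2) 1 by (simp add: power2_eq_1_iff)
      ultimately have "l * (1 - cos Q1) + a * sin Q3 < 0" using geom(2) by simp
      moreover have "0 \<le> l * (1 - cos Q1)" using pos(4) by simp
      ultimately have "a * sin Q3 < 0" by linarith
      then have "sin Q3 = - 1" using S3 pos(3) by auto
      moreover have "0 < sin Q1" using a 1 pos by (metis add.right_neutral zero_less_mult_pos)
      ultimately show False using c(1) by simp
    next
      case 2
      have "v2 = 0" using T(4) 2 by simp
      then have "v1 - v2 > 0" using vsum mg by simp
      then have "kp3 * H1 < 0" "0 < kp4 * H2" using vdiff by linarith+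
      then have "0 < H2 - H1" using pos by (simp add: zero_less_mult_iff mult_less_0_iff)
      moreover have "cos Q1 = 1" using sq[of Q1] C(1) 2 by (simp add: power2_eq_1_iff)
      ultimately have "0 < l * (cos Q2 - 1) + a * sin Q3" using geom(2) by simp
      moreover have "l * (cos Q2 - 1) \<le> 0" using pos(4) by (simp add: mult_nonneg_nonpos)
      ultimately have "0 < a * sin Q3" by linarith
      then have "sin Q3 = 1" using S3 pos(3) by auto
      moreover have "0 < sin Q2" using a 2 pos by (metis add.left_neutral zero_less_mult_pos)
      ultimately show False using c(2) by simp
    next
      case 3
      then show False using T(2,4) vsum mg by simp
    qed
  qed
  then have veq: "v1 = v2" using mom H0 by simp
  then have "v1 > 0" "v2 > 0" using vsum mg by linarith+
  then have "t1 \<noteq> 0" "t2 \<noteq> 0" using T(2,4) by auto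
  then have S: "sin Q1 = 0" "sin Q2 = 0" using ts by auto
  then have "cos Q3 = 1" using geo0 pos(3) by simp
  then have S3: "sin Q3 = 0" using sq[of Q3] by simp
  have "kp3 * H1 = 0" "kp4 * H2 = 0" using vdiff veq by linarith+
  then have Hz: "H1 = 0" "H2 = 0" using pos by auto
  have Qz: "Q = 0" if "sin Q = 0" "\<bar>Q\<bar> \<le> pi / 2" for Q :: real
    using that(2) pi_gt_zero by (intro sin_eq_0_pi[OF _ _ that(1)]) linarith+
  show "X1 = 0" "X2 = 0" "H1 = 0" "H2 = 0" "Q1 = 0" "Q2 = 0" "Q3 = 0"
    using \<open>X1 = 0\<close> \<open>X2 = 0\<close> Hz Qz[OF S(1) angles(1)] Qz[OF S(2) angles(2)] Qz[OF S3 angles(3)] by auto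
qed

context drone_bar_motion
begin

text \<open>The moment balance gives \<open>T1 = lam * c2\<close> and \<open>T2 = lam * c1\<close>.
  Eliminating \<open>\<alpha>3\<close> between the two equations of motion bounds \<open>lam\<close>
  times a positive quadratic form in \<open>c1\<close>, \<open>c2\<close> by a multiple of
  \<open>c1 + c2\<close>. Hence \<open>lam * (c1 + c2)\<close>, which is \<open>T1 + T2\<close>, is
  bounded however small the cosines are.\<close>

lemma bounded_tensions:
  obtains C where "C \<ge> 1" "\<forall>\<^sub>F t in at_top. t > t0 \<and> T1 t + T2 t \<le> C \<and> \<bar>\<omega>1 t\<bar> \<le> C \<and> \<bar>\<omega>2 t\<bar> \<le> C \<and> \<bar>\<omega>3 t\<bar> \<le> C \<and> \<Theta> t \<le> C"
proof -
  obtain M0 where M0: "\<forall>\<^sub>F t in at_top. \<bar>\<omega>3 t\<bar> \<le> M0" by (rule bounded_rotation)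
  define M where "M = max M0 0"
  have M: "M \<ge> 0" "M \<ge> M0" by (auto simp: M_def)
  obtain P where P: "P \<ge> 1"
    "\<And>t. t \<ge> t0 \<Longrightarrow> \<bar>G1 t\<bar> \<le> P + P * (\<bar>S1 t\<bar> * (\<Theta> t * \<bar>u1 t\<bar>))"
    "\<And>t. t \<ge> t0 \<Longrightarrow> \<bar>G2 t\<bar> \<le> P + P * (\<bar>S2 t\<bar> * (\<Theta> t * \<bar>u2 t\<bar>))"
    "\<And>t. t \<ge> t0 \<Longrightarrow> \<bar>p1 t\<bar> \<le> P" "\<And>t. t \<ge> t0 \<Longrightarrow> \<bar>p2 t\<bar> \<le> P"
    "\<And>t. t \<ge> t0 \<Longrightarrow> \<bar>\<omega>1 t\<bar> \<le> P * (1 + \<bar>\<omega>3 t\<bar>)" "\<And>t. t \<ge> t0 \<Longrightarrow> \<bar>\<omega>2 t\<bar> \<le> P * (1 + \<bar>\<omega>3 t\<bar>)"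
    "\<And>t. t \<ge> t0 \<Longrightarrow> \<Theta> t \<le> P * (1 + (\<omega>3 t)\<^sup>2)"
    "\<And>t. t \<ge> t0 \<Longrightarrow> \<bar>u1 t\<bar> \<le> P" "\<And>t. t \<ge> t0 \<Longrightarrow> \<bar>u2 t\<bar> \<le> P"
    by (rule force_bounds) blast
  define W where "W = P * (1 + M)"
  define Th where "Th = P * (1 + M\<^sup>2)"
  define Qg where "Qg = P + P * (1 * (Th * P)) + W * P"
  define Q where "Q = Qg + a / 2 * (M * (W + M))"
  define m where "m = max m1 m2"
  have W: "W \<ge> 0" "Th \<ge> 0" using P(1) M by (auto simp: W_def Th_def)
  have Q0: "Qg \<ge> 0" "Q \<ge> 0" using P(1) M W pos by (auto simp: Qg_def Q_def)
  have m: "m > 0" "m1 \<le> m" "m2 \<le> m" using pos by (auto simp: m_def)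
  define C where "C = 1 + 2 * m * Q + W + M + Th"
  have part: "0 \<le> 2 * m * Q" using m Q0 by simp
  show ?thesis
  proof (rule that[of C])
    show "C \<ge> 1" using part W M by (simp add: C_def)
    show "\<forall>\<^sub>F t in at_top. t > t0 \<and> T1 t + T2 t \<le> C \<and> \<bar>\<omega>1 t\<bar> \<le> C \<and> \<bar>\<omega>2 t\<bar> \<le> C \<and> \<bar>\<omega>3 t\<bar> \<le> C \<and> \<Theta> t \<le> C"
      using M0 eventually_gt_at_top[of t0]
    proof eventually_elim
      case (elim t)
      then have t: "t > t0" "t \<ge> t0" by auto
      have om3: "\<bar>\<omega>3 t\<bar> \<le> M" using elim(1) M by simp
      have om: "\<bar>\<omega>1 t\<bar> \<le> W" "\<bar>\<omega>2 t\<bar> \<le> W"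
        using P(6,7)[OF t(2)] mult_left_mono[of "1 + \<bar>\<omega>3 t\<bar>" "1 + M" P] om3 P(1) unfolding W_def by linarith+
      have "(\<omega>3 t)\<^sup>2 \<le> M\<^sup>2" using power_mono[OF om3 abs_ge_zero, of 2] by simp
      then have Th: "\<Theta> t \<le> Th"
        using P(8)[OF t(2)] mult_left_mono[of "1 + (\<omega>3 t)\<^sup>2" "1 + M\<^sup>2" P] P(1) unfolding Th_def by linarith
      have Gb: "P + P * (\<bar>S\<bar> * (\<Theta> t * \<bar>u\<bar>)) \<le> P + P * (1 * (Th * P))" if "\<bar>S\<bar> \<le> 1" "\<bar>u\<bar> \<le> P" for S u
      proof -
        have "\<Theta> t * \<bar>u\<bar> \<le> Th * P" by (rule mult_mono[OF Th that(2)]) (use W in auto)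
        then have "\<bar>S\<bar> * (\<Theta> t * \<bar>u\<bar>) \<le> 1 * (Th * P)" by (rule mult_mono[OF that(1)]) auto
        then show ?thesis using P(1) by (intro add_left_mono mult_left_mono) auto
      qed
      have g1: "\<bar>G1 t + \<omega>1 t * p1 t\<bar> \<le> Qg"
        using order_trans[OF P(2)[OF t(2)] Gb[OF abs_sin_le_one P(9)[OF t(2)]]] abs_mult_le[OF om(1) P(4)[OF t(2)]]
        unfolding Qg_def by linarith
      have g2: "\<bar>G2 t + \<omega>2 t * p2 t\<bar> \<le> Qg"
        using order_trans[OF P(3)[OF t(2)] Gb[OF abs_sin_le_one P(10)[OF t(2)]]] abs_mult_le[OF om(2) P(5)[OF t(2)]]
        unfolding Qg_def by linarith
      note c = trig_pos(4,5)[OF t(2)] and T = tension[OF t(2)]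
      define lam where "lam = T1 t / c2 t"
      have lam: "T1 t = lam * c2 t" "T2 t = lam * c1 t" "lam > 0"
        using c T moment[OF t(2)] by (auto simp: lam_def field_simps)
      have r: "\<bar>\<omega>3 t * (s1 t * (\<omega>1 t - \<omega>3 t))\<bar> \<le> M * (W + M)" "\<bar>\<omega>3 t * (s2 t * (\<omega>2 t + \<omega>3 t))\<bar> \<le> M * (W + M)"
        using om om3 by (intro abs_mult_le abs_mult_le_right abs_sin_le_one; linarith)+
      have q1: "a / 2 * (\<alpha>3 t * c1 t) \<ge> R1 t - G1 t - Q" and q2: "a / 2 * (\<alpha>3 t * c2 t) \<le> R2 t - G2 t + Q"
      proof -
        have rr: "\<bar>a / 2 * (\<omega>3 t * (s1 t * (\<omega>1 t - \<omega>3 t)))\<bar> \<le> a / 2 * (M * (W + M))"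
          "\<bar>a / 2 * (\<omega>3 t * (s2 t * (\<omega>2 t + \<omega>3 t)))\<bar> \<le> a / 2 * (M * (W + M))"
          using r pos(5) by (simp_all add: abs_mult)
        show "a / 2 * (\<alpha>3 t * c1 t) \<ge> R1 t - G1 t - Q"
          using acc1[OF t(1), unfolded right_diff_distrib[of "a / 2"]] rr(1) g1 unfolding Q_def by linarith
        show "a / 2 * (\<alpha>3 t * c2 t) \<le> R2 t - G2 t + Q"
          using acc2[OF t(1), unfolded right_diff_distrib[of "a / 2"]] rr(2) g2 unfolding Q_def by linarith
      qed
      have "c2 t * (R1 t - G1 t - Q) \<le> c2 t * (a / 2 * (\<alpha>3 t * c1 t))" using q1 c by (intro mult_left_mono) auto
      moreover have "c1 t * (a / 2 * (\<alpha>3 t * c2 t)) \<le> c1 t * (R2 t - G2 t + Q)" using q2 c by (intro mult_left_mono) auto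
      ultimately have "c2 t * (R1 t - G1 t) - c1 t * (R2 t - G2 t) \<le> Q * (c1 t + c2 t)"
        by (simp add: algebra_simps)
      moreover have "c2 t * (R1 t - G1 t) - c1 t * (R2 t - G2 t)
          = lam * ((c2 t)\<^sup>2 / m1 + (c1 t)\<^sup>2 / m2) + lam * ((c1 t)\<^sup>2 + (c2 t)\<^sup>2 - 2 * (c1 t * c2 t) * e12 t) / m3"
        unfolding R1_def R2_def lam(1,2) by (simp add: power2_eq_square field_simps add_divide_distrib diff_divide_distrib)
      moreover have "0 \<le> lam * ((c1 t)\<^sup>2 + (c2 t)\<^sup>2 - 2 * (c1 t * c2 t) * e12 t) / m3"
      proof -
        have "2 * (c1 t * c2 t) * e12 t \<le> 2 * (c1 t * c2 t) * 1"
          using c e12_bound[of t] by (intro mult_left_mono) (auto simp: abs_le_iff)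
        moreover have "0 \<le> (c1 t - c2 t)\<^sup>2" by simp
        ultimately have "0 \<le> (c1 t)\<^sup>2 + (c2 t)\<^sup>2 - 2 * (c1 t * c2 t) * e12 t" by (simp add: power2_diff)
        then show ?thesis using lam(3) pos by simp
      qed
      ultimately have "lam * ((c2 t)\<^sup>2 / m1 + (c1 t)\<^sup>2 / m2) \<le> Q * (c1 t + c2 t)" by linarith
      moreover have "(c1 t + c2 t)\<^sup>2 / (2 * m) \<le> (c2 t)\<^sup>2 / m1 + (c1 t)\<^sup>2 / m2"
      proof -
        have "(c1 t + c2 t)\<^sup>2 \<le> 2 * ((c1 t)\<^sup>2 + (c2 t)\<^sup>2)" using sum_squares_bound[of "c1 t" "c2 t"] by (simp add: power2_sum)
        then have "(c1 t + c2 t)\<^sup>2 / (2 * m) \<le> (2 * ((c1 t)\<^sup>2 + (c2 t)\<^sup>2)) / (2 * m)" using m by (intro divide_right_mono) auto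
        also have "\<dots> = (c2 t)\<^sup>2 / m + (c1 t)\<^sup>2 / m" using m by (simp add: field_simps)
        also have "\<dots> \<le> (c2 t)\<^sup>2 / m1 + (c1 t)\<^sup>2 / m2" using m pos by (intro add_mono divide_left_mono) auto
        finally show ?thesis .
      qed
      then have "lam * ((c1 t + c2 t)\<^sup>2 / (2 * m)) \<le> lam * ((c2 t)\<^sup>2 / m1 + (c1 t)\<^sup>2 / m2)" using lam(3) by (intro mult_left_mono) auto
      ultimately have "lam * ((c1 t + c2 t)\<^sup>2 / (2 * m)) \<le> Q * (c1 t + c2 t)" by linarith
      then have "(lam * (c1 t + c2 t)) * (c1 t + c2 t) \<le> (2 * m * Q) * (c1 t + c2 t)"
        using m by (simp add: field_simps power2_eq_square)
      then have "lam * (c1 t + c2 t) \<le> 2 * m * Q" by (rule mult_right_le_imp_le) (use c in simp)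
      then have "T1 t + T2 t \<le> 2 * m * Q" unfolding lam(1,2) by (simp add: algebra_simps)
      then show ?case using t om om3 Th part W M unfolding C_def by (intro conjI; linarith)
    qed
  qed
qed

text \<open>Bounded tensions and rotation bound the drones' accelerations, so that slow positions
  have vanishing velocities.\<close>

lemma drones_stop: "(u1 \<longlongrightarrow> 0) at_top" "(u2 \<longlongrightarrow> 0) at_top"
proof -
  obtain C where C: "C \<ge> 1" "\<forall>\<^sub>F t in at_top. t > t0 \<and> T1 t + T2 t \<le> C \<and> \<bar>\<omega>1 t\<bar> \<le> C \<and> \<bar>\<omega>2 t\<bar> \<le> C \<and> \<bar>\<omega>3 t\<bar> \<le> C \<and> \<Theta> t \<le> C"
    by (rule bounded_tensions)
  then obtain N where N: "\<And>t. t \<ge> N \<Longrightarrow> t > t0" "\<And>t. t \<ge> N \<Longrightarrow> T1 t + T2 t \<le> C" "\<And>t. t \<ge> N \<Longrightarrow> \<Theta> t \<le> C"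
    unfolding eventually_at_top_linorder by blast
  obtain P where P: "P \<ge> 1" "\<And>t. t \<ge> t0 \<Longrightarrow> \<bar>u1 t\<bar> \<le> P" "\<And>t. t \<ge> t0 \<Longrightarrow> \<bar>u2 t\<bar> \<le> P"
    "\<And>t. t \<ge> t0 \<Longrightarrow> \<bar>b1 t\<bar> \<le> P" "\<And>t. t \<ge> t0 \<Longrightarrow> \<bar>b2 t\<bar> \<le> P"
    by (rule force_bounds) blast
  have *: "(T * S - b - (kd + ka * \<Theta> t) * u) / m \<le> (C + P + (kd + ka * C) * P) / m"
    if "t \<ge> N" "0 \<le> T" "T \<le> C" "\<bar>S\<bar> \<le> 1" "\<bar>b\<bar> \<le> P" "\<bar>u\<bar> \<le> P" "kd > 0" "ka > 0" "m > 0" for t T S b kd ka u m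
  proof -
    have "\<bar>T * S\<bar> \<le> C * 1" by (rule abs_mult_le) (use that in auto)
    moreover have "\<bar>kd + ka * \<Theta> t\<bar> \<le> kd + ka * C" using that N(3)[OF that(1)] by (simp add: mult_left_mono)
    then have "\<bar>(kd + ka * \<Theta> t) * u\<bar> \<le> (kd + ka * C) * P" by (rule abs_mult_le[OF _ that(6)])
    ultimately have "T * S - b - (kd + ka * \<Theta> t) * u \<le> C + P + (kd + ka * C) * P" using that(5) by linarith
    then show ?thesis using that(9) by (simp add: divide_right_mono)
  qed
  have T: "0 \<le> T1 t" "0 \<le> T2 t" "T1 t \<le> C" "T2 t \<le> C" if "t \<ge> N" for t
    using tension[of t] N(1,2)[OF that] by simp_all
  show "(u1 \<longlongrightarrow> 0) at_top"
  proof (rule slow_deriv_tendsto_0[OF position_slow(1) deriv_pos(1) du1])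
    fix t assume t: "N \<le> t"
    show "(T1 t * S1 t - b1 t - (kd1 + ka1 * \<Theta> t) * u1 t) / m1 \<le> (C + P + (kd1 + ka1 * C) * P) / m1"
      by (rule *[OF t T(1,3)[OF t] abs_sin_le_one]) (use P N(1)[OF t] pos in auto)
  qed (use N(1) in force)+
  show "(u2 \<longlongrightarrow> 0) at_top"
  proof (rule slow_deriv_tendsto_0[OF position_slow(2) deriv_pos(3) du2])
    fix t assume t: "N \<le> t"
    have "(T2 t * - S2 t - b2 t - (kd2 + ka2 * \<Theta> t) * u2 t) / m2 \<le> (C + P + (kd2 + ka2 * C) * P) / m2"
      by (rule *[OF t T(2,4)[OF t]]) (use P N(1)[OF t] pos in auto)
    then show "(- T2 t * S2 t - b2 t - (kd2 + ka2 * \<Theta> t) * u2 t) / m2 \<le> (C + P + (kd2 + ka2 * C) * P) / m2" by simp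
  qed (use N(1) in force)+
qed

text \<open>As the drones stop, slowness of \<open>kin_h\<close> passes to
  \<open>u3\<^sup>2\<close>. A speed of \<eta> would then persist as at least
  \<open>\<eta> / 2\<close>, without change of sign, over a window too long for the bounded
  \<open>x3\<close>.\<close>

lemma bar_stops: "(u3 \<longlongrightarrow> 0) at_top"
proof (rule tendstoI)
  fix \<eta> :: real assume \<eta>: "\<eta> > 0"
  obtain K where K: "K \<ge> 1" "\<And>t. t \<ge> t0 \<Longrightarrow> \<bar>x3 t\<bar> \<le> K" by (rule bounds) blast
  define L where "L = (2 * K + 1) / (\<eta> / 2)"
  have L: "L > 0" "\<eta> / 2 * L = 2 * K + 1" using K \<eta> by (auto simp: L_def)
  have "((\<lambda>t. m1 / 2 * (u1 t)\<^sup>2 + m2 / 2 * (u2 t)\<^sup>2) \<longlongrightarrow> m1 / 2 * 0\<^sup>2 + m2 / 2 * 0\<^sup>2) at_top"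
    by (intro tendsto_intros drones_stop)
  then have "slow (\<lambda>t. 2 / m3 * (kin_h t - (m1 / 2 * (u1 t)\<^sup>2 + m2 / 2 * (u2 t)\<^sup>2)))"
    by (intro slow_cmult slow_diff kin_h_slow tendsto_imp_slow)
  moreover have "2 / m3 * (kin_h t - (m1 / 2 * (u1 t)\<^sup>2 + m2 / 2 * (u2 t)\<^sup>2)) = (u3 t)\<^sup>2" for t
    using pos(3) by (simp add: kin_h_def field_simps)
  ultimately have slow: "slow (\<lambda>t. (u3 t)\<^sup>2)" by simp
  have "\<eta>\<^sup>2 / 2 > 0" using \<eta> by simp
  show "\<forall>\<^sub>F t in at_top. dist (u3 t) 0 < \<eta>"
    using slowD[OF slow L(1) \<open>\<eta>\<^sup>2 / 2 > 0\<close>] eventually_ge_at_top[of t0]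
  proof eventually_elim
    case (elim t)
    show ?case
    proof (rule ccontr)
      assume "\<not> dist (u3 t) 0 < \<eta>"
      then have "\<eta> \<le> \<bar>u3 t\<bar>" by (simp add: dist_real_def)
      then have "\<eta>\<^sup>2 \<le> (u3 t)\<^sup>2" using power_mono[of \<eta> "\<bar>u3 t\<bar>" 2] \<eta> by simp
      then have big: "\<eta> / 2 \<le> \<bar>u3 s\<bar>" if "s \<in> {t..t + L}" for s
      proof -
        have "\<bar>(u3 s)\<^sup>2 - (u3 t)\<^sup>2\<bar> < \<eta>\<^sup>2 / 2" using elim(1) that by blast
        then have "\<eta>\<^sup>2 / 4 \<le> (u3 s)\<^sup>2" using \<open>\<eta>\<^sup>2 \<le> (u3 t)\<^sup>2\<close> zero_le_power2[of \<eta>] by argo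
        then have "(\<eta> / 2)\<^sup>2 \<le> \<bar>u3 s\<bar>\<^sup>2" by (simp add: power_divide)
        then show ?thesis by (rule power2_le_imp_le) simp
      qed
      have "isCont u3 s" if "s \<in> {t..t + L}" for s using DERIV_isCont[OF du3[of s]] that elim(2) by simp
      then have "continuous_on {t..t + L} u3" by (simp add: continuous_at_imp_continuous_on)
      moreover have "u3 s \<noteq> 0" if "s \<in> {t..t + L}" for s using big[OF that] \<eta> by auto
      ultimately have "(\<forall>s\<in>{t..t + L}. u3 s > 0) \<or> (\<forall>s\<in>{t..t + L}. u3 s < 0)" by (rule constant_sign)
      then have "\<eta> / 2 * L \<le> \<bar>x3 (t + L) - x3 t\<bar>"
      proof
        assume "\<forall>s\<in>{t..t + L}. u3 s > 0"
        then have "\<eta> / 2 \<le> u3 s" if "t \<le> s" "s \<le> t + L" for s using big[of s] that by force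
        then have "\<eta> / 2 * (t + L - t) \<le> x3 (t + L) - x3 t"
          by (intro deriv_bound_imp_diff_bound(2)[of _ _ _ u3]) (use L elim deriv_pos(5) in auto)
        moreover have "t + L - t = L" by simp
        ultimately show ?thesis by (simp only:)
      next
        assume "\<forall>s\<in>{t..t + L}. u3 s < 0"
        then have "u3 s \<le> - (\<eta> / 2)" if "t \<le> s" "s \<le> t + L" for s using big[of s] that by force
        then have "x3 (t + L) - x3 t \<le> - (\<eta> / 2) * (t + L - t)"
          by (intro deriv_bound_imp_diff_bound(1)[of _ _ _ u3]) (use L elim deriv_pos(5) in auto)
        moreover have "t + L - t = L" by simp
        ultimately show ?thesis by (simp only:)
      qed
      moreover have "\<bar>x3 (t + L)\<bar> \<le> K" "\<bar>x3 t\<bar> \<le> K" using K(2) elim(2) L(1) by simp_all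
      ultimately show False unfolding L(2) by linarith
    qed
  qed
qed

text \<open>The derivative of a function tending to 0 need not tend to 0 itself. By the mean value
  theorem over windows of length \<open>1 / real (Suc k)\<close> it is nevertheless small at
  suitable times near the given sequence.\<close>

lemma averaging:
  assumes lim: "(f \<longlongrightarrow> 0) at_top"
    and df: "\<And>t. t \<ge> t0 \<Longrightarrow> (f has_real_derivative f' t) (at t)"
    and t: "filterlim t at_top sequentially"
  obtains n r where "\<forall>k. k \<le> n k \<and> t (n k) \<le> r k \<and> r k \<le> t (n k) + 1 / real (Suc k)"
    "(\<lambda>k. f' (r k)) \<longlonglongrightarrow> 0"
proof -
  have "\<exists>n r. n \<ge> k \<and> t n \<le> r \<and> r \<le> t n + 1 / real (Suc k) \<and> \<bar>f' r\<bar> \<le> 1 / real (Suc k)" for k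
  proof -
    define d where "d = 1 / real (Suc k)"
    have d: "d > 0" by (simp add: d_def)
    \<comment> \<open>Quadratic in \<open>d\<close>, so that the difference quotient over the length
      \<open>d\<close> is still below \<open>d\<close>.\<close>
    then have "\<forall>\<^sub>F s in at_top. dist (f s) 0 < d * d / 2" by (intro tendstoD[OF lim]) simp
    then obtain N where N: "\<And>s. s \<ge> N \<Longrightarrow> \<bar>f s\<bar> < d * d / 2"
      by (auto simp: eventually_at_top_linorder dist_real_def)
    have "\<forall>\<^sub>F n in sequentially. max N t0 \<le> t n"
      using t unfolding filterlim_at_top by blast
    then obtain n where n: "n \<ge> k" "max N t0 \<le> t n"
      using eventually_conj[OF eventually_ge_at_top[of k]] eventually_happens'[OF sequentially_bot] by blast
    have "\<exists>r>t n. r < t n + d \<and> f (t n + d) - f (t n) = (t n + d - t n) * f' r"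
      by (rule MVT2) (use d n df in auto)
    then obtain r where r: "t n < r" "r < t n + d" "f (t n + d) - f (t n) = d * f' r" by auto
    have "\<bar>f (t n + d)\<bar> < d * d / 2" "\<bar>f (t n)\<bar> < d * d / 2" using N n d by auto
    then have "\<bar>d * f' r\<bar> < d * d" unfolding r(3)[symmetric] by argo
    then have "\<bar>f' r\<bar> < d" using d by (simp add: abs_mult)
    then show ?thesis using n r unfolding d_def by (intro exI[of _ n] exI[of _ r]) auto
  qed
  then obtain n r where nr: "\<And>k. n k \<ge> k" "\<And>k. t (n k) \<le> r k" "\<And>k. r k \<le> t (n k) + 1 / real (Suc k)"
    "\<And>k. \<bar>f' (r k)\<bar> \<le> 1 / real (Suc k)" by metis
  have "(\<lambda>k. f' (r k)) \<longlonglongrightarrow> 0"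
    by (rule Lim_null_comparison[OF _ LIMSEQ_inverse_real_of_nat]) (use nr(4) in \<open>simp add: inverse_eq_divide\<close>)
  then show ?thesis using that nr by blast
qed

text \<open>The shift from the given times to those of \<open>averaging\<close> tends to 0, and a
  bounded derivative makes it invisible in the limit.\<close>

lemma limit_shift:
  assumes t: "filterlim t at_top sequentially" and lim: "(\<lambda>k. F (t k)) \<longlonglongrightarrow> Y"
    and dF: "\<And>s. s \<ge> t0 \<Longrightarrow> (F has_real_derivative F' s) (at s)"
    and bound: "\<forall>\<^sub>F s in at_top. \<bar>F' s\<bar> \<le> C"
    and nr: "\<And>k. n k \<ge> k" "\<And>k. t (n k) \<le> r k" "\<And>k. r k \<le> t (n k) + 1 / real (Suc k)"
  shows "(\<lambda>k. F (r k)) \<longlonglongrightarrow> Y"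
proof -
  have n: "filterlim n sequentially sequentially"
    by (rule filterlim_at_top_mono[OF filterlim_ident]) (simp add: nr)
  have 1: "(\<lambda>k. F (t (n k))) \<longlonglongrightarrow> Y" by (rule filterlim_compose[OF lim n])
  obtain N where N: "\<And>s. s \<ge> N \<Longrightarrow> \<bar>F' s\<bar> \<le> C" using bound unfolding eventually_at_top_linorder by blast
  have "\<forall>\<^sub>F k in sequentially. max N t0 \<le> t (n k)"
    using filterlim_compose[OF t n] unfolding filterlim_at_top by blast
  then have le: "\<forall>\<^sub>F k in sequentially. norm (F (r k) - F (t (n k))) \<le> \<bar>C\<bar> * (1 / real (Suc k))"
  proof eventually_elim
    case (elim k)
    have "\<bar>F (r k) - F (t (n k))\<bar> \<le> \<bar>C\<bar> * (r k - t (n k))"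
    proof (rule deriv_bound_imp_diff_bound(3)[of _ _ _ F'])
      fix s assume "t (n k) \<le> s"
      then have "N \<le> s" "t0 \<le> s" using elim by auto
      then show "(F has_real_derivative F' s) (at s)" "\<bar>F' s\<bar> \<le> \<bar>C\<bar>" using dF N by force+
    qed (rule nr)
    also have "\<dots> \<le> \<bar>C\<bar> * (1 / real (Suc k))" using nr(3)[of k] by (intro mult_left_mono) auto
    finally show ?case by simp
  qed
  have "(\<lambda>k. \<bar>C\<bar> * (1 / real (Suc k))) \<longlonglongrightarrow> \<bar>C\<bar> * 0"
    by (intro tendsto_mult tendsto_const) (use LIMSEQ_inverse_real_of_nat in \<open>simp add: inverse_eq_divide\<close>)
  then have "(\<lambda>k. F (r k) - F (t (n k))) \<longlonglongrightarrow> 0"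
    by (intro Lim_null_comparison[OF le]) simp
  from tendsto_add[OF this 1] show ?thesis by simp
qed

lemma filterlim_shift:
  fixes t r :: "nat \<Rightarrow> real"
  assumes "filterlim t at_top sequentially" "\<And>k. n k \<ge> k" "\<And>k. t (n k) \<le> r k"
  shows "filterlim r at_top sequentially"
proof -
  have "filterlim n sequentially sequentially"
    by (rule filterlim_at_top_mono[OF filterlim_ident]) (simp add: assms(2))
  from filterlim_compose[OF assms(1) this] show ?thesis
    by (rule filterlim_at_top_mono) (simp add: assms(3))
qed

text \<open>Time averages of the drones' equations of motion along a sequence of times converging to a limit position.\<close>

lemma limit_equation:
  assumes t: "filterlim t at_top sequentially"
    and lim: "(\<lambda>k. x1 (t k)) \<longlonglongrightarrow> X1" "(\<lambda>k. x2 (t k)) \<longlonglongrightarrow> X2" "(\<lambda>k. h1 (t k)) \<longlonglongrightarrow> H1" "(\<lambda>k. h2 (t k)) \<longlonglongrightarrow> H2"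
      "(\<lambda>k. \<theta>1 (t k)) \<longlonglongrightarrow> Q1" "(\<lambda>k. \<theta>2 (t k)) \<longlonglongrightarrow> Q2" "(\<lambda>k. \<theta>3 (t k)) \<longlonglongrightarrow> Q3"
    and barrier: "(X1 - X2)\<^sup>2 < \<rho>"
  obtains r where "filterlim r at_top sequentially"
    "(\<lambda>k. p * (T1 (r k) * S1 (r k)) - q * (T1 (r k) * C1 (r k)) + p' * (- (T2 (r k) * S2 (r k))) - q' * (T2 (r k) * C2 (r k))
        + p3 * (T2 (r k) * S2 (r k) - T1 (r k) * S1 (r k)))
       \<longlonglongrightarrow> p * (kp1 * X1 + \<sigma> * \<rho> * (X1 - X2) / (\<rho> - (X1 - X2)\<^sup>2)\<^sup>2) - q * (m3 * g / 2 - kp3 * H1)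
       + p' * (kp2 * X2 - \<sigma> * \<rho> * (X1 - X2) / (\<rho> - (X1 - X2)\<^sup>2)\<^sup>2) - q' * (m3 * g / 2 - kp4 * H2)"
    "(\<lambda>k. \<theta>1 (r k)) \<longlonglongrightarrow> Q1" "(\<lambda>k. \<theta>2 (r k)) \<longlonglongrightarrow> Q2" "(\<lambda>k. \<theta>3 (r k)) \<longlonglongrightarrow> Q3"
proof -
  obtain C where C: "C \<ge> 1" "\<forall>\<^sub>F t in at_top. t > t0 \<and> T1 t + T2 t \<le> C \<and> \<bar>\<omega>1 t\<bar> \<le> C \<and> \<bar>\<omega>2 t\<bar> \<le> C \<and> \<bar>\<omega>3 t\<bar> \<le> C \<and> \<Theta> t \<le> C"
    by (rule bounded_tensions)
  obtain P where P: "P \<ge> 1" "\<And>t. t \<ge> t0 \<Longrightarrow> \<bar>u1 t\<bar> \<le> P" "\<And>t. t \<ge> t0 \<Longrightarrow> \<bar>u2 t\<bar> \<le> P"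
    "\<And>t. t \<ge> t0 \<Longrightarrow> \<bar>w1 t\<bar> \<le> P" "\<And>t. t \<ge> t0 \<Longrightarrow> \<bar>w2 t\<bar> \<le> P"
    by (rule bounds) blast
  have ev: "\<forall>\<^sub>F t in at_top. \<bar>\<omega>1 t\<bar> \<le> C" "\<forall>\<^sub>F t in at_top. \<bar>\<omega>2 t\<bar> \<le> C" "\<forall>\<^sub>F t in at_top. \<bar>\<omega>3 t\<bar> \<le> C"
    "\<forall>\<^sub>F t in at_top. \<Theta> t \<le> C"
    using C(2) by (auto elim: eventually_mono)
  have evP: "\<forall>\<^sub>F t in at_top. \<bar>u1 t\<bar> \<le> P" "\<forall>\<^sub>F t in at_top. \<bar>u2 t\<bar> \<le> P" "\<forall>\<^sub>F t in at_top. \<bar>w1 t\<bar> \<le> P" "\<forall>\<^sub>F t in at_top. \<bar>w2 t\<bar> \<le> P"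
    using P(2-) unfolding eventually_at_top_linorder by blast+
  define D1 where "D1 s = (kd1 + ka1 * \<Theta> s) * u1 s" for s
  define D2 where "D2 s = (kd2 + ka2 * \<Theta> s) * u2 s" for s
  have damp: "((\<lambda>s. (kd + ka * \<Theta> s) * u s) \<longlongrightarrow> 0) at_top" if "(u \<longlongrightarrow> 0) at_top" "ka > 0" "kd > 0" for u kd ka
  proof (rule Lim_null_comparison)
    show "\<forall>\<^sub>F s in at_top. norm ((kd + ka * \<Theta> s) * u s) \<le> (kd + ka * C) * \<bar>u s\<bar>"
      using ev(4)
    proof eventually_elim
      case (elim s)
      have "ka * \<Theta> s \<le> ka * C" "0 \<le> ka * \<Theta> s" using elim that(2) by simp_all
      then have "\<bar>kd + ka * \<Theta> s\<bar> \<le> kd + ka * C" using that(3) by linarith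
      then show ?case unfolding real_norm_def abs_mult by (rule mult_right_mono) simp
    qed
    show "((\<lambda>s. (kd + ka * C) * \<bar>u s\<bar>) \<longlongrightarrow> 0) at_top"
      using tendsto_mult_right_zero[OF tendsto_rabs_zero[OF that(1)]] by simp
  qed
  have D: "(D1 \<longlongrightarrow> 0) at_top" "(D2 \<longlongrightarrow> 0) at_top"
    unfolding D1_def D2_def by (rule damp; use drones_stop pos in simp)+
  \<comment> \<open>One fixed linear combination of the momenta: the averaging times depend on the
    function averaged, so equations averaged separately could not be combined afterwards.\<close>
  define f where "f s = p * (m1 * u1 s) + q * (m1 * w1 s) + p' * (m2 * u2 s) + q' * (m2 * w2 s) + p3 * (m3 * u3 s)" for s
  define f' where "f' s = p * (T1 s * S1 s - b1 s - D1 s) + q * (A1 s - kd3 * w1 s - T1 s * C1 s)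
    + p' * (- T2 s * S2 s - b2 s - D2 s) + q' * (A2 s - kd4 * w2 s - T2 s * C2 s) + p3 * (T2 s * S2 s - T1 s * S1 s)" for s
  have "(f \<longlongrightarrow> p * (m1 * 0) + q * (m1 * 0) + p' * (m2 * 0) + q' * (m2 * 0) + p3 * (m3 * 0)) at_top"
    unfolding f_def by (intro tendsto_intros drones_stop bar_stops vertical_tendsto_0)
  then have f0: "(f \<longlongrightarrow> 0) at_top" by simp
  have df: "(f has_real_derivative f' s) (at s)" if s: "s \<ge> t0" for s
  proof -
    have m: "m1 \<noteq> 0" "m2 \<noteq> 0" "m3 \<noteq> 0" using pos by auto
    show ?thesis
      unfolding f_def f'_def D1_def D2_def
      by (rule DERIV_cong[OF DERIV_add[OF DERIV_add[OF DERIV_add[OF DERIV_add[OF DERIV_cmult[OF DERIV_cmult[OF du1[OF s]]]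
            DERIV_cmult[OF DERIV_cmult[OF dw1[OF s]]]] DERIV_cmult[OF DERIV_cmult[OF du2[OF s]]]] DERIV_cmult[OF DERIV_cmult[OF dw2[OF s]]]]
            DERIV_cmult[OF DERIV_cmult[OF du3[OF s]]]]])
        (use m in simp)
  qed
  obtain n r where "\<forall>k. k \<le> n k \<and> t (n k) \<le> r k \<and> r k \<le> t (n k) + 1 / real (Suc k)"
    and f'0: "(\<lambda>k. f' (r k)) \<longlonglongrightarrow> 0"
    by (rule averaging[OF f0 df t])
  then have nr: "\<And>k. k \<le> n k" "\<And>k. t (n k) \<le> r k" "\<And>k. r k \<le> t (n k) + 1 / real (Suc k)" by blast+
  have r: "filterlim r at_top sequentially" by (rule filterlim_shift[OF t nr(1,2)])
  note sh = limit_shift[OF t _ _ _ nr(1-3)]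
  have l: "(\<lambda>k. x1 (r k)) \<longlonglongrightarrow> X1" "(\<lambda>k. x2 (r k)) \<longlonglongrightarrow> X2" "(\<lambda>k. h1 (r k)) \<longlonglongrightarrow> H1" "(\<lambda>k. h2 (r k)) \<longlonglongrightarrow> H2"
    by (rule sh[OF lim(1) deriv_pos(1) evP(1)] sh[OF lim(2) deriv_pos(3) evP(2)] sh[OF lim(3) deriv_pos(2) evP(3)]
        sh[OF lim(4) deriv_pos(4) evP(4)]; assumption)+
  have q: "(\<lambda>k. \<theta>1 (r k)) \<longlonglongrightarrow> Q1" "(\<lambda>k. \<theta>2 (r k)) \<longlonglongrightarrow> Q2" "(\<lambda>k. \<theta>3 (r k)) \<longlonglongrightarrow> Q3"
    by (rule sh[OF lim(5) deriv_angle(1) ev(1)] sh[OF lim(6) deriv_angle(2) ev(2)] sh[OF lim(7) deriv_angle(3) ev(3)]; assumption)+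
  have nz: "(\<rho> - (X1 - X2)\<^sup>2)\<^sup>2 \<noteq> 0" using barrier by simp
  have b: "(\<lambda>k. b1 (r k)) \<longlonglongrightarrow> kp1 * X1 + \<sigma> * \<rho> * (X1 - X2) / (\<rho> - (X1 - X2)\<^sup>2)\<^sup>2"
    "(\<lambda>k. b2 (r k)) \<longlonglongrightarrow> kp2 * X2 - \<sigma> * \<rho> * (X1 - X2) / (\<rho> - (X1 - X2)\<^sup>2)\<^sup>2"
    unfolding b1_def b2_def by (intro tendsto_intros l nz)+
  have A: "(\<lambda>k. A1 (r k)) \<longlonglongrightarrow> m3 * g / 2 - kp3 * H1" "(\<lambda>k. A2 (r k)) \<longlonglongrightarrow> m3 * g / 2 - kp4 * H2"
    unfolding A1_def A2_def by (intro tendsto_intros l)+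
  note z = filterlim_compose[OF D(1) r] filterlim_compose[OF D(2) r] filterlim_compose[OF w1_tendsto_0 r] filterlim_compose[OF w2_tendsto_0 r]
  have "(\<lambda>k. f' (r k) + p * (b1 (r k) + D1 (r k)) - q * (A1 (r k) - kd3 * w1 (r k)) + p' * (b2 (r k) + D2 (r k)) - q' * (A2 (r k) - kd4 * w2 (r k)))
     \<longlonglongrightarrow> 0 + p * ((kp1 * X1 + \<sigma> * \<rho> * (X1 - X2) / (\<rho> - (X1 - X2)\<^sup>2)\<^sup>2) + 0) - q * ((m3 * g / 2 - kp3 * H1) - kd3 * 0)
       + p' * ((kp2 * X2 - \<sigma> * \<rho> * (X1 - X2) / (\<rho> - (X1 - X2)\<^sup>2)\<^sup>2) + 0) - q' * ((m3 * g / 2 - kp4 * H2) - kd4 * 0)"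
    by (intro tendsto_add tendsto_diff tendsto_mult tendsto_const f'0 b A z)
  moreover have "f' s + p * (b1 s + D1 s) - q * (A1 s - kd3 * w1 s) + p' * (b2 s + D2 s) - q' * (A2 s - kd4 * w2 s)
     = p * (T1 s * S1 s) - q * (T1 s * C1 s) + p' * (- (T2 s * S2 s)) - q' * (T2 s * C2 s) + p3 * (T2 s * S2 s - T1 s * S1 s)" for s
    unfolding f'_def by (simp add: algebra_simps)
  ultimately show ?thesis using r q by (intro that[of r]) simp_all
qed

text \<open>The tensions are bounded but need not converge. Each static equation is therefore drawn
  from a combination of Newton's equations in which they cancel or are multiplied by a factor
  tending to 0, and the signs of the limit tensions from one in which their positivity
  survives.\<close>

lemma cluster_point_0:
  assumes t: "filterlim t at_top sequentially"
    and lim: "(\<lambda>k. x1 (t k)) \<longlonglongrightarrow> X1" "(\<lambda>k. x2 (t k)) \<longlonglongrightarrow> X2" "(\<lambda>k. h1 (t k)) \<longlonglongrightarrow> H1" "(\<lambda>k. h2 (t k)) \<longlonglongrightarrow> H2"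
      "(\<lambda>k. \<theta>1 (t k)) \<longlonglongrightarrow> Q1" "(\<lambda>k. \<theta>2 (t k)) \<longlonglongrightarrow> Q2" "(\<lambda>k. \<theta>3 (t k)) \<longlonglongrightarrow> Q3"
  shows "X1 = 0 \<and> X2 = 0 \<and> H1 = 0 \<and> H2 = 0 \<and> Q1 = 0 \<and> Q2 = 0 \<and> Q3 = 0"
proof -
  obtain C where "\<forall>\<^sub>F t in at_top. t > t0 \<and> T1 t + T2 t \<le> C \<and> \<bar>\<omega>1 t\<bar> \<le> C \<and> \<bar>\<omega>2 t\<bar> \<le> C \<and> \<bar>\<omega>3 t\<bar> \<le> C \<and> \<Theta> t \<le> C"
    by (rule bounded_tensions)
  then have T: "\<forall>\<^sub>F t in at_top. t \<ge> t0 \<and> \<bar>T1 t\<bar> \<le> C \<and> \<bar>T2 t\<bar> \<le> C"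
  proof eventually_elim
    case (elim t)
    then show ?case using tension[of t] by simp
  qed
  have ev: "\<forall>\<^sub>F k in sequentially. P (r k)" if "filterlim r at_top sequentially" "\<forall>\<^sub>F t in at_top. P t" for r :: "nat \<Rightarrow> real" and P
    using that by (simp add: filterlim_iff)
  have le: "Y \<le> c" if "(\<lambda>k. f (t k)) \<longlonglongrightarrow> Y" "\<And>s. s \<ge> t0 \<Longrightarrow> f s \<le> c" for f :: "real \<Rightarrow> real" and Y c
    using that(1) by (rule tendsto_upperbound) (use ev[OF t eventually_ge_at_top[of t0]] that(2) in \<open>auto elim: eventually_mono\<close>)
  have uniq: "Y = Y'" if "(\<lambda>k. f (t k)) \<longlonglongrightarrow> Y" "(\<lambda>k. h (t k)) \<longlonglongrightarrow> Y'" "\<And>s. s \<ge> t0 \<Longrightarrow> f s = h s" for f h :: "real \<Rightarrow> real" and Y Y'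
  proof -
    have "\<forall>\<^sub>F k in sequentially. f (t k) = h (t k)"
      using ev[OF t eventually_ge_at_top[of t0]] that(3) by (auto elim: eventually_mono)
    then have "(\<lambda>k. h (t k)) \<longlonglongrightarrow> Y" using that(1) by (simp cong: tendsto_cong)
    then show ?thesis using that(2) LIMSEQ_unique by blast
  qed
  have barrier': "(X1 - X2)\<^sup>2 < \<rho>"
  proof -
    have "(X1 - X2)\<^sup>2 \<le> \<rho> - \<delta>"
      by (rule le[of "\<lambda>s. (x1 s - x2 s)\<^sup>2"]) (intro tendsto_intros lim, use \<delta>_le in force)
    then show ?thesis using \<delta>_pos by linarith
  qed
  note eq = limit_equation[OF t lim barrier']
  have angles: "\<bar>Q1\<bar> \<le> pi / 2" "\<bar>Q2\<bar> \<le> pi / 2" "\<bar>Q3\<bar> \<le> pi / 2" "\<bar>Q1 - Q3\<bar> \<le> pi / 2" "\<bar>Q2 + Q3\<bar> \<le> pi / 2"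
    by (rule le[OF tendsto_rabs[OF lim(5)]] le[OF tendsto_rabs[OF lim(6)]] le[OF tendsto_rabs[OF lim(7)]]
        le[OF tendsto_rabs[OF tendsto_diff[OF lim(5,7)]]] le[OF tendsto_rabs[OF tendsto_add[OF lim(6,7)]]];
        use angle_range in \<open>force intro: less_imp_le\<close>)+
  have geom: "X2 - X1 = l * (sin Q1 + sin Q2) + a * (cos Q3 - 1)"
    by (rule uniq[of "\<lambda>s. x2 s - x1 s" _ "\<lambda>s. l * (S1 s + S2 s) + a * (C3 s - 1)"])
      ((intro tendsto_intros lim)+, use geometry(1,3) in \<open>force simp: algebra_simps\<close>)
  have geom': "H2 - H1 = l * (cos Q2 - cos Q1) + a * sin Q3"
    by (rule uniq[of "\<lambda>s. h2 s - h1 s" _ "\<lambda>s. l * (C2 s - C1 s) + a * S3 s"])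
      ((intro tendsto_intros lim)+, use geometry(2,4) in \<open>force simp: algebra_simps\<close>)
  have weight: "kp3 * H1 + kp4 * H2 = 0"
  proof -
    have "(\<lambda>k. A1 (t k) + A2 (t k) - m3 * g) \<longlonglongrightarrow> 0" by (rule filterlim_compose[OF weight_tendsto t])
    moreover have "(\<lambda>k. A1 (t k) + A2 (t k) - m3 * g) \<longlonglongrightarrow> (m3 * g / 2 - kp3 * H1) + (m3 * g / 2 - kp4 * H2) - m3 * g"
      unfolding A1_def A2_def by (intro tendsto_intros lim)
    ultimately have "0 = (m3 * g / 2 - kp3 * H1) + (m3 * g / 2 - kp4 * H2) - m3 * g" by (rule LIMSEQ_unique)
    then show ?thesis by simp
  qed
  define H where "H = kp1 * X1 + \<sigma> * \<rho> * (X1 - X2) / (\<rho> - (X1 - X2)\<^sup>2)\<^sup>2"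
  define v1 where "v1 = m3 * g / 2 - kp3 * H1"
  define v2 where "v2 = m3 * g / 2 - kp4 * H2"
  have horiz: "kp1 * X1 + kp2 * X2 = 0"
  proof -
    \<comment> \<open>The sum of the horizontal equations of all three masses, in which the tensions
      cancel.\<close>
    obtain r where "(\<lambda>k. 1 * (T1 (r k) * S1 (r k)) - 0 * (T1 (r k) * C1 (r k)) + 1 * (- (T2 (r k) * S2 (r k))) - 0 * (T2 (r k) * C2 (r k))
        + 1 * (T2 (r k) * S2 (r k) - T1 (r k) * S1 (r k)))
       \<longlonglongrightarrow> 1 * (kp1 * X1 + \<sigma> * \<rho> * (X1 - X2) / (\<rho> - (X1 - X2)\<^sup>2)\<^sup>2) - 0 * (m3 * g / 2 - kp3 * H1)
       + 1 * (kp2 * X2 - \<sigma> * \<rho> * (X1 - X2) / (\<rho> - (X1 - X2)\<^sup>2)\<^sup>2) - 0 * (m3 * g / 2 - kp4 * H2)"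
      by (rule eq)
    then show ?thesis by (simp add: LIMSEQ_const_iff)
  qed
  have b2: "kp2 * X2 - \<sigma> * \<rho> * (X1 - X2) / (\<rho> - (X1 - X2)\<^sup>2)\<^sup>2 = - H" using horiz by (simp add: H_def)
  note eq' = eq[unfolded b2 H_def[symmetric] v1_def[symmetric] v2_def[symmetric]]
  have null: "(\<lambda>k. F (r k) * y k) \<longlonglongrightarrow> 0" if r: "filterlim r at_top sequentially" and y: "y \<longlonglongrightarrow> 0" and F: "\<forall>\<^sub>F s in at_top. \<bar>F s\<bar> \<le> C"
    for F :: "real \<Rightarrow> real" and r y
  proof (rule Lim_null_comparison)
    show "\<forall>\<^sub>F k in sequentially. norm (F (r k) * y k) \<le> C * \<bar>y k\<bar>"
      using ev[OF r F] by eventually_elim (simp add: abs_mult mult_right_mono)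
    show "(\<lambda>k. C * \<bar>y k\<bar>) \<longlonglongrightarrow> 0" using tendsto_mult_right_zero[OF tendsto_rabs_zero[OF y]] by simp
  qed
  have Tb: "\<forall>\<^sub>F s in at_top. \<bar>T1 s\<bar> \<le> C" "\<forall>\<^sub>F s in at_top. \<bar>T2 s\<bar> \<le> C"
    using T by (auto elim: eventually_mono)
  have dir1: "H * cos Q1 = v1 * sin Q1"
  proof -
    \<comment> \<open>Projection across the limit direction of the first cable: the tension is
      multiplied by \<open>sin (\<theta>1 - Q1)\<close>, which tends to 0.\<close>
    obtain r where r: "filterlim r at_top sequentially"
      "(\<lambda>k. cos Q1 * (T1 (r k) * S1 (r k)) - sin Q1 * (T1 (r k) * C1 (r k)) + 0 * (- (T2 (r k) * S2 (r k))) - 0 * (T2 (r k) * C2 (r k))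
        + 0 * (T2 (r k) * S2 (r k) - T1 (r k) * S1 (r k))) \<longlonglongrightarrow> cos Q1 * H - sin Q1 * v1 + 0 * (- H) - 0 * v2"
      "(\<lambda>k. \<theta>1 (r k)) \<longlonglongrightarrow> Q1" by (rule eq')
    have "(\<lambda>k. sin (\<theta>1 (r k) - Q1)) \<longlonglongrightarrow> sin (Q1 - Q1)" by (intro tendsto_intros r(3))
    then have "(\<lambda>k. T1 (r k) * sin (\<theta>1 (r k) - Q1)) \<longlonglongrightarrow> 0" by (intro null r(1) Tb) simp
    moreover have "T1 s * sin (\<theta>1 s - Q1) = cos Q1 * (T1 s * S1 s) - sin Q1 * (T1 s * C1 s)" for s
      by (simp add: sin_diff algebra_simps)
    ultimately have "0 = cos Q1 * H - sin Q1 * v1" using r(2) by (intro LIMSEQ_unique) simp_all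
    then show ?thesis by (simp add: mult.commute)
  qed
  have dir2: "H * cos Q2 = v2 * sin Q2"
  proof -
    obtain r where r: "filterlim r at_top sequentially"
      "(\<lambda>k. 0 * (T1 (r k) * S1 (r k)) - 0 * (T1 (r k) * C1 (r k)) + (- cos Q2) * (- (T2 (r k) * S2 (r k))) - sin Q2 * (T2 (r k) * C2 (r k))
        + 0 * (T2 (r k) * S2 (r k) - T1 (r k) * S1 (r k))) \<longlonglongrightarrow> 0 * H - 0 * v1 + (- cos Q2) * (- H) - sin Q2 * v2"
      "(\<lambda>k. \<theta>2 (r k)) \<longlonglongrightarrow> Q2" by (rule eq')
    have "(\<lambda>k. sin (\<theta>2 (r k) - Q2)) \<longlonglongrightarrow> sin (Q2 - Q2)" by (intro tendsto_intros r(3))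
    then have "(\<lambda>k. T2 (r k) * sin (\<theta>2 (r k) - Q2)) \<longlonglongrightarrow> 0" by (intro null r(1) Tb) simp
    moreover have "T2 s * sin (\<theta>2 s - Q2) = cos Q2 * (T2 s * S2 s) - sin Q2 * (T2 s * C2 s)" for s
      by (simp add: sin_diff algebra_simps)
    ultimately have "0 = cos Q2 * H - sin Q2 * v2" using r(2) by (intro LIMSEQ_unique) simp_all
    then show ?thesis by (simp add: mult.commute)
  qed
  have nonneg: "0 \<le> Y" if r: "filterlim r at_top sequentially" and q: "(\<lambda>k. q (r k)) \<longlonglongrightarrow> Q"
    and Y: "(\<lambda>k. F (r k) * cos (q (r k) - Q)) \<longlonglongrightarrow> Y" and F: "\<And>s. s \<ge> t0 \<Longrightarrow> F s > 0" for F q :: "real \<Rightarrow> real" and r Q Y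
  proof (rule tendsto_lowerbound[OF Y])
    have "(\<lambda>k. cos (q (r k) - Q)) \<longlonglongrightarrow> cos (Q - Q)" by (intro tendsto_intros q)
    then have "\<forall>\<^sub>F k in sequentially. 0 < cos (q (r k) - Q)" by (rule order_tendstoD) simp
    then show "\<forall>\<^sub>F k in sequentially. 0 \<le> F (r k) * cos (q (r k) - Q)"
      using ev[OF r eventually_ge_at_top[of t0]] by eventually_elim (simp add: F less_imp_le)
  qed simp
  have cdiff: "F * cos (x - Q) = sin Q * (F * sin x) + cos Q * (F * cos x)" for F x Q :: real
    by (simp add: cos_diff algebra_simps)
  have nonneg1: "0 \<le> H * sin Q1 + v1 * cos Q1"
  proof -
    \<comment> \<open>Projection along the limit direction: the factor
      \<open>cos (\<theta>1 - Q1)\<close> tends to 1, so the limit inherits the sign of the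
      tension.\<close>
    obtain r where r: "filterlim r at_top sequentially"
      "(\<lambda>k. sin Q1 * (T1 (r k) * S1 (r k)) - (- cos Q1) * (T1 (r k) * C1 (r k)) + 0 * (- (T2 (r k) * S2 (r k))) - 0 * (T2 (r k) * C2 (r k))
        + 0 * (T2 (r k) * S2 (r k) - T1 (r k) * S1 (r k))) \<longlonglongrightarrow> sin Q1 * H - (- cos Q1) * v1 + 0 * (- H) - 0 * v2"
      "(\<lambda>k. \<theta>1 (r k)) \<longlonglongrightarrow> Q1" by (rule eq')
    show ?thesis
      by (rule nonneg[OF r(1,3) _ tension(1)]) (use r(2) in \<open>simp add: cdiff mult.commute\<close>)
  qed
  have nonneg2: "0 \<le> H * sin Q2 + v2 * cos Q2"
  proof -
    obtain r where r: "filterlim r at_top sequentially"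
      "(\<lambda>k. 0 * (T1 (r k) * S1 (r k)) - 0 * (T1 (r k) * C1 (r k)) + (- sin Q2) * (- (T2 (r k) * S2 (r k))) - (- cos Q2) * (T2 (r k) * C2 (r k))
        + 0 * (T2 (r k) * S2 (r k) - T1 (r k) * S1 (r k))) \<longlonglongrightarrow> 0 * H - 0 * v1 + (- sin Q2) * (- H) - (- cos Q2) * v2"
      "(\<lambda>k. \<theta>2 (r k)) \<longlonglongrightarrow> Q2" by (rule eq')
    show ?thesis
      by (rule nonneg[OF r(1,3) _ tension(2)]) (use r(2) in \<open>simp add: cdiff mult.commute\<close>)
  qed
  have mom: "(H * sin Q1 + v1 * cos Q1) * cos (Q1 - Q3) = (H * sin Q2 + v2 * cos Q2) * cos (Q2 + Q3)"
  proof -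
    define d1 where "d1 = cos (Q1 - Q3)"
    define d2 where "d2 = cos (Q2 + Q3)"
    \<comment> \<open>Projections along both limit directions, weighted by the limit cosines
      \<open>d1\<close> and \<open>d2\<close>; the deviation from the moment balance at the actual
      angles tends to 0.\<close>
    obtain r where r: "filterlim r at_top sequentially"
      "(\<lambda>k. (d1 * sin Q1) * (T1 (r k) * S1 (r k)) - (- (d1 * cos Q1)) * (T1 (r k) * C1 (r k))
         + (d2 * sin Q2) * (- (T2 (r k) * S2 (r k))) - (d2 * cos Q2) * (T2 (r k) * C2 (r k))
        + 0 * (T2 (r k) * S2 (r k) - T1 (r k) * S1 (r k)))
        \<longlonglongrightarrow> (d1 * sin Q1) * H - (- (d1 * cos Q1)) * v1 + (d2 * sin Q2) * (- H) - (d2 * cos Q2) * v2"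
      "(\<lambda>k. \<theta>1 (r k)) \<longlonglongrightarrow> Q1" "(\<lambda>k. \<theta>2 (r k)) \<longlonglongrightarrow> Q2" "(\<lambda>k. \<theta>3 (r k)) \<longlonglongrightarrow> Q3" by (rule eq')
    have "(\<lambda>k. d1 * cos (\<theta>1 (r k) - Q1) - cos (\<theta>1 (r k) - \<theta>3 (r k))) \<longlonglongrightarrow> d1 * cos (Q1 - Q1) - cos (Q1 - Q3)"
      by (intro tendsto_intros r)
    then have 1: "(\<lambda>k. T1 (r k) * (d1 * cos (\<theta>1 (r k) - Q1) - c1 (r k))) \<longlonglongrightarrow> 0" by (intro null r(1) Tb) (simp add: d1_def)
    have "(\<lambda>k. d2 * cos (\<theta>2 (r k) - Q2) - cos (\<theta>2 (r k) + \<theta>3 (r k))) \<longlonglongrightarrow> d2 * cos (Q2 - Q2) - cos (Q2 + Q3)"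
      by (intro tendsto_intros r)
    then have 2: "(\<lambda>k. T2 (r k) * (d2 * cos (\<theta>2 (r k) - Q2) - c2 (r k))) \<longlonglongrightarrow> 0" by (intro null r(1) Tb) (simp add: d2_def)
    have 3: "T1 s * (d1 * cos (\<theta>1 s - Q1) - c1 s) - T2 s * (d2 * cos (\<theta>2 s - Q2) - c2 s)
       = (d1 * sin Q1) * (T1 s * S1 s) - (- (d1 * cos Q1)) * (T1 s * C1 s)
         + (d2 * sin Q2) * (- (T2 s * S2 s)) - (d2 * cos Q2) * (T2 s * C2 s) + 0 * (T2 s * S2 s - T1 s * S1 s)" if "s \<ge> t0" for s
    proof -
      have "T1 s * (d1 * cos (\<theta>1 s - Q1) - c1 s) - T2 s * (d2 * cos (\<theta>2 s - Q2) - c2 s)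
          = d1 * (T1 s * cos (\<theta>1 s - Q1)) - d2 * (T2 s * cos (\<theta>2 s - Q2)) - (T1 s * c1 s - T2 s * c2 s)"
        by (simp add: right_diff_distrib)
      also have "\<dots> = d1 * (T1 s * cos (\<theta>1 s - Q1)) - d2 * (T2 s * cos (\<theta>2 s - Q2))" using moment[OF that] by simp
      also have "\<dots> = (d1 * sin Q1) * (T1 s * S1 s) - (- (d1 * cos Q1)) * (T1 s * C1 s)
         + (d2 * sin Q2) * (- (T2 s * S2 s)) - (d2 * cos Q2) * (T2 s * C2 s) + 0 * (T2 s * S2 s - T1 s * S1 s)"
        unfolding cdiff by (simp add: distrib_left)
      finally show ?thesis .
    qed
    have "(\<lambda>k. T1 (r k) * (d1 * cos (\<theta>1 (r k) - Q1) - c1 (r k)) - T2 (r k) * (d2 * cos (\<theta>2 (r k) - Q2) - c2 (r k)))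
       \<longlonglongrightarrow> (d1 * sin Q1) * H - (- (d1 * cos Q1)) * v1 + (d2 * sin Q2) * (- H) - (d2 * cos Q2) * v2"
    proof (rule Lim_transform_eventually[OF r(2)])
      show "\<forall>\<^sub>F k in sequentially. (d1 * sin Q1) * (T1 (r k) * S1 (r k)) - (- (d1 * cos Q1)) * (T1 (r k) * C1 (r k))
         + (d2 * sin Q2) * (- (T2 (r k) * S2 (r k))) - (d2 * cos Q2) * (T2 (r k) * C2 (r k))
        + 0 * (T2 (r k) * S2 (r k) - T1 (r k) * S1 (r k))
        = T1 (r k) * (d1 * cos (\<theta>1 (r k) - Q1) - c1 (r k)) - T2 (r k) * (d2 * cos (\<theta>2 (r k) - Q2) - c2 (r k))"
        using ev[OF r(1) eventually_ge_at_top[of t0]] by eventually_elim (rule 3[symmetric])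
    qed
    from LIMSEQ_unique[OF tendsto_diff[OF 1 2] this] show ?thesis
      unfolding d1_def d2_def by (simp add: algebra_simps)
  qed
  show ?thesis
    using unique_equilibrium[of m3 g a l kp1 kp2 kp3 kp4 \<sigma> \<rho> Q1 Q2 Q3 X1 X2 H2 H1 v1 v2, folded H_def,
      OF pos(3-10,17,18) angles barrier' geom geom' horiz weight v1_def v2_def dir1 dir2 nonneg1 nonneg2 mom]
    by blast
qed

theorem converges:
  "(x1 \<longlongrightarrow> 0) at_top" "(x2 \<longlongrightarrow> 0) at_top" "(h1 \<longlongrightarrow> 0) at_top" "(h2 \<longlongrightarrow> 0) at_top"
  "(\<theta>1 \<longlongrightarrow> 0) at_top" "(\<theta>2 \<longlongrightarrow> 0) at_top" "(\<theta>3 \<longlongrightarrow> 0) at_top"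
proof -
  \<comment> \<open>One vector for the whole configuration, so that a single subsequence serves all
    components.\<close>
  define \<Phi> where "\<Phi> t = (x1 t, x2 t, h1 t, h2 t, \<theta>1 t, \<theta>2 t, \<theta>3 t)" for t
  obtain K where K: "K \<ge> 1" "\<And>t. t \<ge> t0 \<Longrightarrow> \<bar>x1 t\<bar> \<le> K" "\<And>t. t \<ge> t0 \<Longrightarrow> \<bar>x2 t\<bar> \<le> K"
    "\<And>t. t \<ge> t0 \<Longrightarrow> \<bar>h1 t\<bar> \<le> K" "\<And>t. t \<ge> t0 \<Longrightarrow> \<bar>h2 t\<bar> \<le> K"
    by (rule bounds) blast
  define B where "B = {- (K + pi)..K + pi}"
  have B: "y \<in> B" if "\<bar>y\<bar> \<le> K \<or> \<bar>y\<bar> < pi / 2" for y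
  proof -
    have "\<bar>y\<bar> \<le> K + pi" using that K(1) pi_gt_zero by argo
    then show ?thesis unfolding B_def atLeastAtMost_iff by argo
  qed
  have lim: "(\<Phi> \<longlongrightarrow> 0) at_top"
  proof (rule tendsto_0_if_cluster_points_0)
    have "\<Phi> ` {t0..} \<subseteq> B \<times> B \<times> B \<times> B \<times> B \<times> B \<times> B"
      using K angle_range by (auto simp: \<Phi>_def intro!: B)
    then show "bounded (\<Phi> ` {t0..})"
      by (rule bounded_subset[rotated]) (intro bounded_Times; simp add: B_def bounded_closed_interval)
    fix t y assume t: "filterlim t at_top sequentially" and y: "(\<lambda>n. \<Phi> (t n)) \<longlonglongrightarrow> y"
    obtain X1 X2 H1 H2 Q1 Q2 Q3 where eq: "y = (X1, X2, H1, H2, Q1, Q2, Q3)" by (metis prod.exhaust)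
    note f1 = tendsto_fst[OF y] and s1 = tendsto_snd[OF y]
    note f2 = tendsto_fst[OF s1] and s2 = tendsto_snd[OF s1]
    note f3 = tendsto_fst[OF s2] and s3 = tendsto_snd[OF s2]
    note f4 = tendsto_fst[OF s3] and s4 = tendsto_snd[OF s3]
    note f5 = tendsto_fst[OF s4] and s5 = tendsto_snd[OF s4]
    note f6 = tendsto_fst[OF s5] and s6 = tendsto_snd[OF s5]
    have "X1 = 0 \<and> X2 = 0 \<and> H1 = 0 \<and> H2 = 0 \<and> Q1 = 0 \<and> Q2 = 0 \<and> Q3 = 0"
      by (rule cluster_point_0[OF t]) (use f1 f2 f3 f4 f5 f6 s6 in \<open>simp_all add: \<Phi>_def eq\<close>)
    then show "y = 0" by (simp add: eq zero_prod_def)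
  qed
  note s1 = tendsto_snd[OF lim]
  note s2 = tendsto_snd[OF s1] note s3 = tendsto_snd[OF s2] note s4 = tendsto_snd[OF s3]
  note s5 = tendsto_snd[OF s4] note s6 = tendsto_snd[OF s5]
  show "(x1 \<longlongrightarrow> 0) at_top" "(x2 \<longlongrightarrow> 0) at_top" "(h1 \<longlongrightarrow> 0) at_top" "(h2 \<longlongrightarrow> 0) at_top"
    "(\<theta>1 \<longlongrightarrow> 0) at_top" "(\<theta>2 \<longlongrightarrow> 0) at_top" "(\<theta>3 \<longlongrightarrow> 0) at_top"
    using tendsto_fst[OF lim] tendsto_fst[OF s1] tendsto_fst[OF s2] tendsto_fst[OF s3] tendsto_fst[OF s4] tendsto_fst[OF s5] s6
    by (simp_all add: \<Phi>_def zero_prod_def)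
qed

end

section \<open>From the Lagrangian description to Newton's equations\<close>

lemma euler_lagrange_equations:
  assumes EL: "euler_lagrange m1 m2 m3 l1 l2 a g q f1 \<phi>1 f2 \<phi>2" and q: "twice_differentiable q" and t: "t > 0"
  defines "v \<equiv> time_deriv q t" and "c \<equiv> time_deriv (time_deriv q) t"
  shows "m1 * acc_y 0 0 0 (q t) v c + m2 * acc_y l1 l2 a (q t) v c + m3 * acc_y l1 0 (a / 2) (q t) v c
      = f1 t * sin (\<phi>1 t) + f2 t * sin (\<phi>2 t)" (is ?y)
    and "m1 * (acc_z 0 0 0 (q t) v c + g) + m2 * (acc_z l1 l2 a (q t) v c + g) + m3 * (acc_z l1 0 (a / 2) (q t) v c + g)
      = f1 t * cos (\<phi>1 t) + f2 t * cos (\<phi>2 t)" (is ?z)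
    and "m2 * (cos (q t $ 5) * (acc_z l1 l2 a (q t) v c + g) - sin (q t $ 5) * acc_y l1 l2 a (q t) v c)
      + m3 / 2 * (cos (q t $ 5) * (acc_z l1 0 (a / 2) (q t) v c + g) - sin (q t $ 5) * acc_y l1 0 (a / 2) (q t) v c)
      = f2 t * cos (\<phi>2 t) * cos (q t $ 5) - f2 t * sin (\<phi>2 t) * sin (q t $ 5) \<or> a = 0" (is ?m)
proof -
  have dq: "((\<lambda>s. q s $ i) has_real_derivative time_deriv q t $ i) (at t)" for i
    by (rule component_derivative[OF twice_differentiableD(1)[OF q t]])
  have dv: "((\<lambda>s. time_deriv q s $ i) has_real_derivative c $ i) (at t)" for i
    unfolding c_def by (rule component_derivative[OF twice_differentiableD(2)[OF q t]])
  note vel = velocity_derivatives[of q "time_deriv q", OF dq dv, folded v_def]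
  have td: "time_deriv f t = d" if "(f has_real_derivative d) (at t)" for f d
    using that t by (intro time_deriv_eqI) (simp_all add: has_real_derivative_iff_has_vector_derivative)
  have E: "time_deriv (\<lambda>s. partial_deriv i (lagrangian m1 m2 m3 l1 l2 a g (q s)) (time_deriv q s)) t
      - partial_deriv i (\<lambda>x. lagrangian m1 m2 m3 l1 l2 a g x v) (q t)
     = generalized_force l1 l2 a (q t) (f1 t) (\<phi>1 t) (f2 t) (\<phi>2 t) $ i" for i
    using EL t unfolding euler_lagrange_def v_def by simp
  note F = generalized_force_def Let_def vector_5
  have "time_deriv (\<lambda>s. partial_deriv 1 (lagrangian m1 m2 m3 l1 l2 a g (q s)) (time_deriv q s)) t
      = m1 * acc_y 0 0 0 (q t) v c + m2 * acc_y l1 l2 a (q t) v c + m3 * acc_y l1 0 (a / 2) (q t) v c"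
    unfolding momenta by (rule td) (intro DERIV_add DERIV_cmult vel)
  with E[of 1] show ?y unfolding position_forces F by simp
  have "time_deriv (\<lambda>s. partial_deriv 2 (lagrangian m1 m2 m3 l1 l2 a g (q s)) (time_deriv q s)) t
      = m1 * acc_z 0 0 0 (q t) v c + m2 * acc_z l1 l2 a (q t) v c + m3 * acc_z l1 0 (a / 2) (q t) v c"
    unfolding momenta by (rule td) (intro DERIV_add DERIV_cmult vel)
  with E[of 2] show ?z unfolding position_forces F by (simp add: algebra_simps)
  \<comment> \<open>The last term, due to the turning of the bar, is cancelled by the velocity part
    of the position derivative.\<close>
  have r: "((\<lambda>s. cos (q s $ 5) * Z s - sin (q s $ 5) * Y s) has_real_derivative
      cos (q t $ 5) * Z' - sin (q t $ 5) * Y' - v $ 5 * (sin (q t $ 5) * Z t + cos (q t $ 5) * Y t)) (at t)"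
    if "(Y has_real_derivative Y') (at t)" "(Z has_real_derivative Z') (at t)" for Y Z Y' Z'
    by (rule dq[of 5, folded v_def] that derivative_eq_intros refl)+ (simp add: algebra_simps)
  have "time_deriv (\<lambda>s. partial_deriv 5 (lagrangian m1 m2 m3 l1 l2 a g (q s)) (time_deriv q s)) t
      = m2 * a * (cos (q t $ 5) * acc_z l1 l2 a (q t) v c - sin (q t $ 5) * acc_y l1 l2 a (q t) v c
          - v $ 5 * (sin (q t $ 5) * vel_z l1 l2 a (q t) v + cos (q t $ 5) * vel_y l1 l2 a (q t) v))
      + m3 * (a / 2) * (cos (q t $ 5) * acc_z l1 0 (a / 2) (q t) v c - sin (q t $ 5) * acc_y l1 0 (a / 2) (q t) v c
          - v $ 5 * (sin (q t $ 5) * vel_z l1 0 (a / 2) (q t) v + cos (q t $ 5) * vel_y l1 0 (a / 2) (q t) v))"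
    unfolding momenta by (rule td) (unfold v_def, intro DERIV_add DERIV_cmult r[unfolded v_def] vel[unfolded v_def])
  with E[of 5] have "a * (m2 * (cos (q t $ 5) * (acc_z l1 l2 a (q t) v c + g) - sin (q t $ 5) * acc_y l1 l2 a (q t) v c)
      + m3 / 2 * (cos (q t $ 5) * (acc_z l1 0 (a / 2) (q t) v c + g) - sin (q t $ 5) * acc_y l1 0 (a / 2) (q t) v c))
      = a * (f2 t * cos (\<phi>2 t) * cos (q t $ 5) - f2 t * sin (\<phi>2 t) * sin (q t $ 5))"
    unfolding position_forces F by (simp add: algebra_simps)
  \<comment> \<open>The length \<open>a\<close> is cancelled here, whence the alternative
    \<open>a = 0\<close>.\<close>
  then show ?m unfolding mult_cancel_left by blast
qed

lemma drone_accelerations: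
  assumes q: "twice_differentiable q" and t: "t > 0"
  defines "v \<equiv> time_deriv q t" and "c \<equiv> time_deriv (time_deriv q) t"
  shows "time_deriv (time_deriv (\<lambda>s. drone2_pos l1 l2 a (q s))) t = (acc_y l1 l2 a (q t) v c, acc_z l1 l2 a (q t) v c)"
proof -
  have dq: "((\<lambda>s. q s $ i) has_real_derivative time_deriv q t $ i) (at t)" if "t > 0" for i t
    by (rule component_derivative[OF twice_differentiableD(1)[OF q that]])
  have dv: "((\<lambda>s. time_deriv q s $ i) has_real_derivative c $ i) (at t)" for i
    unfolding c_def by (rule component_derivative[OF twice_differentiableD(2)[OF q t]])
  note vel = velocity_derivatives[of q "time_deriv q", OF dq[OF t] dv]
  show ?thesis
    unfolding v_def
  proof (rule time_deriv_eqI2[OF t, where v="\<lambda>s. (vel_y l1 l2 a (q s) (time_deriv q s), vel_z l1 l2 a (q s) (time_deriv q s))"])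
    fix s :: real assume s: "s > 0"
    show "((\<lambda>s. drone2_pos l1 l2 a (q s)) has_vector_derivative (vel_y l1 l2 a (q s) (time_deriv q s), vel_z l1 l2 a (q s) (time_deriv q s))) (at s)"
      using has_vector_derivative_Pair[OF drone2_pos_derivatives[OF dq[OF s], of l1 l2 a, unfolded has_real_derivative_iff_has_vector_derivative]]
      by simp
  qed (intro has_vector_derivative_Pair vel[unfolded has_real_derivative_iff_has_vector_derivative])
qed

lemma drone1_pos_eq: "drone1_pos q = drone2_pos 0 0 0 q"
  by (simp add: drone1_pos_def drone2_pos_def)

lemma bar_pos_eq: "bar_pos l1 a q = drone2_pos l1 0 (a / 2) q"
  by (simp add: bar_pos_def drone2_pos_def)

theorem theorem1:
  fixes m1 m2 m3 g a l1 l2 l :: real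
    and y1d z1d y2d z2d \<theta>1d \<theta>2d :: real
    and kp1 kp2 kp3 kp4 kd1 kd2 kd3 kd4 ka1 ka2 \<sigma> \<rho> :: real
    and q :: "real \<Rightarrow> real^5"
    and f1 \<phi>1 f2 \<phi>2 :: "real \<Rightarrow> real"
    and y1 z1 y2 z2 \<theta>1 \<theta>2 \<theta>3 ey1 ez1 ey2 ez2 ey :: "real \<Rightarrow> real"
  assumes parameters: "m1 > 0" "m2 > 0" "m3 > 0" "g > 0" "a > 0" "l1 = l" "l2 = l" "l > 0"
    and desired: "y2d - y1d = a" "z1d = z2d" "\<theta>1d = 0" "\<theta>2d = 0"
    and gains: "kp1 > 0" "kp2 > 0" "kp3 > 0" "kp4 > 0" "kd1 > 0" "kd2 > 0" "kd3 > 0" "kd4 > 0"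
      "ka1 > 0" "ka2 > 0" "\<sigma> > 0" "\<rho> > 0"
    and positions:
      "y1 = (\<lambda>t. fst (drone1_pos (q t)))" "z1 = (\<lambda>t. snd (drone1_pos (q t)))"
      "y2 = (\<lambda>t. fst (drone2_pos l1 l2 a (q t)))" "z2 = (\<lambda>t. snd (drone2_pos l1 l2 a (q t)))"
    and angles: "\<theta>1 = (\<lambda>t. q t $ 3)" "\<theta>2 = (\<lambda>t. q t $ 4)" "\<theta>3 = (\<lambda>t. q t $ 5)"
    and errors:
      "ey1 = (\<lambda>t. y1 t - y1d)" "ez1 = (\<lambda>t. z1 t - z1d)"
      "ey2 = (\<lambda>t. y2 t - y2d)" "ez2 = (\<lambda>t. z2 t - z2d)"
      "ey = (\<lambda>t. ey1 t - ey2 t)"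
    and regular: "twice_differentiable q"
    and dynamics: "euler_lagrange m1 m2 m3 l1 l2 a g q f1 \<phi>1 f2 \<phi>2"
    and control_y1: "\<And>t. t \<ge> 0 \<Longrightarrow>
      f1 t * sin (\<phi>1 t) =
        - kp1 * ey1 t - kd1 * time_deriv y1 t
        - ka1 * ((time_deriv \<theta>1 t)\<^sup>2 + (time_deriv \<theta>2 t)\<^sup>2 + (time_deriv \<theta>3 t)\<^sup>2) * time_deriv y1 t
        - 1 / 2 * m3 * g * tan \<theta>2d - \<sigma> * \<rho> * ey t / (\<rho> - (ey t)\<^sup>2)\<^sup>2"
    and control_y2: "\<And>t. t \<ge> 0 \<Longrightarrow>
      f2 t * sin (\<phi>2 t) =
        - kp2 * ey2 t - kd2 * time_deriv y2 t
        - ka2 * ((time_deriv \<theta>1 t)\<^sup>2 + (time_deriv \<theta>2 t)\<^sup>2 + (time_deriv \<theta>3 t)\<^sup>2) * time_deriv y2 t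
        + 1 / 2 * m3 * g * tan \<theta>2d + \<sigma> * \<rho> * ey t / (\<rho> - (ey t)\<^sup>2)\<^sup>2"
    and control_z1: "\<And>t. t \<ge> 0 \<Longrightarrow>
      f1 t * cos (\<phi>1 t) = - kp3 * ez1 t - kd3 * time_deriv z1 t + 1 / 2 * (2 * m1 + m3) * g"
    and control_z2: "\<And>t. t \<ge> 0 \<Longrightarrow>
      f2 t * cos (\<phi>2 t) = - kp4 * ez2 t - kd4 * time_deriv z2 t + 1 / 2 * (2 * m2 + m3) * g"
    and initial: "\<rho> > \<bar>ey1 0 - ey2 0\<bar>\<^sup>2"
    and assumption_1: "assumption1 m1 m2 l1 l2 a g q f1 \<phi>1 f2 \<phi>2"
  shows "((\<lambda>t. vector [ey1 t, ez1 t] :: real^2) \<longlongrightarrow> 0) at_top \<and>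
         ((\<lambda>t. vector [ey2 t, ez2 t] :: real^2) \<longlongrightarrow> 0) at_top \<and>
         ((\<lambda>t. vector [\<theta>1 t, \<theta>2 t, \<theta>3 t] :: real^3) \<longlongrightarrow> 0) at_top"
proof -
  define v where "v = time_deriv q"
  define c where "c = time_deriv v"
  define x3 where "x3 t = fst (bar_pos l a (q t)) - (y1d + a / 2)" for t
  define h3 where "h3 t = snd (bar_pos l a (q t)) - z1d" for t
  note ll = parameters(6,7)
  have dq: "((\<lambda>s. q s $ i) has_real_derivative v t $ i) (at t)" if "t > 0" for i t
    unfolding v_def by (rule component_derivative[OF twice_differentiableD(1)[OF regular that]])
  have dv: "((\<lambda>s. v s $ i) has_real_derivative c t $ i) (at t)" if "t > 0" for i t
    unfolding v_def c_def by (rule component_derivative[OF twice_differentiableD(2)[OF regular that]])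
  note dpos = drone2_pos_derivatives[OF dq] and dvel = velocity_derivatives[OF dq dv]
  have td: "time_deriv f t = d" if "t > 0" "(f has_real_derivative d) (at t)" for f t d
    using that by (intro time_deriv_eqI) (simp_all add: has_real_derivative_iff_has_vector_derivative)
  have e: "ey1 = (\<lambda>t. fst (drone2_pos 0 0 0 (q t)) - y1d)" "ez1 = (\<lambda>t. snd (drone2_pos 0 0 0 (q t)) - z1d)"
    "ey2 = (\<lambda>t. fst (drone2_pos l l a (q t)) - (y1d + a))" "ez2 = (\<lambda>t. snd (drone2_pos l l a (q t)) - z1d)"
    unfolding errors positions drone1_pos_eq ll using desired by (auto simp: fun_eq_iff)
  have x3: "x3 = (\<lambda>t. fst (drone2_pos l 0 (a / 2) (q t)) - (y1d + a / 2))" "h3 = (\<lambda>t. snd (drone2_pos l 0 (a / 2) (q t)) - z1d)"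
    unfolding x3_def h3_def bar_pos_eq by auto
  define u1 where "u1 t = vel_y 0 0 0 (q t) (v t)" for t
  define w1 where "w1 t = vel_z 0 0 0 (q t) (v t)" for t
  define u2 where "u2 t = vel_y l l a (q t) (v t)" for t
  define w2 where "w2 t = vel_z l l a (q t) (v t)" for t
  define u3 where "u3 t = vel_y l 0 (a / 2) (q t) (v t)" for t
  define w3 where "w3 t = vel_z l 0 (a / 2) (q t) (v t)" for t
  have tdy: "time_deriv y1 t = u1 t" "time_deriv z1 t = w1 t" "time_deriv y2 t = u2 t" "time_deriv z2 t = w2 t"
    "time_deriv \<theta>1 t = v t $ 3" "time_deriv \<theta>2 t = v t $ 4" "time_deriv \<theta>3 t = v t $ 5" if "t > 0" for t
    unfolding positions angles drone1_pos_eq ll u1_def w1_def u2_def w2_def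
    by (rule td[OF that] dpos dq that)+
  define \<Theta> where "\<Theta> t = (v t $ 3)\<^sup>2 + (v t $ 4)\<^sup>2 + (v t $ 5)\<^sup>2" for t
  have F: "f1 t * sin (\<phi>1 t) = - kp1 * ey1 t - \<sigma> * \<rho> * (ey1 t - ey2 t) / (\<rho> - (ey1 t - ey2 t)\<^sup>2)\<^sup>2 - (kd1 + ka1 * \<Theta> t) * u1 t"
    "f2 t * sin (\<phi>2 t) = - kp2 * ey2 t + \<sigma> * \<rho> * (ey1 t - ey2 t) / (\<rho> - (ey1 t - ey2 t)\<^sup>2)\<^sup>2 - (kd2 + ka2 * \<Theta> t) * u2 t"
    "f1 t * cos (\<phi>1 t) = m1 * g + (m3 * g / 2 - kp3 * ez1 t - kd3 * w1 t)"
    "f2 t * cos (\<phi>2 t) = m2 * g + (m3 * g / 2 - kp4 * ez2 t - kd4 * w2 t)" if "t > 0" for t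
    using control_y1[of t] control_y2[of t] control_z1[of t] control_z2[of t] that
    unfolding tdy[OF that] \<Theta>_def desired errors(5) by (simp_all add: algebra_simps)
  \<comment> \<open>The tensions are given separately at each time; the choice makes them functions
    of time.\<close>
  define \<tau> where "\<tau> t = (SOME p. fst p > 0 \<and> snd p > 0 \<and>
       m1 *\<^sub>R time_deriv (time_deriv (\<lambda>s. drone1_pos (q s))) t =
         (f1 t * sin (\<phi>1 t), f1 t * cos (\<phi>1 t) - m1 * g) + fst p *\<^sub>R (sin (q t $ 3), - cos (q t $ 3)) \<and>
       m2 *\<^sub>R time_deriv (time_deriv (\<lambda>s. drone2_pos l1 l2 a (q s))) t =
         (f2 t * sin (\<phi>2 t), f2 t * cos (\<phi>2 t) - m2 * g) - snd p *\<^sub>R (sin (q t $ 4), cos (q t $ 4)))" for t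
  define T1 where "T1 t = fst (\<tau> t)" for t
  define T2 where "T2 t = snd (\<tau> t)" for t
  have \<tau>: "T1 t > 0 \<and> T2 t > 0 \<and>
       m1 *\<^sub>R time_deriv (time_deriv (\<lambda>s. drone1_pos (q s))) t =
         (f1 t * sin (\<phi>1 t), f1 t * cos (\<phi>1 t) - m1 * g) + T1 t *\<^sub>R (sin (q t $ 3), - cos (q t $ 3)) \<and>
       m2 *\<^sub>R time_deriv (time_deriv (\<lambda>s. drone2_pos l1 l2 a (q s))) t =
         (f2 t * sin (\<phi>2 t), f2 t * cos (\<phi>2 t) - m2 * g) - T2 t *\<^sub>R (sin (q t $ 4), cos (q t $ 4))" if "t > 0" for t
    unfolding T1_def T2_def \<tau>_def
    by (rule someI_ex) (use assumption_1 that in \<open>simp add: assumption1_def cables_in_tension_def\<close>)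
  have T: "T1 t > 0" "T2 t > 0" if "t > 0" for t using \<tau>[OF that] by blast+
  define ay where "ay r s b t = acc_y r s b (q t) (v t) (c t)" for r s b t
  define az where "az r s b t = acc_z r s b (q t) (v t) (c t)" for r s b t
  have n1: "m1 * ay 0 0 0 t = f1 t * sin (\<phi>1 t) + T1 t * sin (\<theta>1 t)"
      "m1 * (az 0 0 0 t + g) = f1 t * cos (\<phi>1 t) - T1 t * cos (\<theta>1 t)"
    and n2: "m2 * ay l l a t = f2 t * sin (\<phi>2 t) - T2 t * sin (\<theta>2 t)"
      "m2 * (az l l a t + g) = f2 t * cos (\<phi>2 t) - T2 t * cos (\<theta>2 t)" if "t > 0" for t
    using \<tau>[OF that] unfolding drone1_pos_eq ll drone_accelerations[OF regular that] angles
    by (simp_all add: ay_def az_def v_def c_def algebra_simps)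
  note EL = euler_lagrange_equations[OF dynamics regular, unfolded ll, folded v_def, folded c_def, folded ay_def az_def]
  \<comment> \<open>The equations of the whole system minus those of the drones.\<close>
  have n3: "m3 * ay l 0 (a / 2) t = T2 t * sin (\<theta>2 t) - T1 t * sin (\<theta>1 t)"
      "m3 * (az l 0 (a / 2) t + g) = T1 t * cos (\<theta>1 t) + T2 t * cos (\<theta>2 t)" if "t > 0" for t
    using EL(1,2)[OF that] n1[OF that] n2[OF that] by linarith+
  have moment: "T1 t * cos (\<theta>1 t - \<theta>3 t) = T2 t * cos (\<theta>2 t + \<theta>3 t)" if "t > 0" for t
  proof -
    \<comment> \<open>Without inertia of the bar about its centre, the equation for
      \<open>\<theta>3\<close> reduces to a static balance of the moments of the tensions.\<close>
    have "f2 t * cos (\<phi>2 t) * cos (\<theta>3 t) - f2 t * sin (\<phi>2 t) * sin (\<theta>3 t)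
      = cos (\<theta>3 t) * (m2 * (az l l a t + g)) - sin (\<theta>3 t) * (m2 * ay l l a t)
        + (cos (\<theta>3 t) * (m3 * (az l 0 (a / 2) t + g)) - sin (\<theta>3 t) * (m3 * ay l 0 (a / 2) t)) / 2"
      using EL(3)[OF that] parameters(5) by (simp add: angles add_divide_distrib diff_divide_distrib algebra_simps)
    then show ?thesis
      unfolding n2[OF that] n3[OF that] by (simp add: cos_add cos_diff algebra_simps) argo
  qed
  have under: "h3 t < ez1 t" "h3 t < ez2 t"
    and range: "\<bar>\<theta>1 t\<bar> < pi / 2" "\<bar>\<theta>2 t\<bar> < pi / 2" "\<bar>\<theta>3 t\<bar> < pi / 2"
      "\<bar>\<theta>1 t - \<theta>3 t\<bar> < pi / 2" "\<bar>\<theta>2 t + \<theta>3 t\<bar> < pi / 2" if "t > 0" for t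
  proof -
    have A: "\<forall>t\<ge>0. snd (bar_pos l a (q t)) < snd (drone1_pos (q t)) \<and> snd (bar_pos l a (q t)) < snd (drone2_pos l l a (q t))"
      "\<forall>t\<ge>0. \<forall>\<alpha> \<in> {\<phi>1 t, \<phi>2 t, q t $ 3, q t $ 4, q t $ 5}. - (pi / 2) < \<alpha> \<and> \<alpha> < pi / 2"
      "\<forall>t\<ge>0. \<bar>q t $ 4 + q t $ 5\<bar> < pi / 2 \<and> \<bar>q t $ 3 - q t $ 5\<bar> < pi / 2"
      using assumption_1 unfolding assumption1_def ll by blast+
    have "t \<ge> 0" using that by simp
    then show "h3 t < ez1 t" "h3 t < ez2 t"
      using A(1) unfolding h3_def errors positions ll desired(2) by auto
    show "\<bar>\<theta>1 t\<bar> < pi / 2" "\<bar>\<theta>2 t\<bar> < pi / 2" "\<bar>\<theta>3 t\<bar> < pi / 2"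
      using A(2) \<open>t \<ge> 0\<close> unfolding angles abs_less_iff by force+
    show "\<bar>\<theta>1 t - \<theta>3 t\<bar> < pi / 2" "\<bar>\<theta>2 t + \<theta>3 t\<bar> < pi / 2"
      using A(3) \<open>t \<ge> 0\<close> unfolding angles by blast+
  qed
  \<comment> \<open>The barrier condition is given at time 0, where derivatives are one-sided;
    continuity moves it to some \<open>t0 > 0\<close>.\<close>
  have "continuous (at 0 within {0..}) q"
    using regular differentiable_imp_continuous_within unfolding twice_differentiable_def differentiable_on_def by auto
  then have "((\<lambda>t. (ey1 t - ey2 t)\<^sup>2) \<longlongrightarrow> (ey1 0 - ey2 0)\<^sup>2) (at 0 within {0..})"
    unfolding continuous_within e drone2_pos_def fst_conv by (intro tendsto_intros)
  moreover have "(ey1 0 - ey2 0)\<^sup>2 < \<rho>" using initial by simp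
  ultimately have "\<forall>\<^sub>F t in at 0 within {0..}. (ey1 t - ey2 t)\<^sup>2 < \<rho>" by (rule order_tendstoD)
  then obtain d where d: "d > 0" "\<And>t. t \<ge> 0 \<Longrightarrow> t \<noteq> 0 \<Longrightarrow> dist t 0 < d \<Longrightarrow> (ey1 t - ey2 t)\<^sup>2 < \<rho>"
    unfolding eventually_at by auto
  define t0 where "t0 = d / 2"
  have t0: "t0 > 0" "(ey1 t0 - ey2 t0)\<^sup>2 < \<rho>" using d by (auto simp: t0_def)
  have p: "t > 0" if "t \<ge> t0" for t using that t0(1) by simp
  interpret drone_bar_motion m1 m2 m3 g a l kp1 kp2 kp3 kp4 kd1 kd2 kd3 kd4 ka1 ka2 \<sigma> \<rho> t0
    ey1 ez1 ey2 ez2 x3 h3 u1 w1 u2 w2 u3 w3 \<theta>1 \<theta>2 \<theta>3 "\<lambda>t. v t $ 3" "\<lambda>t. v t $ 4" "\<lambda>t. v t $ 5" "\<lambda>t. c t $ 5" T1 T2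
  proof (unfold_locales, goal_cases)
    case (27 t) show ?case unfolding e u1_def by (rule DERIV_cong[OF DERIV_diff[OF dpos(1) DERIV_const]]) (use p 27 in simp_all)
  next
    case (28 t) show ?case unfolding e w1_def by (rule DERIV_cong[OF DERIV_diff[OF dpos(2) DERIV_const]]) (use p 28 in simp_all)
  next
    case (29 t) show ?case unfolding e u2_def by (rule DERIV_cong[OF DERIV_diff[OF dpos(1) DERIV_const]]) (use p 29 in simp_all)
  next
    case (30 t) show ?case unfolding e w2_def by (rule DERIV_cong[OF DERIV_diff[OF dpos(2) DERIV_const]]) (use p 30 in simp_all)
  next
    case (31 t) show ?case unfolding x3 u3_def by (rule DERIV_cong[OF DERIV_diff[OF dpos(1) DERIV_const]]) (use p 31 in simp_all)
  next
    case (32 t) show ?case unfolding x3 w3_def by (rule DERIV_cong[OF DERIV_diff[OF dpos(2) DERIV_const]]) (use p 32 in simp_all)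
  next
    case (19 t) then show ?case by (simp add: e x3 angles drone2_pos_def right_diff_distrib)
  next
    case (20 t) then show ?case by (simp add: e x3 angles drone2_pos_def)
  next
    case (21 t) then show ?case by (simp add: e x3 angles drone2_pos_def right_diff_distrib)
  next
    case (22 t) then show ?case by (simp add: e x3 angles drone2_pos_def)
  next
    case (23 t) then show ?case by (simp add: u1_def u3_def vel_y_def angles)
  next
    case (24 t) then show ?case by (simp add: w1_def w3_def vel_z_def angles)
  next
    case (25 t) then show ?case by (simp add: u2_def u3_def vel_y_def angles)
  next
    case (26 t) then show ?case by (simp add: w2_def w3_def vel_z_def angles)
  next
    case (37 t) show ?case unfolding u1_def
      by (rule DERIV_cong[OF dvel(1)[OF p p, OF 37 37], folded ay_def])
        (use n1(1)[OF p[OF 37]] F(1)[OF p[OF 37]] parameters(1) in \<open>simp add: \<Theta>_def u1_def w1_def u2_def w2_def eq_divide_eq algebra_simps\<close>)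
  next
    case (38 t) show ?case unfolding w1_def
      by (rule DERIV_cong[OF dvel(2)[OF p p, OF 38 38], folded az_def])
        (use n1(2)[OF p[OF 38]] F(3)[OF p[OF 38]] parameters(1) in \<open>simp add:  u1_def w1_def u2_def w2_def eq_divide_eq algebra_simps\<close>)
  next
    case (39 t) show ?case unfolding u2_def
      by (rule DERIV_cong[OF dvel(1)[OF p p, OF 39 39], folded ay_def])
        (use n2(1)[OF p[OF 39]] F(2)[OF p[OF 39]] parameters(2) in \<open>simp add: \<Theta>_def u1_def w1_def u2_def w2_def eq_divide_eq algebra_simps\<close>)
  next
    case (40 t) show ?case unfolding w2_def
      by (rule DERIV_cong[OF dvel(2)[OF p p, OF 40 40], folded az_def])
        (use n2(2)[OF p[OF 40]] F(4)[OF p[OF 40]] parameters(2) in \<open>simp add:  u1_def w1_def u2_def w2_def eq_divide_eq algebra_simps\<close>)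
  next
    case (41 t) show ?case unfolding u3_def
      by (rule DERIV_cong[OF dvel(1)[OF p p, OF 41 41], folded ay_def])
        (use n3(1)[OF p[OF 41]] parameters(3) in \<open>simp add:  u1_def w1_def u2_def w2_def eq_divide_eq algebra_simps\<close>)
  next
    case (42 t) show ?case unfolding w3_def
      by (rule DERIV_cong[OF dvel(2)[OF p p, OF 42 42], folded az_def])
        (use n3(2)[OF p[OF 42]] parameters(3) in \<open>simp add:  u1_def w1_def u2_def w2_def eq_divide_eq algebra_simps\<close>)
  qed (use parameters gains p under range T moment t0(2) dq dv angles in simp_all)
  have 2: "((\<lambda>t. vector [f t, h t] :: real^2) \<longlongrightarrow> 0) at_top" if "(f \<longlongrightarrow> 0) at_top" "(h \<longlongrightarrow> 0) at_top" for f h :: "real \<Rightarrow> real"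
  proof (rule vec_tendstoI)
    fix i :: 2
    show "((\<lambda>t. (vector [f t, h t] :: real^2) $ i) \<longlongrightarrow> 0 $ i) at_top"
      using exhaust_2[of i] that by (auto simp: vector_2)
  qed
  have 3: "((\<lambda>t. vector [\<theta>1 t, \<theta>2 t, \<theta>3 t] :: real^3) \<longlongrightarrow> 0) at_top"
  proof (rule vec_tendstoI)
    fix i :: 3
    show "((\<lambda>t. (vector [\<theta>1 t, \<theta>2 t, \<theta>3 t] :: real^3) $ i) \<longlongrightarrow> 0 $ i) at_top"
      using exhaust_3[of i] converges by (auto simp: vector_3)
  qed
  from 2[OF converges(1,3)] 2[OF converges(2,4)] 3 show ?thesis by blast
qed

end
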